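(* Let $(H,\mathcal R)$ be a quasitriangular Hopf algebra, $\mathcal R^{-1}=\bar R^\alpha\otimes\bar R_\alpha$, $A$ a left $H$-module algebra, $V,W$ quasi-commutative left $H$-module $A$-bimodules, $(\Omega^\bullet,\wedge,\mathrm d)$ a graded quasi-commutative left $H$-covariant differential calculus over $A$, $\nabla_V\in\mathrm{Con}_A(V)$ and $\nabla_W\in\mathrm{Con}_A(W)$. Then the curvature $R_{\nabla_V\oplus_{\mathcal R}\nabla_W}\in\mathrm{Hom}_A(V\otimes_AW,V\otimes_AW\otimes_A\Omega^2)$ of the sum of the connections satisfies $$R_{\nabla_V\oplus_{\mathcal R}\nabla_W}=\tau^{-1}_{\mathcal R\,23}\circ(R_{\nabla_V}\otimes_{\mathcal R}\mathrm{id}_W)+\mathrm{id}_V\otimes_{\mathcal R}R_{\nabla_W}+(\mathrm{id}_{V\otimes_AW}\otimes_{\mathcal R}\wedge)\circ\tau^{-1}_{\mathcal R\,23}\circ\Bigl(\nabla_V\otimes_{\mathcal R}\nabla_W-(\bar R^\alpha\blacktriangleright\nabla_V)\otimes_{\mathcal R}(\bar R_\alpha\blacktriangleright\nabla_W)\Bigr),$$ where $R_{\nabla_V}\in\mathrm{Hom}_A(V,V\otimes_A\Omega^2)$ and $R_{\nabla_W}\in\mathrm{Hom}_A(W,W\otimes_A\Omega^2)$ are the curvatures of $\nabla_V$ and $\nabla_W$. (The maps in the last summand are evaluated on representatives $v\otimes w\in V\otimes W$ and composed with the canonical projection to $V\otimes_A\Omega\otimes_AW\otimes_A\Omega$.)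 Moreover, the last summand is a right $A$-linear map.
   Context: $\mathbb K$ is a commutative ring with unit; modules, algebras (associative, unital) and unadorned tensor products are over $\mathbb K$. For a Hopf algebra $H$ with coproduct $\Delta$, counit $\varepsilon$, antipode $S$, write $\Delta(\xi)=\xi_1\otimes\xi_2$ (sum understood). A quasitriangular Hopf algebra $(H,\mathcal R)$ is a Hopf algebra with an invertible $\mathcal R=R^\alpha\otimes R_\alpha\in H\otimes H$ satisfying $\xi_2\otimes\xi_1=\mathcal R\,\Delta(\xi)\,\mathcal R^{-1}$, $(\Delta\otimes\mathrm{id})\mathcal R=\mathcal R_{13}\mathcal R_{23}$, $(\mathrm{id}\otimes\Delta)\mathcal R=\mathcal R_{13}\mathcal R_{12}$. A left $H$-module algebra is an algebra $A$ with left $H$-action satisfying $\xi\triangleright(ab)=(\xi_1\triangleright a)(\xi_2\triangleright b)$, $\xi\triangleright1=\varepsilon(\xi)1$. A left $H$-module $A$-bimodule is an $A$-bimodule $V$ with left $H$-action satisfying $\xi\triangleright(a\cdot v)=(\xi_1\triangleright a)\cdot(\xi_2\triangleright v)$, $\xi\triangleright(v\cdot a)=(\xi_1\triangleright v)\cdot(\xi_2\triangleright a)$; it is quasi-commutative if $v\cdot a=(\bar R^\alpha\triangleright a)\cdot(\bar R_\alpha\triangleright v)$ for all $a\in A$, $v\in V$. Tensor products (over $\mathbb K$ or $A$) carry the $H$-action $\xi\triangleright(v\otimes w)=(\xi_1\triangleright v)\otimes(\xi_2\triangleright w)$. $\mathrm{Hom}_A$ denotes right $A$-linear maps. A differential calculus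 over $A$ is a graded algebra $(\Omega^\bullet=\bigoplus_{n\ge0}\Omega^n,\wedge)$ with $\Omega^0=A$ and $\mathbb K$-linear maps $\mathrm d:\Omega^n\to\Omega^{n+1}$ with $\mathrm d\circ\mathrm d=0$ and $\mathrm d(\theta\wedge\theta')=(\mathrm d\theta)\wedge\theta'+(-1)^{\deg\theta}\theta\wedge\mathrm d\theta'$, such that every $\theta\in\Omega:=\Omega^1$ is of the form $\sum_ia_i\,\mathrm db_i$ with $a_i,b_i\in A$. It is left $H$-covariant if $A$ and $\Omega^\bullet$ are left $H$-module algebras, the $H$-action preserves degree, and $\xi\triangleright\mathrm d\theta=\mathrm d(\xi\triangleright\theta)$. It is graded quasi-commutative if $\theta\wedge\theta'=(-1)^{\deg\theta\deg\theta'}(\bar R^\alpha\triangleright\theta')\wedge(\bar R_\alpha\triangleright\theta)$ for all homogeneous $\theta,\theta'\in\Omega^\bullet$ (including degree $0$). A (right) connection on $V$ is a $\mathbb K$-linear map $\nabla:V\to V\otimes_A\Omega$ with $\nabla(v\cdot a)=(\nabla v)\cdot a+v\otimes_A\mathrm da$; $\mathrm{Con}_A(V)$ is the set of these. A connection extends to a $\mathbb K$-linear map $\nabla:V\otimes_A\Omega^\bullet\to V\otimes_A\Omega^\bullet$ by $\nabla(v\otimes_A\theta)=(\nabla v)\wedge\theta+v\otimes_A\mathrm d\theta$, and its curvature is $R_\nabla:=\nabla\circ\nabla:V\to V\otimes_A\Omega^2$, a right $A$-linear map. For linear maps of left $H$-modules: $\xi\blacktriangleright Q:=\xi_1\triangleright\circ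 Q\circ S(\xi_2)\triangleright$, and $P\otimes_{\mathcal R}Q:=(P\circ\bar R^\alpha\triangleright)\otimes(\bar R_\alpha\blacktriangleright Q)$, with $(P\otimes Q)(v\otimes w)=P(v)\otimes Q(w)$; for right $A$-linear $P,Q$ between quasi-commutative bimodules this induces a well defined map on tensor products over $A$, denoted the same way. $\tau^{-1}_{\mathcal R\,23}$ is the inverse braiding exchanging the second and third tensor factors, a form in $\Omega$ or $\Omega^2$ and an element of $W$: $\theta\otimes_Aw\mapsto(R_\alpha\triangleright w)\otimes_A(R^\alpha\triangleright\theta)$. The sum of connections $\nabla_V\oplus_{\mathcal R}\nabla_W\in\mathrm{Con}_A(V\otimes_AW)$ is the (well defined) map $$(\nabla_V\oplus_{\mathcal R}\nabla_W)(v\otimes_Aw)=\tau^{-1}_{\mathcal R\,23}\bigl(\nabla_V(v)\otimes_Aw\bigr)+(\bar R^\alpha\triangleright v)\otimes_A(\bar R_\alpha\blacktriangleright\nabla_W)(w).$$ The map $\mathrm{id}_{V\otimes_AW}\otimes_{\mathcal R}\wedge:V\otimes_AW\otimes_A\Omega\otimes_A\Omega\to V\otimes_AW\otimes_A\Omega^2$ multiplies the last two factors. *)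

theory Defs
  imports "HOL-Algebra.Module" "HOL-Algebra.Free_Abelian_Groups"
begin

section \<open>Tensor products\<close>

type_synonym ('v, 'w) tens = "(('v \<times> 'w) \<Rightarrow>\<^sub>0 int) set"

definition balanced_rels ::
  "'b set \<Rightarrow> ('v \<Rightarrow> 'b \<Rightarrow> 'v) \<Rightarrow> ('b \<Rightarrow> 'w \<Rightarrow> 'w) \<Rightarrow> ('v, 'm) ring_scheme \<Rightarrow> ('w, 'n) ring_scheme
    \<Rightarrow> (('v \<times> 'w) \<Rightarrow>\<^sub>0 int) set" where
  "balanced_rels B r l V W =
     {frag_of (v \<oplus>\<^bsub>V\<^esub> v', w) - frag_of (v, w) - frag_of (v', w) | v v' w.
        v \<in> carrier V \<and> v' \<in> carrier V \<and> w \<in> carrier W}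
   \<union> {frag_of (v, w \<oplus>\<^bsub>W\<^esub> w') - frag_of (v, w) - frag_of (v, w') | v w w'.
        v \<in> carrier V \<and> w \<in> carrier W \<and> w' \<in> carrier W}
   \<union> {frag_of (r v b, w) - frag_of (v, l b w) | v b w.
        v \<in> carrier V \<and> b \<in> B \<and> w \<in> carrier W}"

definition balanced_null ::
  "'b set \<Rightarrow> ('v \<Rightarrow> 'b \<Rightarrow> 'v) \<Rightarrow> ('b \<Rightarrow> 'w \<Rightarrow> 'w) \<Rightarrow> ('v, 'm) ring_scheme \<Rightarrow> ('w, 'n) ring_scheme
    \<Rightarrow> (('v \<times> 'w) \<Rightarrow>\<^sub>0 int) set" where
  "balanced_null B r l V W =
     generate (free_Abelian_group (carrier V \<times> carrier W)) (balanced_rels B r l V W)"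

definition pure_tensor ::
  "'b set \<Rightarrow> ('v \<Rightarrow> 'b \<Rightarrow> 'v) \<Rightarrow> ('b \<Rightarrow> 'w \<Rightarrow> 'w) \<Rightarrow> ('v, 'm) ring_scheme \<Rightarrow> ('w, 'n) ring_scheme
    \<Rightarrow> 'v \<Rightarrow> 'w \<Rightarrow> ('v, 'w) tens" where
  "pure_tensor B r l V W v w =
     balanced_null B r l V W #>\<^bsub>free_Abelian_group (carrier V \<times> carrier W)\<^esub> frag_of (v, w)"

text \<open>The tensor product of a right module \<open>V\<close> (scalar action \<open>r\<close>) and a left module \<open>W\<close>
  (scalar action \<open>l\<close>) over the scalars \<open>B\<close>, as an additive group. The multiplicative fields
  of the record are not used.\<close>

definition tensor_group ::
  "'b set \<Rightarrow> ('v \<Rightarrow> 'b \<Rightarrow> 'v) \<Rightarrow> ('b \<Rightarrow> 'w \<Rightarrow> 'w) \<Rightarrow> ('v, 'm) ring_scheme \<Rightarrow> ('w, 'n) ring_scheme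
    \<Rightarrow> ('v, 'w) tens ring" where
  "tensor_group B r l V W =
     (let Q = free_Abelian_group (carrier V \<times> carrier W) Mod balanced_null B r l V W in
      \<lparr>carrier = carrier Q, monoid.mult = (\<lambda>_ _. undefined), one = undefined,
       ring.zero = one Q, add = monoid.mult Q\<rparr>)"

definition frag_eval :: "('x, 'm) ring_scheme \<Rightarrow> ('v \<Rightarrow> 'w \<Rightarrow> 'x) \<Rightarrow> (('v \<times> 'w) \<Rightarrow>\<^sub>0 int) \<Rightarrow> 'x" where
  "frag_eval X f p =
     (\<Oplus>\<^bsub>X\<^esub>z\<in>Poly_Mapping.keys p. [Poly_Mapping.lookup p z] \<cdot>\<^bsub>X\<^esub> f (fst z) (snd z))"

text \<open>\<open>tsum X t f\<close> is \<open>\<Sum>\<^sub>i f (v\<^sub>i) (w\<^sub>i)\<close> in \<open>X\<close> for \<open>t = \<Sum>\<^sub>i v\<^sub>i \<otimes> w\<^sub>i\<close>. It is meaningful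
  exactly when the sum does not depend on the representative of \<open>t\<close>, e.g. when \<open>f\<close> is balanced.
  It serves both for maps induced on tensor products and for Sweedler-type sums.\<close>

definition tsum :: "('x, 'm) ring_scheme \<Rightarrow> ('v, 'w) tens \<Rightarrow> ('v \<Rightarrow> 'w \<Rightarrow> 'x) \<Rightarrow> 'x" where
  "tsum X t f = the_elem (frag_eval X f ` t)"


section \<open>Algebras and tensor products over the ground ring\<close>

definition K_linear ::
  "('k, 'l) ring_scheme \<Rightarrow> ('k, 'v, 'm) module_scheme \<Rightarrow> ('k, 'w, 'n) module_scheme \<Rightarrow> ('v \<Rightarrow> 'w) set" where
  "K_linear K V W = {f \<in> carrier V \<rightarrow> carrier W.
     (\<forall>x\<in>carrier V. \<forall>y\<in>carrier V. f (x \<oplus>\<^bsub>V\<^esub> y) = f x \<oplus>\<^bsub>W\<^esub> f y) \<and>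
     (\<forall>k\<in>carrier K. \<forall>x\<in>carrier V. f (k \<odot>\<^bsub>V\<^esub> x) = k \<odot>\<^bsub>W\<^esub> f x)}"

text \<open>The library locale \<open>algebra\<close> is about commutative algebras only.\<close>

locale assoc_algebra = module K B + B: ring B
  for K :: "('k, 'l) ring_scheme" and B :: "('k, 'b, 'm) module_scheme" +
  assumes smult_mult_left: "\<lbrakk>k \<in> carrier K; x \<in> carrier B; y \<in> carrier B\<rbrakk> \<Longrightarrow>
      (k \<odot>\<^bsub>B\<^esub> x) \<otimes>\<^bsub>B\<^esub> y = k \<odot>\<^bsub>B\<^esub> (x \<otimes>\<^bsub>B\<^esub> y)"
    and smult_mult_right: "\<lbrakk>k \<in> carrier K; x \<in> carrier B; y \<in> carrier B\<rbrakk> \<Longrightarrow>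
      x \<otimes>\<^bsub>B\<^esub> (k \<odot>\<^bsub>B\<^esub> y) = k \<odot>\<^bsub>B\<^esub> (x \<otimes>\<^bsub>B\<^esub> y)"

definition ktens ::
  "('k, 'l) ring_scheme \<Rightarrow> ('k, 'v, 'm) module_scheme \<Rightarrow> ('k, 'w, 'n) module_scheme
    \<Rightarrow> 'v \<Rightarrow> 'w \<Rightarrow> ('v, 'w) tens" where
  "ktens K V W = pure_tensor (carrier K) (\<lambda>v k. k \<odot>\<^bsub>V\<^esub> v) (\<lambda>k w. k \<odot>\<^bsub>W\<^esub> w) V W"

text \<open>The ring structure is only meaningful if both factors are algebras.\<close>

definition ktensor ::
  "('k, 'l) ring_scheme \<Rightarrow> ('k, 'v, 'm) module_scheme \<Rightarrow> ('k, 'w, 'n) module_scheme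
    \<Rightarrow> ('k, ('v, 'w) tens) module" where
  "ktensor K V W =
     (let G = tensor_group (carrier K) (\<lambda>v k. k \<odot>\<^bsub>V\<^esub> v) (\<lambda>k w. k \<odot>\<^bsub>W\<^esub> w) V W in
      \<lparr>carrier = carrier G,
       monoid.mult = (\<lambda>s t. tsum G s (\<lambda>v w. tsum G t (\<lambda>v' w'. ktens K V W (v \<otimes>\<^bsub>V\<^esub> v') (w \<otimes>\<^bsub>W\<^esub> w')))),
       one = ktens K V W \<one>\<^bsub>V\<^esub> \<one>\<^bsub>W\<^esub>,
       ring.zero = \<zero>\<^bsub>G\<^esub>,
       add = add G,
       smult = (\<lambda>k t. tsum G t (\<lambda>v w. ktens K V W (k \<odot>\<^bsub>V\<^esub> v) w))\<rparr>)"


section \<open>Quasitriangular Hopf algebras\<close>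

record ('k, 'h) hopf = "('k, 'h) module" +
  comul :: "'h \<Rightarrow> ('h, 'h) tens"
  counit :: "'h \<Rightarrow> 'k"
  antipode :: "'h \<Rightarrow> 'h"

definition ktensor3 :: "('k, 'l) ring_scheme \<Rightarrow> ('k, 'h, 'm) module_scheme
    \<Rightarrow> ('k, (('h, 'h) tens, 'h) tens) module" where
  "ktensor3 K H = ktensor K (ktensor K H H) H"

definition ktens3 :: "('k, 'l) ring_scheme \<Rightarrow> ('k, 'h, 'm) module_scheme
    \<Rightarrow> 'h \<Rightarrow> 'h \<Rightarrow> 'h \<Rightarrow> (('h, 'h) tens, 'h) tens" where
  "ktens3 K H x y z = ktens K (ktensor K H H) H (ktens K H H x y) z"

definition comul_id :: "('k, 'l) ring_scheme \<Rightarrow> ('k, 'h, 'm) hopf_scheme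
    \<Rightarrow> ('h, 'h) tens \<Rightarrow> (('h, 'h) tens, 'h) tens" where
  "comul_id K H t = tsum (ktensor3 K H) t (\<lambda>x y. ktens K (ktensor K H H) H (comul H x) y)"

text \<open>\<open>id \<otimes> \<Delta>\<close>, rebracketed to land in \<open>(H \<otimes> H) \<otimes> H\<close>.\<close>

definition id_comul :: "('k, 'l) ring_scheme \<Rightarrow> ('k, 'h, 'm) hopf_scheme
    \<Rightarrow> ('h, 'h) tens \<Rightarrow> (('h, 'h) tens, 'h) tens" where
  "id_comul K H t = tsum (ktensor3 K H) t (\<lambda>x y.
     tsum (ktensor3 K H) (comul H y) (\<lambda>y1 y2. ktens3 K H x y1 y2))"

locale hopf_algebra = assoc_algebra K H
  for K :: "('k, 'l) ring_scheme" and H :: "('k, 'h, 'm) hopf_scheme" +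
  assumes comul_linear: "comul H \<in> K_linear K H (ktensor K H H)"
    and comul_hom: "comul H \<in> ring_hom H (ktensor K H H)"
    and counit_hom: "counit H \<in> ring_hom H K"
    and counit_smult: "\<lbrakk>k \<in> carrier K; x \<in> carrier H\<rbrakk> \<Longrightarrow> counit H (k \<odot>\<^bsub>H\<^esub> x) = k \<otimes>\<^bsub>K\<^esub> counit H x"
    and coassoc: "x \<in> carrier H \<Longrightarrow> comul_id K H (comul H x) = id_comul K H (comul H x)"
    and counit_left: "x \<in> carrier H \<Longrightarrow> tsum H (comul H x) (\<lambda>a b. counit H a \<odot>\<^bsub>H\<^esub> b) = x"
    and counit_right: "x \<in> carrier H \<Longrightarrow> tsum H (comul H x) (\<lambda>a b. counit H b \<odot>\<^bsub>H\<^esub> a) = x"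
    and antipode_linear: "antipode H \<in> K_linear K H H"
    and antipode_left: "x \<in> carrier H \<Longrightarrow>
      tsum H (comul H x) (\<lambda>a b. antipode H a \<otimes>\<^bsub>H\<^esub> b) = counit H x \<odot>\<^bsub>H\<^esub> \<one>\<^bsub>H\<^esub>"
    and antipode_right: "x \<in> carrier H \<Longrightarrow>
      tsum H (comul H x) (\<lambda>a b. a \<otimes>\<^bsub>H\<^esub> antipode H b) = counit H x \<odot>\<^bsub>H\<^esub> \<one>\<^bsub>H\<^esub>"

definition leg12 :: "('k, 'l) ring_scheme \<Rightarrow> ('k, 'h, 'm) module_scheme
    \<Rightarrow> ('h, 'h) tens \<Rightarrow> (('h, 'h) tens, 'h) tens" where
  "leg12 K H t = tsum (ktensor3 K H) t (\<lambda>x y. ktens3 K H x y \<one>\<^bsub>H\<^esub>)"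

definition leg13 :: "('k, 'l) ring_scheme \<Rightarrow> ('k, 'h, 'm) module_scheme
    \<Rightarrow> ('h, 'h) tens \<Rightarrow> (('h, 'h) tens, 'h) tens" where
  "leg13 K H t = tsum (ktensor3 K H) t (\<lambda>x y. ktens3 K H x \<one>\<^bsub>H\<^esub> y)"

definition leg23 :: "('k, 'l) ring_scheme \<Rightarrow> ('k, 'h, 'm) module_scheme
    \<Rightarrow> ('h, 'h) tens \<Rightarrow> (('h, 'h) tens, 'h) tens" where
  "leg23 K H t = tsum (ktensor3 K H) t (\<lambda>x y. ktens3 K H \<one>\<^bsub>H\<^esub> x y)"

definition Rbar :: "('k, 'l) ring_scheme \<Rightarrow> ('k, 'h, 'm) module_scheme
    \<Rightarrow> ('h, 'h) tens \<Rightarrow> ('h, 'h) tens" where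
  "Rbar K H R = inv\<^bsub>ktensor K H H\<^esub> R"

locale quasitriangular_hopf_algebra = hopf_algebra K H
  for K :: "('k, 'l) ring_scheme" and H :: "('k, 'h, 'm) hopf_scheme" and R :: "('h, 'h) tens" +
  assumes R_invertible: "R \<in> Units (ktensor K H H)"
    and R_comul: "x \<in> carrier H \<Longrightarrow>
      tsum (ktensor K H H) (comul H x) (\<lambda>a b. ktens K H H b a)
        = R \<otimes>\<^bsub>ktensor K H H\<^esub> comul H x \<otimes>\<^bsub>ktensor K H H\<^esub> Rbar K H R"
    and comul_id_R: "comul_id K H R = leg13 K H R \<otimes>\<^bsub>ktensor3 K H\<^esub> leg23 K H R"
    and id_comul_R: "id_comul K H R = leg13 K H R \<otimes>\<^bsub>ktensor3 K H\<^esub> leg12 K H R"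


section \<open>Module algebras and bimodules\<close>

record ('k, 'h, 'v) hmod = "('k, 'v) module" +
  act :: "'h \<Rightarrow> 'v \<Rightarrow> 'v"

record ('k, 'h, 'a, 'v) hbimod = "('k, 'h, 'v) hmod" +
  lmul :: "'a \<Rightarrow> 'v \<Rightarrow> 'v"
  rmul :: "'v \<Rightarrow> 'a \<Rightarrow> 'v"

locale H_module = module K V
  for K :: "('k, 'l) ring_scheme" and H :: "('k, 'h, 'm) hopf_scheme"
    and V :: "('k, 'h, 'v, 'n) hmod_scheme" +
  assumes act_closed: "\<lbrakk>x \<in> carrier H; v \<in> carrier V\<rbrakk> \<Longrightarrow> act V x v \<in> carrier V"
    and act_add_left: "\<lbrakk>x \<in> carrier H; y \<in> carrier H; v \<in> carrier V\<rbrakk> \<Longrightarrow>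
      act V (x \<oplus>\<^bsub>H\<^esub> y) v = act V x v \<oplus>\<^bsub>V\<^esub> act V y v"
    and act_add_right: "\<lbrakk>x \<in> carrier H; v \<in> carrier V; w \<in> carrier V\<rbrakk> \<Longrightarrow>
      act V x (v \<oplus>\<^bsub>V\<^esub> w) = act V x v \<oplus>\<^bsub>V\<^esub> act V x w"
    and act_smult_left: "\<lbrakk>k \<in> carrier K; x \<in> carrier H; v \<in> carrier V\<rbrakk> \<Longrightarrow>
      act V (k \<odot>\<^bsub>H\<^esub> x) v = k \<odot>\<^bsub>V\<^esub> act V x v"
    and act_smult_right: "\<lbrakk>k \<in> carrier K; x \<in> carrier H; v \<in> carrier V\<rbrakk> \<Longrightarrow>
      act V x (k \<odot>\<^bsub>V\<^esub> v) = k \<odot>\<^bsub>V\<^esub> act V x v"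
    and act_mult: "\<lbrakk>x \<in> carrier H; y \<in> carrier H; v \<in> carrier V\<rbrakk> \<Longrightarrow>
      act V (x \<otimes>\<^bsub>H\<^esub> y) v = act V x (act V y v)"
    and act_one: "v \<in> carrier V \<Longrightarrow> act V \<one>\<^bsub>H\<^esub> v = v"

locale H_module_algebra = H_module K H A + A: assoc_algebra K A
  for K :: "('k, 'l) ring_scheme" and H :: "('k, 'h, 'm) hopf_scheme"
    and A :: "('k, 'h, 'a, 'n) hmod_scheme" +
  assumes act_prod: "\<lbrakk>x \<in> carrier H; a \<in> carrier A; b \<in> carrier A\<rbrakk> \<Longrightarrow>
      act A x (a \<otimes>\<^bsub>A\<^esub> b) = tsum A (comul H x) (\<lambda>x1 x2. act A x1 a \<otimes>\<^bsub>A\<^esub> act A x2 b)"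
    and act_unit: "x \<in> carrier H \<Longrightarrow> act A x \<one>\<^bsub>A\<^esub> = counit H x \<odot>\<^bsub>A\<^esub> \<one>\<^bsub>A\<^esub>"

locale K_bimodule = module K V
  for K :: "('k, 'l) ring_scheme" and A :: "('k, 'a, 'm) module_scheme"
    and V :: "('k, 'h, 'a, 'v, 'n) hbimod_scheme" +
  assumes lmul_closed: "\<lbrakk>a \<in> carrier A; v \<in> carrier V\<rbrakk> \<Longrightarrow> lmul V a v \<in> carrier V"
    and rmul_closed: "\<lbrakk>a \<in> carrier A; v \<in> carrier V\<rbrakk> \<Longrightarrow> rmul V v a \<in> carrier V"
    and lmul_add_left: "\<lbrakk>a \<in> carrier A; b \<in> carrier A; v \<in> carrier V\<rbrakk> \<Longrightarrow>
      lmul V (a \<oplus>\<^bsub>A\<^esub> b) v = lmul V a v \<oplus>\<^bsub>V\<^esub> lmul V b v"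
    and lmul_add_right: "\<lbrakk>a \<in> carrier A; v \<in> carrier V; w \<in> carrier V\<rbrakk> \<Longrightarrow>
      lmul V a (v \<oplus>\<^bsub>V\<^esub> w) = lmul V a v \<oplus>\<^bsub>V\<^esub> lmul V a w"
    and rmul_add_left: "\<lbrakk>a \<in> carrier A; v \<in> carrier V; w \<in> carrier V\<rbrakk> \<Longrightarrow>
      rmul V (v \<oplus>\<^bsub>V\<^esub> w) a = rmul V v a \<oplus>\<^bsub>V\<^esub> rmul V w a"
    and rmul_add_right: "\<lbrakk>a \<in> carrier A; b \<in> carrier A; v \<in> carrier V\<rbrakk> \<Longrightarrow>
      rmul V v (a \<oplus>\<^bsub>A\<^esub> b) = rmul V v a \<oplus>\<^bsub>V\<^esub> rmul V v b"
    and lmul_smult_left: "\<lbrakk>k \<in> carrier K; a \<in> carrier A; v \<in> carrier V\<rbrakk> \<Longrightarrow>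
      lmul V (k \<odot>\<^bsub>A\<^esub> a) v = k \<odot>\<^bsub>V\<^esub> lmul V a v"
    and lmul_smult_right: "\<lbrakk>k \<in> carrier K; a \<in> carrier A; v \<in> carrier V\<rbrakk> \<Longrightarrow>
      lmul V a (k \<odot>\<^bsub>V\<^esub> v) = k \<odot>\<^bsub>V\<^esub> lmul V a v"
    and rmul_smult_left: "\<lbrakk>k \<in> carrier K; a \<in> carrier A; v \<in> carrier V\<rbrakk> \<Longrightarrow>
      rmul V (k \<odot>\<^bsub>V\<^esub> v) a = k \<odot>\<^bsub>V\<^esub> rmul V v a"
    and rmul_smult_right: "\<lbrakk>k \<in> carrier K; a \<in> carrier A; v \<in> carrier V\<rbrakk> \<Longrightarrow>
      rmul V v (k \<odot>\<^bsub>A\<^esub> a) = k \<odot>\<^bsub>V\<^esub> rmul V v a"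
    and lmul_mult: "\<lbrakk>a \<in> carrier A; b \<in> carrier A; v \<in> carrier V\<rbrakk> \<Longrightarrow>
      lmul V (a \<otimes>\<^bsub>A\<^esub> b) v = lmul V a (lmul V b v)"
    and rmul_mult: "\<lbrakk>a \<in> carrier A; b \<in> carrier A; v \<in> carrier V\<rbrakk> \<Longrightarrow>
      rmul V v (a \<otimes>\<^bsub>A\<^esub> b) = rmul V (rmul V v a) b"
    and lmul_one: "v \<in> carrier V \<Longrightarrow> lmul V \<one>\<^bsub>A\<^esub> v = v"
    and rmul_one: "v \<in> carrier V \<Longrightarrow> rmul V v \<one>\<^bsub>A\<^esub> = v"
    and lmul_rmul: "\<lbrakk>a \<in> carrier A; b \<in> carrier A; v \<in> carrier V\<rbrakk> \<Longrightarrow>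
      rmul V (lmul V a v) b = lmul V a (rmul V v b)"

locale H_module_bimodule = H_module K H V + K_bimodule K A V
  for K :: "('k, 'l) ring_scheme" and H :: "('k, 'h, 'm) hopf_scheme"
    and A :: "('k, 'h, 'a, 'p) hmod_scheme" and V :: "('k, 'h, 'a, 'v, 'n) hbimod_scheme" +
  assumes act_lmul: "\<lbrakk>x \<in> carrier H; a \<in> carrier A; v \<in> carrier V\<rbrakk> \<Longrightarrow>
      act V x (lmul V a v) = tsum V (comul H x) (\<lambda>x1 x2. lmul V (act A x1 a) (act V x2 v))"
    and act_rmul: "\<lbrakk>x \<in> carrier H; a \<in> carrier A; v \<in> carrier V\<rbrakk> \<Longrightarrow>
      act V x (rmul V v a) = tsum V (comul H x) (\<lambda>x1 x2. rmul V (act V x1 v) (act A x2 a))"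

locale quasi_commutative_bimodule = H_module_bimodule K H A V
  for K :: "('k, 'l) ring_scheme" and H :: "('k, 'h, 'm) hopf_scheme" and R :: "('h, 'h) tens"
    and A :: "('k, 'h, 'a, 'p) hmod_scheme" and V :: "('k, 'h, 'a, 'v, 'n) hbimod_scheme" +
  assumes quasi_comm: "\<lbrakk>a \<in> carrier A; v \<in> carrier V\<rbrakk> \<Longrightarrow>
      rmul V v a = tsum V (Rbar K H R) (\<lambda>r s. lmul V (act A r a) (act V s v))"

definition Hom_right :: "('k, 'l) ring_scheme \<Rightarrow> ('a, 'm) ring_scheme
    \<Rightarrow> ('k, 'h, 'a, 'v, 'n) hbimod_scheme \<Rightarrow> ('k, 'h, 'a, 'w, 'p) hbimod_scheme \<Rightarrow> ('v \<Rightarrow> 'w) set" where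
  "Hom_right K A V W = {f \<in> K_linear K V W.
     \<forall>v\<in>carrier V. \<forall>a\<in>carrier A. f (rmul V v a) = rmul W (f v) a}"

definition atens :: "('a, 'm) ring_scheme
    \<Rightarrow> ('k, 'h, 'a, 'v, 'n) hbimod_scheme \<Rightarrow> ('k, 'h, 'a, 'w, 'p) hbimod_scheme
    \<Rightarrow> 'v \<Rightarrow> 'w \<Rightarrow> ('v, 'w) tens" where
  "atens A V W = pure_tensor (carrier A) (rmul V) (lmul W) V W"

text \<open>\<open>V \<otimes>\<^sub>A W\<close> as a left \<open>H\<close>-module \<open>A\<close>-bimodule.\<close>

definition atensor :: "('k, 'h, 'l) hopf_scheme \<Rightarrow> ('a, 'm) ring_scheme
    \<Rightarrow> ('k, 'h, 'a, 'v, 'n) hbimod_scheme \<Rightarrow> ('k, 'h, 'a, 'w, 'p) hbimod_scheme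
    \<Rightarrow> ('k, 'h, 'a, ('v, 'w) tens) hbimod" where
  "atensor H A V W =
     (let G = tensor_group (carrier A) (rmul V) (lmul W) V W in
      \<lparr>carrier = carrier G, monoid.mult = (\<lambda>_ _. undefined), one = undefined,
       ring.zero = \<zero>\<^bsub>G\<^esub>, add = add G,
       smult = (\<lambda>k t. tsum G t (\<lambda>v w. atens A V W (k \<odot>\<^bsub>V\<^esub> v) w)),
       act = (\<lambda>x t. tsum G t (\<lambda>v w. tsum G (comul H x) (\<lambda>x1 x2. atens A V W (act V x1 v) (act W x2 w)))),
       lmul = (\<lambda>a t. tsum G t (\<lambda>v w. atens A V W (lmul V a v) w)),
       rmul = (\<lambda>t a. tsum G t (\<lambda>v w. atens A V W v (rmul W w a)))\<rparr>)"

text \<open>The canonical projection \<open>V \<otimes> W \<rightarrow> V \<otimes>\<^sub>A W\<close> and the two rebracketing maps.\<close>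

definition proj_tensor :: "('k, 'h, 'l) hopf_scheme \<Rightarrow> ('a, 'm) ring_scheme
    \<Rightarrow> ('k, 'h, 'a, 'v, 'n) hbimod_scheme \<Rightarrow> ('k, 'h, 'a, 'w, 'p) hbimod_scheme
    \<Rightarrow> ('v, 'w) tens \<Rightarrow> ('v, 'w) tens" where
  "proj_tensor H A V W t = tsum (atensor H A V W) t (atens A V W)"

definition assoc_left :: "('k, 'h, 'l) hopf_scheme \<Rightarrow> ('a, 'm) ring_scheme
    \<Rightarrow> ('k, 'h, 'a, 'v, 'n) hbimod_scheme \<Rightarrow> ('k, 'h, 'a, 'w, 'p) hbimod_scheme
    \<Rightarrow> ('k, 'h, 'a, 'z, 'q) hbimod_scheme
    \<Rightarrow> ('v, ('w, 'z) tens) tens \<Rightarrow> (('v, 'w) tens, 'z) tens" where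
  "assoc_left H A V W Z t =
     (let X = atensor H A (atensor H A V W) Z in
      tsum X t (\<lambda>v s. tsum X s (\<lambda>w z. atens A (atensor H A V W) Z (atens A V W v w) z)))"

definition assoc_right :: "('k, 'h, 'l) hopf_scheme \<Rightarrow> ('a, 'm) ring_scheme
    \<Rightarrow> ('k, 'h, 'a, 'v, 'n) hbimod_scheme \<Rightarrow> ('k, 'h, 'a, 'w, 'p) hbimod_scheme
    \<Rightarrow> ('k, 'h, 'a, 'z, 'q) hbimod_scheme
    \<Rightarrow> (('v, 'w) tens, 'z) tens \<Rightarrow> ('v, ('w, 'z) tens) tens" where
  "assoc_right H A V W Z t =
     (let X = atensor H A V (atensor H A W Z) in
      tsum X t (\<lambda>s z. tsum X s (\<lambda>v w. atens A V (atensor H A W Z) v (atens A W Z w z))))"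


section \<open>Tensor products of maps and the braiding\<close>

text \<open>The adjoint action of \<open>x\<close> on a linear map \<open>Q : V \<rightarrow> W\<close>.\<close>

definition badj :: "('k, 'h, 'l) hopf_scheme
    \<Rightarrow> ('k, 'h, 'v, 'm) hmod_scheme \<Rightarrow> ('k, 'h, 'w, 'n) hmod_scheme
    \<Rightarrow> 'h \<Rightarrow> ('v \<Rightarrow> 'w) \<Rightarrow> ('v \<Rightarrow> 'w)" where
  "badj H V W x Q = (\<lambda>v. tsum W (comul H x) (\<lambda>x1 x2. act W x1 (Q (act V (antipode H x2) v))))"

text \<open>\<open>P \<otimes>\<^sub>R Q : V \<otimes> W \<rightarrow> V' \<otimes> W'\<close> over the ground ring, for \<open>P : V \<rightarrow> V'\<close> and \<open>Q : W \<rightarrow> W'\<close>.\<close>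

definition rtensor_K :: "('k, 'l) ring_scheme \<Rightarrow> ('k, 'h, 'm) hopf_scheme \<Rightarrow> ('h, 'h) tens
    \<Rightarrow> ('k, 'h, 'v, 'n) hmod_scheme \<Rightarrow> ('k, 'h, 'v1, 'n1) hmod_scheme
    \<Rightarrow> ('k, 'h, 'w, 'p) hmod_scheme \<Rightarrow> ('k, 'h, 'w1, 'p1) hmod_scheme
    \<Rightarrow> ('v \<Rightarrow> 'v1) \<Rightarrow> ('w \<Rightarrow> 'w1) \<Rightarrow> ('v, 'w) tens \<Rightarrow> ('v1, 'w1) tens" where
  "rtensor_K K H R V V' W W' P Q t =
     tsum (ktensor K V' W') t (\<lambda>v w. tsum (ktensor K V' W') (Rbar K H R)
       (\<lambda>r s. ktens K V' W' (P (act V r v)) (badj H W W' s Q w)))"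

text \<open>The induced map \<open>V \<otimes>\<^sub>A W \<rightarrow> V' \<otimes>\<^sub>A W'\<close> for right \<open>A\<close>-linear \<open>P\<close> and \<open>Q\<close>.\<close>

definition rtensor_A :: "('k, 'l) ring_scheme \<Rightarrow> ('k, 'h, 'm) hopf_scheme \<Rightarrow> ('h, 'h) tens
    \<Rightarrow> ('a, 'q) ring_scheme
    \<Rightarrow> ('k, 'h, 'a, 'v, 'n) hbimod_scheme \<Rightarrow> ('k, 'h, 'a, 'v1, 'n1) hbimod_scheme
    \<Rightarrow> ('k, 'h, 'a, 'w, 'p) hbimod_scheme \<Rightarrow> ('k, 'h, 'a, 'w1, 'p1) hbimod_scheme
    \<Rightarrow> ('v \<Rightarrow> 'v1) \<Rightarrow> ('w \<Rightarrow> 'w1) \<Rightarrow> ('v, 'w) tens \<Rightarrow> ('v1, 'w1) tens" where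
  "rtensor_A K H R A V V' W W' P Q t =
     tsum (atensor H A V' W') t (\<lambda>v w. tsum (atensor H A V' W') (Rbar K H R)
       (\<lambda>r s. atens A V' W' (P (act V r v)) (badj H W W' s Q w)))"

text \<open>\<open>\<tau>\<^sup>-\<^sup>1\<close> on the factors 2 and 3: \<open>(V \<otimes>\<^sub>A M) \<otimes>\<^sub>A W \<rightarrow> (V \<otimes>\<^sub>A W) \<otimes>\<^sub>A M\<close>. It uses \<open>R\<close> itself, not
  its inverse.\<close>

definition tau23_inv :: "('k, 'h, 'l) hopf_scheme \<Rightarrow> ('h, 'h) tens \<Rightarrow> ('a, 'q) ring_scheme
    \<Rightarrow> ('k, 'h, 'a, 'v, 'n) hbimod_scheme \<Rightarrow> ('k, 'h, 'a, 'o, 'p) hbimod_scheme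
    \<Rightarrow> ('k, 'h, 'a, 'w, 'm) hbimod_scheme
    \<Rightarrow> (('v, 'o) tens, 'w) tens \<Rightarrow> (('v, 'w) tens, 'o) tens" where
  "tau23_inv H R A V M W t =
     (let X = atensor H A (atensor H A V W) M in
      tsum X t (\<lambda>s w. tsum X s (\<lambda>v m. tsum X R
        (\<lambda>r1 r2. atens A (atensor H A V W) M (atens A V W v (act W r2 w)) (act M r1 m)))))"

text \<open>\<open>f \<otimes>\<^sub>A id\<close> for a right \<open>A\<close>-linear \<open>f : V \<rightarrow> V'\<close>.\<close>

definition tensor_id :: "('k, 'h, 'l) hopf_scheme \<Rightarrow> ('a, 'q) ring_scheme
    \<Rightarrow> ('k, 'h, 'a, 'v1, 'n) hbimod_scheme \<Rightarrow> ('k, 'h, 'a, 'w, 'p) hbimod_scheme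
    \<Rightarrow> ('v \<Rightarrow> 'v1) \<Rightarrow> ('v, 'w) tens \<Rightarrow> ('v1, 'w) tens" where
  "tensor_id H A V' W f t = tsum (atensor H A V' W) t (\<lambda>v w. atens A V' W (f v) w)"


section \<open>Differential calculi\<close>

text \<open>A graded algebra is given internally, as an algebra with a family of submodules. The
  differential is only used on homogeneous elements.\<close>

record ('k, 'h, 'o) dcalc = "('k, 'h, 'o) hmod" +
  grade :: "nat \<Rightarrow> 'o set"
  diff :: "'o \<Rightarrow> 'o"

definition signed :: "nat \<Rightarrow> ('o, 'm) ring_scheme \<Rightarrow> 'o \<Rightarrow> 'o" where
  "signed n \<Omega> x = (if even n then x else \<ominus>\<^bsub>\<Omega>\<^esub> x)"

text \<open>\<open>\<Omega>\<^sup>n\<close> as an \<open>A\<close>-bimodule.\<close>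

definition forms :: "('k, 'h, 'o, 'm) dcalc_scheme \<Rightarrow> nat \<Rightarrow> ('k, 'h, 'o, 'o) hbimod" where
  "forms \<Omega> n = \<lparr>carrier = grade \<Omega> n, monoid.mult = monoid.mult \<Omega>, one = one \<Omega>,
     ring.zero = \<zero>\<^bsub>\<Omega>\<^esub>, add = add \<Omega>, smult = smult \<Omega>, act = act \<Omega>,
     lmul = monoid.mult \<Omega>, rmul = monoid.mult \<Omega>\<rparr>"

locale graded_algebra = assoc_algebra K \<Omega>
  for K :: "('k, 'l) ring_scheme" and \<Omega> :: "('k, 'h, 'o, 'm) dcalc_scheme" +
  assumes grade_submodule: "submodule (grade \<Omega> n) K \<Omega>"
    and grade_one: "\<one>\<^bsub>\<Omega>\<^esub> \<in> grade \<Omega> 0"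
    and grade_mult: "\<lbrakk>x \<in> grade \<Omega> m; y \<in> grade \<Omega> n\<rbrakk> \<Longrightarrow> x \<otimes>\<^bsub>\<Omega>\<^esub> y \<in> grade \<Omega> (m + n)"
    and grade_direct_sum: "x \<in> carrier \<Omega> \<Longrightarrow>
      \<exists>!c. (\<forall>n. c n \<in> grade \<Omega> n) \<and> finite {n. c n \<noteq> \<zero>\<^bsub>\<Omega>\<^esub>}
           \<and> x = (\<Oplus>\<^bsub>\<Omega>\<^esub>n\<in>{n. c n \<noteq> \<zero>\<^bsub>\<Omega>\<^esub>}. c n)"

locale differential_calculus = graded_algebra K \<Omega>
  for K :: "('k, 'l) ring_scheme" and A :: "('k, 'h, 'o, 'p) hmod_scheme"
    and \<Omega> :: "('k, 'h, 'o, 'm) dcalc_scheme" +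
  assumes grade_0: "carrier A = grade \<Omega> 0" "\<one>\<^bsub>A\<^esub> = \<one>\<^bsub>\<Omega>\<^esub>"
      "\<lbrakk>a \<in> carrier A; b \<in> carrier A\<rbrakk> \<Longrightarrow> a \<otimes>\<^bsub>A\<^esub> b = a \<otimes>\<^bsub>\<Omega>\<^esub> b"
      "\<lbrakk>a \<in> carrier A; b \<in> carrier A\<rbrakk> \<Longrightarrow> a \<oplus>\<^bsub>A\<^esub> b = a \<oplus>\<^bsub>\<Omega>\<^esub> b"
      "\<lbrakk>k \<in> carrier K; a \<in> carrier A\<rbrakk> \<Longrightarrow> k \<odot>\<^bsub>A\<^esub> a = k \<odot>\<^bsub>\<Omega>\<^esub> a"
    and diff_linear: "diff \<Omega> \<in> K_linear K (forms \<Omega> n) (forms \<Omega> (Suc n))"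
    and diff_diff: "x \<in> grade \<Omega> n \<Longrightarrow> diff \<Omega> (diff \<Omega> x) = \<zero>\<^bsub>\<Omega>\<^esub>"
    and leibniz: "\<lbrakk>x \<in> grade \<Omega> m; y \<in> grade \<Omega> n\<rbrakk> \<Longrightarrow>
      diff \<Omega> (x \<otimes>\<^bsub>\<Omega>\<^esub> y) = (diff \<Omega> x \<otimes>\<^bsub>\<Omega>\<^esub> y) \<oplus>\<^bsub>\<Omega>\<^esub> signed m \<Omega> (x \<otimes>\<^bsub>\<Omega>\<^esub> diff \<Omega> y)"
    and one_forms_generated: "x \<in> grade \<Omega> 1 \<Longrightarrow>
      \<exists>(N::nat) a b. a \<in> {..<N} \<rightarrow> carrier A \<and> b \<in> {..<N} \<rightarrow> carrier A
        \<and> x = (\<Oplus>\<^bsub>\<Omega>\<^esub>i\<in>{..<N}. a i \<otimes>\<^bsub>\<Omega>\<^esub> diff \<Omega> (b i))"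

locale covariant_calculus = differential_calculus K A \<Omega> + H_module_algebra K H \<Omega>
  for K :: "('k, 'l) ring_scheme" and H :: "('k, 'h, 'n) hopf_scheme"
    and A :: "('k, 'h, 'o, 'p) hmod_scheme" and \<Omega> :: "('k, 'h, 'o, 'm) dcalc_scheme" +
  assumes A_module_algebra: "H_module_algebra K H A"
    and act_grade_0: "\<lbrakk>x \<in> carrier H; a \<in> carrier A\<rbrakk> \<Longrightarrow> act A x a = act \<Omega> x a"
    and act_grade: "\<lbrakk>x \<in> carrier H; w \<in> grade \<Omega> n\<rbrakk> \<Longrightarrow> act \<Omega> x w \<in> grade \<Omega> n"
    and act_diff: "\<lbrakk>x \<in> carrier H; w \<in> grade \<Omega> n\<rbrakk> \<Longrightarrow> act \<Omega> x (diff \<Omega> w) = diff \<Omega> (act \<Omega> x w)"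

locale quasi_commutative_calculus = covariant_calculus K H A \<Omega>
  for K :: "('k, 'l) ring_scheme" and H :: "('k, 'h, 'n) hopf_scheme" and R :: "('h, 'h) tens"
    and A :: "('k, 'h, 'o, 'p) hmod_scheme" and \<Omega> :: "('k, 'h, 'o, 'm) dcalc_scheme" +
  assumes graded_quasi_comm: "\<lbrakk>w \<in> grade \<Omega> m; w' \<in> grade \<Omega> n\<rbrakk> \<Longrightarrow>
      w \<otimes>\<^bsub>\<Omega>\<^esub> w' = signed (m * n) \<Omega> (tsum \<Omega> (Rbar K H R) (\<lambda>r s. act \<Omega> r w' \<otimes>\<^bsub>\<Omega>\<^esub> act \<Omega> s w))"

text \<open>The product \<open>\<Omega> \<otimes>\<^sub>A \<Omega> \<rightarrow> \<Omega>\<^sup>2\<close>.\<close>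

definition wedge_map :: "('k, 'h, 'o, 'm) dcalc_scheme \<Rightarrow> ('o, 'o) tens \<Rightarrow> 'o" where
  "wedge_map \<Omega> t = tsum \<Omega> t (monoid.mult \<Omega>)"


section \<open>Connections\<close>

definition connections :: "('k, 'l) ring_scheme \<Rightarrow> ('k, 'h, 'n) hopf_scheme
    \<Rightarrow> ('o, 'p) ring_scheme \<Rightarrow> ('k, 'h, 'o, 'm) dcalc_scheme
    \<Rightarrow> ('k, 'h, 'o, 'v, 'q) hbimod_scheme \<Rightarrow> ('v \<Rightarrow> ('v, 'o) tens) set" where
  "connections K H A \<Omega> V =
     (let X = atensor H A V (forms \<Omega> 1) in
      {D \<in> K_linear K V X. \<forall>v\<in>carrier V. \<forall>a\<in>carrier A.
        D (rmul V v a) = rmul X (D v) a \<oplus>\<^bsub>X\<^esub> atens A V (forms \<Omega> 1) v (diff \<Omega> a)})"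

text \<open>The extension \<open>V \<otimes>\<^sub>A \<Omega>\<^sup>n \<rightarrow> V \<otimes>\<^sub>A \<Omega>\<^sup>n\<^sup>+\<^sup>1\<close> of a connection, where
  \<open>(v \<otimes> \<omega>) \<and> \<theta> = v \<otimes> (\<omega> \<and> \<theta>)\<close>.\<close>

definition conn_ext :: "('k, 'h, 'n) hopf_scheme
    \<Rightarrow> ('o, 'p) ring_scheme \<Rightarrow> ('k, 'h, 'o, 'm) dcalc_scheme
    \<Rightarrow> ('k, 'h, 'o, 'v, 'q) hbimod_scheme \<Rightarrow> nat \<Rightarrow> ('v \<Rightarrow> ('v, 'o) tens)
    \<Rightarrow> ('v, 'o) tens \<Rightarrow> ('v, 'o) tens" where
  "conn_ext H A \<Omega> V n D t =
     (let X = atensor H A V (forms \<Omega> (Suc n)); ten = atens A V (forms \<Omega> (Suc n)) in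
      tsum X t (\<lambda>v w. tsum X (D v) (\<lambda>v' w'. ten v' (w' \<otimes>\<^bsub>\<Omega>\<^esub> w)) \<oplus>\<^bsub>X\<^esub> ten v (diff \<Omega> w)))"

definition curvature :: "('k, 'h, 'n) hopf_scheme
    \<Rightarrow> ('o, 'p) ring_scheme \<Rightarrow> ('k, 'h, 'o, 'm) dcalc_scheme
    \<Rightarrow> ('k, 'h, 'o, 'v, 'q) hbimod_scheme \<Rightarrow> ('v \<Rightarrow> ('v, 'o) tens)
    \<Rightarrow> 'v \<Rightarrow> ('v, 'o) tens" where
  "curvature H A \<Omega> V D = conn_ext H A \<Omega> V 1 D \<circ> D"

definition sum_connection :: "('k, 'l) ring_scheme \<Rightarrow> ('k, 'h, 'n) hopf_scheme \<Rightarrow> ('h, 'h) tens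
    \<Rightarrow> ('o, 'p) ring_scheme \<Rightarrow> ('k, 'h, 'o, 'm) dcalc_scheme
    \<Rightarrow> ('k, 'h, 'o, 'v, 'q) hbimod_scheme \<Rightarrow> ('k, 'h, 'o, 'w, 'r) hbimod_scheme
    \<Rightarrow> ('v \<Rightarrow> ('v, 'o) tens) \<Rightarrow> ('w \<Rightarrow> ('w, 'o) tens)
    \<Rightarrow> ('v, 'w) tens \<Rightarrow> (('v, 'w) tens, 'o) tens" where
  "sum_connection K H R A \<Omega> V W DV DW t =
     (let F = forms \<Omega> 1; VF = atensor H A V F; WF = atensor H A W F;
          VWF = atensor H A V WF; X = atensor H A (atensor H A V W) F in
      tsum X t (\<lambda>v w.
        tau23_inv H R A V F W (atens A VF W (DV v) w)
        \<oplus>\<^bsub>X\<^esub> assoc_left H A V W F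
              (tsum VWF (Rbar K H R) (\<lambda>r s. atens A V WF (act V r v) (badj H W WF s DW w)))))"

text \<open>The map \<open>DV \<otimes>\<^sub>R DW - \<Sum> badj r DV \<otimes>\<^sub>R badj s DW\<close>, summed over \<open>r \<otimes> s = Rbar\<close>,
  from \<open>V \<otimes> W\<close> to \<open>(V \<otimes>\<^sub>A \<Omega>) \<otimes> (W \<otimes>\<^sub>A \<Omega>)\<close>. The tensor products between the \<open>V\<close> part and the
  \<open>W\<close> part are over the ground ring, since connections are not \<open>A\<close>-linear.\<close>

definition mixed_diff :: "('k, 'l) ring_scheme \<Rightarrow> ('k, 'h, 'n) hopf_scheme \<Rightarrow> ('h, 'h) tens
    \<Rightarrow> ('o, 'p) ring_scheme \<Rightarrow> ('k, 'h, 'o, 'm) dcalc_scheme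
    \<Rightarrow> ('k, 'h, 'o, 'v, 'q) hbimod_scheme \<Rightarrow> ('k, 'h, 'o, 'w, 'r) hbimod_scheme
    \<Rightarrow> ('v \<Rightarrow> ('v, 'o) tens) \<Rightarrow> ('w \<Rightarrow> ('w, 'o) tens)
    \<Rightarrow> ('v, 'w) tens \<Rightarrow> (('v, 'o) tens, ('w, 'o) tens) tens" where
  "mixed_diff K H R A \<Omega> V W DV DW t =
     (let VF = atensor H A V (forms \<Omega> 1); WF = atensor H A W (forms \<Omega> 1); X = ktensor K VF WF in
      rtensor_K K H R V VF W WF DV DW t
      \<ominus>\<^bsub>X\<^esub> tsum X (Rbar K H R) (\<lambda>r s.
            rtensor_K K H R V VF W WF (badj H V VF r DV) (badj H W WF s DW) t))"

text \<open>The last summand of the curvature formula, on \<open>V \<otimes> W\<close>.\<close>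

definition mixed_term :: "('k, 'l) ring_scheme \<Rightarrow> ('k, 'h, 'n) hopf_scheme \<Rightarrow> ('h, 'h) tens
    \<Rightarrow> ('o, 'p) ring_scheme \<Rightarrow> ('k, 'h, 'o, 'm) dcalc_scheme
    \<Rightarrow> ('k, 'h, 'o, 'v, 'q) hbimod_scheme \<Rightarrow> ('k, 'h, 'o, 'w, 'r) hbimod_scheme
    \<Rightarrow> ('v \<Rightarrow> ('v, 'o) tens) \<Rightarrow> ('w \<Rightarrow> ('w, 'o) tens)
    \<Rightarrow> ('v, 'w) tens \<Rightarrow> (('v, 'w) tens, 'o) tens" where
  "mixed_term K H R A \<Omega> V W DV DW =
     (let F = forms \<Omega> 1; VF = atensor H A V F; WF = atensor H A W F; VW = atensor H A V W in
      rtensor_A K H R A VW VW (atensor H A F F) (forms \<Omega> 2) id (wedge_map \<Omega>)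
      \<circ> assoc_right H A VW F F
      \<circ> tensor_id H A (atensor H A VW F) F (tau23_inv H R A V F W)
      \<circ> assoc_left H A VF W F
      \<circ> proj_tensor H A VF WF
      \<circ> mixed_diff K H R A \<Omega> V W DV DW)"

end

(*
  A connection is neither right linear nor equivariant, but it is right linear up to the Leibniz term,
  which is equivariant, and the adjoint action of x in H multiplies this term by the counit of x. This
  is enough to manipulate the adjoint action on connections like the one on right linear maps.

  The curvature of the sum is its extension to one-forms applied to the two summands
  tau^{-1}(nabla_V v (x) w) and v (x)_R nabla_W w. The parts where both derivatives hit the same factor
  are the two curvatures. In the first summand the derivative of w has to pass the one-form of
  nabla_V v: the braiding turns nabla_W into its image under the adjoint action, and anticommuting the
  two one-forms gives the minus sign of the mixed term. As the three other terms are right linear,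
  so is the mixed term, and it descends to the tensor product over A.
*)
theory Submission
  imports Defs
begin

section \<open>Maps out of tensor products\<close>

text \<open>Connections are not A-linear, so neither summand of the sum connection is well defined
  on V \<otimes>_A W alone: moving a scalar a across the tensor sign changes both by the sum of v
  \<otimes> s w \<otimes> d(r a) over R = r \<otimes> s, with opposite signs. This correction is
  computed for any map that is right linear up to an equivariant term \<delta>; a curvature is the
  case \<delta> = 0. The inverse braiding of a form past W is well defined over A because forms
  commute with scalars through R in both orders of its legs; for W only one order is given. Hence
  the two notions of quasi-commutativity. The adjoint action, written x . Q here, is controlled by
  the equation (x_1 . Q)(x_2 m) = x Q(m), which determines it. Its formulas for products, composites
  and extensions of connections are verified through this equation. Sweedler sums are
  \<open>tsum\<close>s, which have a value when the summand is bilinear in its legs. So each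
  rewriting below comes with a proof of linearity in every leg, and linear functions of a tensor are
  compared on pure tensors.\<close>

lemma frag_eval_superset:
  assumes X: "abelian_group X" and "finite S" "Poly_Mapping.keys p \<subseteq> S"
    and f: "\<And>v w. (v, w) \<in> S \<Longrightarrow> f v w \<in> carrier X"
  shows "frag_eval X f p =
    (\<Oplus>\<^bsub>X\<^esub>z\<in>S. [Poly_Mapping.lookup p z] \<cdot>\<^bsub>X\<^esub> f (fst z) (snd z))"
proof -
  interpret X: abelian_group X by (rule X)
  have "\<And>z. z \<in> S \<Longrightarrow> f (fst z) (snd z) \<in> carrier X" using f by auto
  moreover have "[(0 :: int)] \<cdot>\<^bsub>X\<^esub> x = \<zero>\<^bsub>X\<^esub>" for x
    by (simp add: add_pow_def int_pow_def)
  ultimately show ?thesis unfolding frag_eval_def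
    by (intro X.add.finprod_mono_neutral_cong_left)
      (use assms in \<open>auto simp: in_keys_iff\<close>)
qed

lemma frag_eval_closed:
  assumes X: "abelian_group X" and p: "Poly_Mapping.keys p \<subseteq> M"
    and f: "\<And>v w. (v, w) \<in> M \<Longrightarrow> f v w \<in> carrier X"
  shows "frag_eval X f p \<in> carrier X"
proof -
  interpret X: abelian_group X by (rule X)
  have "\<And>z. z \<in> Poly_Mapping.keys p \<Longrightarrow> f (fst z) (snd z) \<in> carrier X" using f p by auto
  then show ?thesis unfolding frag_eval_def by auto
qed

text \<open>Coefficients can cancel in p + q, so the three supports may differ; all three sums are
  therefore taken over the union of the supports of p and q.\<close>

lemma frag_eval_add:
  assumes X: "abelian_group X" and p: "Poly_Mapping.keys p \<subseteq> M" and q: "Poly_Mapping.keys q \<subseteq> M"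
    and f: "\<And>v w. (v, w) \<in> M \<Longrightarrow> f v w \<in> carrier X"
  shows "frag_eval X f (p + q) = frag_eval X f p \<oplus>\<^bsub>X\<^esub> frag_eval X f q"
proof -
  interpret X: abelian_group X by (rule X)
  let ?S = "Poly_Mapping.keys p \<union> Poly_Mapping.keys q"
  have S: "finite ?S" "?S \<subseteq> M" using p q by auto
  have f': "\<And>v w. (v, w) \<in> ?S \<Longrightarrow> f v w \<in> carrier X" using S f by blast
  have f'': "\<And>z. z \<in> ?S \<Longrightarrow> f (fst z) (snd z) \<in> carrier X" using f' by auto
  have eq: "frag_eval X f p' = (\<Oplus>\<^bsub>X\<^esub>z\<in>?S. [Poly_Mapping.lookup p' z] \<cdot>\<^bsub>X\<^esub> f (fst z) (snd z))"
    if "Poly_Mapping.keys p' \<subseteq> ?S" for p'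
    using frag_eval_superset[OF X S(1) that f'] .
  have "frag_eval X f (p + q) = (\<Oplus>\<^bsub>X\<^esub>z\<in>?S. [Poly_Mapping.lookup p z] \<cdot>\<^bsub>X\<^esub> f (fst z) (snd z)
      \<oplus>\<^bsub>X\<^esub> [Poly_Mapping.lookup q z] \<cdot>\<^bsub>X\<^esub> f (fst z) (snd z))"
    unfolding eq[OF Poly_Mapping.keys_add]
    by (intro X.add.finprod_cong') (use f'' in \<open>auto simp: lookup_add X.add.int_pow_mult\<close>)
  also have "\<dots> = frag_eval X f p \<oplus>\<^bsub>X\<^esub> frag_eval X f q"
    unfolding eq[OF Un_upper1] eq[OF Un_upper2]
    by (intro X.finsum_addf) (use f'' in auto)
  finally show ?thesis .
qed

lemma frag_eval_of:
  assumes X: "abelian_group X" and f: "f v w \<in> carrier X"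
  shows "frag_eval X f (frag_of (v, w)) = f v w"
proof -
  interpret X: abelian_group X by (rule X)
  show ?thesis unfolding frag_eval_def using f
    by (simp add: X.add.int_pow_1 flip: X.add.finprod_singleton_swap)
qed

lemma frag_eval_hom:
  assumes X: "abelian_group X"
    and f: "\<And>v w. (v, w) \<in> M \<Longrightarrow> f v w \<in> carrier X"
  shows "group_hom (free_Abelian_group M) (add_monoid X) (frag_eval X f)"
proof -
  interpret X: abelian_group X by (rule X)
  show ?thesis
    by (auto simp: group_hom_def group_hom_axioms_def X.a_group hom_def
      frag_eval_closed[OF X _ f] frag_eval_add[OF X _ _ f])
qed

lemma frag_eval_cong:
  assumes X: "abelian_group X" and p: "Poly_Mapping.keys p \<subseteq> M"
    and g: "\<And>v w. (v, w) \<in> M \<Longrightarrow> g v w \<in> carrier X"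
    and fg: "\<And>v w. (v, w) \<in> M \<Longrightarrow> f v w = g v w"
  shows "frag_eval X f p = frag_eval X g p"
proof -
  interpret X: abelian_group X by (rule X)
  have "\<And>z. z \<in> Poly_Mapping.keys p \<Longrightarrow> z \<in> M" using p by auto
  then have "\<And>z. z \<in> Poly_Mapping.keys p \<Longrightarrow> f (fst z) (snd z) = g (fst z) (snd z) \<and> g (fst z) (snd z) \<in> carrier X"
    using fg g by (metis prod.collapse)
  then show ?thesis unfolding frag_eval_def by (intro X.add.finprod_cong') auto
qed

text \<open>A \<open>tsum\<close> depends on its target only through carrier, addition and zero. The
  operations of \<open>ktensor\<close> and \<open>atensor\<close> are defined by sums in the bare
  record \<open>tensor_group\<close>; this moves the sums to the finished module.\<close>

lemma tsum_additive_structure: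
  fixes X :: "('x, 'm) ring_scheme" and Y :: "('x, 'n) ring_scheme"
  assumes "carrier X = carrier Y" "add X = add Y" "\<zero>\<^bsub>X\<^esub> = \<zero>\<^bsub>Y\<^esub>"
  shows "tsum X = (tsum Y :: ('v, 'w) tens \<Rightarrow> _)"
proof -
  have "finsum X f S = finsum Y f S" for f :: "'v \<times> 'w \<Rightarrow> 'x" and S
    unfolding finsum_def finprod_def using assms by simp
  moreover have "[k] \<cdot>\<^bsub>X\<^esub> x = [k] \<cdot>\<^bsub>Y\<^esub> x" for k :: int and x
    unfolding add_pow_def int_pow_def nat_pow_def m_inv_def Let_def partial_object.simps monoid.simps using assms by simp
  ultimately show ?thesis
    unfolding tsum_def[abs_def] frag_eval_def[abs_def] by (intro ext) simp
qed

section \<open>Linear and bilinear maps\<close>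

lemma K_linearI:
  assumes "\<And>x. x \<in> carrier V \<Longrightarrow> f x \<in> carrier W"
    and "\<And>x y. \<lbrakk>x \<in> carrier V; y \<in> carrier V\<rbrakk> \<Longrightarrow> f (x \<oplus>\<^bsub>V\<^esub> y) = f x \<oplus>\<^bsub>W\<^esub> f y"
    and "\<And>k x. \<lbrakk>k \<in> carrier K; x \<in> carrier V\<rbrakk> \<Longrightarrow> f (k \<odot>\<^bsub>V\<^esub> x) = k \<odot>\<^bsub>W\<^esub> f x"
  shows "f \<in> K_linear K V W"
  using assms by (auto simp: K_linear_def)

lemma K_linear_closed: "\<lbrakk>f \<in> K_linear K V W; x \<in> carrier V\<rbrakk> \<Longrightarrow> f x \<in> carrier W"
  and K_linear_add: "\<lbrakk>f \<in> K_linear K V W; x \<in> carrier V; y \<in> carrier V\<rbrakk> \<Longrightarrow> f (x \<oplus>\<^bsub>V\<^esub> y) = f x \<oplus>\<^bsub>W\<^esub> f y"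
  and K_linear_smult: "\<lbrakk>f \<in> K_linear K V W; k \<in> carrier K; x \<in> carrier V\<rbrakk> \<Longrightarrow> f (k \<odot>\<^bsub>V\<^esub> x) = k \<odot>\<^bsub>W\<^esub> f x"
  by (auto simp: K_linear_def)

lemma K_linear_comp:
  assumes g: "g \<in> K_linear K V W" and f: "f \<in> K_linear K U V"
  shows "(\<lambda>x. g (f x)) \<in> K_linear K U W"
  by (rule K_linearI) (simp_all add: K_linear_closed[OF f] K_linear_closed[OF g] K_linear_add[OF f]
    K_linear_add[OF g] K_linear_smult[OF f] K_linear_smult[OF g])

text \<open>Phrased as linearity in each argument, so that the rules for linear maps apply to a
  summand leg by leg.\<close>

definition bilinear_map ::
  "('k, 'l) ring_scheme \<Rightarrow> ('k, 'v, 'm) module_scheme \<Rightarrow> ('k, 'w, 'n) module_scheme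
    \<Rightarrow> ('k, 'x, 'p) module_scheme \<Rightarrow> ('v \<Rightarrow> 'w \<Rightarrow> 'x) \<Rightarrow> bool" where
  "bilinear_map K V W X f \<longleftrightarrow> (\<forall>w\<in>carrier W. (\<lambda>v. f v w) \<in> K_linear K V X)
     \<and> (\<forall>v\<in>carrier V. (\<lambda>w. f v w) \<in> K_linear K W X)"

text \<open>One treatment of both tensor products: the balancing scalars \<open>B\<close> are the
  carrier of K for \<open>ktensor\<close> and the carrier of A for \<open>atensor\<close>. By
  \<open>scal\<close> a ground scalar acts on both factors through some element of \<open>B\<close>,
  so balance also moves ground scalars across; \<open>r_smult\<close> makes scalar multiplication of
  the left factor respect the relations. \<open>T\<close> is a variable record because the two
  tensor products carry different further operations.\<close>

locale tensor_space = V: module K V + W: module K W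
  for K :: "('k, 'l) ring_scheme" and V :: "('k, 'v, 'm) module_scheme"
    and W :: "('k, 'w, 'n) module_scheme" +
  fixes B :: "'b set" and r :: "'v \<Rightarrow> 'b \<Rightarrow> 'v" and l :: "'b \<Rightarrow> 'w \<Rightarrow> 'w"
    and T :: "('k, ('v, 'w) tens, 'z) module_scheme" and pt :: "'v \<Rightarrow> 'w \<Rightarrow> ('v, 'w) tens"
  assumes r_closed: "\<lbrakk>v \<in> carrier V; b \<in> B\<rbrakk> \<Longrightarrow> r v b \<in> carrier V"
    and l_closed: "\<lbrakk>w \<in> carrier W; b \<in> B\<rbrakk> \<Longrightarrow> l b w \<in> carrier W"
    and scal: "k \<in> carrier K \<Longrightarrow> \<exists>b\<in>B. (\<forall>v\<in>carrier V. r v b = k \<odot>\<^bsub>V\<^esub> v) \<and> (\<forall>w\<in>carrier W. l b w = k \<odot>\<^bsub>W\<^esub> w)"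
    and r_smult: "\<lbrakk>k \<in> carrier K; v \<in> carrier V; b \<in> B\<rbrakk> \<Longrightarrow> r (k \<odot>\<^bsub>V\<^esub> v) b = k \<odot>\<^bsub>V\<^esub> r v b"
    and T_def: "carrier T = carrier (tensor_group B r l V W)" "add T = add (tensor_group B r l V W)"
      "\<zero>\<^bsub>T\<^esub> = \<zero>\<^bsub>tensor_group B r l V W\<^esub>"
      "smult T = (\<lambda>k t. tsum (tensor_group B r l V W) t (\<lambda>v w. pt (k \<odot>\<^bsub>V\<^esub> v) w))"
    and pt_def: "pt = pure_tensor B r l V W"
begin

abbreviation "G \<equiv> free_Abelian_group (carrier V \<times> carrier W)"
abbreviation "N \<equiv> balanced_null B r l V W"

lemma rels_subset: "balanced_rels B r l V W \<subseteq> carrier G"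
  using r_closed l_closed unfolding balanced_rels_def
  by (auto dest!: subsetD[OF keys_diff])

sublocale G: comm_group G by (rule abelian_free_Abelian_group)

lemma N_subgroup: "subgroup N G"
  unfolding balanced_null_def by (rule G.generate_is_subgroup[OF rels_subset])

sublocale N: normal N G
  using N_subgroup G.normal_iff_subgroup by blast

lemma T_carrier: "carrier T = rcosets\<^bsub>G\<^esub> N"
  and T_add: "s \<oplus>\<^bsub>T\<^esub> t = s <#>\<^bsub>G\<^esub> t"
  and T_zero: "\<zero>\<^bsub>T\<^esub> = N"
  unfolding T_def by (simp_all add: tensor_group_def Let_def FactGroup_def)

lemma T_abelian_group: "abelian_group T"
proof -
  interpret Q: comm_group "G Mod N" by (rule G.abelian_FactGroup[OF N_subgroup])
  have Q: "carrier T = carrier (G Mod N)" "add T = monoid.mult (G Mod N)" "\<zero>\<^bsub>T\<^esub> = one (G Mod N)"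
    unfolding T_def by (simp_all add: tensor_group_def Let_def)
  show ?thesis
    by (rule abelian_groupI; unfold Q)
      (use Q.m_closed Q.one_closed Q.m_assoc Q.m_comm Q.l_one Q.l_inv_ex in simp_all)
qed

sublocale T: abelian_group T by (rule T_abelian_group)

lemma coset_add: "\<lbrakk>p \<in> carrier G; q \<in> carrier G\<rbrakk> \<Longrightarrow> (N #>\<^bsub>G\<^esub> p) \<oplus>\<^bsub>T\<^esub> (N #>\<^bsub>G\<^esub> q) = N #>\<^bsub>G\<^esub> (p + q)"
  unfolding T_add using N.rcos_sum by simp

lemma coset_in_T: "p \<in> carrier G \<Longrightarrow> N #>\<^bsub>G\<^esub> p \<in> carrier T"
  unfolding T_carrier by (rule G.rcosetsI) (use N.subset in auto)

lemma pt_closed [simp]: "\<lbrakk>v \<in> carrier V; w \<in> carrier W\<rbrakk> \<Longrightarrow> pt v w \<in> carrier T"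
  unfolding pt_def pure_tensor_def by (rule coset_in_T) simp

lemma coset_eqI: "\<lbrakk>p \<in> carrier G; q \<in> carrier G; p - q \<in> N\<rbrakk> \<Longrightarrow> N #>\<^bsub>G\<^esub> p = N #>\<^bsub>G\<^esub> q"
  by (rule G.repr_independence[OF _ _ N_subgroup, of p q, symmetric])
    (auto simp: r_coset_def intro!: bexI[of _ "p - q"])

lemma rels_in_N: "x \<in> balanced_rels B r l V W \<Longrightarrow> x \<in> N"
  unfolding balanced_null_def by (rule generate.incl)

lemma pt_add_left: "\<lbrakk>v \<in> carrier V; v' \<in> carrier V; w \<in> carrier W\<rbrakk> \<Longrightarrow> pt (v \<oplus>\<^bsub>V\<^esub> v') w = pt v w \<oplus>\<^bsub>T\<^esub> pt v' w"
  unfolding pt_def pure_tensor_def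
  by (subst coset_add, simp, simp, rule coset_eqI, simp, force dest!: subsetD[OF keys_add],
    rule rels_in_N, unfold balanced_rels_def diff_diff_add[symmetric]) blast

lemma pt_add_right: "\<lbrakk>v \<in> carrier V; w \<in> carrier W; w' \<in> carrier W\<rbrakk> \<Longrightarrow> pt v (w \<oplus>\<^bsub>W\<^esub> w') = pt v w \<oplus>\<^bsub>T\<^esub> pt v w'"
  unfolding pt_def pure_tensor_def
  by (subst coset_add, simp, simp, rule coset_eqI, simp, force dest!: subsetD[OF keys_add],
    rule rels_in_N, unfold balanced_rels_def diff_diff_add[symmetric]) blast

lemma pt_bal: "\<lbrakk>v \<in> carrier V; b \<in> B; w \<in> carrier W\<rbrakk> \<Longrightarrow> pt (r v b) w = pt v (l b w)"
  unfolding pt_def pure_tensor_def using r_closed l_closed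
  by (intro coset_eqI rels_in_N) (auto simp: balanced_rels_def)

lemma pt_smult:
  assumes k: "k \<in> carrier K" and v: "v \<in> carrier V" and w: "w \<in> carrier W"
  shows "pt (k \<odot>\<^bsub>V\<^esub> v) w = pt v (k \<odot>\<^bsub>W\<^esub> w)"
proof -
  obtain b where b: "b \<in> B" "r v b = k \<odot>\<^bsub>V\<^esub> v" "l b w = k \<odot>\<^bsub>W\<^esub> w"
    using scal[OF k] v w by blast
  then show ?thesis using pt_bal[OF v b(1) w] by simp
qed

lemma T_rep:
  assumes "t \<in> carrier T"
  obtains p where "p \<in> carrier G" "t = N #>\<^bsub>G\<^esub> p"
  using assms unfolding T_carrier RCOSETS_def by auto

text \<open>Pure tensors generate under addition alone, since -(v \<otimes> w) = (-v) \<otimes> w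
  and 0 = 0 \<otimes> 0.\<close>

lemma T_induct [consumes 1, case_names pure add]:
  assumes t: "t \<in> carrier T"
    and pure: "\<And>v w. \<lbrakk>v \<in> carrier V; w \<in> carrier W\<rbrakk> \<Longrightarrow> P (pt v w)"
    and add: "\<And>s t. \<lbrakk>s \<in> carrier T; t \<in> carrier T; P s; P t\<rbrakk> \<Longrightarrow> P (s \<oplus>\<^bsub>T\<^esub> t)"
  shows "P t"
proof -
  obtain p where p: "p \<in> carrier G" "t = N #>\<^bsub>G\<^esub> p"
    using t by (rule T_rep)
  have pure_minus: "N #>\<^bsub>G\<^esub> (- frag_of (v, w)) = pt (\<ominus>\<^bsub>V\<^esub> v) w"
    if vw: "v \<in> carrier V" "w \<in> carrier W" for v w
  proof -
    have z: "pt \<zero>\<^bsub>V\<^esub> w = \<zero>\<^bsub>T\<^esub>"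
      using pt_add_left[of "\<zero>\<^bsub>V\<^esub>" "\<zero>\<^bsub>V\<^esub>" w] vw T.add.r_cancel_one' by fastforce
    have 0: "pt (\<ominus>\<^bsub>V\<^esub> v) w \<oplus>\<^bsub>T\<^esub> pt v w = \<zero>\<^bsub>T\<^esub>"
      using pt_add_left[of "\<ominus>\<^bsub>V\<^esub> v" v w] vw z by (simp add: V.M.l_neg)
    have 1: "(N #>\<^bsub>G\<^esub> (- frag_of (v, w))) \<oplus>\<^bsub>T\<^esub> pt v w = \<zero>\<^bsub>T\<^esub>"
      unfolding pt_def pure_tensor_def T_zero
      using vw N_subgroup by (subst coset_add) (auto simp: G.coset_mult_one[OF N.subset, simplified])
    show ?thesis
      by (rule T.add.right_cancel[THEN iffD1, of "pt v w"]) (use 0 1 vw coset_in_T in auto)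
  qed
  have "Poly_Mapping.keys p \<subseteq> carrier V \<times> carrier W" using p by simp
  \<comment> \<open>The induction on the free abelian group builds differences, while
    \<open>P\<close> is closed under sums only. Carrying the negative along turns x - y into x +
    (-y).\<close>
  then have "P (N #>\<^bsub>G\<^esub> p) \<and> P (N #>\<^bsub>G\<^esub> (- p))"
  proof (rule free_Abelian_group_induct, goal_cases)
    case 1
    have "\<zero>\<^bsub>T\<^esub> = pt \<zero>\<^bsub>V\<^esub> \<zero>\<^bsub>W\<^esub>"
      using pt_add_left[of "\<zero>\<^bsub>V\<^esub>" "\<zero>\<^bsub>V\<^esub>" "\<zero>\<^bsub>W\<^esub>"] T.add.r_cancel_one' by fastforce
    then show ?case using pure[of "\<zero>\<^bsub>V\<^esub>" "\<zero>\<^bsub>W\<^esub>"] G.coset_mult_one[OF N.subset]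
      by (simp add: T_zero)
  next
    case (2 x y)
    then have "N #>\<^bsub>G\<^esub> (x - y) = (N #>\<^bsub>G\<^esub> x) \<oplus>\<^bsub>T\<^esub> (N #>\<^bsub>G\<^esub> (- y))"
      "N #>\<^bsub>G\<^esub> (- (x - y)) = (N #>\<^bsub>G\<^esub> (- x)) \<oplus>\<^bsub>T\<^esub> (N #>\<^bsub>G\<^esub> y)"
      by (simp_all add: coset_add)
    then show ?case using 2 by (auto intro!: add coset_in_T)
  next
    case (3 a)
    then show ?case
      using pure[of "fst a" "snd a"] pure[of "\<ominus>\<^bsub>V\<^esub> fst a" "snd a"] pure_minus[of "fst a" "snd a"] by (cases a) (auto simp: pt_def pure_tensor_def)
  qed
  then show ?thesis using p by simp
qed

lemma tsum_T: "tsum T = tsum (tensor_group B r l V W)"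
  by (rule tsum_additive_structure) (rule T_def)+

section \<open>The universal property for additive balanced maps\<close>

context
  fixes X :: "('x, 'y) ring_scheme" and f
  assumes X: "abelian_group X"
    and f_closed: "\<And>v w. \<lbrakk>v \<in> carrier V; w \<in> carrier W\<rbrakk> \<Longrightarrow> f v w \<in> carrier X"
    and f_left: "\<And>v v' w. \<lbrakk>v \<in> carrier V; v' \<in> carrier V; w \<in> carrier W\<rbrakk> \<Longrightarrow>
      f (v \<oplus>\<^bsub>V\<^esub> v') w = f v w \<oplus>\<^bsub>X\<^esub> f v' w"
    and f_right: "\<And>v w w'. \<lbrakk>v \<in> carrier V; w \<in> carrier W; w' \<in> carrier W\<rbrakk> \<Longrightarrow>
      f v (w \<oplus>\<^bsub>W\<^esub> w') = f v w \<oplus>\<^bsub>X\<^esub> f v w'"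
    and f_bal: "\<And>v b w. \<lbrakk>v \<in> carrier V; b \<in> B; w \<in> carrier W\<rbrakk> \<Longrightarrow> f (r v b) w = f v (l b w)"
begin

interpretation X: abelian_group X by (rule X)

interpretation ev: group_hom G "add_monoid X" "frag_eval X f"
  by (rule frag_eval_hom) (auto simp: X.abelian_group_axioms f_closed)

text \<open>The kernel of the evaluation is a subgroup, so it contains the generated subgroup
  \<open>N\<close> as soon as it contains the three kinds of generators.\<close>

lemma frag_eval_null: "p \<in> N \<Longrightarrow> frag_eval X f p = \<zero>\<^bsub>X\<^esub>"
proof -
  let ?k = "kernel G (add_monoid X) (frag_eval X f)"
  have of: "frag_eval X f (frag_of (v, w)) = f v w" if "v \<in> carrier V" "w \<in> carrier W" for v w
    using that by (intro frag_eval_of X.abelian_group_axioms f_closed)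
  have diff: "frag_eval X f (p - q) = frag_eval X f p \<ominus>\<^bsub>X\<^esub> frag_eval X f q"
    if "p \<in> carrier G" "q \<in> carrier G" for p q
  proof -
    have "frag_eval X f (p + - q) = frag_eval X f p \<oplus>\<^bsub>X\<^esub> frag_eval X f (- q)"
      using that ev.hom_mult[of p "- q"] by simp
    moreover have "frag_eval X f (- q) = \<ominus>\<^bsub>X\<^esub> frag_eval X f q"
      using that ev.hom_inv[of q] by (simp add: a_inv_def)
    ultimately show ?thesis by (simp add: a_minus_def)
  qed
  have minus2: "a \<oplus>\<^bsub>X\<^esub> b \<ominus>\<^bsub>X\<^esub> a \<ominus>\<^bsub>X\<^esub> b = \<zero>\<^bsub>X\<^esub>" if "a \<in> carrier X" "b \<in> carrier X" for a b
  proof -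
    have "a \<oplus>\<^bsub>X\<^esub> b \<ominus>\<^bsub>X\<^esub> a = b"
      using that by (simp add: X.a_comm[of a b] X.minus_eq X.a_assoc X.r_neg)
    then show ?thesis using that by (simp add: X.minus_eq X.r_neg)
  qed
  have "balanced_rels B r l V W \<subseteq> ?k"
  proof
    fix x assume x: "x \<in> balanced_rels B r l V W"
    then have "frag_eval X f x = \<zero>\<^bsub>X\<^esub>"
      unfolding balanced_rels_def
    proof (elim UnE, goal_cases)
      case 1
      then obtain v v' w where x: "x = frag_of (v \<oplus>\<^bsub>V\<^esub> v', w) - frag_of (v, w) - frag_of (v', w)"
        and c: "v \<in> carrier V" "v' \<in> carrier V" "w \<in> carrier W" by auto
      have k: "frag_of (v \<oplus>\<^bsub>V\<^esub> v', w) - frag_of (v, w) \<in> carrier G"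
        using c by (auto dest!: subsetD[OF keys_diff])
      have "f (v \<oplus>\<^bsub>V\<^esub> v') w = f v w \<oplus>\<^bsub>X\<^esub> f v' w"
        using c f_left by simp
      then show ?case using c k f_closed unfolding x
        by (simp add: diff of minus2)
    next
      case 2
      then obtain v w w' where x: "x = frag_of (v, w \<oplus>\<^bsub>W\<^esub> w') - frag_of (v, w) - frag_of (v, w')"
        and c: "v \<in> carrier V" "w \<in> carrier W" "w' \<in> carrier W" by auto
      have k: "frag_of (v, w \<oplus>\<^bsub>W\<^esub> w') - frag_of (v, w) \<in> carrier G"
        using c by (auto dest!: subsetD[OF keys_diff])
      have "f v (w \<oplus>\<^bsub>W\<^esub> w') = f v w \<oplus>\<^bsub>X\<^esub> f v w'"
        using c f_right by simp
      then show ?case using c k f_closed unfolding x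
        by (simp add: diff of minus2)
    next
      case 3
      then show ?case using r_closed l_closed f_closed
        by (auto simp: diff of f_bal X.minus_eq X.r_neg)
    qed
    then show "x \<in> ?k" unfolding kernel_def using subsetD[OF rels_subset x] by simp
  qed
  then have "N \<subseteq> ?k" unfolding balanced_null_def
    by (rule G.generate_subgroup_incl[OF _ ev.subgroup_kernel])
  then show "p \<in> N \<Longrightarrow> frag_eval X f p = \<zero>\<^bsub>X\<^esub>" unfolding kernel_def by auto
qed

text \<open>The evaluation is constant on a class, so the image of the class is a singleton and
  \<open>the_elem\<close> in \<open>tsum\<close> returns the common value.\<close>

lemma tsum_coset:
  assumes p: "p \<in> carrier G"
  shows "tsum X (N #>\<^bsub>G\<^esub> p) f = frag_eval X f p"
proof -
  have "frag_eval X f q = frag_eval X f p" if q: "q \<in> N #>\<^bsub>G\<^esub> p" for q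
  proof -
    obtain n where n: "n \<in> N" "q = n + p" using q unfolding r_coset_def by auto
    then have "frag_eval X f q = frag_eval X f n \<oplus>\<^bsub>X\<^esub> frag_eval X f p"
      using ev.hom_mult[of n p] p N.subset by auto
    then show ?thesis using frag_eval_null[OF n(1)] p ev.hom_closed[of p] by auto
  qed
  then have "frag_eval X f ` (N #>\<^bsub>G\<^esub> p) = (\<lambda>_. frag_eval X f p) ` (N #>\<^bsub>G\<^esub> p)"
    by (rule image_cong[OF refl])
  also have "\<dots> = {frag_eval X f p}"
    by (rule image_constant[OF G.rcos_self[OF p N_subgroup]])
  finally have "frag_eval X f ` (N #>\<^bsub>G\<^esub> p) = {frag_eval X f p}" .
  then show ?thesis unfolding tsum_def by simp
qed

lemma add_tsum_closed:
  assumes "t \<in> carrier T"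
  shows "tsum X t f \<in> carrier X"
proof -
  obtain p where p: "p \<in> carrier G" "t = N #>\<^bsub>G\<^esub> p"
    using assms by (rule T_rep)
  show ?thesis
    unfolding p(2) tsum_coset[OF p(1)] using ev.hom_closed[OF p(1)] by simp
qed

lemma add_tsum_add: "\<lbrakk>s \<in> carrier T; t \<in> carrier T\<rbrakk> \<Longrightarrow> tsum X (s \<oplus>\<^bsub>T\<^esub> t) f = tsum X s f \<oplus>\<^bsub>X\<^esub> tsum X t f"
proof -
  assume "s \<in> carrier T" "t \<in> carrier T"
  then obtain p q where pq: "p \<in> carrier G" "q \<in> carrier G" "s = N #>\<^bsub>G\<^esub> p" "t = N #>\<^bsub>G\<^esub> q"
    unfolding T_carrier RCOSETS_def by auto
  then have "p + q \<in> carrier G" using G.m_closed by simp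
  then show ?thesis using pq ev.hom_mult[of p q] by (simp add: coset_add tsum_coset)
qed

lemma add_tsum_pt: "\<lbrakk>v \<in> carrier V; w \<in> carrier W\<rbrakk> \<Longrightarrow> tsum X (pt v w) f = f v w"
proof -
  assume vw: "v \<in> carrier V" "w \<in> carrier W"
  then have "tsum X (pt v w) f = frag_eval X f (frag_of (v, w))"
    unfolding pt_def pure_tensor_def by (intro tsum_coset) simp
  also have "\<dots> = f v w"
    by (rule frag_eval_of) (use vw X.abelian_group_axioms f_closed in auto)
  finally show ?thesis .
qed

end

text \<open>Scalar multiplication is itself a \<open>tsum\<close>, taken before \<open>T\<close> is
  known to be a module. This is why the universal property is first proved for additive
  maps.\<close>

lemma smult_pt: "\<lbrakk>k \<in> carrier K; v \<in> carrier V; w \<in> carrier W\<rbrakk> \<Longrightarrow> k \<odot>\<^bsub>T\<^esub> pt v w = pt (k \<odot>\<^bsub>V\<^esub> v) w"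
  and smult_closed: "\<lbrakk>k \<in> carrier K; t \<in> carrier T\<rbrakk> \<Longrightarrow> k \<odot>\<^bsub>T\<^esub> t \<in> carrier T"
  and smult_add: "\<lbrakk>k \<in> carrier K; s \<in> carrier T; t \<in> carrier T\<rbrakk> \<Longrightarrow> k \<odot>\<^bsub>T\<^esub> (s \<oplus>\<^bsub>T\<^esub> t) = k \<odot>\<^bsub>T\<^esub> s \<oplus>\<^bsub>T\<^esub> k \<odot>\<^bsub>T\<^esub> t"
proof -
  assume k: "k \<in> carrier K"
  have f: "pt (k \<odot>\<^bsub>V\<^esub> v) w \<in> carrier T" if "v \<in> carrier V" "w \<in> carrier W" for v w
    using that k by simp
  have a1: "pt (k \<odot>\<^bsub>V\<^esub> (v \<oplus>\<^bsub>V\<^esub> v')) w = pt (k \<odot>\<^bsub>V\<^esub> v) w \<oplus>\<^bsub>T\<^esub> pt (k \<odot>\<^bsub>V\<^esub> v') w"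
    if "v \<in> carrier V" "v' \<in> carrier V" "w \<in> carrier W" for v v' w
    using that k by (simp add: V.smult_r_distr pt_add_left)
  have a2: "pt (k \<odot>\<^bsub>V\<^esub> v) (w \<oplus>\<^bsub>W\<^esub> w') = pt (k \<odot>\<^bsub>V\<^esub> v) w \<oplus>\<^bsub>T\<^esub> pt (k \<odot>\<^bsub>V\<^esub> v) w'"
    if "v \<in> carrier V" "w \<in> carrier W" "w' \<in> carrier W" for v w w'
    using that k by (simp add: pt_add_right)
  have b: "pt (k \<odot>\<^bsub>V\<^esub> r v b) w = pt (k \<odot>\<^bsub>V\<^esub> v) (l b w)"
    if "v \<in> carrier V" "b \<in> B" "w \<in> carrier W" for v b w
    using that k by (simp add: r_smult[symmetric] pt_bal)
  note f = T_abelian_group f a1 a2 b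
  show "v \<in> carrier V \<Longrightarrow> w \<in> carrier W \<Longrightarrow> k \<odot>\<^bsub>T\<^esub> pt v w = pt (k \<odot>\<^bsub>V\<^esub> v) w"
    unfolding T_def(4) tsum_T[symmetric] by (rule add_tsum_pt[OF f])
  show "t \<in> carrier T \<Longrightarrow> k \<odot>\<^bsub>T\<^esub> t \<in> carrier T"
    unfolding T_def(4) tsum_T[symmetric] by (rule add_tsum_closed[OF f])
  show "s \<in> carrier T \<Longrightarrow> t \<in> carrier T \<Longrightarrow> k \<odot>\<^bsub>T\<^esub> (s \<oplus>\<^bsub>T\<^esub> t) = k \<odot>\<^bsub>T\<^esub> s \<oplus>\<^bsub>T\<^esub> k \<odot>\<^bsub>T\<^esub> t"
    unfolding T_def(4) tsum_T[symmetric] by (rule add_tsum_add[OF f])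
qed

lemma T_module: "module K T"
proof (rule moduleI[OF V.is_cring T_abelian_group])
  show "a \<in> carrier K \<Longrightarrow> x \<in> carrier T \<Longrightarrow> a \<odot>\<^bsub>T\<^esub> x \<in> carrier T" for a x
    by (rule smult_closed)
  show "a \<in> carrier K \<Longrightarrow> x \<in> carrier T \<Longrightarrow> y \<in> carrier T \<Longrightarrow>
      a \<odot>\<^bsub>T\<^esub> (x \<oplus>\<^bsub>T\<^esub> y) = a \<odot>\<^bsub>T\<^esub> x \<oplus>\<^bsub>T\<^esub> a \<odot>\<^bsub>T\<^esub> y" for a x y
    by (rule smult_add)
  show "(a \<oplus>\<^bsub>K\<^esub> b) \<odot>\<^bsub>T\<^esub> x = a \<odot>\<^bsub>T\<^esub> x \<oplus>\<^bsub>T\<^esub> b \<odot>\<^bsub>T\<^esub> x"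
    if a: "a \<in> carrier K" "b \<in> carrier K" and "x \<in> carrier T" for a b x
    using that(3)
  proof (induction rule: T_induct)
    case (pure v w)
    then show ?case using a by (simp add: smult_pt V.smult_l_distr pt_add_left)
  next
    case (add s t)
    then show ?case using a by (simp add: smult_add smult_closed T.a_ac)
  qed
  show "(a \<otimes>\<^bsub>K\<^esub> b) \<odot>\<^bsub>T\<^esub> x = a \<odot>\<^bsub>T\<^esub> (b \<odot>\<^bsub>T\<^esub> x)"
    if a: "a \<in> carrier K" "b \<in> carrier K" and "x \<in> carrier T" for a b x
    using that(3)
  proof (induction rule: T_induct)
    case (pure v w)
    then show ?case using a by (simp add: smult_pt V.smult_assoc1)
  next
    case (add s t)
    then show ?case using a by (simp add: smult_add smult_closed)
  qed
  show "\<one>\<^bsub>K\<^esub> \<odot>\<^bsub>T\<^esub> x = x" if "x \<in> carrier T" for x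
    using that
  proof (induction rule: T_induct)
    case (pure v w)
    then show ?case by (simp add: smult_pt)
  next
    case (add s t)
    then show ?case by (simp add: smult_add)
  qed
qed

lemma pt_linear_left: "w \<in> carrier W \<Longrightarrow> (\<lambda>v. pt v w) \<in> K_linear K V T"
  by (simp add: K_linear_def pt_add_left smult_pt)

lemma pt_linear_right: "v \<in> carrier V \<Longrightarrow> pt v \<in> K_linear K W T"
  by (simp add: K_linear_def pt_add_right smult_pt pt_smult)

lemma K_linear_eqI:
  assumes g: "g \<in> K_linear K T X" and h: "h \<in> K_linear K T X"
    and eq: "\<And>v w. \<lbrakk>v \<in> carrier V; w \<in> carrier W\<rbrakk> \<Longrightarrow> g (pt v w) = h (pt v w)"
    and t: "t \<in> carrier T"
  shows "g t = h t"
  using t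
proof (induction rule: T_induct)
  case (add s t)
  then show ?case using g h unfolding K_linear_def by simp
qed (rule eq)

section \<open>The universal property for balanced bilinear maps\<close>

definition balanced :: "('k, 'x, 'y) module_scheme \<Rightarrow> ('v \<Rightarrow> 'w \<Rightarrow> 'x) \<Rightarrow> bool" where
  "balanced X f \<longleftrightarrow> bilinear_map K V W X f
     \<and> (\<forall>v\<in>carrier V. \<forall>b\<in>B. \<forall>w\<in>carrier W. f (r v b) w = f v (l b w))"

lemma balanced_additive:
  assumes "balanced X f"
  shows "v \<in> carrier V \<Longrightarrow> w \<in> carrier W \<Longrightarrow> f v w \<in> carrier X"
    "v \<in> carrier V \<Longrightarrow> v' \<in> carrier V \<Longrightarrow> w \<in> carrier W \<Longrightarrow> f (v \<oplus>\<^bsub>V\<^esub> v') w = f v w \<oplus>\<^bsub>X\<^esub> f v' w"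
    "v \<in> carrier V \<Longrightarrow> w \<in> carrier W \<Longrightarrow> w' \<in> carrier W \<Longrightarrow> f v (w \<oplus>\<^bsub>W\<^esub> w') = f v w \<oplus>\<^bsub>X\<^esub> f v w'"
    "v \<in> carrier V \<Longrightarrow> b \<in> B \<Longrightarrow> w \<in> carrier W \<Longrightarrow> f (r v b) w = f v (l b w)"
  using assms unfolding balanced_def bilinear_map_def K_linear_def by auto

lemma balanced_smult:
  assumes "balanced X f"
  shows "k \<in> carrier K \<Longrightarrow> v \<in> carrier V \<Longrightarrow> w \<in> carrier W \<Longrightarrow> f (k \<odot>\<^bsub>V\<^esub> v) w = k \<odot>\<^bsub>X\<^esub> f v w"
  using assms unfolding balanced_def bilinear_map_def K_linear_def by auto

context
  fixes X :: "('k, 'x, 'y) module_scheme"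
  assumes X: "module K X"
begin

interpretation X: module K X by (rule X)

context
  fixes f
  assumes balX: "balanced X f"
begin

lemmas f = balanced_additive[OF balX]

lemma tsum_closed: "t \<in> carrier T \<Longrightarrow> tsum X t f \<in> carrier X"
  by (rule add_tsum_closed[OF X.abelian_group_axioms f])

lemma tsum_add: "\<lbrakk>s \<in> carrier T; t \<in> carrier T\<rbrakk> \<Longrightarrow> tsum X (s \<oplus>\<^bsub>T\<^esub> t) f = tsum X s f \<oplus>\<^bsub>X\<^esub> tsum X t f"
  by (rule add_tsum_add[OF X.abelian_group_axioms f])

lemma tsum_pt: "\<lbrakk>v \<in> carrier V; w \<in> carrier W\<rbrakk> \<Longrightarrow> tsum X (pt v w) f = f v w"
  by (rule add_tsum_pt[OF X.abelian_group_axioms f])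

lemma tsum_linear: "(\<lambda>t. tsum X t f) \<in> K_linear K T X"
proof -
  have "tsum X (k \<odot>\<^bsub>T\<^esub> t) f = k \<odot>\<^bsub>X\<^esub> tsum X t f" if k: "k \<in> carrier K" and "t \<in> carrier T" for k t
    using that(2)
  proof (induction rule: T_induct)
    case (pure v w)
    then show ?case using k by (simp add: smult_pt tsum_pt balanced_smult[OF balX])
  next
    case (add s t)
    then show ?case using k by (simp add: smult_add smult_closed tsum_add tsum_closed X.smult_r_distr)
  qed
  then show ?thesis by (auto simp: K_linear_def tsum_closed tsum_add)
qed

text \<open>\<open>tsum\<close> evaluates every representative of the class, and each of them has
  its support in the carriers, so agreement on the carriers suffices.\<close>

lemma tsum_cong:
  assumes eq: "\<And>v w. \<lbrakk>v \<in> carrier V; w \<in> carrier W\<rbrakk> \<Longrightarrow> g v w = f v w" and t: "t \<in> carrier T"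
  shows "tsum X t g = tsum X t f"
proof -
  obtain p where p: "p \<in> carrier G" "t = N #>\<^bsub>G\<^esub> p"
    using t by (rule T_rep)
  have "frag_eval X g q = frag_eval X f q" if "q \<in> t" for q
  proof (rule frag_eval_cong[where M = "carrier V \<times> carrier W"])
    show "Poly_Mapping.keys q \<subseteq> carrier V \<times> carrier W"
      using subsetD[OF G.r_coset_subset_G[OF N.subset p(1)] that[unfolded p(2)]]
      by (simp only: carrier_free_Abelian_group_iff)
  qed (use f eq X.abelian_group_axioms in auto)
  then have "frag_eval X g ` t = frag_eval X f ` t" by (rule image_cong[OF refl])
  then show ?thesis unfolding tsum_def by simp
qed

text \<open>Moving an operator into or out of a sum is the basic step of every calculation with
  Sweedler legs. The pushed summand is again balanced, so both sides are additive in the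
  tensor.\<close>

lemma tsum_push:
  assumes Y: "module K Y" and g: "g \<in> K_linear K X Y" and t: "t \<in> carrier T"
  shows "g (tsum X t f) = tsum Y t (\<lambda>v w. g (f v w))"
proof -
  interpret Y: module K Y by (rule Y)
  have "balanced Y (\<lambda>v w. g (f v w))"
    using balX unfolding balanced_def bilinear_map_def by (auto intro!: K_linear_comp[OF g])
  note gf = balanced_additive[OF this]
  have pt: "tsum Y (pt v w) (\<lambda>v w. g (f v w)) = g (f v w)" if "v \<in> carrier V" "w \<in> carrier W" for v w
    by (rule add_tsum_pt[OF Y.abelian_group_axioms gf]) (use that in auto)
  have gadd: "tsum Y (s \<oplus>\<^bsub>T\<^esub> t) (\<lambda>v w. g (f v w)) = tsum Y s (\<lambda>v w. g (f v w)) \<oplus>\<^bsub>Y\<^esub> tsum Y t (\<lambda>v w. g (f v w))"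
    if "s \<in> carrier T" "t \<in> carrier T" for s t
    by (rule add_tsum_add[OF Y.abelian_group_axioms gf]) (use that in auto)
  show ?thesis
    using t
  proof (induction rule: T_induct)
    case (pure v w)
    then show ?case by (simp add: tsum_pt pt)
  next
    case (add s t)
    then show ?case
      by (simp add: tsum_add gadd K_linear_add[OF g] tsum_closed)
  qed
qed

end

end

end

text \<open>Closure rules for linear maps. With them the side condition of a sum, linearity of its
  summand in each leg, is read off from the shape of the summand.\<close>

named_theorems lin

lemma K_linear_id [lin]: "(\<lambda>x. x) \<in> K_linear K V V"
  by (rule K_linearI) auto

lemma K_linear_plus:
  assumes W: "module K W" and f: "f \<in> K_linear K V W" and g: "g \<in> K_linear K V W"
  shows "(\<lambda>x. f x \<oplus>\<^bsub>W\<^esub> g x) \<in> K_linear K V W"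
proof -
  interpret module K W by (rule W)
  show ?thesis
    by (rule K_linearI) (simp_all add: K_linear_closed[OF f] K_linear_closed[OF g] K_linear_add[OF f]
      K_linear_add[OF g] K_linear_smult[OF f] K_linear_smult[OF g] M.a_ac smult_r_distr)
qed

lemma K_linear_uminus:
  assumes W: "module K W" and f: "f \<in> K_linear K V W"
  shows "(\<lambda>x. \<ominus>\<^bsub>W\<^esub> f x) \<in> K_linear K V W"
proof -
  interpret module K W by (rule W)
  show ?thesis
    by (rule K_linearI) (simp_all add: K_linear_closed[OF f] K_linear_add[OF f] K_linear_smult[OF f]
        M.minus_add smult_r_minus)
qed

lemma K_linear_scaled:
  assumes W: "module K W" and f: "f \<in> K_linear K V W" and k: "k \<in> carrier K"
  shows "(\<lambda>x. k \<odot>\<^bsub>W\<^esub> f x) \<in> K_linear K V W"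
proof -
  interpret module K W by (rule W)
  show ?thesis
    using k by (intro K_linearI) (simp_all add: K_linear_closed[OF f] K_linear_add[OF f] K_linear_smult[OF f]
        smult_r_distr smult_assoc1[symmetric] R.m_comm)
qed

lemma K_linear_zero:
  assumes W: "module K W"
  shows "(\<lambda>x. \<zero>\<^bsub>W\<^esub>) \<in> K_linear K V W"
proof -
  interpret module K W by (rule W)
  show ?thesis by (rule K_linearI) simp_all
qed

lemma K_linear_cong:
  assumes "f \<in> K_linear K V W" "module K V" and eq: "\<And>x. x \<in> carrier V \<Longrightarrow> g x = f x"
  shows "g \<in> K_linear K V W"
proof -
  interpret module K V by fact
  show ?thesis using assms(1) by (intro K_linearI) (simp_all add: eq K_linear_def Pi_iff)
qed

lemma K_linear_map_zero:
  assumes f: "f \<in> K_linear K V W" and "module K V" "module K W"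
  shows "f \<zero>\<^bsub>V\<^esub> = \<zero>\<^bsub>W\<^esub>"
proof -
  interpret V: module K V by fact
  interpret W: module K W by fact
  show ?thesis
    using K_linear_add[OF f, of "\<zero>\<^bsub>V\<^esub>" "\<zero>\<^bsub>V\<^esub>"] K_linear_closed[OF f, of "\<zero>\<^bsub>V\<^esub>"]
    by (metis V.M.zero_closed V.M.l_zero W.M.add.r_cancel_one')
qed

lemma K_linear_map_uminus:
  assumes f: "f \<in> K_linear K V W" and "module K V" "module K W" and x: "x \<in> carrier V"
  shows "f (\<ominus>\<^bsub>V\<^esub> x) = \<ominus>\<^bsub>W\<^esub> f x"
proof -
  interpret V: module K V by fact
  interpret W: module K W by fact
  have "f (\<ominus>\<^bsub>V\<^esub> x) \<oplus>\<^bsub>W\<^esub> f x = \<zero>\<^bsub>W\<^esub>"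
    using K_linear_add[OF f, of "\<ominus>\<^bsub>V\<^esub> x" x] K_linear_map_zero[OF assms(1-3)] x
    by (simp add: V.M.l_neg)
  then show ?thesis
    using K_linear_closed[OF f, of x] K_linear_closed[OF f, of "\<ominus>\<^bsub>V\<^esub> x"] x
    by (simp add: W.M.minus_equality[symmetric])
qed

lemma bilinear_mapI [lin]:
  assumes "\<And>w. w \<in> carrier W \<Longrightarrow> (\<lambda>v. f v w) \<in> K_linear K V X"
    and "\<And>v. v \<in> carrier V \<Longrightarrow> (\<lambda>w. f v w) \<in> K_linear K W X"
  shows "bilinear_map K V W X f"
  using assms by (simp add: bilinear_map_def)

lemma bilinear_mapD:
  assumes "bilinear_map K V W X f"
  shows "w \<in> carrier W \<Longrightarrow> (\<lambda>v. f v w) \<in> K_linear K V X"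
    and "v \<in> carrier V \<Longrightarrow> (\<lambda>w. f v w) \<in> K_linear K W X"
    and "\<lbrakk>v \<in> carrier V; w \<in> carrier W\<rbrakk> \<Longrightarrow> f v w \<in> carrier X"
  using assms by (auto simp: bilinear_map_def K_linear_def)

definition trilinear_map ::
  "('k, 'l) ring_scheme \<Rightarrow> ('k, 'u, 'm1) module_scheme \<Rightarrow> ('k, 'v, 'm2) module_scheme
    \<Rightarrow> ('k, 'w, 'm3) module_scheme \<Rightarrow> ('k, 'x, 'p) module_scheme \<Rightarrow> ('u \<Rightarrow> 'v \<Rightarrow> 'w \<Rightarrow> 'x) \<Rightarrow> bool" where
  "trilinear_map K U V W X f \<longleftrightarrow>
     (\<forall>v\<in>carrier V. \<forall>w\<in>carrier W. (\<lambda>u. f u v w) \<in> K_linear K U X)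
     \<and> (\<forall>u\<in>carrier U. \<forall>w\<in>carrier W. (\<lambda>v. f u v w) \<in> K_linear K V X)
     \<and> (\<forall>u\<in>carrier U. \<forall>v\<in>carrier V. (\<lambda>w. f u v w) \<in> K_linear K W X)"

lemma trilinear_mapI [lin]:
  assumes "\<And>v w. \<lbrakk>v \<in> carrier V; w \<in> carrier W\<rbrakk> \<Longrightarrow> (\<lambda>u. f u v w) \<in> K_linear K U X"
    and "\<And>u w. \<lbrakk>u \<in> carrier U; w \<in> carrier W\<rbrakk> \<Longrightarrow> (\<lambda>v. f u v w) \<in> K_linear K V X"
    and "\<And>u v. \<lbrakk>u \<in> carrier U; v \<in> carrier V\<rbrakk> \<Longrightarrow> (\<lambda>w. f u v w) \<in> K_linear K W X"
  shows "trilinear_map K U V W X f"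
  using assms by (simp add: trilinear_map_def)

lemma trilinear_mapD:
  assumes "trilinear_map K U V W X f"
  shows "\<lbrakk>v \<in> carrier V; w \<in> carrier W\<rbrakk> \<Longrightarrow> (\<lambda>u. f u v w) \<in> K_linear K U X"
    and "\<lbrakk>u \<in> carrier U; w \<in> carrier W\<rbrakk> \<Longrightarrow> (\<lambda>v. f u v w) \<in> K_linear K V X"
    and "\<lbrakk>u \<in> carrier U; v \<in> carrier V\<rbrakk> \<Longrightarrow> (\<lambda>w. f u v w) \<in> K_linear K W X"
    and "\<lbrakk>u \<in> carrier U; v \<in> carrier V; w \<in> carrier W\<rbrakk> \<Longrightarrow> f u v w \<in> carrier X"
proof -
  show "\<lbrakk>v \<in> carrier V; w \<in> carrier W\<rbrakk> \<Longrightarrow> (\<lambda>u. f u v w) \<in> K_linear K U X"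
    and "\<lbrakk>u \<in> carrier U; w \<in> carrier W\<rbrakk> \<Longrightarrow> (\<lambda>v. f u v w) \<in> K_linear K V X"
    and *: "\<lbrakk>u \<in> carrier U; v \<in> carrier V\<rbrakk> \<Longrightarrow> (\<lambda>w. f u v w) \<in> K_linear K W X"
    using assms by (auto simp: trilinear_map_def)
  then show "\<lbrakk>u \<in> carrier U; v \<in> carrier V; w \<in> carrier W\<rbrakk> \<Longrightarrow> f u v w \<in> carrier X"
    using K_linear_closed[OF *, of w] by simp
qed

context tensor_space
begin

text \<open>Gives linearity of an inner sum in the legs of an outer one. For fixed parameters both
  sides of each linearity equation are linear in the tensor, so they are compared on pure
  tensors.\<close>

lemma tsum_param:
  assumes X: "module K X" and Z: "module K Z"
    and f: "\<And>z. z \<in> carrier Z \<Longrightarrow> balanced X (f z)"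
    and lin: "\<And>v w. \<lbrakk>v \<in> carrier V; w \<in> carrier W\<rbrakk> \<Longrightarrow> (\<lambda>z. f z v w) \<in> K_linear K Z X"
    and t: "t \<in> carrier T"
  shows "(\<lambda>z. tsum X t (f z)) \<in> K_linear K Z X"
proof -
  interpret X: module K X by (rule X)
  interpret Z: module K Z by (rule Z)
  have cl: "\<And>z. z \<in> carrier Z \<Longrightarrow> tsum X t (f z) \<in> carrier X"
    by (rule tsum_closed[OF X f t])
  show ?thesis
  proof (rule K_linearI[OF cl])
    fix z z' assume z: "z \<in> carrier Z" "z' \<in> carrier Z"
    show "tsum X t (f (z \<oplus>\<^bsub>Z\<^esub> z')) = tsum X t (f z) \<oplus>\<^bsub>X\<^esub> tsum X t (f z')"
      by (rule K_linear_eqI[where g = "\<lambda>t. tsum X t (f (z \<oplus>\<^bsub>Z\<^esub> z'))",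
            OF _ _ _ t]) (use z in \<open>auto intro!: tsum_linear K_linear_plus X f simp: tsum_pt[OF X f] K_linear_add[OF lin]\<close>)
  next
    fix k z assume z: "k \<in> carrier K" "z \<in> carrier Z"
    show "tsum X t (f (k \<odot>\<^bsub>Z\<^esub> z)) = k \<odot>\<^bsub>X\<^esub> tsum X t (f z)"
      by (rule K_linear_eqI[where g = "\<lambda>t. tsum X t (f (k \<odot>\<^bsub>Z\<^esub> z))",
            OF _ _ _ t]) (use z in \<open>auto intro!: tsum_linear K_linear_scaled X f simp: tsum_pt[OF X f] K_linear_smult[OF lin]\<close>)
  qed
qed

end

section \<open>Tensor products over the ground ring\<close>

lemma ktensor_space:
  assumes "module K V" "module K W"
  shows "tensor_space K V W (carrier K) (\<lambda>v k. k \<odot>\<^bsub>V\<^esub> v) (\<lambda>k w. k \<odot>\<^bsub>W\<^esub> w) (ktensor K V W) (ktens K V W)"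
proof -
  interpret V: module K V by fact
  interpret W: module K W by fact
  show ?thesis
  proof
    show "k \<odot>\<^bsub>V\<^esub> v \<in> carrier V" if "v \<in> carrier V" "k \<in> carrier K" for v k using that by simp
    show "k \<odot>\<^bsub>W\<^esub> v \<in> carrier W" if "v \<in> carrier W" "k \<in> carrier K" for v k using that by simp
    show "\<exists>b\<in>carrier K. (\<forall>v\<in>carrier V. b \<odot>\<^bsub>V\<^esub> v = k \<odot>\<^bsub>V\<^esub> v) \<and> (\<forall>w\<in>carrier W. b \<odot>\<^bsub>W\<^esub> w = k \<odot>\<^bsub>W\<^esub> w)"
      if "k \<in> carrier K" for k using that by blast
    show "b \<odot>\<^bsub>V\<^esub> (k \<odot>\<^bsub>V\<^esub> v) = k \<odot>\<^bsub>V\<^esub> (b \<odot>\<^bsub>V\<^esub> v)"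
      if "k \<in> carrier K" "v \<in> carrier V" "b \<in> carrier K" for k v b
      using that by (simp add: V.smult_assoc1[symmetric] V.R.m_comm)
  qed (simp_all add: ktensor_def ktens_def Let_def)
qed

context
  fixes K :: "('k, 'l) ring_scheme" and V :: "('k, 'v, 'm) module_scheme"
    and W :: "('k, 'w, 'n) module_scheme"
  assumes V: "module K V" and W: "module K W"
begin

interpretation V: module K V by (rule V)
interpretation W: module K W by (rule W)
interpretation T: tensor_space K V W "carrier K" "\<lambda>v k. k \<odot>\<^bsub>V\<^esub> v" "\<lambda>k w. k \<odot>\<^bsub>W\<^esub> w" "ktensor K V W" "ktens K V W"
  by (rule ktensor_space[OF V W])

lemma ktensor_balanced:
  assumes "module K X" and f: "bilinear_map K V W X f"
  shows "T.balanced X f"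
proof -
  interpret X: module K X by fact
  show ?thesis
    using f unfolding T.balanced_def by (auto simp: bilinear_map_def K_linear_def)
qed

lemma ktensor_module: "module K (ktensor K V W)" by (rule T.T_module)

lemma ktens_closed: "\<lbrakk>v \<in> carrier V; w \<in> carrier W\<rbrakk> \<Longrightarrow> ktens K V W v w \<in> carrier (ktensor K V W)"
  by (rule T.pt_closed)

lemma ktens_linear_left: "f \<in> K_linear K Z V \<Longrightarrow> w \<in> carrier W \<Longrightarrow> (\<lambda>z. ktens K V W (f z) w) \<in> K_linear K Z (ktensor K V W)"
  by (rule K_linear_comp[OF T.pt_linear_left])

lemma ktens_linear_right: "v \<in> carrier V \<Longrightarrow> f \<in> K_linear K Z W \<Longrightarrow> (\<lambda>z. ktens K V W v (f z)) \<in> K_linear K Z (ktensor K V W)"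
  by (rule K_linear_comp[OF T.pt_linear_right])

lemma ktensor_eqI:
  assumes g: "g \<in> K_linear K (ktensor K V W) X" and h: "h \<in> K_linear K (ktensor K V W) X"
    and eq: "\<And>v w. \<lbrakk>v \<in> carrier V; w \<in> carrier W\<rbrakk> \<Longrightarrow> g (ktens K V W v w) = h (ktens K V W v w)"
    and t: "t \<in> carrier (ktensor K V W)"
  shows "g t = h t"
  using assms by (rule T.K_linear_eqI)

lemma ksum_closed: "module K X \<Longrightarrow> bilinear_map K V W X f \<Longrightarrow> t \<in> carrier (ktensor K V W) \<Longrightarrow> tsum X t f \<in> carrier X"
  by (rule T.tsum_closed[OF _ ktensor_balanced])

lemma ksum_ktens: "module K X \<Longrightarrow> bilinear_map K V W X f \<Longrightarrow> v \<in> carrier V \<Longrightarrow> w \<in> carrier W \<Longrightarrow>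
    tsum X (ktens K V W v w) f = f v w"
  by (rule T.tsum_pt[OF _ ktensor_balanced])

lemma ksum_linear: "module K X \<Longrightarrow> bilinear_map K V W X f \<Longrightarrow> g \<in> K_linear K Z (ktensor K V W) \<Longrightarrow>
    (\<lambda>z. tsum X (g z) f) \<in> K_linear K Z X"
  by (rule K_linear_comp[OF T.tsum_linear[OF _ ktensor_balanced]])

lemma ksum_cong: "module K X \<Longrightarrow> t \<in> carrier (ktensor K V W) \<Longrightarrow> bilinear_map K V W X f \<Longrightarrow>
    (\<And>v w. \<lbrakk>v \<in> carrier V; w \<in> carrier W\<rbrakk> \<Longrightarrow> g v w = f v w) \<Longrightarrow> tsum X t g = tsum X t f"
  by (rule T.tsum_cong[OF _ ktensor_balanced])

lemma ksum_push: "module K X \<Longrightarrow> module K Y \<Longrightarrow> t \<in> carrier (ktensor K V W) \<Longrightarrow> bilinear_map K V W X f \<Longrightarrow>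
    g \<in> K_linear K X Y \<Longrightarrow> g (tsum X t f) = tsum Y t (\<lambda>v w. g (f v w))"
  by (rule T.tsum_push[OF _ ktensor_balanced])

lemma ksum_param:
  assumes X: "module K X" and Z: "module K Z" and t: "t \<in> carrier (ktensor K V W)"
    and f: "\<And>z. z \<in> carrier Z \<Longrightarrow> bilinear_map K V W X (\<lambda>v w. f z v w)"
    and lin: "\<And>v w. \<lbrakk>v \<in> carrier V; w \<in> carrier W\<rbrakk> \<Longrightarrow> (\<lambda>z. f z v w) \<in> K_linear K Z X"
  shows "(\<lambda>z. tsum X t (\<lambda>v w. f z v w)) \<in> K_linear K Z X"
  by (rule T.tsum_param[OF X Z ktensor_balanced[OF X f] lin t])

end

text \<open>Fubini for two independent sums: both sides are linear in \<open>s\<close>, and for a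
  pure tensor the sum over \<open>s\<close> has a single term.\<close>

lemma ksum_swap:
  assumes V: "module K V" and W: "module K W" and V': "module K V'" and W': "module K W'"
    and X: "module K X" and s: "s \<in> carrier (ktensor K V W)" and t: "t \<in> carrier (ktensor K V' W')"
    and f1: "\<And>v w. \<lbrakk>v \<in> carrier V; w \<in> carrier W\<rbrakk> \<Longrightarrow> bilinear_map K V' W' X (\<lambda>v' w'. f v w v' w')"
    and f2: "\<And>v' w'. \<lbrakk>v' \<in> carrier V'; w' \<in> carrier W'\<rbrakk> \<Longrightarrow> bilinear_map K V W X (\<lambda>v w. f v w v' w')"
  shows "tsum X s (\<lambda>v w. tsum X t (\<lambda>v' w'. f v w v' w')) = tsum X t (\<lambda>v' w'. tsum X s (\<lambda>v w. f v w v' w'))"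
proof -
  have bil: "bilinear_map K V W X (\<lambda>v w. tsum X t (\<lambda>v' w'. f v w v' w'))"
    by (intro bilinear_mapI ksum_param[OF V' W' X _ t] V W f1 bilinear_mapD[OF f2])
  have bil': "bilinear_map K V' W' X (\<lambda>v' w'. tsum X s (\<lambda>v w. f v w v' w'))" if "s \<in> carrier (ktensor K V W)" for s
    using that by (intro bilinear_mapI ksum_param[OF V W X] V' W' f2 bilinear_mapD[OF f1])
  show ?thesis
  proof (rule ktensor_eqI[OF V W _ _ _ s, where g = "\<lambda>s. tsum X s (\<lambda>v w. tsum X t (\<lambda>v' w'. f v w v' w'))"])
    show "(\<lambda>s. tsum X s (\<lambda>v w. tsum X t (f v w))) \<in> K_linear K (ktensor K V W) X"
      by (intro ksum_linear[OF V W X bil] K_linear_id)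
    show "(\<lambda>s. tsum X t (\<lambda>v' w'. tsum X s (\<lambda>v w. f v w v' w'))) \<in> K_linear K (ktensor K V W) X"
      by (intro ksum_param[OF V' W' X ktensor_module[OF V W] t bil'] ksum_linear[OF V W X f2] K_linear_id)
    show "tsum X (ktens K V W v w) (\<lambda>v w. tsum X t (f v w)) =
        tsum X t (\<lambda>v' w'. tsum X (ktens K V W v w) (\<lambda>v w. f v w v' w'))"
      if vw: "v \<in> carrier V" "w \<in> carrier W" for v w
    proof -
      have "tsum X t (\<lambda>v' w'. tsum X (ktens K V W v w) (\<lambda>v w. f v w v' w')) = tsum X t (\<lambda>v' w'. f v w v' w')"
        using vw by (intro ksum_cong[OF V' W' X t f1] ksum_ktens[OF V W X f2])
      then show ?thesis by (simp add: ksum_ktens[OF V W X bil] vw)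
    qed
  qed
qed

lemma assoc_algebra_mult_linear:
  assumes "assoc_algebra K B"
  shows "f \<in> K_linear K Z B \<Longrightarrow> y \<in> carrier B \<Longrightarrow> (\<lambda>z. f z \<otimes>\<^bsub>B\<^esub> y) \<in> K_linear K Z B"
    and "x \<in> carrier B \<Longrightarrow> f \<in> K_linear K Z B \<Longrightarrow> (\<lambda>z. x \<otimes>\<^bsub>B\<^esub> f z) \<in> K_linear K Z B"
proof -
  interpret assoc_algebra K B by fact
  show "f \<in> K_linear K Z B \<Longrightarrow> y \<in> carrier B \<Longrightarrow> (\<lambda>z. f z \<otimes>\<^bsub>B\<^esub> y) \<in> K_linear K Z B"
    by (rule K_linear_comp[of "\<lambda>x. x \<otimes>\<^bsub>B\<^esub> y"]) (auto simp: K_linear_def B.l_distr smult_mult_left)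
  show "x \<in> carrier B \<Longrightarrow> f \<in> K_linear K Z B \<Longrightarrow> (\<lambda>z. x \<otimes>\<^bsub>B\<^esub> f z) \<in> K_linear K Z B"
    by (rule K_linear_comp[of "\<lambda>y. x \<otimes>\<^bsub>B\<^esub> y"]) (auto simp: K_linear_def B.r_distr smult_mult_right)
qed

section \<open>The tensor product of two algebras\<close>

context
  fixes K :: "('k, 'l) ring_scheme" and V :: "('k, 'v, 'm) module_scheme"
    and W :: "('k, 'w, 'n) module_scheme"
  assumes V: "assoc_algebra K V" and W: "assoc_algebra K W"
begin

interpretation V: assoc_algebra K V by (rule V)
interpretation W: assoc_algebra K W by (rule W)

private abbreviation "T \<equiv> ktensor K V W"

lemmas VM = V.module_axioms and WM = W.module_axioms
lemmas T_mod = ktensor_module[OF VM WM]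
interpretation T: module K T by (rule T_mod)

lemmas mult_lin = assoc_algebra_mult_linear[OF V] assoc_algebra_mult_linear[OF W]
  ktens_linear_left[OF VM WM] ktens_linear_right[OF VM WM] K_linear_id bilinear_mapI

lemma ktensor_mult_def:
  "s \<otimes>\<^bsub>T\<^esub> t = tsum T s (\<lambda>v w. tsum T t (\<lambda>v' w'. ktens K V W (v \<otimes>\<^bsub>V\<^esub> v') (w \<otimes>\<^bsub>W\<^esub> w')))"
proof -
  interpret S: tensor_space K V W "carrier K" "\<lambda>v k. k \<odot>\<^bsub>V\<^esub> v" "\<lambda>k w. k \<odot>\<^bsub>W\<^esub> w" T "ktens K V W"
    by (rule ktensor_space[OF VM WM])
  show ?thesis unfolding S.tsum_T by (simp add: ktensor_def Let_def)
qed

lemma ktensor_mult_inner: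
  "\<lbrakk>v \<in> carrier V; w \<in> carrier W\<rbrakk> \<Longrightarrow> bilinear_map K V W T (\<lambda>v' w'. ktens K V W (v \<otimes>\<^bsub>V\<^esub> v') (w \<otimes>\<^bsub>W\<^esub> w'))"
  by (intro mult_lin V.B.m_closed W.B.m_closed)

lemma ktensor_mult_outer:
  "t \<in> carrier T \<Longrightarrow> bilinear_map K V W T (\<lambda>v w. tsum T t (\<lambda>v' w'. ktens K V W (v \<otimes>\<^bsub>V\<^esub> v') (w \<otimes>\<^bsub>W\<^esub> w')))"
  by (rule bilinear_mapI; rule ksum_param[OF VM WM T_mod];
    (intro VM WM ktensor_mult_inner mult_lin V.B.m_closed W.B.m_closed)?; simp?)

lemma ktensor_mult_linear: "s \<in> carrier T \<Longrightarrow> (\<lambda>t. s \<otimes>\<^bsub>T\<^esub> t) \<in> K_linear K T T"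
  "t \<in> carrier T \<Longrightarrow> (\<lambda>s. s \<otimes>\<^bsub>T\<^esub> t) \<in> K_linear K T T"
  unfolding ktensor_mult_def
   apply (rule ksum_param[OF VM WM T_mod T_mod], assumption, erule ktensor_mult_outer)
   apply (intro ksum_linear[OF VM WM T_mod ktensor_mult_inner] K_linear_id; assumption)
  apply (intro ksum_linear[OF VM WM T_mod ktensor_mult_outer] K_linear_id; assumption)
  done

lemma ktensor_mult_ktens:
  "\<lbrakk>v \<in> carrier V; w \<in> carrier W; v' \<in> carrier V; w' \<in> carrier W\<rbrakk> \<Longrightarrow>
    ktens K V W v w \<otimes>\<^bsub>T\<^esub> ktens K V W v' w' = ktens K V W (v \<otimes>\<^bsub>V\<^esub> v') (w \<otimes>\<^bsub>W\<^esub> w')"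
  unfolding ktensor_mult_def
  by (simp add: ksum_ktens[OF VM WM T_mod ktensor_mult_outer] ktens_closed[OF VM WM]
    ksum_ktens[OF VM WM T_mod ktensor_mult_inner])

lemma ktensor_one: "\<one>\<^bsub>T\<^esub> = ktens K V W \<one>\<^bsub>V\<^esub> \<one>\<^bsub>W\<^esub>"
  by (simp add: ktensor_def Let_def)

lemmas kt_closed = ktens_closed[OF VM WM]

text \<open>The associative law is linear in each of its three tensors, so it is reduced to pure
  tensors one argument at a time; there it is the law in the two factors.\<close>

lemma ktensor_assoc_algebra: "assoc_algebra K (ktensor K V W)"
proof -
  note ml = ktensor_mult_linear
  have cl: "s \<otimes>\<^bsub>T\<^esub> t \<in> carrier T" if "s \<in> carrier T" "t \<in> carrier T" for s t
    using K_linear_closed[OF ml(1)] that .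
  note eqI = ktensor_eqI[OF VM WM, where X = T]
  have assoc: "x \<otimes>\<^bsub>T\<^esub> y \<otimes>\<^bsub>T\<^esub> z = x \<otimes>\<^bsub>T\<^esub> (y \<otimes>\<^bsub>T\<^esub> z)"
    if x: "x \<in> carrier T" and y: "y \<in> carrier T" and z: "z \<in> carrier T" for x y z
  proof (rule eqI[where g = "\<lambda>x. x \<otimes>\<^bsub>T\<^esub> y \<otimes>\<^bsub>T\<^esub> z", OF _ _ _ x])
    fix a b assume ab: "a \<in> carrier V" "b \<in> carrier W"
    let ?x = "ktens K V W a b"
    show "?x \<otimes>\<^bsub>T\<^esub> y \<otimes>\<^bsub>T\<^esub> z = ?x \<otimes>\<^bsub>T\<^esub> (y \<otimes>\<^bsub>T\<^esub> z)"
    proof (rule eqI[where g = "\<lambda>y. ?x \<otimes>\<^bsub>T\<^esub> y \<otimes>\<^bsub>T\<^esub> z", OF _ _ _ y])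
      fix c d assume cd: "c \<in> carrier V" "d \<in> carrier W"
      let ?y = "ktens K V W c d"
      show "?x \<otimes>\<^bsub>T\<^esub> ?y \<otimes>\<^bsub>T\<^esub> z = ?x \<otimes>\<^bsub>T\<^esub> (?y \<otimes>\<^bsub>T\<^esub> z)"
        by (rule eqI[where g = "\<lambda>z. ?x \<otimes>\<^bsub>T\<^esub> ?y \<otimes>\<^bsub>T\<^esub> z", OF _ _ _ z])
          (use ab cd in \<open>auto intro!: ml kt_closed K_linear_comp[OF ml(1)] simp: ktensor_mult_ktens V.B.m_assoc W.B.m_assoc\<close>)
    qed (use ab z in \<open>auto intro!: ml kt_closed K_linear_comp[OF ml(1)] K_linear_comp[OF ml(2)]\<close>)
  qed (use y z cl in \<open>auto intro!: ml K_linear_comp[OF ml(2)]\<close>)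
  have one: "\<one>\<^bsub>T\<^esub> \<in> carrier T" unfolding ktensor_one by (intro kt_closed V.B.one_closed W.B.one_closed)
  have l_one: "\<one>\<^bsub>T\<^esub> \<otimes>\<^bsub>T\<^esub> x = x" if "x \<in> carrier T" for x
    by (rule eqI[OF ml(1) K_linear_id _ that]) (auto simp: one[unfolded ktensor_one] ktensor_one ktensor_mult_ktens)
  have r_one: "x \<otimes>\<^bsub>T\<^esub> \<one>\<^bsub>T\<^esub> = x" if "x \<in> carrier T" for x
    by (rule eqI[OF ml(2) K_linear_id _ that]) (auto simp: one[unfolded ktensor_one] ktensor_one ktensor_mult_ktens)
  have ring: "ring T"
    by (rule ringI[OF T.abelian_group_axioms])
      (auto intro!: monoidI cl one l_one r_one simp: assoc K_linear_add[OF ml(1)] K_linear_add[OF ml(2)])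
  show ?thesis
    by (intro assoc_algebra.intro T_mod ring assoc_algebra_axioms.intro)
      (simp_all add: K_linear_smult[OF ml(1)] K_linear_smult[OF ml(2)])
qed

text \<open>The axioms on \<Delta> and R are equations of products in tensor powers of H. This rule
  turns a product into an iterated sum, the form in which they are applied to elements.\<close>

lemma ksum_mult:
  assumes X: "module K X" and f: "bilinear_map K V W X f"
    and s: "s \<in> carrier T" and t: "t \<in> carrier T"
  shows "tsum X (s \<otimes>\<^bsub>T\<^esub> t) f = tsum X s (\<lambda>v w. tsum X t (\<lambda>v' w'. f (v \<otimes>\<^bsub>V\<^esub> v') (w \<otimes>\<^bsub>W\<^esub> w')))"
proof -
  have g: "(\<lambda>t. tsum X t f) \<in> K_linear K T X"
    by (intro ksum_linear[OF VM WM X f] K_linear_id)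
  show ?thesis
    unfolding ktensor_mult_def
  proof (subst ksum_push[OF VM WM T_mod X s ktensor_mult_outer[OF t] g], rule ksum_cong[OF VM WM X s])
    fix v w assume vw: "v \<in> carrier V" "w \<in> carrier W"
    show "tsum X (tsum T t (\<lambda>v' w'. ktens K V W (v \<otimes>\<^bsub>V\<^esub> v') (w \<otimes>\<^bsub>W\<^esub> w'))) f
        = tsum X t (\<lambda>v' w'. f (v \<otimes>\<^bsub>V\<^esub> v') (w \<otimes>\<^bsub>W\<^esub> w'))"
      using vw
      by (subst ksum_push[OF VM WM T_mod X t ktensor_mult_inner g], simp, simp, intro ksum_cong[OF VM WM X t])
        (auto intro!: bilinear_mapI K_linear_comp[OF bilinear_mapD(1)[OF f]] K_linear_comp[OF bilinear_mapD(2)[OF f]]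
          mult_lin simp: ksum_ktens[OF VM WM X f])
  next
    show "bilinear_map K V W X (\<lambda>v w. tsum X t (\<lambda>v' w'. f (v \<otimes>\<^bsub>V\<^esub> v') (w \<otimes>\<^bsub>W\<^esub> w')))"
      by (rule bilinear_mapI; rule ksum_param[OF VM WM X])
        (use t in \<open>auto intro!: VM WM bilinear_mapI K_linear_comp[OF bilinear_mapD(1)[OF f]] K_linear_comp[OF bilinear_mapD(2)[OF f]]
          mult_lin\<close>)
  qed
qed

end

section \<open>Sweedler calculus\<close>

text \<open>The linear map on the threefold tensor power induced by a trilinear \<open>f\<close>.
  Applied to both sides it turns an equation there into an equation of iterated sums.\<close>

definition eval3 :: "('x, 'm) ring_scheme \<Rightarrow> ('a \<Rightarrow> 'b \<Rightarrow> 'c \<Rightarrow> 'x) \<Rightarrow> (('a, 'b) tens, 'c) tens \<Rightarrow> 'x" where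
  "eval3 X f t = tsum X t (\<lambda>u z. tsum X u (\<lambda>x y. f x y z))"

context hopf_algebra
begin

lemma H_module: "module K H" by (rule module_axioms)

lemmas H_modules [simp] = H_module ktensor_module[OF H_module H_module]

lemma HH_algebra: "assoc_algebra K (ktensor K H H)"
  by (intro ktensor_assoc_algebra assoc_algebra_axioms)

lemma comul_closed [simp]: "x \<in> carrier H \<Longrightarrow> comul H x \<in> carrier (ktensor K H H)"
  by (rule K_linear_closed[OF comul_linear])

lemma antipode_closed [simp]: "x \<in> carrier H \<Longrightarrow> antipode H x \<in> carrier H"
  by (rule K_linear_closed[OF antipode_linear])

lemma counit_closed [simp]: "x \<in> carrier H \<Longrightarrow> counit H x \<in> carrier K"
  by (rule ring_hom_closed[OF counit_hom])

lemma counit_one [simp]: "counit H \<one>\<^bsub>H\<^esub> = \<one>\<^bsub>K\<^esub>"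
  by (rule ring_hom_one[OF counit_hom])

lemma H_mult_linear_left [lin]: "f \<in> K_linear K Z H \<Longrightarrow> y \<in> carrier H \<Longrightarrow> (\<lambda>z. f z \<otimes>\<^bsub>H\<^esub> y) \<in> K_linear K Z H"
  and H_mult_linear_right [lin]: "x \<in> carrier H \<Longrightarrow> f \<in> K_linear K Z H \<Longrightarrow> (\<lambda>z. x \<otimes>\<^bsub>H\<^esub> f z) \<in> K_linear K Z H"
  by (rule assoc_algebra_mult_linear[OF assoc_algebra_axioms]; assumption)+

lemma antipode_linear_comp [lin]: "f \<in> K_linear K Z H \<Longrightarrow> (\<lambda>z. antipode H (f z)) \<in> K_linear K Z H"
  by (rule K_linear_comp[OF antipode_linear])

lemma counit_scaled_linear [lin]:
  assumes X: "module K X" and x: "x \<in> carrier X" and f: "f \<in> K_linear K Z H"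
  shows "(\<lambda>z. counit H (f z) \<odot>\<^bsub>X\<^esub> x) \<in> K_linear K Z X"
proof -
  interpret X: module K X by (rule X)
  have "(\<lambda>h. counit H h \<odot>\<^bsub>X\<^esub> x) \<in> K_linear K H X"
    by (rule K_linearI) (simp_all add: x ring_hom_add[OF counit_hom] counit_smult X.smult_l_distr X.smult_assoc1)
  then show ?thesis by (rule K_linear_comp[OF _ f])
qed

lemma counit_scaled_linear_right [lin]:
  assumes X: "module K X" and x: "x \<in> carrier H" and f: "f \<in> K_linear K Z X"
  shows "(\<lambda>z. counit H x \<odot>\<^bsub>X\<^esub> f z) \<in> K_linear K Z X"
  by (rule K_linear_scaled[OF X f]) (simp add: x)

lemma hsum_closed [simp]: "module K X \<Longrightarrow> t \<in> carrier (ktensor K H H) \<Longrightarrow> bilinear_map K H H X f \<Longrightarrow> tsum X t f \<in> carrier X"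
  by (rule ksum_closed[OF H_module H_module])

lemma hsum_cong: "module K X \<Longrightarrow> t \<in> carrier (ktensor K H H) \<Longrightarrow> bilinear_map K H H X f \<Longrightarrow>
    (\<And>a b. \<lbrakk>a \<in> carrier H; b \<in> carrier H\<rbrakk> \<Longrightarrow> g a b = f a b) \<Longrightarrow> tsum X t g = tsum X t f"
  by (rule ksum_cong[OF H_module H_module])

lemma hsum_push: "module K X \<Longrightarrow> module K Y \<Longrightarrow> t \<in> carrier (ktensor K H H) \<Longrightarrow> bilinear_map K H H X f \<Longrightarrow>
    g \<in> K_linear K X Y \<Longrightarrow> g (tsum X t f) = tsum Y t (\<lambda>a b. g (f a b))"
  by (rule ksum_push[OF H_module H_module])

lemma hsum_param [lin]: "module K X \<Longrightarrow> module K Z \<Longrightarrow> t \<in> carrier (ktensor K H H) \<Longrightarrow>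
    (\<And>z. z \<in> carrier Z \<Longrightarrow> bilinear_map K H H X (\<lambda>a b. f z a b)) \<Longrightarrow>
    (\<And>a b. \<lbrakk>a \<in> carrier H; b \<in> carrier H\<rbrakk> \<Longrightarrow> (\<lambda>z. f z a b) \<in> K_linear K Z X) \<Longrightarrow>
    (\<lambda>z. tsum X t (\<lambda>a b. f z a b)) \<in> K_linear K Z X"
  by (rule ksum_param[OF H_module H_module])

lemma comul_sum_linear [lin]: "module K X \<Longrightarrow> bilinear_map K H H X f \<Longrightarrow> g \<in> K_linear K Z H \<Longrightarrow>
    (\<lambda>z. tsum X (comul H (g z)) f) \<in> K_linear K Z X"
  by (rule ksum_linear[OF H_module H_module _ _ K_linear_comp[OF comul_linear]])

lemma hsum_swap: "module K X \<Longrightarrow> s \<in> carrier (ktensor K H H) \<Longrightarrow> t \<in> carrier (ktensor K H H) \<Longrightarrow>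
    (\<And>a b. \<lbrakk>a \<in> carrier H; b \<in> carrier H\<rbrakk> \<Longrightarrow> bilinear_map K H H X (\<lambda>c d. f a b c d)) \<Longrightarrow>
    (\<And>c d. \<lbrakk>c \<in> carrier H; d \<in> carrier H\<rbrakk> \<Longrightarrow> bilinear_map K H H X (\<lambda>a b. f a b c d)) \<Longrightarrow>
    tsum X s (\<lambda>a b. tsum X t (\<lambda>c d. f a b c d)) = tsum X t (\<lambda>c d. tsum X s (\<lambda>a b. f a b c d))"
  by (rule ksum_swap[OF H_module H_module H_module H_module])

lemma hsum_mult:
  assumes "module K X" "bilinear_map K H H X f" "s \<in> carrier (ktensor K H H)" "t \<in> carrier (ktensor K H H)"
  shows "tsum X (s \<otimes>\<^bsub>ktensor K H H\<^esub> t) f = tsum X s (\<lambda>a b. tsum X t (\<lambda>c d. f (a \<otimes>\<^bsub>H\<^esub> c) (b \<otimes>\<^bsub>H\<^esub> d)))"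
  by (rule ksum_mult[OF assoc_algebra_axioms assoc_algebra_axioms assms])

lemma hsum_plus:
  assumes X: "module K X" and t: "t \<in> carrier (ktensor K H H)" and f: "bilinear_map K H H X f" and g: "bilinear_map K H H X g"
  shows "tsum X t (\<lambda>a b. f a b \<oplus>\<^bsub>X\<^esub> g a b) = tsum X t f \<oplus>\<^bsub>X\<^esub> tsum X t g"
proof -
  have fg: "bilinear_map K H H X (\<lambda>a b. f a b \<oplus>\<^bsub>X\<^esub> g a b)"
    by (intro bilinear_mapI K_linear_plus X bilinear_mapD[OF f] bilinear_mapD[OF g])
  note lin = ksum_linear[OF H_module H_module X _ K_linear_id]
  show ?thesis
    by (rule ktensor_eqI[OF H_module H_module lin[OF fg] K_linear_plus[OF X lin[OF f] lin[OF g]] _ t])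
      (simp add: ksum_ktens[OF H_module H_module X] f g fg)
qed

lemma comul_mult_sum:
  assumes "module K X" "bilinear_map K H H X f" "x \<in> carrier H" "y \<in> carrier H"
  shows "tsum X (comul H (x \<otimes>\<^bsub>H\<^esub> y)) f = tsum X (comul H x) (\<lambda>a b. tsum X (comul H y) (\<lambda>c d. f (a \<otimes>\<^bsub>H\<^esub> c) (b \<otimes>\<^bsub>H\<^esub> d)))"
  by (simp add: ring_hom_mult[OF comul_hom] assms hsum_mult)

lemma comul_one_sum:
  assumes "module K X" "bilinear_map K H H X f"
  shows "tsum X (comul H \<one>\<^bsub>H\<^esub>) f = f \<one>\<^bsub>H\<^esub> \<one>\<^bsub>H\<^esub>"
  by (simp add: ring_hom_one[OF comul_hom] ktensor_one[OF assoc_algebra_axioms assoc_algebra_axioms]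
    ksum_ktens[OF H_module H_module] assms)

text \<open>The axiom is stated inside H; applying an arbitrary linear \<open>f\<close> gives the
  form needed when the legs occur under other operations. The next three lemmas transport their
  axioms in the same way.\<close>

lemma counit_left_sum:
  assumes X: "module K X" and f: "f \<in> K_linear K H X" and x: "x \<in> carrier H"
  shows "tsum X (comul H x) (\<lambda>a b. counit H a \<odot>\<^bsub>X\<^esub> f b) = f x"
proof -
  have "f x = f (tsum H (comul H x) (\<lambda>a b. counit H a \<odot>\<^bsub>H\<^esub> b))"
    by (simp add: counit_left x)
  also have "\<dots> = tsum X (comul H x) (\<lambda>a b. f (counit H a \<odot>\<^bsub>H\<^esub> b))"
    by (rule hsum_push[OF _ X _ _ f]; (intro lin)?; simp add: x)
  also have "\<dots> = tsum X (comul H x) (\<lambda>a b. counit H a \<odot>\<^bsub>X\<^esub> f b)"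
    by (rule hsum_cong[OF X]; (intro lin f X)?; simp add: x K_linear_smult[OF f] K_linear_closed[OF f])
  finally show ?thesis by simp
qed

lemma counit_right_sum:
  assumes X: "module K X" and f: "f \<in> K_linear K H X" and x: "x \<in> carrier H"
  shows "tsum X (comul H x) (\<lambda>a b. counit H b \<odot>\<^bsub>X\<^esub> f a) = f x"
proof -
  have "f x = f (tsum H (comul H x) (\<lambda>a b. counit H b \<odot>\<^bsub>H\<^esub> a))"
    by (simp add: counit_right x)
  also have "\<dots> = tsum X (comul H x) (\<lambda>a b. f (counit H b \<odot>\<^bsub>H\<^esub> a))"
    by (rule hsum_push[OF _ X _ _ f]; (intro lin)?; simp add: x)
  also have "\<dots> = tsum X (comul H x) (\<lambda>a b. counit H b \<odot>\<^bsub>X\<^esub> f a)"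
    by (rule hsum_cong[OF X]; (intro lin f X)?; simp add: x K_linear_smult[OF f] K_linear_closed[OF f])
  finally show ?thesis by simp
qed

lemma antipode_left_sum:
  assumes X: "module K X" and f: "f \<in> K_linear K H X" and x: "x \<in> carrier H"
  shows "tsum X (comul H x) (\<lambda>a b. f (antipode H a \<otimes>\<^bsub>H\<^esub> b)) = counit H x \<odot>\<^bsub>X\<^esub> f \<one>\<^bsub>H\<^esub>"
proof -
  have "tsum X (comul H x) (\<lambda>a b. f (antipode H a \<otimes>\<^bsub>H\<^esub> b)) = f (tsum H (comul H x) (\<lambda>a b. antipode H a \<otimes>\<^bsub>H\<^esub> b))"
    by (rule hsum_push[OF _ X _ _ f, symmetric]; (intro lin)?; simp add: x)
  then show ?thesis by (simp add: antipode_left x K_linear_smult[OF f])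
qed

lemma antipode_right_sum:
  assumes X: "module K X" and f: "f \<in> K_linear K H X" and x: "x \<in> carrier H"
  shows "tsum X (comul H x) (\<lambda>a b. f (a \<otimes>\<^bsub>H\<^esub> antipode H b)) = counit H x \<odot>\<^bsub>X\<^esub> f \<one>\<^bsub>H\<^esub>"
proof -
  have "tsum X (comul H x) (\<lambda>a b. f (a \<otimes>\<^bsub>H\<^esub> antipode H b)) = f (tsum H (comul H x) (\<lambda>a b. a \<otimes>\<^bsub>H\<^esub> antipode H b))"
    by (rule hsum_push[OF _ X _ _ f, symmetric]; (intro lin)?; simp add: x)
  then show ?thesis by (simp add: antipode_right x K_linear_smult[OF f])
qed

lemma H3_module [simp]: "module K (ktensor3 K H)"
  unfolding ktensor3_def by (intro ktensor_module) simp_all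

lemma ktens3_linear [lin]:
  "f \<in> K_linear K Z H \<Longrightarrow> y \<in> carrier H \<Longrightarrow> z \<in> carrier H \<Longrightarrow> (\<lambda>x. ktens3 K H (f x) y z) \<in> K_linear K Z (ktensor3 K H)"
  "x \<in> carrier H \<Longrightarrow> f \<in> K_linear K Z H \<Longrightarrow> z \<in> carrier H \<Longrightarrow> (\<lambda>y. ktens3 K H x (f y) z) \<in> K_linear K Z (ktensor3 K H)"
  "x \<in> carrier H \<Longrightarrow> y \<in> carrier H \<Longrightarrow> f \<in> K_linear K Z H \<Longrightarrow> (\<lambda>z. ktens3 K H x y (f z)) \<in> K_linear K Z (ktensor3 K H)"
  unfolding ktens3_def ktensor3_def
  by (intro ktens_linear_left ktens_linear_right ktens_closed; simp)+

lemma ktens_comul_linear [lin]: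
  "f \<in> K_linear K Z H \<Longrightarrow> y \<in> carrier H \<Longrightarrow> (\<lambda>x. ktens K (ktensor K H H) H (comul H (f x)) y) \<in> K_linear K Z (ktensor3 K H)"
  "x \<in> carrier H \<Longrightarrow> f \<in> K_linear K Z H \<Longrightarrow> (\<lambda>z. ktens K (ktensor K H H) H (comul H x) (f z)) \<in> K_linear K Z (ktensor3 K H)"
  unfolding ktensor3_def
  by (intro ktens_linear_left ktens_linear_right K_linear_comp[OF comul_linear]; simp)+

section \<open>Coassociativity as an identity of iterated sums\<close>

context
  fixes X :: "('k, 'x, 'y) module_scheme" and f
  assumes X: "module K X" and f: "trilinear_map K H H H X f"
begin

lemma trilinear_inner: "z \<in> carrier H \<Longrightarrow> bilinear_map K H H X (\<lambda>x y. f x y z)"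
  "x \<in> carrier H \<Longrightarrow> bilinear_map K H H X (\<lambda>y z. f x y z)"
  "y \<in> carrier H \<Longrightarrow> bilinear_map K H H X (\<lambda>x z. f x y z)"
  by (intro bilinear_mapI trilinear_mapD[OF f]; assumption)+

lemma eval3_bilinear: "bilinear_map K (ktensor K H H) H X (\<lambda>u z. tsum X u (\<lambda>x y. f x y z))"
  by (intro bilinear_mapI ksum_linear[OF H_module H_module X trilinear_inner(1)] K_linear_id
    hsum_param[OF X H_module] trilinear_inner(1) trilinear_mapD[OF f]; simp)

lemma eval3_linear: "eval3 X f \<in> K_linear K (ktensor3 K H) X"
  unfolding ktensor3_def eval3_def[abs_def]
  by (rule ksum_linear[OF _ _ X eval3_bilinear K_linear_id]) simp_all

lemma eval3_ktens: "u \<in> carrier (ktensor K H H) \<Longrightarrow> z \<in> carrier H \<Longrightarrow>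
    eval3 X f (ktens K (ktensor K H H) H u z) = tsum X u (\<lambda>x y. f x y z)"
  unfolding eval3_def by (rule ksum_ktens[OF _ _ X eval3_bilinear]) simp_all

lemma eval3_ktens3: "\<lbrakk>x \<in> carrier H; y \<in> carrier H; z \<in> carrier H\<rbrakk> \<Longrightarrow> eval3 X f (ktens3 K H x y z) = f x y z"
  unfolding ktens3_def
  by (simp add: eval3_ktens ktens_closed ksum_ktens[OF H_module H_module X trilinear_inner(1)])

lemma sum_comul_left_bilinear: "bilinear_map K H H X (\<lambda>x z. tsum X (comul H x) (\<lambda>a b. f a b z))"
  by (intro bilinear_mapI comul_sum_linear X trilinear_inner K_linear_id hsum_param trilinear_mapD[OF f]; simp)

lemma sum_comul_right_bilinear: "bilinear_map K H H X (\<lambda>x z. tsum X (comul H z) (\<lambda>a b. f x a b))"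
  by (intro bilinear_mapI comul_sum_linear X trilinear_inner K_linear_id hsum_param trilinear_mapD[OF f]; simp)

lemma eval3_comul_id:
  assumes t: "t \<in> carrier (ktensor K H H)"
  shows "eval3 X f (comul_id K H t) = tsum X t (\<lambda>x z. tsum X (comul H x) (\<lambda>a b. f a b z))"
proof -
  have "eval3 X f (comul_id K H t) = tsum X t (\<lambda>x y. eval3 X f (ktens K (ktensor K H H) H (comul H x) y))"
    unfolding comul_id_def by (rule hsum_push[OF _ X t _ eval3_linear]; (intro lin)?; simp)
  also have "\<dots> = tsum X t (\<lambda>x z. tsum X (comul H x) (\<lambda>a b. f a b z))"
    by (rule hsum_cong[OF X t sum_comul_left_bilinear]) (simp add: eval3_ktens)
  finally show ?thesis .
qed

lemma eval3_id_comul: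
  assumes t: "t \<in> carrier (ktensor K H H)"
  shows "eval3 X f (id_comul K H t) = tsum X t (\<lambda>x z. tsum X (comul H z) (\<lambda>a b. f x a b))"
proof -
  have "eval3 X f (id_comul K H t) = tsum X t (\<lambda>x z. eval3 X f (tsum (ktensor3 K H) (comul H z) (\<lambda>a b. ktens3 K H x a b)))"
    unfolding id_comul_def by (rule hsum_push[OF _ X t _ eval3_linear]; (intro lin)?; simp)
  also have "\<dots> = tsum X t (\<lambda>x z. tsum X (comul H z) (\<lambda>a b. f x a b))"
  proof (rule hsum_cong[OF X t sum_comul_right_bilinear])
    fix x z assume xz: "x \<in> carrier H" "z \<in> carrier H"
    have "eval3 X f (tsum (ktensor3 K H) (comul H z) (\<lambda>a b. ktens3 K H x a b)) = tsum X (comul H z) (\<lambda>a b. eval3 X f (ktens3 K H x a b))"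
      by (rule hsum_push[OF _ X _ _ eval3_linear]; (intro lin)?; simp add: xz)
    also have "\<dots> = tsum X (comul H z) (\<lambda>a b. f x a b)"
      by (rule hsum_cong[OF X]) (simp_all add: xz trilinear_inner eval3_ktens3)
    finally show "eval3 X f (tsum (ktensor3 K H) (comul H z) (\<lambda>a b. ktens3 K H x a b)) = tsum X (comul H z) (\<lambda>a b. f x a b)" .
  qed
  finally show ?thesis .
qed

lemma coassoc_sum:
  "x \<in> carrier H \<Longrightarrow> tsum X (comul H x) (\<lambda>a c. tsum X (comul H a) (\<lambda>a b. f a b c))
    = tsum X (comul H x) (\<lambda>a b. tsum X (comul H b) (\<lambda>b c. f a b c))"
  using eval3_comul_id[of "comul H x"] eval3_id_comul[of "comul H x"] coassoc by simp

end

lemmas coassoc_sum' = coassoc_sum[symmetric]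

text \<open>This replaces the anti-comultiplicativity of the antipode.\<close>

lemma antipode_comul_cancel:
  assumes X: "module K X" and f: "trilinear_map K H H H X f" and x: "x \<in> carrier H"
  shows "tsum X (comul H x) (\<lambda>a s. tsum X (comul H a) (\<lambda>a b. tsum X (comul H b) (\<lambda>b c.
      tsum X (comul H (antipode H s)) (\<lambda>p q. f a (b \<otimes>\<^bsub>H\<^esub> p) (c \<otimes>\<^bsub>H\<^esub> q))))) = f x \<one>\<^bsub>H\<^esub> \<one>\<^bsub>H\<^esub>"
proof -
  note [simp] = X trilinear_mapD(4)[OF f]
  note tl = trilinear_mapD(1-3)[OF f]
  have fl [lin]: "g \<in> K_linear K Z H \<Longrightarrow> v \<in> carrier H \<Longrightarrow> w \<in> carrier H \<Longrightarrow> (\<lambda>z. f (g z) v w) \<in> K_linear K Z X"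
    "u \<in> carrier H \<Longrightarrow> g \<in> K_linear K Z H \<Longrightarrow> w \<in> carrier H \<Longrightarrow> (\<lambda>z. f u (g z) w) \<in> K_linear K Z X"
    "u \<in> carrier H \<Longrightarrow> v \<in> carrier H \<Longrightarrow> g \<in> K_linear K Z H \<Longrightarrow> (\<lambda>z. f u v (g z)) \<in> K_linear K Z X"
    for g and Z :: "('k, 'z, 'zz) module_scheme" and u v w
    using K_linear_comp[OF tl(1)[of v w]] K_linear_comp[OF tl(2)[of u w]] K_linear_comp[OF tl(3)[of u v]] by auto
  have "tsum X (comul H x) (\<lambda>a s. tsum X (comul H a) (\<lambda>a b. tsum X (comul H b) (\<lambda>b c.
      tsum X (comul H (antipode H s)) (\<lambda>p q. f a (b \<otimes>\<^bsub>H\<^esub> p) (c \<otimes>\<^bsub>H\<^esub> q)))))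
    = tsum X (comul H x) (\<lambda>a y. tsum X (comul H y) (\<lambda>b s. tsum X (comul H b) (\<lambda>b c.
      tsum X (comul H (antipode H s)) (\<lambda>p q. f a (b \<otimes>\<^bsub>H\<^esub> p) (c \<otimes>\<^bsub>H\<^esub> q)))))"
    by (rule coassoc_sum; (intro lin fl)?; simp add: x)
  \<comment> \<open>\<Delta> is multiplicative, so the two inner coproducts combine to \<Delta>(b
    S(s)), and the sum over b and s falls under the antipode axiom.\<close>
  also have "\<dots> = tsum X (comul H x) (\<lambda>a y. tsum X (comul H y) (\<lambda>b s.
      tsum X (comul H (b \<otimes>\<^bsub>H\<^esub> antipode H s)) (\<lambda>b c. f a b c)))"
    by (rule hsum_cong; (intro lin fl)?; (rule hsum_cong; (intro lin fl)?)?; (subst comul_mult_sum; (intro lin fl)?)?; simp add: x)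
  also have "\<dots> = tsum X (comul H x) (\<lambda>a y. counit H y \<odot>\<^bsub>X\<^esub> f a \<one>\<^bsub>H\<^esub> \<one>\<^bsub>H\<^esub>)"
    by (rule hsum_cong; (intro lin fl)?; (subst antipode_right_sum[where f = "\<lambda>x. tsum X (comul H x) (\<lambda>b c. f _ b c)"]; (intro lin fl)?)?;
      (subst comul_one_sum; (intro lin fl)?)?; simp add: x)
  also have "\<dots> = f x \<one>\<^bsub>H\<^esub> \<one>\<^bsub>H\<^esub>"
    by (rule counit_right_sum; (intro lin fl)?; simp add: x)
  finally show ?thesis .
qed

end

text \<open>Linearity in one argument after substitution of a linear map, which is the shape in
  which the linearity rules meet a bilinear function.\<close>

lemma bilinear_comp:
  assumes "bilinear_map K V W X f"
  shows "g \<in> K_linear K Z V \<Longrightarrow> w \<in> carrier W \<Longrightarrow> (\<lambda>z. f (g z) w) \<in> K_linear K Z X"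
    and "v \<in> carrier V \<Longrightarrow> h \<in> K_linear K Z W \<Longrightarrow> (\<lambda>z. f v (h z)) \<in> K_linear K Z X"
  using K_linear_comp[OF bilinear_mapD(1)[OF assms]] K_linear_comp[OF bilinear_mapD(2)[OF assms]] by auto

lemma trilinear_comp:
  assumes "trilinear_map K U V W X f"
  shows "g \<in> K_linear K Z U \<Longrightarrow> v \<in> carrier V \<Longrightarrow> w \<in> carrier W \<Longrightarrow> (\<lambda>z. f (g z) v w) \<in> K_linear K Z X"
    and "u \<in> carrier U \<Longrightarrow> h \<in> K_linear K Z V \<Longrightarrow> w \<in> carrier W \<Longrightarrow> (\<lambda>z. f u (h z) w) \<in> K_linear K Z X"
    and "u \<in> carrier U \<Longrightarrow> v \<in> carrier V \<Longrightarrow> k \<in> K_linear K Z W \<Longrightarrow> (\<lambda>z. f u v (k z)) \<in> K_linear K Z X"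
  using K_linear_comp[OF trilinear_mapD(1)[OF assms]] K_linear_comp[OF trilinear_mapD(2)[OF assms]]
    K_linear_comp[OF trilinear_mapD(3)[OF assms]] by auto

section \<open>The universal R-matrix\<close>

context quasitriangular_hopf_algebra
begin

lemma R_closed [simp]: "R \<in> carrier (ktensor K H H)"
  and Rbar_closed [simp]: "Rbar K H R \<in> carrier (ktensor K H H)"
  and R_Rbar: "R \<otimes>\<^bsub>ktensor K H H\<^esub> Rbar K H R = ktens K H H \<one>\<^bsub>H\<^esub> \<one>\<^bsub>H\<^esub>"
  and Rbar_R: "Rbar K H R \<otimes>\<^bsub>ktensor K H H\<^esub> R = ktens K H H \<one>\<^bsub>H\<^esub> \<one>\<^bsub>H\<^esub>"
proof -
  interpret HH: assoc_algebra K "ktensor K H H" by (rule HH_algebra)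
  show "R \<in> carrier (ktensor K H H)" using R_invertible by (rule HH.B.Units_closed)
  show "Rbar K H R \<in> carrier (ktensor K H H)"
    unfolding Rbar_def using R_invertible by (rule HH.B.Units_inv_closed)
  note one = ktensor_one[OF assoc_algebra_axioms assoc_algebra_axioms]
  show "R \<otimes>\<^bsub>ktensor K H H\<^esub> Rbar K H R = ktens K H H \<one>\<^bsub>H\<^esub> \<one>\<^bsub>H\<^esub>"
    unfolding Rbar_def using R_invertible by (simp add: one[symmetric])
  show "Rbar K H R \<otimes>\<^bsub>ktensor K H H\<^esub> R = ktens K H H \<one>\<^bsub>H\<^esub> \<one>\<^bsub>H\<^esub>"
    unfolding Rbar_def using R_invertible by (simp add: one[symmetric])
qed

lemma R_Rbar_sum:
  assumes X: "module K X" and f: "bilinear_map K H H X f"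
  shows "tsum X R (\<lambda>r s. tsum X (Rbar K H R) (\<lambda>r' s'. f (r \<otimes>\<^bsub>H\<^esub> r') (s \<otimes>\<^bsub>H\<^esub> s'))) = f \<one>\<^bsub>H\<^esub> \<one>\<^bsub>H\<^esub>"
  using hsum_mult[OF X f R_closed Rbar_closed]
  by (simp add: R_Rbar ksum_ktens[OF H_module H_module X f])

lemma Rbar_R_sum:
  assumes X: "module K X" and f: "bilinear_map K H H X f"
  shows "tsum X (Rbar K H R) (\<lambda>r s. tsum X R (\<lambda>r' s'. f (r \<otimes>\<^bsub>H\<^esub> r') (s \<otimes>\<^bsub>H\<^esub> s'))) = f \<one>\<^bsub>H\<^esub> \<one>\<^bsub>H\<^esub>"
  using hsum_mult[OF X f Rbar_closed R_closed]
  by (simp add: Rbar_R ksum_ktens[OF H_module H_module X f])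

text \<open>The axiom multiplied by R from the right: R \<Delta>(x) = \<Delta>^op(x) R, which moves
  a coproduct across R instead of conjugating with it.\<close>

lemma R_comul_sum:
  assumes X: "module K X" and f: "bilinear_map K H H X f" and x: "x \<in> carrier H"
  shows "tsum X R (\<lambda>r s. tsum X (comul H x) (\<lambda>a b. f (r \<otimes>\<^bsub>H\<^esub> a) (s \<otimes>\<^bsub>H\<^esub> b)))
    = tsum X (comul H x) (\<lambda>a b. tsum X R (\<lambda>r s. f (b \<otimes>\<^bsub>H\<^esub> r) (a \<otimes>\<^bsub>H\<^esub> s)))"
proof -
  let ?HH = "ktensor K H H"
  interpret HH: assoc_algebra K ?HH by (rule HH_algebra)
  let ?op = "tsum ?HH (comul H x) (\<lambda>a b. ktens K H H b a)"
  have op: "bilinear_map K H H ?HH (\<lambda>a b. ktens K H H b a)"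
    by (intro bilinear_mapI ktens_linear_left ktens_linear_right K_linear_id H_module)
  have opc: "?op \<in> carrier ?HH" by (rule hsum_closed[OF _ _ op]) (simp_all add: x)
  have "?op \<otimes>\<^bsub>?HH\<^esub> R = R \<otimes>\<^bsub>?HH\<^esub> comul H x \<otimes>\<^bsub>?HH\<^esub> (Rbar K H R \<otimes>\<^bsub>?HH\<^esub> R)"
    by (simp add: R_comul x HH.B.m_assoc)
  also have "\<dots> = R \<otimes>\<^bsub>?HH\<^esub> comul H x"
    by (simp add: Rbar_R ktensor_one[OF assoc_algebra_axioms assoc_algebra_axioms, symmetric] x)
  finally have eq: "R \<otimes>\<^bsub>?HH\<^esub> comul H x = ?op \<otimes>\<^bsub>?HH\<^esub> R" by simp
  have "tsum X R (\<lambda>r s. tsum X (comul H x) (\<lambda>a b. f (r \<otimes>\<^bsub>H\<^esub> a) (s \<otimes>\<^bsub>H\<^esub> b))) = tsum X (?op \<otimes>\<^bsub>?HH\<^esub> R) f"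
    by (simp add: hsum_mult[OF X f] x flip: eq)
  also have "\<dots> = tsum X ?op (\<lambda>a b. tsum X R (\<lambda>r s. f (a \<otimes>\<^bsub>H\<^esub> r) (b \<otimes>\<^bsub>H\<^esub> s)))"
    by (rule hsum_mult[OF X f opc R_closed])
  also have "\<dots> = tsum X (comul H x) (\<lambda>a b. tsum X (ktens K H H b a) (\<lambda>a b. tsum X R (\<lambda>r s. f (a \<otimes>\<^bsub>H\<^esub> r) (b \<otimes>\<^bsub>H\<^esub> s))))"
    by (rule hsum_push[OF _ X _ op ksum_linear[OF H_module H_module X _ K_linear_id]];
      (intro lin bilinear_comp[OF f])?; simp add: X x bilinear_mapD[OF f])
  also have "\<dots> = tsum X (comul H x) (\<lambda>a b. tsum X R (\<lambda>r s. f (b \<otimes>\<^bsub>H\<^esub> r) (a \<otimes>\<^bsub>H\<^esub> s)))"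
    by (rule hsum_cong; (intro lin bilinear_comp[OF f])?; (rule ksum_ktens[OF H_module H_module X]; (intro lin bilinear_comp[OF f])?)?; simp add: X x bilinear_mapD[OF f])
  finally show ?thesis .
qed

text \<open>The identities (\<Delta> \<otimes> id) R = R_13 R_23 and (id \<otimes> \<Delta>) R =
  R_13 R_12, applied to a trilinear \<open>f\<close>. The units in the empty legs drop out, and a
  product survives in the leg that both factors share.\<close>

lemma comul_R_sum:
  assumes X: "module K X" and f: "trilinear_map K H H H X f"
  shows "tsum X R (\<lambda>r s. tsum X (comul H r) (\<lambda>a b. f a b s))
      = tsum X R (\<lambda>r s. tsum X R (\<lambda>r' s'. f r r' (s \<otimes>\<^bsub>H\<^esub> s')))"
    (is "_ = ?r1")
    and "tsum X R (\<lambda>r s. tsum X (comul H s) (\<lambda>a b. f r a b))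
      = tsum X R (\<lambda>r s. tsum X R (\<lambda>r' s'. f (r \<otimes>\<^bsub>H\<^esub> r') s' s))"
    (is "_ = ?r2")
proof -
  let ?HH = "ktensor K H H" and ?H3 = "ktensor3 K H"
  note fl = trilinear_comp[OF f]
  note [simp] = X trilinear_mapD(4)[OF f]
  note HA = assoc_algebra_axioms
  interpret H3: assoc_algebra K ?H3
    unfolding ktensor3_def by (intro ktensor_assoc_algebra HA HH_algebra)
  have mult: "ktens3 K H a b c \<otimes>\<^bsub>?H3\<^esub> ktens3 K H a' b' c' = ktens3 K H (a \<otimes>\<^bsub>H\<^esub> a') (b \<otimes>\<^bsub>H\<^esub> b') (c \<otimes>\<^bsub>H\<^esub> c')"
    if "a \<in> carrier H" "b \<in> carrier H" "c \<in> carrier H" "a' \<in> carrier H" "b' \<in> carrier H" "c' \<in> carrier H"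
    for a b c a' b' c'
    unfolding ktens3_def ktensor3_def using that
    by (simp add: ktensor_mult_ktens[OF HH_algebra HA] ktensor_mult_ktens[OF HA HA] ktens_closed[OF H_module H_module])
  have lin3: "(\<lambda>z. g z \<otimes>\<^bsub>?H3\<^esub> y) \<in> K_linear K Z ?H3" "(\<lambda>z. y \<otimes>\<^bsub>?H3\<^esub> g z) \<in> K_linear K Z ?H3"
    if "g \<in> K_linear K Z ?H3" "y \<in> carrier ?H3" for g y and Z :: "('k, 'z, 'zz) module_scheme"
    using assoc_algebra_mult_linear[OF H3.assoc_algebra_axioms] that by auto
  have k3: "ktens3 K H a b c \<in> carrier ?H3" if "a \<in> carrier H" "b \<in> carrier H" "c \<in> carrier H" for a b c
    unfolding ktens3_def ktensor3_def using that by (simp add: ktens_closed)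
  \<comment> \<open>Evaluates a product of two leg embeddings as a double sum, by pushing first the
    multiplication and then \<open>eval3\<close> through the sums.\<close>
  have prod: "eval3 X f (tsum ?H3 R p \<otimes>\<^bsub>?H3\<^esub> tsum ?H3 R q)
      = tsum X R (\<lambda>r s. tsum X R (\<lambda>r' s'. eval3 X f (p r s \<otimes>\<^bsub>?H3\<^esub> q r' s')))"
    if p: "bilinear_map K H H ?H3 p" and q: "bilinear_map K H H ?H3 q" for p q
  proof -
    have "tsum ?H3 R p \<otimes>\<^bsub>?H3\<^esub> tsum ?H3 R q = tsum ?H3 R (\<lambda>r s. p r s \<otimes>\<^bsub>?H3\<^esub> tsum ?H3 R q)"
      by (rule hsum_push[OF _ _ _ p lin3(1)[OF K_linear_id]]) (simp_all add: q)
    also have "eval3 X f \<dots> = tsum X R (\<lambda>r s. eval3 X f (p r s \<otimes>\<^bsub>?H3\<^esub> tsum ?H3 R q))"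
      by (rule hsum_push[OF _ _ _ _ eval3_linear[OF X f]]; (intro lin lin3 bilinear_comp[OF p])?; simp add: q)
    also have "\<dots> = tsum X R (\<lambda>r s. tsum X R (\<lambda>r' s'. eval3 X f (p r s \<otimes>\<^bsub>?H3\<^esub> q r' s')))"
    proof (rule hsum_cong)
      fix r s assume rs: "r \<in> carrier H" "s \<in> carrier H"
      have p': "p r s \<in> carrier ?H3" by (rule bilinear_mapD(3)[OF p rs])
      show "eval3 X f (p r s \<otimes>\<^bsub>?H3\<^esub> tsum ?H3 R q) = tsum X R (\<lambda>r' s'. eval3 X f (p r s \<otimes>\<^bsub>?H3\<^esub> q r' s'))"
        by (rule hsum_push[OF _ _ _ q K_linear_comp[OF eval3_linear[OF X f] lin3(2)[OF K_linear_id p']]]) simp_all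
    next
      show "bilinear_map K H H X (\<lambda>r s. tsum X R (\<lambda>r' s'. eval3 X f (p r s \<otimes>\<^bsub>?H3\<^esub> q r' s')))"
        apply (intro lin lin3 bilinear_comp[OF p] bilinear_comp[OF q] K_linear_comp[OF eval3_linear[OF X f]])
        apply (simp_all add: bilinear_mapD(3)[OF p] bilinear_mapD(3)[OF q])
        done
    qed simp_all
    finally show ?thesis .
  qed
  have "tsum X R (\<lambda>r s. tsum X (comul H r) (\<lambda>a b. f a b s)) = eval3 X f (comul_id K H R)"
    by (rule eval3_comul_id[OF X f R_closed, symmetric])
  also have "\<dots> = tsum X R (\<lambda>r s. tsum X R (\<lambda>r' s'. eval3 X f (ktens3 K H r \<one>\<^bsub>H\<^esub> s \<otimes>\<^bsub>?H3\<^esub> ktens3 K H \<one>\<^bsub>H\<^esub> r' s')))"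
    unfolding comul_id_R leg13_def leg23_def by (rule prod; (intro lin)?; simp)
  also have "\<dots> = ?r1"
    by (rule hsum_cong; (intro lin fl)?; (rule hsum_cong; (intro lin fl)?)?; simp add: mult eval3_ktens3[OF X f])
  finally show "tsum X R (\<lambda>r s. tsum X (comul H r) (\<lambda>a b. f a b s)) = ?r1" .
  have "tsum X R (\<lambda>r s. tsum X (comul H s) (\<lambda>a b. f r a b)) = eval3 X f (id_comul K H R)"
    by (rule eval3_id_comul[OF X f R_closed, symmetric])
  also have "\<dots> = tsum X R (\<lambda>r s. tsum X R (\<lambda>r' s'. eval3 X f (ktens3 K H r \<one>\<^bsub>H\<^esub> s \<otimes>\<^bsub>?H3\<^esub> ktens3 K H r' s' \<one>\<^bsub>H\<^esub>)))"
    unfolding id_comul_R leg13_def leg12_def by (rule prod; (intro lin)?; simp)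
  also have "\<dots> = ?r2"
    by (rule hsum_cong; (intro lin fl)?; (rule hsum_cong; (intro lin fl)?)?; simp add: mult eval3_ktens3[OF X f])
  finally show "tsum X R (\<lambda>r s. tsum X (comul H s) (\<lambda>a b. f r a b)) = ?r2" .
qed

section \<open>Coproduct and counit on the inverse R-matrix\<close>

abbreviation "Rb \<equiv> Rbar K H R"

text \<open>R_13 R_23 is a right inverse of \<open>(\<Delta> \<otimes> id) Rbar\<close>, and R_13
  R_12 is one of \<open>(id \<otimes> \<Delta>) Rbar\<close>: the two copies of R come from a
  coproduct on one copy, and \<Delta> is multiplicative, so the product is the image of
  \<open>Rbar R = 1\<close>.\<close>

lemma comul_Rbar_cancel:
  assumes X: "module K X" and g: "trilinear_map K H H H X g"
  shows "tsum X Rb (\<lambda>r s. tsum X (comul H r) (\<lambda>a b. tsum X R (\<lambda>u v. tsum X R (\<lambda>u' v'.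
      g (a \<otimes>\<^bsub>H\<^esub> u) (b \<otimes>\<^bsub>H\<^esub> u') (s \<otimes>\<^bsub>H\<^esub> (v \<otimes>\<^bsub>H\<^esub> v')))))) = g \<one>\<^bsub>H\<^esub> \<one>\<^bsub>H\<^esub> \<one>\<^bsub>H\<^esub>"
    and "tsum X Rb (\<lambda>r s. tsum X (comul H s) (\<lambda>a b. tsum X R (\<lambda>u v. tsum X R (\<lambda>u' v'.
      g (r \<otimes>\<^bsub>H\<^esub> (u \<otimes>\<^bsub>H\<^esub> u')) (a \<otimes>\<^bsub>H\<^esub> v') (b \<otimes>\<^bsub>H\<^esub> v))))) = g \<one>\<^bsub>H\<^esub> \<one>\<^bsub>H\<^esub> \<one>\<^bsub>H\<^esub>"
proof -
  note gl = trilinear_comp[OF g]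
  note [simp] = X trilinear_mapD(4)[OF g]
  have "tsum X Rb (\<lambda>r s. tsum X (comul H r) (\<lambda>a b. tsum X R (\<lambda>u v. tsum X R (\<lambda>u' v'.
      g (a \<otimes>\<^bsub>H\<^esub> u) (b \<otimes>\<^bsub>H\<^esub> u') (s \<otimes>\<^bsub>H\<^esub> (v \<otimes>\<^bsub>H\<^esub> v'))))))
    = tsum X Rb (\<lambda>r s. tsum X (comul H r) (\<lambda>a b. tsum X R (\<lambda>u v. tsum X (comul H u) (\<lambda>c d.
      g (a \<otimes>\<^bsub>H\<^esub> c) (b \<otimes>\<^bsub>H\<^esub> d) (s \<otimes>\<^bsub>H\<^esub> v)))))"
    by (rule hsum_cong; (intro lin gl)?; (rule hsum_cong; (intro lin gl)?)?; (rule comul_R_sum(1)[symmetric]; (intro lin gl)?)?; simp)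
  also have "\<dots> = tsum X Rb (\<lambda>r s. tsum X R (\<lambda>u v. tsum X (comul H (r \<otimes>\<^bsub>H\<^esub> u)) (\<lambda>a b. g a b (s \<otimes>\<^bsub>H\<^esub> v))))"
    by (rule hsum_cong; (intro lin gl)?; (subst hsum_swap; (intro lin gl)?)?; (rule hsum_cong; (intro lin gl)?)?;
      (rule comul_mult_sum[symmetric]; (intro lin gl)?)?; simp)
  also have "\<dots> = tsum X (comul H \<one>\<^bsub>H\<^esub>) (\<lambda>a b. g a b \<one>\<^bsub>H\<^esub>)"
    by (rule Rbar_R_sum; (intro lin gl)?; simp)
  also have "\<dots> = g \<one>\<^bsub>H\<^esub> \<one>\<^bsub>H\<^esub> \<one>\<^bsub>H\<^esub>"
    by (rule comul_one_sum; (intro lin gl)?; simp)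
  finally show "tsum X Rb (\<lambda>r s. tsum X (comul H r) (\<lambda>a b. tsum X R (\<lambda>u v. tsum X R (\<lambda>u' v'.
      g (a \<otimes>\<^bsub>H\<^esub> u) (b \<otimes>\<^bsub>H\<^esub> u') (s \<otimes>\<^bsub>H\<^esub> (v \<otimes>\<^bsub>H\<^esub> v')))))) = g \<one>\<^bsub>H\<^esub> \<one>\<^bsub>H\<^esub> \<one>\<^bsub>H\<^esub>" .
  have "tsum X Rb (\<lambda>r s. tsum X (comul H s) (\<lambda>a b. tsum X R (\<lambda>u v. tsum X R (\<lambda>u' v'.
      g (r \<otimes>\<^bsub>H\<^esub> (u \<otimes>\<^bsub>H\<^esub> u')) (a \<otimes>\<^bsub>H\<^esub> v') (b \<otimes>\<^bsub>H\<^esub> v)))))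
    = tsum X Rb (\<lambda>r s. tsum X (comul H s) (\<lambda>a b. tsum X R (\<lambda>u v. tsum X (comul H v) (\<lambda>c d.
      g (r \<otimes>\<^bsub>H\<^esub> u) (a \<otimes>\<^bsub>H\<^esub> c) (b \<otimes>\<^bsub>H\<^esub> d)))))"
    by (rule hsum_cong; (intro lin gl)?; (rule hsum_cong; (intro lin gl)?)?; (rule comul_R_sum(2)[symmetric]; (intro lin gl)?)?; simp)
  also have "\<dots> = tsum X Rb (\<lambda>r s. tsum X R (\<lambda>u v. tsum X (comul H (s \<otimes>\<^bsub>H\<^esub> v)) (\<lambda>a b. g (r \<otimes>\<^bsub>H\<^esub> u) a b)))"
    by (rule hsum_cong; (intro lin gl)?; (subst hsum_swap; (intro lin gl)?)?; (rule hsum_cong; (intro lin gl)?)?;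
      (rule comul_mult_sum[symmetric]; (intro lin gl)?)?; simp)
  also have "\<dots> = tsum X (comul H \<one>\<^bsub>H\<^esub>) (\<lambda>a b. g \<one>\<^bsub>H\<^esub> a b)"
    by (rule Rbar_R_sum; (intro lin gl)?; simp)
  also have "\<dots> = g \<one>\<^bsub>H\<^esub> \<one>\<^bsub>H\<^esub> \<one>\<^bsub>H\<^esub>"
    by (rule comul_one_sum; (intro lin gl)?; simp)
  finally show "tsum X Rb (\<lambda>r s. tsum X (comul H s) (\<lambda>a b. tsum X R (\<lambda>u v. tsum X R (\<lambda>u' v'.
      g (r \<otimes>\<^bsub>H\<^esub> (u \<otimes>\<^bsub>H\<^esub> u')) (a \<otimes>\<^bsub>H\<^esub> v') (b \<otimes>\<^bsub>H\<^esub> v))))) = g \<one>\<^bsub>H\<^esub> \<one>\<^bsub>H\<^esub> \<one>\<^bsub>H\<^esub>" .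
qed

text \<open>This is \<open>(\<Delta> \<otimes> id) Rbar = Rbar_23 Rbar_13\<close>: both sides are
  inverse to R_13 R_23, the left one by \<open>comul_Rbar_cancel\<close>.\<close>

lemma comul_Rbar_sum_left:
  assumes X: "module K X" and f: "trilinear_map K H H H X f"
  shows "tsum X Rb (\<lambda>r s. tsum X (comul H r) (\<lambda>a b. f a b s))
      = tsum X Rb (\<lambda>r s. tsum X Rb (\<lambda>r' s'. f r r' (s' \<otimes>\<^bsub>H\<^esub> s)))"
proof -
  note fl = trilinear_comp[OF f]
  note [simp] = X trilinear_mapD(4)[OF f] B.m_assoc
  \<comment> \<open>\<open>f\<close> after right multiplication by \<open>Rbar_23 Rbar_13\<close>.
    Multiplying by R_13 R_23 beforehand gives back \<open>f\<close>, so \<open>f\<close> becomes a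
    sum of values of \<open>?g\<close> to which \<open>comul_Rbar_cancel\<close> applies.\<close>
  let ?g = "\<lambda>a b c. tsum X Rb (\<lambda>r' s'. tsum X Rb (\<lambda>r s. f (a \<otimes>\<^bsub>H\<^esub> r) (b \<otimes>\<^bsub>H\<^esub> r') (c \<otimes>\<^bsub>H\<^esub> (s' \<otimes>\<^bsub>H\<^esub> s))))"
  have g: "trilinear_map K H H H X ?g"
    by (intro lin fl; simp)
  have eq: "tsum X R (\<lambda>u v. tsum X R (\<lambda>u' v'. ?g (a \<otimes>\<^bsub>H\<^esub> u) (b \<otimes>\<^bsub>H\<^esub> u') (c \<otimes>\<^bsub>H\<^esub> (v \<otimes>\<^bsub>H\<^esub> v')))) = f a b c"
    if abc [simp]: "a \<in> carrier H" "b \<in> carrier H" "c \<in> carrier H" for a b c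
  proof -
    have "tsum X R (\<lambda>u v. tsum X R (\<lambda>u' v'. ?g (a \<otimes>\<^bsub>H\<^esub> u) (b \<otimes>\<^bsub>H\<^esub> u') (c \<otimes>\<^bsub>H\<^esub> (v \<otimes>\<^bsub>H\<^esub> v'))))
      = tsum X R (\<lambda>u v. tsum X R (\<lambda>u' v'. tsum X Rb (\<lambda>r' s'. tsum X Rb (\<lambda>r s.
          f (a \<otimes>\<^bsub>H\<^esub> (u \<otimes>\<^bsub>H\<^esub> r)) (b \<otimes>\<^bsub>H\<^esub> (u' \<otimes>\<^bsub>H\<^esub> r')) (c \<otimes>\<^bsub>H\<^esub> (v \<otimes>\<^bsub>H\<^esub> ((v' \<otimes>\<^bsub>H\<^esub> s') \<otimes>\<^bsub>H\<^esub> s)))))))"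
      by (rule hsum_cong; (intro lin fl)?; (rule hsum_cong; (intro lin fl)?)?; (rule hsum_cong; (intro lin fl)?)?; (rule hsum_cong; (intro lin fl)?)?; simp)
    also have "\<dots> = tsum X R (\<lambda>u v. tsum X Rb (\<lambda>r s. f (a \<otimes>\<^bsub>H\<^esub> (u \<otimes>\<^bsub>H\<^esub> r)) (b \<otimes>\<^bsub>H\<^esub> \<one>\<^bsub>H\<^esub>) (c \<otimes>\<^bsub>H\<^esub> (v \<otimes>\<^bsub>H\<^esub> (\<one>\<^bsub>H\<^esub> \<otimes>\<^bsub>H\<^esub> s)))))"
      by (rule hsum_cong; (intro lin fl)?; (rule R_Rbar_sum[where f = "\<lambda>x y. tsum X Rb (\<lambda>r s. f (_ \<otimes>\<^bsub>H\<^esub> (_ \<otimes>\<^bsub>H\<^esub> r)) (_ \<otimes>\<^bsub>H\<^esub> x) (_ \<otimes>\<^bsub>H\<^esub> (_ \<otimes>\<^bsub>H\<^esub> (y \<otimes>\<^bsub>H\<^esub> s))))"]; (intro lin fl)?)?; simp)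
    also have "\<dots> = tsum X R (\<lambda>u v. tsum X Rb (\<lambda>r s. f (a \<otimes>\<^bsub>H\<^esub> (u \<otimes>\<^bsub>H\<^esub> r)) b (c \<otimes>\<^bsub>H\<^esub> (v \<otimes>\<^bsub>H\<^esub> s))))"
      by (rule hsum_cong; (intro lin fl)?; (rule hsum_cong; (intro lin fl)?)?; simp)
    also have "\<dots> = f (a \<otimes>\<^bsub>H\<^esub> \<one>\<^bsub>H\<^esub>) b (c \<otimes>\<^bsub>H\<^esub> \<one>\<^bsub>H\<^esub>)"
      by (rule R_Rbar_sum; (intro lin fl)?; simp)
    finally show ?thesis by simp
  qed
  have "tsum X Rb (\<lambda>r s. tsum X (comul H r) (\<lambda>a b. f a b s))
    = tsum X Rb (\<lambda>r s. tsum X (comul H r) (\<lambda>a b. tsum X R (\<lambda>u v. tsum X R (\<lambda>u' v'.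
        ?g (a \<otimes>\<^bsub>H\<^esub> u) (b \<otimes>\<^bsub>H\<^esub> u') (s \<otimes>\<^bsub>H\<^esub> (v \<otimes>\<^bsub>H\<^esub> v'))))))"
  proof (rule hsum_cong[OF X Rbar_closed, symmetric])
    show "bilinear_map K H H X (\<lambda>r s. tsum X (comul H r) (\<lambda>a b. f a b s))" by (intro lin fl; simp)
  qed (rule hsum_cong; (intro lin fl)?; (rule eq)?; simp)
  also have "\<dots> = ?g \<one>\<^bsub>H\<^esub> \<one>\<^bsub>H\<^esub> \<one>\<^bsub>H\<^esub>"
    by (rule comul_Rbar_cancel(1)[OF X g])
  also have "\<dots> = tsum X Rb (\<lambda>r' s'. tsum X Rb (\<lambda>r s. f r r' (s' \<otimes>\<^bsub>H\<^esub> s)))"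
    by (rule hsum_cong; (intro lin fl)?; (rule hsum_cong; (intro lin fl)?)?; simp)
  also have "\<dots> = tsum X Rb (\<lambda>r s. tsum X Rb (\<lambda>r' s'. f r r' (s' \<otimes>\<^bsub>H\<^esub> s)))"
    by (rule hsum_swap; (intro lin fl)?; simp)
  finally show ?thesis .
qed

text \<open>This is \<open>(id \<otimes> \<Delta>) Rbar = Rbar_12 Rbar_13\<close>, obtained in the
  same way from R_13 R_12.\<close>

lemma comul_Rbar_sum_right:
  assumes X: "module K X" and f: "trilinear_map K H H H X f"
  shows "tsum X Rb (\<lambda>r s. tsum X (comul H s) (\<lambda>a b. f r a b))
      = tsum X Rb (\<lambda>r s. tsum X Rb (\<lambda>r' s'. f (r \<otimes>\<^bsub>H\<^esub> r') s s'))"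
proof -
  note fl = trilinear_comp[OF f]
  note [simp] = X trilinear_mapD(4)[OF f] B.m_assoc
  let ?g = "\<lambda>a b c. tsum X Rb (\<lambda>r s. tsum X Rb (\<lambda>r' s'. f (a \<otimes>\<^bsub>H\<^esub> (r \<otimes>\<^bsub>H\<^esub> r')) (b \<otimes>\<^bsub>H\<^esub> s) (c \<otimes>\<^bsub>H\<^esub> s')))"
  have g: "trilinear_map K H H H X ?g"
    by (intro lin fl; simp)
  have eq: "tsum X R (\<lambda>u v. tsum X R (\<lambda>u' v'. ?g (a \<otimes>\<^bsub>H\<^esub> (u \<otimes>\<^bsub>H\<^esub> u')) (b \<otimes>\<^bsub>H\<^esub> v') (c \<otimes>\<^bsub>H\<^esub> v))) = f a b c"
    if abc [simp]: "a \<in> carrier H" "b \<in> carrier H" "c \<in> carrier H" for a b c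
  proof -
    have "tsum X R (\<lambda>u v. tsum X R (\<lambda>u' v'. ?g (a \<otimes>\<^bsub>H\<^esub> (u \<otimes>\<^bsub>H\<^esub> u')) (b \<otimes>\<^bsub>H\<^esub> v') (c \<otimes>\<^bsub>H\<^esub> v)))
      = tsum X R (\<lambda>u v. tsum X R (\<lambda>u' v'. tsum X Rb (\<lambda>r s. tsum X Rb (\<lambda>r' s'.
          f (a \<otimes>\<^bsub>H\<^esub> (u \<otimes>\<^bsub>H\<^esub> ((u' \<otimes>\<^bsub>H\<^esub> r) \<otimes>\<^bsub>H\<^esub> r'))) (b \<otimes>\<^bsub>H\<^esub> (v' \<otimes>\<^bsub>H\<^esub> s)) (c \<otimes>\<^bsub>H\<^esub> (v \<otimes>\<^bsub>H\<^esub> s'))))))"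
      by (rule hsum_cong; (intro lin fl)?; (rule hsum_cong; (intro lin fl)?)?; (rule hsum_cong; (intro lin fl)?)?; (rule hsum_cong; (intro lin fl)?)?; simp)
    also have "\<dots> = tsum X R (\<lambda>u v. tsum X Rb (\<lambda>r' s'. f (a \<otimes>\<^bsub>H\<^esub> (u \<otimes>\<^bsub>H\<^esub> (\<one>\<^bsub>H\<^esub> \<otimes>\<^bsub>H\<^esub> r'))) (b \<otimes>\<^bsub>H\<^esub> \<one>\<^bsub>H\<^esub>) (c \<otimes>\<^bsub>H\<^esub> (v \<otimes>\<^bsub>H\<^esub> s'))))"
      by (rule hsum_cong; (intro lin fl)?; (rule R_Rbar_sum[where f = "\<lambda>x y. tsum X Rb (\<lambda>r' s'. f (_ \<otimes>\<^bsub>H\<^esub> (_ \<otimes>\<^bsub>H\<^esub> (x \<otimes>\<^bsub>H\<^esub> r'))) (_ \<otimes>\<^bsub>H\<^esub> y) (_ \<otimes>\<^bsub>H\<^esub> (_ \<otimes>\<^bsub>H\<^esub> s')))"]; (intro lin fl)?)?; simp)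
    also have "\<dots> = tsum X R (\<lambda>u v. tsum X Rb (\<lambda>r s. f (a \<otimes>\<^bsub>H\<^esub> (u \<otimes>\<^bsub>H\<^esub> r)) b (c \<otimes>\<^bsub>H\<^esub> (v \<otimes>\<^bsub>H\<^esub> s))))"
      by (rule hsum_cong; (intro lin fl)?; (rule hsum_cong; (intro lin fl)?)?; simp)
    also have "\<dots> = f (a \<otimes>\<^bsub>H\<^esub> \<one>\<^bsub>H\<^esub>) b (c \<otimes>\<^bsub>H\<^esub> \<one>\<^bsub>H\<^esub>)"
      by (rule R_Rbar_sum; (intro lin fl)?; simp)
    finally show ?thesis by simp
  qed
  have "tsum X Rb (\<lambda>r s. tsum X (comul H s) (\<lambda>a b. f r a b))
    = tsum X Rb (\<lambda>r s. tsum X (comul H s) (\<lambda>a b. tsum X R (\<lambda>u v. tsum X R (\<lambda>u' v'.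
        ?g (r \<otimes>\<^bsub>H\<^esub> (u \<otimes>\<^bsub>H\<^esub> u')) (a \<otimes>\<^bsub>H\<^esub> v') (b \<otimes>\<^bsub>H\<^esub> v)))))"
  proof (rule hsum_cong[OF X Rbar_closed, symmetric])
    show "bilinear_map K H H X (\<lambda>r s. tsum X (comul H s) (\<lambda>a b. f r a b))" by (intro lin fl; simp)
  qed (rule hsum_cong; (intro lin fl)?; (rule eq)?; simp)
  also have "\<dots> = ?g \<one>\<^bsub>H\<^esub> \<one>\<^bsub>H\<^esub> \<one>\<^bsub>H\<^esub>"
    by (rule comul_Rbar_cancel(2)[OF X g])
  also have "\<dots> = tsum X Rb (\<lambda>r s. tsum X Rb (\<lambda>r' s'. f (r \<otimes>\<^bsub>H\<^esub> r') s s'))"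
    by (rule hsum_cong; (intro lin fl)?; (rule hsum_cong; (intro lin fl)?)?; simp)
  finally show ?thesis .
qed

text \<open>The counit on the middle leg of
  \<open>(id \<otimes> \<Delta>) Rbar = Rbar_12 Rbar_13\<close> shows that multiplying
  \<open>Rbar\<close> from the left by the element \<open>(id \<otimes> \<epsilon>) Rbar\<close> in
  the first leg changes nothing. As \<open>Rbar\<close> is invertible, this element is 1.\<close>

lemma counit_Rbar_sum:
  assumes X: "module K X" and f: "f \<in> K_linear K H X"
  shows "tsum X Rb (\<lambda>r s. counit H s \<odot>\<^bsub>X\<^esub> f r) = f \<one>\<^bsub>H\<^esub>"
proof -
  interpret X: module K X by (rule X)
  note [simp] = X K_linear_closed[OF f] B.m_assoc
  note fl = K_linear_comp[OF f]
  have eps: "counit H (a \<otimes>\<^bsub>H\<^esub> b) \<odot>\<^bsub>X\<^esub> x = counit H a \<odot>\<^bsub>X\<^esub> (counit H b \<odot>\<^bsub>X\<^esub> x)"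
    if "a \<in> carrier H" "b \<in> carrier H" "x \<in> carrier X" for a b x
    using that by (simp add: ring_hom_mult[OF counit_hom] X.smult_assoc1)
  \<comment> \<open>Multiplies by R on the right and applies the counit to the second leg; this R
    cancels the surplus copy of \<open>Rbar\<close> at the end.\<close>
  let ?h = "\<lambda>a c. tsum X R (\<lambda>u v. counit H (c \<otimes>\<^bsub>H\<^esub> v) \<odot>\<^bsub>X\<^esub> f (a \<otimes>\<^bsub>H\<^esub> u))"
  have h: "bilinear_map K H H X ?h" by (intro lin fl; simp)
  note hl = bilinear_comp[OF h]
  have "f \<one>\<^bsub>H\<^esub> = counit H \<one>\<^bsub>H\<^esub> \<odot>\<^bsub>X\<^esub> f \<one>\<^bsub>H\<^esub>" by simp
  also have "\<dots> = tsum X Rb (\<lambda>r s. ?h r s)"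
    by (rule Rbar_R_sum[symmetric, where f = "\<lambda>u v. counit H v \<odot>\<^bsub>X\<^esub> f u"]; (intro lin fl)?; simp)
  also have "\<dots> = tsum X Rb (\<lambda>r s. tsum X (comul H s) (\<lambda>a b. counit H a \<odot>\<^bsub>X\<^esub> ?h r b))"
    by (rule hsum_cong; (intro lin hl)?; (rule counit_left_sum[symmetric]; (intro lin hl)?)?; (rule X bilinear_mapD(3)[OF h])?; simp)
  also have "\<dots> = tsum X Rb (\<lambda>r s. tsum X Rb (\<lambda>r' s'. counit H s \<odot>\<^bsub>X\<^esub> ?h (r \<otimes>\<^bsub>H\<^esub> r') s'))"
    by (rule comul_Rbar_sum_right; (intro lin hl)?; (rule X bilinear_mapD(3)[OF h])?; simp)
  also have "\<dots> = tsum X Rb (\<lambda>r s. counit H s \<odot>\<^bsub>X\<^esub> f r)"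
  proof (rule hsum_cong)
    fix r s assume rs [simp]: "r \<in> carrier H" "s \<in> carrier H"
    have "tsum X Rb (\<lambda>r' s'. counit H s \<odot>\<^bsub>X\<^esub> ?h (r \<otimes>\<^bsub>H\<^esub> r') s')
      = tsum X Rb (\<lambda>r' s'. tsum X R (\<lambda>u v. counit H s \<odot>\<^bsub>X\<^esub> (counit H (s' \<otimes>\<^bsub>H\<^esub> v) \<odot>\<^bsub>X\<^esub> f (r \<otimes>\<^bsub>H\<^esub> (r' \<otimes>\<^bsub>H\<^esub> u)))))"
      by (rule hsum_cong; (intro lin fl)?; (subst hsum_push[where g = "\<lambda>x. counit H s \<odot>\<^bsub>X\<^esub> x" and Y = X]; (intro lin fl)?)?; (rule hsum_cong; (intro lin fl)?)?; simp)
    also have "\<dots> = counit H s \<odot>\<^bsub>X\<^esub> (counit H \<one>\<^bsub>H\<^esub> \<odot>\<^bsub>X\<^esub> f (r \<otimes>\<^bsub>H\<^esub> \<one>\<^bsub>H\<^esub>))"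
      by (rule Rbar_R_sum[where f = "\<lambda>a b. counit H s \<odot>\<^bsub>X\<^esub> (counit H b \<odot>\<^bsub>X\<^esub> f (r \<otimes>\<^bsub>H\<^esub> a))"]; (intro lin fl)?; simp)
    finally show "tsum X Rb (\<lambda>r' s'. counit H s \<odot>\<^bsub>X\<^esub> ?h (r \<otimes>\<^bsub>H\<^esub> r') s') = counit H s \<odot>\<^bsub>X\<^esub> f r" by simp
  next
    show "bilinear_map K H H X (\<lambda>r s. counit H s \<odot>\<^bsub>X\<^esub> f r)" by (intro lin fl; simp)
  qed simp_all
  finally show ?thesis by simp
qed

end

section \<open>The adjoint action on linear maps\<close>

context hopf_algebra
begin

lemma antipode_one [simp]: "antipode H \<one>\<^bsub>H\<^esub> = \<one>\<^bsub>H\<^esub>"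
proof -
  have "bilinear_map K H H H (\<lambda>a b. antipode H a \<otimes>\<^bsub>H\<^esub> b)" by (intro lin; simp)
  from comul_one_sum[OF H_module this] show ?thesis
    using antipode_left_sum[OF H_module K_linear_id, of "\<one>\<^bsub>H\<^esub>"] by simp
qed

text \<open>In Sweedler notation, x_1 \<otimes> x_2 S(x_3) = x \<otimes> 1 and x_1 \<otimes> S(x_2)
  x_3 = x \<otimes> 1. The second shows below that \<open>badj\<close> solves its convolution
  equation, the first that the solution is unique.\<close>

lemma antipode_cancel:
  assumes X: "module K X" and f: "bilinear_map K H H X f" and x: "x \<in> carrier H"
  shows "tsum X (comul H x) (\<lambda>a s. tsum X (comul H a) (\<lambda>a b. f a (b \<otimes>\<^bsub>H\<^esub> antipode H s))) = f x \<one>\<^bsub>H\<^esub>"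
    and "tsum X (comul H x) (\<lambda>a b. tsum X (comul H a) (\<lambda>a s. f a (antipode H s \<otimes>\<^bsub>H\<^esub> b))) = f x \<one>\<^bsub>H\<^esub>"
proof -
  note fl = bilinear_comp[OF f]
  note [simp] = X bilinear_mapD(3)[OF f] x
  have "tsum X (comul H x) (\<lambda>a s. tsum X (comul H a) (\<lambda>a b. f a (b \<otimes>\<^bsub>H\<^esub> antipode H s)))
    = tsum X (comul H x) (\<lambda>a y. tsum X (comul H y) (\<lambda>b s. f a (b \<otimes>\<^bsub>H\<^esub> antipode H s)))"
    by (rule coassoc_sum; (intro lin fl)?; simp)
  also have "\<dots> = tsum X (comul H x) (\<lambda>a y. counit H y \<odot>\<^bsub>X\<^esub> f a \<one>\<^bsub>H\<^esub>)"
    by (rule hsum_cong; (intro lin fl)?; (rule antipode_right_sum; (intro lin fl)?)?; simp)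
  also have "\<dots> = f x \<one>\<^bsub>H\<^esub>"
    by (rule counit_right_sum; (intro lin fl)?; simp)
  finally show "tsum X (comul H x) (\<lambda>a s. tsum X (comul H a) (\<lambda>a b. f a (b \<otimes>\<^bsub>H\<^esub> antipode H s))) = f x \<one>\<^bsub>H\<^esub>" .
  have "tsum X (comul H x) (\<lambda>a b. tsum X (comul H a) (\<lambda>a s. f a (antipode H s \<otimes>\<^bsub>H\<^esub> b)))
    = tsum X (comul H x) (\<lambda>a y. tsum X (comul H y) (\<lambda>s b. f a (antipode H s \<otimes>\<^bsub>H\<^esub> b)))"
    by (rule coassoc_sum; (intro lin fl)?; simp)
  also have "\<dots> = tsum X (comul H x) (\<lambda>a y. counit H y \<odot>\<^bsub>X\<^esub> f a \<one>\<^bsub>H\<^esub>)"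
    by (rule hsum_cong; (intro lin fl)?; (rule antipode_left_sum; (intro lin fl)?)?; simp)
  also have "\<dots> = f x \<one>\<^bsub>H\<^esub>"
    by (rule counit_right_sum; (intro lin fl)?; simp)
  finally show "tsum X (comul H x) (\<lambda>a b. tsum X (comul H a) (\<lambda>a s. f a (antipode H s \<otimes>\<^bsub>H\<^esub> b))) = f x \<one>\<^bsub>H\<^esub>" .
qed

lemma H_module_module [simp]: "H_module K H V \<Longrightarrow> module K V"
  by (rule H_module.axioms)

lemma act_closed' [simp]: "H_module K H V \<Longrightarrow> x \<in> carrier H \<Longrightarrow> v \<in> carrier V \<Longrightarrow> act V x v \<in> carrier V"
  by (rule H_module.act_closed)

lemma act_linear_left [lin]:
  assumes V: "H_module K H V" and f: "f \<in> K_linear K Z H" and v: "v \<in> carrier V"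
  shows "(\<lambda>z. act V (f z) v) \<in> K_linear K Z V"
proof -
  interpret H_module K H V by (rule V)
  have "(\<lambda>x. act V x v) \<in> K_linear K H V"
    using v by (intro K_linearI) (simp_all add: act_closed act_add_left act_smult_left)
  then show ?thesis by (rule K_linear_comp[OF _ f])
qed

lemma act_linear_right [lin]:
  assumes V: "H_module K H V" and x: "x \<in> carrier H" and f: "f \<in> K_linear K Z V"
  shows "(\<lambda>z. act V x (f z)) \<in> K_linear K Z V"
proof -
  interpret H_module K H V by (rule V)
  have "act V x \<in> K_linear K V V"
    using x by (intro K_linearI) (simp_all add: act_closed act_add_right act_smult_right)
  then show ?thesis by (rule K_linear_comp[OF _ f])
qed

lemma act_mult': "H_module K H V \<Longrightarrow> x \<in> carrier H \<Longrightarrow> y \<in> carrier H \<Longrightarrow> v \<in> carrier V \<Longrightarrow> act V (x \<otimes>\<^bsub>H\<^esub> y) v = act V x (act V y v)"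
  by (rule H_module.act_mult)

lemma act_one' [simp]: "H_module K H V \<Longrightarrow> v \<in> carrier V \<Longrightarrow> act V \<one>\<^bsub>H\<^esub> v = v"
  by (rule H_module.act_one)

section \<open>The adjoint action and its convolution equation\<close>

context
  fixes M :: "('k, 'h, 'v, 'm1) hmod_scheme" and N :: "('k, 'h, 'w, 'm2) hmod_scheme" and Q
  assumes M [simp]: "H_module K H M" and N [simp]: "H_module K H N" and Q: "Q \<in> K_linear K M N"
begin

private lemmas Q_lin = K_linear_comp[OF Q]
private lemmas Q_cl = K_linear_closed[OF Q]

lemma badj_linear_left: "f \<in> K_linear K Z H \<Longrightarrow> m \<in> carrier M \<Longrightarrow> (\<lambda>z. badj H M N (f z) Q m) \<in> K_linear K Z N"
  unfolding badj_def by (intro lin Q_lin; simp add: Q_cl)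

lemma badj_linear_right: "module K Z \<Longrightarrow> x \<in> carrier H \<Longrightarrow> f \<in> K_linear K Z M \<Longrightarrow> (\<lambda>z. badj H M N x Q (f z)) \<in> K_linear K Z N"
  unfolding badj_def by (intro lin Q_lin; simp add: K_linear_closed Q_cl)

lemma badj_linear: "x \<in> carrier H \<Longrightarrow> badj H M N x Q \<in> K_linear K M N"
  by (rule badj_linear_right[OF _ _ K_linear_id]) simp_all

lemma badj_closed: "x \<in> carrier H \<Longrightarrow> m \<in> carrier M \<Longrightarrow> badj H M N x Q m \<in> carrier N"
  by (rule K_linear_closed[OF badj_linear])

text \<open>The adjoint action is the only family \<open>P\<close> with P(x_1)(x_2 m) = x Q(m),
  because the antipode can cancel x_2. Most later formulas for \<open>badj\<close> are proved by
  checking this equation, in which the antipode does not occur.\<close>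

lemma badj_unique:
  assumes P: "\<And>m. m \<in> carrier M \<Longrightarrow> (\<lambda>x. P x m) \<in> K_linear K H N"
      "\<And>x. x \<in> carrier H \<Longrightarrow> (\<lambda>m. P x m) \<in> K_linear K M N"
    and eq: "\<And>x m. x \<in> carrier H \<Longrightarrow> m \<in> carrier M \<Longrightarrow> tsum N (comul H x) (\<lambda>a b. P a (act M b m)) = act N x (Q m)"
    and x [simp]: "x \<in> carrier H" and m [simp]: "m \<in> carrier M"
  shows "badj H M N x Q m = P x m"
proof -
  have Pb: "bilinear_map K H M N P" by (intro bilinear_mapI P)
  note Pl = bilinear_comp[OF Pb]
  have "badj H M N x Q m = tsum N (comul H x) (\<lambda>a s. tsum N (comul H a) (\<lambda>a b. P a (act M (b \<otimes>\<^bsub>H\<^esub> antipode H s) m)))"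
    unfolding badj_def
  proof (rule hsum_cong)
    fix a s assume as [simp]: "a \<in> carrier H" "s \<in> carrier H"
    have "act N a (Q (act M (antipode H s) m)) = tsum N (comul H a) (\<lambda>a b. P a (act M b (act M (antipode H s) m)))"
      by (rule eq[symmetric]) simp_all
    also have "\<dots> = tsum N (comul H a) (\<lambda>a b. P a (act M (b \<otimes>\<^bsub>H\<^esub> antipode H s) m))"
      by (rule hsum_cong; (intro lin Pl)?; simp add: act_mult'[OF M])
    finally show "act N a (Q (act M (antipode H s) m)) = tsum N (comul H a) (\<lambda>a b. P a (act M (b \<otimes>\<^bsub>H\<^esub> antipode H s) m))" .
  next
    show "bilinear_map K H H N (\<lambda>a s. tsum N (comul H a) (\<lambda>a b. P a (act M (b \<otimes>\<^bsub>H\<^esub> antipode H s) m)))"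
      by (intro lin Pl; simp add: bilinear_mapD(3)[OF Pb])
  qed simp_all
  also have "\<dots> = P x (act M \<one>\<^bsub>H\<^esub> m)"
    by (rule antipode_cancel(1); (intro lin Pl)?; simp)
  finally show ?thesis by simp
qed

text \<open>The definition gives x_1 Q(S(x_2) x_3 m), and the last two legs cancel.\<close>

lemma badj_conv:
  assumes x [simp]: "x \<in> carrier H" and m [simp]: "m \<in> carrier M"
  shows "tsum N (comul H x) (\<lambda>a b. badj H M N a Q (act M b m)) = act N x (Q m)"
proof -
  have "tsum N (comul H x) (\<lambda>a b. badj H M N a Q (act M b m))
    = tsum N (comul H x) (\<lambda>a b. tsum N (comul H a) (\<lambda>a s. act N a (Q (act M (antipode H s \<otimes>\<^bsub>H\<^esub> b) m))))"
    unfolding badj_def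
    by (rule hsum_cong; (intro lin Q_lin)?; (rule hsum_cong; (intro lin Q_lin)?)?; simp add: Q_cl act_mult'[OF M])
  also have "\<dots> = act N x (Q (act M \<one>\<^bsub>H\<^esub> m))"
    by (rule antipode_cancel(2); (intro lin Q_lin)?; simp add: Q_cl)
  finally show ?thesis by simp
qed

lemma badj_one: "m \<in> carrier M \<Longrightarrow> badj H M N \<one>\<^bsub>H\<^esub> Q m = Q m"
  unfolding badj_def by (subst comul_one_sum; (intro lin Q_lin)?; simp add: Q_cl)

text \<open>For an equivariant \<open>Q\<close> the family \<epsilon>(x) Q solves the convolution
  equation.\<close>

lemma badj_equivariant:
  assumes eq: "\<And>x m. x \<in> carrier H \<Longrightarrow> m \<in> carrier M \<Longrightarrow> Q (act M x m) = act N x (Q m)"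
    and x: "x \<in> carrier H" and m: "m \<in> carrier M"
  shows "badj H M N x Q m = counit H x \<odot>\<^bsub>N\<^esub> Q m"
proof (rule badj_unique[OF _ _ _ x m])
  fix x m assume xm [simp]: "x \<in> carrier H" "m \<in> carrier M"
  show "tsum N (comul H x) (\<lambda>a b. counit H a \<odot>\<^bsub>N\<^esub> Q (act M b m)) = act N x (Q m)"
    by (subst counit_left_sum; (intro lin Q_lin)?; simp add: Q_cl eq)
qed (intro lin Q_lin; simp add: Q_cl)+

end

context
  fixes M :: "('k, 'h, 'v, 'm1) hmod_scheme" and N :: "('k, 'h, 'w, 'm2) hmod_scheme" and Q
  assumes M [simp]: "H_module K H M" and N [simp]: "H_module K H N" and Q: "Q \<in> K_linear K M N"
begin

private lemmas Q_comp = K_linear_comp[OF Q]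
private lemmas badj_lin = badj_linear_left[OF M N Q] badj_linear_right[OF M N Q]
private lemmas badj_cl = K_linear_closed[OF Q] badj_closed[OF M N Q]

text \<open>Write the adjoint action of y as y_1 Q(S(y_2) m) and apply \<open>badj_conv\<close> to x
  y_1. This produces y_2 S(y_3), which cancels.\<close>

lemma act_badj:
  assumes x [simp]: "x \<in> carrier H" and y [simp]: "y \<in> carrier H" and m [simp]: "m \<in> carrier M"
  shows "act N x (badj H M N y Q m) = tsum N (comul H x) (\<lambda>a b. badj H M N (a \<otimes>\<^bsub>H\<^esub> y) Q (act M b m))"
proof -
  note [simp] = badj_cl
  have "act N x (badj H M N y Q m) = tsum N (comul H y) (\<lambda>b t. act N x (act N b (Q (act M (antipode H t) m))))"
    unfolding badj_def
    by (rule hsum_push[OF _ _ _ _ act_linear_right[OF N x K_linear_id]]; (intro lin Q_comp)?; simp)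
  also have "\<dots> = tsum N (comul H y) (\<lambda>b t. tsum N (comul H x) (\<lambda>c d. tsum N (comul H b) (\<lambda>e f.
      badj H M N (c \<otimes>\<^bsub>H\<^esub> e) Q (act M d (act M (f \<otimes>\<^bsub>H\<^esub> antipode H t) m)))))"
  proof (rule hsum_cong)
    fix b t assume bt [simp]: "b \<in> carrier H" "t \<in> carrier H"
    have "act N x (act N b (Q (act M (antipode H t) m))) = act N (x \<otimes>\<^bsub>H\<^esub> b) (Q (act M (antipode H t) m))"
      by (simp add: act_mult'[OF N])
    also have "\<dots> = tsum N (comul H (x \<otimes>\<^bsub>H\<^esub> b)) (\<lambda>c d. badj H M N c Q (act M d (act M (antipode H t) m)))"
      by (rule badj_conv[OF M N Q, symmetric]) simp_all
    also have "\<dots> = tsum N (comul H x) (\<lambda>c d. tsum N (comul H b) (\<lambda>e f.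
        badj H M N (c \<otimes>\<^bsub>H\<^esub> e) Q (act M (d \<otimes>\<^bsub>H\<^esub> f) (act M (antipode H t) m))))"
      by (rule comul_mult_sum; (intro lin badj_lin)?; simp)
    also have "\<dots> = tsum N (comul H x) (\<lambda>c d. tsum N (comul H b) (\<lambda>e f.
        badj H M N (c \<otimes>\<^bsub>H\<^esub> e) Q (act M d (act M (f \<otimes>\<^bsub>H\<^esub> antipode H t) m))))"
      by (rule hsum_cong; (intro lin badj_lin)?; (rule hsum_cong; (intro lin badj_lin)?)?; simp add: act_mult'[OF M])
    finally show "act N x (act N b (Q (act M (antipode H t) m))) = \<dots>" .
  next
    show "bilinear_map K H H N (\<lambda>b t. tsum N (comul H x) (\<lambda>c d. tsum N (comul H b) (\<lambda>e f.
      badj H M N (c \<otimes>\<^bsub>H\<^esub> e) Q (act M d (act M (f \<otimes>\<^bsub>H\<^esub> antipode H t) m)))))"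
      by (intro lin badj_lin; simp)
  qed simp_all
  also have "\<dots> = tsum N (comul H x) (\<lambda>c d. tsum N (comul H y) (\<lambda>b t. tsum N (comul H b) (\<lambda>e f.
      badj H M N (c \<otimes>\<^bsub>H\<^esub> e) Q (act M d (act M (f \<otimes>\<^bsub>H\<^esub> antipode H t) m)))))"
    by (rule hsum_swap; (intro lin badj_lin)?; simp)
  also have "\<dots> = tsum N (comul H x) (\<lambda>c d. badj H M N (c \<otimes>\<^bsub>H\<^esub> y) Q (act M d (act M \<one>\<^bsub>H\<^esub> m)))"
    by (rule hsum_cong; (intro lin badj_lin)?; (rule antipode_cancel(1); (intro lin badj_lin)?)?; simp)
  finally show ?thesis by simp
qed

text \<open>\<open>act_badj\<close> is exactly the convolution equation for the map
  \<open>badj H M N y Q\<close>, so uniqueness applies.\<close>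

lemma badj_mult:
  assumes x: "x \<in> carrier H" and y [simp]: "y \<in> carrier H" and m: "m \<in> carrier M"
  shows "badj H M N x (badj H M N y Q) m = badj H M N (x \<otimes>\<^bsub>H\<^esub> y) Q m"
  by (rule badj_unique[OF M N badj_linear[OF M N Q y] _ _ _ x m])
    (intro lin badj_lin act_badj[symmetric]; simp add: badj_cl)+

end

text \<open>Coassociativity splits the convolution equation of the composite into that of
  \<open>Q\<close> inside that of \<open>P\<close>. The intended composite is a curvature, a
  connection followed by its extension.\<close>

lemma badj_comp:
  assumes M [simp]: "H_module K H M" and N [simp]: "H_module K H N" and L [simp]: "H_module K H L"
    and Q: "Q \<in> K_linear K M N" and P: "P \<in> K_linear K N L"
    and x: "x \<in> carrier H" and m: "m \<in> carrier M"
  shows "badj H M L x (\<lambda>m. P (Q m)) m = tsum L (comul H x) (\<lambda>a b. badj H N L a P (badj H M N b Q m))"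
proof -
  note badj_lin = badj_linear_left[OF M N Q] badj_linear_right[OF M N Q]
    badj_linear_left[OF N L P] badj_linear_right[OF N L P]
  note [simp] = K_linear_closed[OF Q] badj_closed[OF M N Q] badj_closed[OF N L P]
  show ?thesis
  proof (rule badj_unique[OF M L K_linear_comp[OF P Q] _ _ _ x m])
    fix x m assume [simp]: "x \<in> carrier H" "m \<in> carrier M"
    have "tsum L (comul H x) (\<lambda>a c. tsum L (comul H a) (\<lambda>a b. badj H N L a P (badj H M N b Q (act M c m))))
      = tsum L (comul H x) (\<lambda>a y. tsum L (comul H y) (\<lambda>b c. badj H N L a P (badj H M N b Q (act M c m))))"
      by (rule coassoc_sum; (intro lin badj_lin)?; simp)
    also have "\<dots> = tsum L (comul H x) (\<lambda>a y. badj H N L a P (act N y (Q m)))"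
    proof (rule hsum_cong)
      fix a y assume [simp]: "a \<in> carrier H" "y \<in> carrier H"
      have "tsum L (comul H y) (\<lambda>b c. badj H N L a P (badj H M N b Q (act M c m)))
        = badj H N L a P (tsum N (comul H y) (\<lambda>b c. badj H M N b Q (act M c m)))"
        by (rule hsum_push[OF _ _ _ _ badj_linear[OF N L P], symmetric]; (intro lin badj_lin)?; simp)
      then show "tsum L (comul H y) (\<lambda>b c. badj H N L a P (badj H M N b Q (act M c m))) = badj H N L a P (act N y (Q m))"
        by (simp add: badj_conv[OF M N Q])
    qed ((intro lin badj_lin)?; simp)+
    also have "\<dots> = act L x (P (Q m))" by (rule badj_conv[OF N L P]) simp_all
    finally show "tsum L (comul H x) (\<lambda>a c. tsum L (comul H a) (\<lambda>a b. badj H N L a P (badj H M N b Q (act M c m)))) = act L x (P (Q m))" .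
  qed (intro lin badj_lin; simp)+
qed

end

context quasitriangular_hopf_algebra
begin

text \<open>The operator form of \<open>R\<^sub>1 \<otimes> (R\<^sub>2 \<rhd> \<sigma>(Q)) = R\<^sub>1 \<otimes> Q \<circ> (R\<^sub>2 \<rhd>)\<close> with the inverse R-matrix acting by the adjoint
  action: it lets the braiding pass through a map that is not equivariant.\<close>

lemma R_act_Rbar_badj_sum:
  assumes M [simp]: "H_module K H M" and N [simp]: "H_module K H N" and Q: "Q \<in> K_linear K M N"
    and X [simp]: "module K X" and f: "bilinear_map K H N X f" and m [simp]: "m \<in> carrier M"
  shows "tsum X Rb (\<lambda>r s. tsum X R (\<lambda>r' s'. f (r' \<otimes>\<^bsub>H\<^esub> r) (act N s' (badj H M N s Q m))))
    = tsum X R (\<lambda>r s. f r (Q (act M s m)))"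
proof -
  note badj_lin = badj_linear_left[OF M N Q] badj_linear_right[OF M N Q] bilinear_comp[OF f] K_linear_comp[OF Q]
  note [simp] = K_linear_closed[OF Q] badj_closed[OF M N Q] bilinear_mapD(3)[OF f] B.m_assoc
  have "tsum X Rb (\<lambda>r s. tsum X R (\<lambda>r' s'. f (r' \<otimes>\<^bsub>H\<^esub> r) (act N s' (badj H M N s Q m))))
    = tsum X Rb (\<lambda>r s. tsum X R (\<lambda>r1 s1. tsum X R (\<lambda>r2 s2. f (r1 \<otimes>\<^bsub>H\<^esub> (r2 \<otimes>\<^bsub>H\<^esub> r)) (badj H M N (s2 \<otimes>\<^bsub>H\<^esub> s) Q (act M s1 m)))))"
  proof (rule hsum_cong)
    fix r s assume [simp]: "r \<in> carrier H" "s \<in> carrier H"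
    have "tsum X R (\<lambda>r' s'. f (r' \<otimes>\<^bsub>H\<^esub> r) (act N s' (badj H M N s Q m)))
      = tsum X R (\<lambda>r' s'. tsum X (comul H s') (\<lambda>c d. f (r' \<otimes>\<^bsub>H\<^esub> r) (badj H M N (c \<otimes>\<^bsub>H\<^esub> s) Q (act M d m))))"
    proof (rule hsum_cong)
      fix r' s' assume [simp]: "r' \<in> carrier H" "s' \<in> carrier H"
      have rr: "r' \<otimes>\<^bsub>H\<^esub> r \<in> carrier H" by simp
      show "f (r' \<otimes>\<^bsub>H\<^esub> r) (act N s' (badj H M N s Q m))
        = tsum X (comul H s') (\<lambda>c d. f (r' \<otimes>\<^bsub>H\<^esub> r) (badj H M N (c \<otimes>\<^bsub>H\<^esub> s) Q (act M d m)))"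
        unfolding act_badj[OF M N Q \<open>s' \<in> carrier H\<close> \<open>s \<in> carrier H\<close> m]
        by (rule hsum_push[OF _ _ _ _ bilinear_mapD(2)[OF f rr]]; (intro lin badj_lin)?; simp)
    qed ((intro lin badj_lin)?; simp)+
    also have "\<dots> = tsum X R (\<lambda>r1 s1. tsum X R (\<lambda>r2 s2. f ((r1 \<otimes>\<^bsub>H\<^esub> r2) \<otimes>\<^bsub>H\<^esub> r) (badj H M N (s2 \<otimes>\<^bsub>H\<^esub> s) Q (act M s1 m))))"
      by (rule comul_R_sum(2); (intro lin badj_lin)?; simp)
    also have "\<dots> = tsum X R (\<lambda>r1 s1. tsum X R (\<lambda>r2 s2. f (r1 \<otimes>\<^bsub>H\<^esub> (r2 \<otimes>\<^bsub>H\<^esub> r)) (badj H M N (s2 \<otimes>\<^bsub>H\<^esub> s) Q (act M s1 m))))"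
      by (rule hsum_cong; (intro lin badj_lin)?; (rule hsum_cong; (intro lin badj_lin)?)?; simp)
    finally show "tsum X R (\<lambda>r' s'. f (r' \<otimes>\<^bsub>H\<^esub> r) (act N s' (badj H M N s Q m))) = \<dots>" .
  qed ((intro lin badj_lin)?; simp)+
  also have "\<dots> = tsum X R (\<lambda>r1 s1. tsum X Rb (\<lambda>r s. tsum X R (\<lambda>r2 s2. f (r1 \<otimes>\<^bsub>H\<^esub> (r2 \<otimes>\<^bsub>H\<^esub> r)) (badj H M N (s2 \<otimes>\<^bsub>H\<^esub> s) Q (act M s1 m)))))"
    by (rule hsum_swap; (intro lin badj_lin)?; simp)
  also have "\<dots> = tsum X R (\<lambda>r1 s1. tsum X R (\<lambda>r2 s2. tsum X Rb (\<lambda>r s. f (r1 \<otimes>\<^bsub>H\<^esub> (r2 \<otimes>\<^bsub>H\<^esub> r)) (badj H M N (s2 \<otimes>\<^bsub>H\<^esub> s) Q (act M s1 m)))))"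
    by (rule hsum_cong; (intro lin badj_lin)?; (rule hsum_swap; (intro lin badj_lin)?)?; simp)
  \<comment> \<open>The second copy of R, in (r2, s2), meets the copy of \<open>Rbar\<close> in (r,
    s), and the two cancel.\<close>
  also have "\<dots> = tsum X R (\<lambda>r1 s1. f (r1 \<otimes>\<^bsub>H\<^esub> \<one>\<^bsub>H\<^esub>) (badj H M N \<one>\<^bsub>H\<^esub> Q (act M s1 m)))"
    by (rule hsum_cong; (intro lin badj_lin)?; (rule R_Rbar_sum; (intro lin badj_lin)?)?; simp)
  also have "\<dots> = tsum X R (\<lambda>r s. f r (Q (act M s m)))"
    by (rule hsum_cong; (intro lin badj_lin)?; simp add: badj_one[OF M N Q])
  finally show ?thesis .
qed

end

section \<open>Tensor products over a module algebra\<close>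

text \<open>\<open>balanced\<close> for scalars in A, stated outside the locale so that several
  pairs of modules can be treated at once.\<close>

definition balanced_map ::
  "('k, 'l) ring_scheme \<Rightarrow> ('a, 'q) ring_scheme \<Rightarrow> ('k, 'h, 'a, 'v, 'm) hbimod_scheme
    \<Rightarrow> ('k, 'h, 'a, 'w, 'n) hbimod_scheme \<Rightarrow> ('k, 'x, 'p) module_scheme \<Rightarrow> ('v \<Rightarrow> 'w \<Rightarrow> 'x) \<Rightarrow> bool" where
  "balanced_map K A V W X f \<longleftrightarrow> bilinear_map K V W X f
     \<and> (\<forall>v\<in>carrier V. \<forall>a\<in>carrier A. \<forall>w\<in>carrier W. f (rmul V v a) w = f v (lmul W a w))"

lemma balanced_mapI:
  assumes "bilinear_map K V W X f"
    and "\<And>v a w. \<lbrakk>v \<in> carrier V; a \<in> carrier A; w \<in> carrier W\<rbrakk> \<Longrightarrow> f (rmul V v a) w = f v (lmul W a w)"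
  shows "balanced_map K A V W X f"
  using assms by (simp add: balanced_map_def)

locale braided_setting = quasitriangular_hopf_algebra K H R + A: H_module_algebra K H A
  for K :: "('k, 'l) ring_scheme" and H :: "('k, 'h, 'm) hopf_scheme" and R :: "('h, 'h) tens"
    and A :: "('k, 'h, 'a, 'p) hmod_scheme"
begin

lemma A_H_module [simp]: "H_module K H A" by (rule A.H_module_axioms)

lemma bimod_H_module [simp]: "H_module_bimodule K H A V \<Longrightarrow> H_module K H V"
  by (rule H_module_bimodule.axioms)

lemma bimod_K_bimodule: "H_module_bimodule K H A V \<Longrightarrow> K_bimodule K A V"
  by (rule H_module_bimodule.axioms)

lemma lmul_closed' [simp]: "\<lbrakk>H_module_bimodule K H A V; a \<in> carrier A; v \<in> carrier V\<rbrakk> \<Longrightarrow> lmul V a v \<in> carrier V"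
  and rmul_closed' [simp]: "\<lbrakk>H_module_bimodule K H A V; a \<in> carrier A; v \<in> carrier V\<rbrakk> \<Longrightarrow> rmul V v a \<in> carrier V"
  by (rule K_bimodule.lmul_closed[OF bimod_K_bimodule], assumption+)
    (rule K_bimodule.rmul_closed[OF bimod_K_bimodule], assumption+)

lemma lmul_linear_left [lin]:
  assumes V: "H_module_bimodule K H A V" and f: "f \<in> K_linear K Z A" and v: "v \<in> carrier V"
  shows "(\<lambda>z. lmul V (f z) v) \<in> K_linear K Z V"
proof -
  interpret K_bimodule K A V by (rule bimod_K_bimodule[OF V])
  have "(\<lambda>a. lmul V a v) \<in> K_linear K A V"
    using v by (intro K_linearI) (simp_all add: lmul_closed lmul_add_left lmul_smult_left)
  then show ?thesis by (rule K_linear_comp[OF _ f])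
qed

lemma lmul_linear_right [lin]:
  assumes V: "H_module_bimodule K H A V" and a: "a \<in> carrier A" and f: "f \<in> K_linear K Z V"
  shows "(\<lambda>z. lmul V a (f z)) \<in> K_linear K Z V"
proof -
  interpret K_bimodule K A V by (rule bimod_K_bimodule[OF V])
  have "lmul V a \<in> K_linear K V V"
    using a by (intro K_linearI) (simp_all add: lmul_closed lmul_add_right lmul_smult_right)
  then show ?thesis by (rule K_linear_comp[OF _ f])
qed

lemma rmul_linear_left [lin]:
  assumes V: "H_module_bimodule K H A V" and f: "f \<in> K_linear K Z V" and a: "a \<in> carrier A"
  shows "(\<lambda>z. rmul V (f z) a) \<in> K_linear K Z V"
proof -
  interpret K_bimodule K A V by (rule bimod_K_bimodule[OF V])
  have "(\<lambda>v. rmul V v a) \<in> K_linear K V V"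
    using a by (intro K_linearI) (simp_all add: rmul_closed rmul_add_left rmul_smult_left)
  then show ?thesis by (rule K_linear_comp[OF _ f])
qed

lemma rmul_linear_right [lin]:
  assumes V: "H_module_bimodule K H A V" and v: "v \<in> carrier V" and f: "f \<in> K_linear K Z A"
  shows "(\<lambda>z. rmul V v (f z)) \<in> K_linear K Z V"
proof -
  interpret K_bimodule K A V by (rule bimod_K_bimodule[OF V])
  have "rmul V v \<in> K_linear K A V"
    using v by (intro K_linearI) (simp_all add: rmul_closed rmul_add_right rmul_smult_right)
  then show ?thesis by (rule K_linear_comp[OF _ f])
qed

lemma A_mult_linear [lin]:
  "f \<in> K_linear K Z A \<Longrightarrow> y \<in> carrier A \<Longrightarrow> (\<lambda>z. f z \<otimes>\<^bsub>A\<^esub> y) \<in> K_linear K Z A"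
  "x \<in> carrier A \<Longrightarrow> f \<in> K_linear K Z A \<Longrightarrow> (\<lambda>z. x \<otimes>\<^bsub>A\<^esub> f z) \<in> K_linear K Z A"
  using assoc_algebra_mult_linear[OF A.A.assoc_algebra_axioms] by auto

lemma atensor_space:
  assumes V: "H_module_bimodule K H A V" and W: "H_module_bimodule K H A W"
  shows "tensor_space K V W (carrier A) (rmul V) (lmul W) (atensor H A V W) (atens A V W)"
proof -
  interpret V: H_module_bimodule K H A V by (rule V)
  interpret W: H_module_bimodule K H A W by (rule W)
  show ?thesis
  proof
    \<comment> \<open>A ground scalar k acts on both factors through the element k 1 of A.\<close>
    show "\<exists>b\<in>carrier A. (\<forall>v\<in>carrier V. rmul V v b = k \<odot>\<^bsub>V\<^esub> v) \<and> (\<forall>w\<in>carrier W. lmul W b w = k \<odot>\<^bsub>W\<^esub> w)"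
      if "k \<in> carrier K" for k
      using that A.smult_closed[of k "\<one>\<^bsub>A\<^esub>"]
      by (intro bexI[of _ "k \<odot>\<^bsub>A\<^esub> \<one>\<^bsub>A\<^esub>"]) (simp_all add: V.rmul_smult_right W.lmul_smult_left V.rmul_one W.lmul_one)
  qed (simp_all add: V V.rmul_closed W.lmul_closed V.rmul_smult_left atensor_def Let_def atens_def)
qed

section \<open>V \<otimes>_A W as an H-module A-bimodule\<close>

context
  fixes V :: "('k, 'h, 'a, 'v, 'm1) hbimod_scheme" and W :: "('k, 'h, 'a, 'w, 'm2) hbimod_scheme"
  assumes V [simp]: "H_module_bimodule K H A V" and W [simp]: "H_module_bimodule K H A W"
begin

interpretation T: tensor_space K V W "carrier A" "rmul V" "lmul W" "atensor H A V W" "atens A V W"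
  by (rule atensor_space[OF V W])

lemma balanced_iff: "T.balanced X f \<longleftrightarrow> balanced_map K A V W X f"
  by (auto simp: T.balanced_def balanced_map_def)

lemma atensor_module: "module K (atensor H A V W)" by (rule T.T_module)

lemma atens_closed: "\<lbrakk>v \<in> carrier V; w \<in> carrier W\<rbrakk> \<Longrightarrow> atens A V W v w \<in> carrier (atensor H A V W)"
  by (rule T.pt_closed)

lemma atens_linear_left: "f \<in> K_linear K Z V \<Longrightarrow> w \<in> carrier W \<Longrightarrow> (\<lambda>z. atens A V W (f z) w) \<in> K_linear K Z (atensor H A V W)"
  by (rule K_linear_comp[OF T.pt_linear_left])

lemma atens_linear_right: "v \<in> carrier V \<Longrightarrow> f \<in> K_linear K Z W \<Longrightarrow> (\<lambda>z. atens A V W v (f z)) \<in> K_linear K Z (atensor H A V W)"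
  by (rule K_linear_comp[OF T.pt_linear_right])

lemma atens_balanced: "\<lbrakk>v \<in> carrier V; a \<in> carrier A; w \<in> carrier W\<rbrakk> \<Longrightarrow> atens A V W (rmul V v a) w = atens A V W v (lmul W a w)"
  by (rule T.pt_bal)

lemma atensor_eqI:
  assumes g: "g \<in> K_linear K (atensor H A V W) X" and h: "h \<in> K_linear K (atensor H A V W) X"
    and eq: "\<And>v w. \<lbrakk>v \<in> carrier V; w \<in> carrier W\<rbrakk> \<Longrightarrow> g (atens A V W v w) = h (atens A V W v w)"
    and t: "t \<in> carrier (atensor H A V W)"
  shows "g t = h t"
  using assms by (rule T.K_linear_eqI)

lemma asum_atens: "module K X \<Longrightarrow> balanced_map K A V W X f \<Longrightarrow> v \<in> carrier V \<Longrightarrow> w \<in> carrier W \<Longrightarrow>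
    tsum X (atens A V W v w) f = f v w"
  by (rule T.tsum_pt[unfolded balanced_iff])

lemma asum_linear: "module K X \<Longrightarrow> balanced_map K A V W X f \<Longrightarrow> g \<in> K_linear K Z (atensor H A V W) \<Longrightarrow>
    (\<lambda>z. tsum X (g z) f) \<in> K_linear K Z X"
  by (rule K_linear_comp[OF T.tsum_linear[unfolded balanced_iff]])

lemma asum_push: "module K X \<Longrightarrow> module K Y \<Longrightarrow> t \<in> carrier (atensor H A V W) \<Longrightarrow> balanced_map K A V W X f \<Longrightarrow>
    g \<in> K_linear K X Y \<Longrightarrow> g (tsum X t f) = tsum Y t (\<lambda>v w. g (f v w))"
  by (rule T.tsum_push[unfolded balanced_iff])

lemma asum_cong: "module K X \<Longrightarrow> balanced_map K A V W X f \<Longrightarrow>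
    (\<And>v w. \<lbrakk>v \<in> carrier V; w \<in> carrier W\<rbrakk> \<Longrightarrow> g v w = f v w) \<Longrightarrow> t \<in> carrier (atensor H A V W) \<Longrightarrow> tsum X t g = tsum X t f"
  by (rule T.tsum_cong[unfolded balanced_iff])

lemma asum_param:
  assumes X: "module K X" and Z: "module K Z" and t: "t \<in> carrier (atensor H A V W)"
    and f: "\<And>z. z \<in> carrier Z \<Longrightarrow> balanced_map K A V W X (\<lambda>v w. f z v w)"
    and lin: "\<And>v w. \<lbrakk>v \<in> carrier V; w \<in> carrier W\<rbrakk> \<Longrightarrow> (\<lambda>z. f z v w) \<in> K_linear K Z X"
  shows "(\<lambda>z. tsum X t (\<lambda>v w. f z v w)) \<in> K_linear K Z X"
  by (rule T.tsum_param[OF X Z f[folded balanced_iff] lin t])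

private abbreviation "VW \<equiv> atensor H A V W"
private abbreviation "t \<equiv> atens A V W"

lemmas [simp] = atensor_module atens_closed
lemmas at_lin = atens_linear_left atens_linear_right

lemma tsum_atensor:
  "tsum (tensor_group (carrier A) (rmul V) (lmul W) V W) = (tsum VW :: ('c, 'd) tens \<Rightarrow> _)"
  by (rule tsum_additive_structure[symmetric]) (rule T.T_def)+

lemma atensor_ops:
  "act VW = (\<lambda>x s. tsum VW s (\<lambda>v w. tsum VW (comul H x) (\<lambda>a b. t (act V a v) (act W b w))))"
  "lmul VW = (\<lambda>a s. tsum VW s (\<lambda>v w. t (lmul V a v) w))"
  "rmul VW = (\<lambda>s a. tsum VW s (\<lambda>v w. t v (rmul W w a)))"
  unfolding tsum_atensor[symmetric] by (simp_all add: atensor_def Let_def)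

text \<open>Whether a sits on the left or on the right factor, it is hit by the middle leg of x_1
  \<otimes> x_2 \<otimes> x_3; by coassociativity both iterated coproducts give the same three
  legs.\<close>

lemma act_balanced:
  assumes x [simp]: "x \<in> carrier H"
  shows "balanced_map K A V W VW (\<lambda>v w. tsum VW (comul H x) (\<lambda>a b. t (act V a v) (act W b w)))"
proof (rule balanced_mapI)
  show "bilinear_map K V W VW (\<lambda>v w. tsum VW (comul H x) (\<lambda>a b. t (act V a v) (act W b w)))"
    by (intro lin at_lin; simp)
next
  fix v a w assume [simp]: "v \<in> carrier V" "a \<in> carrier A" "w \<in> carrier W"
  have "tsum VW (comul H x) (\<lambda>b c. t (act V b (rmul V v a)) (act W c w))
    = tsum VW (comul H x) (\<lambda>b c. tsum VW (comul H b) (\<lambda>b d. t (act V b v) (lmul W (act A d a) (act W c w))))"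
  proof (rule hsum_cong)
    fix b c assume [simp]: "b \<in> carrier H" "c \<in> carrier H"
    have "t (act V b (rmul V v a)) (act W c w) = t (tsum V (comul H b) (\<lambda>b d. rmul V (act V b v) (act A d a))) (act W c w)"
      by (simp add: H_module_bimodule.act_rmul[OF V])
    also have "\<dots> = tsum VW (comul H b) (\<lambda>b d. t (rmul V (act V b v) (act A d a)) (act W c w))"
      by (rule hsum_push[OF _ _ _ _ atens_linear_left[OF K_linear_id]]; (intro lin)?; simp)
    also have "\<dots> = tsum VW (comul H b) (\<lambda>b d. t (act V b v) (lmul W (act A d a) (act W c w)))"
      by (rule hsum_cong; (intro lin at_lin)?; simp add: atens_balanced)
    finally show "t (act V b (rmul V v a)) (act W c w) = \<dots>" .
  qed ((intro lin at_lin)?; simp)+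
  also have "\<dots> = tsum VW (comul H x) (\<lambda>b c. tsum VW (comul H c) (\<lambda>d c. t (act V b v) (lmul W (act A d a) (act W c w))))"
    by (rule coassoc_sum; (intro lin at_lin)?; simp)
  also have "\<dots> = tsum VW (comul H x) (\<lambda>b c. t (act V b v) (act W c (lmul W a w)))"
  proof (rule hsum_cong)
    fix b c assume [simp]: "b \<in> carrier H" "c \<in> carrier H"
    show "tsum VW (comul H c) (\<lambda>d c. t (act V b v) (lmul W (act A d a) (act W c w))) = t (act V b v) (act W c (lmul W a w))"
      unfolding H_module_bimodule.act_lmul[OF W \<open>c \<in> carrier H\<close> \<open>a \<in> carrier A\<close> \<open>w \<in> carrier W\<close>]
      by (rule hsum_push[OF _ _ _ _ atens_linear_right[OF _ K_linear_id], symmetric]; (intro lin)?; simp)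
  qed ((intro lin at_lin)?; simp)+
  finally show "tsum VW (comul H x) (\<lambda>b c. t (act V b (rmul V v a)) (act W c w))
    = tsum VW (comul H x) (\<lambda>b c. t (act V b v) (act W c (lmul W a w)))" .
qed

lemma lmul_rmul_balanced:
  assumes a [simp]: "a \<in> carrier A"
  shows "balanced_map K A V W VW (\<lambda>v w. t (lmul V a v) w)" "balanced_map K A V W VW (\<lambda>v w. t v (rmul W w a))"
proof -
  interpret V: H_module_bimodule K H A V by (rule V)
  interpret W: H_module_bimodule K H A W by (rule W)
  show "balanced_map K A V W VW (\<lambda>v w. t (lmul V a v) w)"
    by (rule balanced_mapI; (intro lin at_lin)?; simp add: V.lmul_rmul[symmetric] atens_balanced)
  show "balanced_map K A V W VW (\<lambda>v w. t v (rmul W w a))"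
    by (rule balanced_mapI; (intro lin at_lin)?; simp add: W.lmul_rmul atens_balanced)
qed

lemma act_atens: "\<lbrakk>x \<in> carrier H; v \<in> carrier V; w \<in> carrier W\<rbrakk> \<Longrightarrow>
    act VW x (t v w) = tsum VW (comul H x) (\<lambda>a b. t (act V a v) (act W b w))"
  unfolding atensor_ops by (rule asum_atens[OF _ act_balanced]) simp_all

lemma lmul_atens: "\<lbrakk>a \<in> carrier A; v \<in> carrier V; w \<in> carrier W\<rbrakk> \<Longrightarrow> lmul VW a (t v w) = t (lmul V a v) w"
  unfolding atensor_ops by (rule asum_atens[OF _ lmul_rmul_balanced(1)]) simp_all

lemma rmul_atens: "\<lbrakk>a \<in> carrier A; v \<in> carrier V; w \<in> carrier W\<rbrakk> \<Longrightarrow> rmul VW (t v w) a = t v (rmul W w a)"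
  unfolding atensor_ops by (rule asum_atens[OF _ lmul_rmul_balanced(2)]) simp_all

lemma atensor_op_linear:
  "x \<in> carrier H \<Longrightarrow> (\<lambda>s. act VW x s) \<in> K_linear K VW VW"
  "s \<in> carrier VW \<Longrightarrow> (\<lambda>x. act VW x s) \<in> K_linear K H VW"
  "a \<in> carrier A \<Longrightarrow> (\<lambda>s. lmul VW a s) \<in> K_linear K VW VW"
  "s \<in> carrier VW \<Longrightarrow> (\<lambda>a. lmul VW a s) \<in> K_linear K A VW"
  "a \<in> carrier A \<Longrightarrow> (\<lambda>s. rmul VW s a) \<in> K_linear K VW VW"
  "s \<in> carrier VW \<Longrightarrow> (\<lambda>a. rmul VW s a) \<in> K_linear K A VW"
  unfolding atensor_ops
  by (intro asum_linear act_balanced lmul_rmul_balanced asum_param lin at_lin; simp)+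

lemmas op_linear = K_linear_comp[OF atensor_op_linear(1)] K_linear_comp[OF atensor_op_linear(2)]
  K_linear_comp[OF atensor_op_linear(3)] K_linear_comp[OF atensor_op_linear(4)]
  K_linear_comp[OF atensor_op_linear(5)] K_linear_comp[OF atensor_op_linear(6)]

lemmas op_closed = K_linear_closed[OF atensor_op_linear(1)] K_linear_closed[OF atensor_op_linear(3)] K_linear_closed[OF atensor_op_linear(5)]

lemma atensor_H_module: "H_module K H VW"
proof (rule H_module.intro[OF atensor_module H_module_axioms.intro])
  show "act VW (x \<otimes>\<^bsub>H\<^esub> y) s = act VW x (act VW y s)" if [simp]: "x \<in> carrier H" "y \<in> carrier H" and s: "s \<in> carrier VW" for x y s
  proof (rule atensor_eqI[OF _ _ _ s, where X = VW and g = "\<lambda>s. act VW (x \<otimes>\<^bsub>H\<^esub> y) s"])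
    fix v w assume [simp]: "v \<in> carrier V" "w \<in> carrier W"
    have "act VW (x \<otimes>\<^bsub>H\<^esub> y) (t v w) = tsum VW (comul H (x \<otimes>\<^bsub>H\<^esub> y)) (\<lambda>a b. t (act V a v) (act W b w))"
      by (simp add: act_atens)
    also have "\<dots> = tsum VW (comul H x) (\<lambda>a b. tsum VW (comul H y) (\<lambda>c d. t (act V (a \<otimes>\<^bsub>H\<^esub> c) v) (act W (b \<otimes>\<^bsub>H\<^esub> d) w)))"
      by (rule comul_mult_sum; (intro lin at_lin)?; simp)
    also have "\<dots> = tsum VW (comul H y) (\<lambda>c d. tsum VW (comul H x) (\<lambda>a b. t (act V (a \<otimes>\<^bsub>H\<^esub> c) v) (act W (b \<otimes>\<^bsub>H\<^esub> d) w)))"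
      by (rule hsum_swap; (intro lin at_lin)?; simp)
    also have "\<dots> = tsum VW (comul H y) (\<lambda>c d. act VW x (t (act V c v) (act W d w)))"
    proof (rule hsum_cong)
      fix c d assume [simp]: "c \<in> carrier H" "d \<in> carrier H"
      show "tsum VW (comul H x) (\<lambda>a b. t (act V (a \<otimes>\<^bsub>H\<^esub> c) v) (act W (b \<otimes>\<^bsub>H\<^esub> d) w)) = act VW x (t (act V c v) (act W d w))"
        by (simp add: act_atens, rule hsum_cong; (intro lin at_lin)?; simp add: act_mult'[OF bimod_H_module])
    qed ((intro lin op_linear at_lin)?; simp)+
    also have "\<dots> = act VW x (act VW y (t v w))"
      unfolding act_atens[OF \<open>y \<in> carrier H\<close> \<open>v \<in> carrier V\<close> \<open>w \<in> carrier W\<close>]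
      by (rule hsum_push[OF _ _ _ _ atensor_op_linear(1), symmetric]; (intro lin at_lin)?; simp)
    finally show "act VW (x \<otimes>\<^bsub>H\<^esub> y) (t v w) = act VW x (act VW y (t v w))" .
  qed (intro op_linear K_linear_id; simp)+
  show "act VW \<one>\<^bsub>H\<^esub> s = s" if s: "s \<in> carrier VW" for s
  proof (rule atensor_eqI[OF _ _ _ s, where X = VW and g = "\<lambda>s. act VW \<one>\<^bsub>H\<^esub> s"])
    fix v w assume [simp]: "v \<in> carrier V" "w \<in> carrier W"
    show "act VW \<one>\<^bsub>H\<^esub> (t v w) = t v w"
      by (simp add: act_atens, subst comul_one_sum; (intro lin at_lin)?; simp)
  qed (intro op_linear K_linear_id; simp)+
qed (simp_all add: op_closed K_linear_add[OF atensor_op_linear(1)] K_linear_add[OF atensor_op_linear(2)]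
   K_linear_smult[OF atensor_op_linear(1)] K_linear_smult[OF atensor_op_linear(2)])

lemma atensor_K_bimodule: "K_bimodule K A VW"
proof -
  interpret V: H_module_bimodule K H A V by (rule V)
  interpret W: H_module_bimodule K H A W by (rule W)
  show ?thesis
  proof (rule K_bimodule.intro[OF atensor_module K_bimodule_axioms.intro])
    show "lmul VW (a \<otimes>\<^bsub>A\<^esub> b) s = lmul VW a (lmul VW b s)" if "a \<in> carrier A" "b \<in> carrier A" and s: "s \<in> carrier VW" for a b s
      by (rule atensor_eqI[OF _ _ _ s, where X = VW and g = "\<lambda>s. lmul VW (a \<otimes>\<^bsub>A\<^esub> b) s"])
       (use that in \<open>auto intro!: op_linear K_linear_id simp: lmul_atens V.lmul_mult\<close>)
    show "rmul VW s (a \<otimes>\<^bsub>A\<^esub> b) = rmul VW (rmul VW s a) b" if "a \<in> carrier A" "b \<in> carrier A" and s: "s \<in> carrier VW" for a b s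
      by (rule atensor_eqI[OF _ _ _ s, where X = VW and g = "\<lambda>s. rmul VW s (a \<otimes>\<^bsub>A\<^esub> b)"])
       (use that in \<open>auto intro!: op_linear K_linear_id simp: rmul_atens W.rmul_mult\<close>)
    show "rmul VW (lmul VW a s) b = lmul VW a (rmul VW s b)" if "a \<in> carrier A" "b \<in> carrier A" and s: "s \<in> carrier VW" for a b s
      by (rule atensor_eqI[OF _ _ _ s, where X = VW and g = "\<lambda>s. rmul VW (lmul VW a s) b"])
       (use that in \<open>auto intro!: op_linear K_linear_id simp: rmul_atens lmul_atens\<close>)
    show "lmul VW \<one>\<^bsub>A\<^esub> s = s" if s: "s \<in> carrier VW" for s
      by (rule atensor_eqI[OF _ _ _ s, where X = VW and g = "\<lambda>s. lmul VW \<one>\<^bsub>A\<^esub> s"])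
       (auto intro!: op_linear K_linear_id simp: lmul_atens V.lmul_one)
    show "rmul VW s \<one>\<^bsub>A\<^esub> = s" if s: "s \<in> carrier VW" for s
      by (rule atensor_eqI[OF _ _ _ s, where X = VW and g = "\<lambda>s. rmul VW s \<one>\<^bsub>A\<^esub>"])
       (auto intro!: op_linear K_linear_id simp: rmul_atens W.rmul_one)
  qed (simp_all add: op_closed K_linear_add[OF atensor_op_linear(3)] K_linear_add[OF atensor_op_linear(4)]
   K_linear_add[OF atensor_op_linear(5)] K_linear_add[OF atensor_op_linear(6)]
   K_linear_smult[OF atensor_op_linear(3)] K_linear_smult[OF atensor_op_linear(4)]
   K_linear_smult[OF atensor_op_linear(5)] K_linear_smult[OF atensor_op_linear(6)])
qed

lemma atensor_bimodule: "H_module_bimodule K H A (atensor H A V W)"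
proof (rule H_module_bimodule.intro[OF atensor_H_module atensor_K_bimodule H_module_bimodule_axioms.intro])
  fix x a s assume [simp]: "x \<in> carrier H" "a \<in> carrier A" and s: "s \<in> carrier VW"
  show "act VW x (lmul VW a s) = tsum VW (comul H x) (\<lambda>x1 x2. lmul VW (act A x1 a) (act VW x2 s))"
  proof (rule atensor_eqI[OF _ _ _ s, where X = VW and g = "\<lambda>s. act VW x (lmul VW a s)"])
    fix v w assume [simp]: "v \<in> carrier V" "w \<in> carrier W"
    have "act VW x (lmul VW a (t v w)) = tsum VW (comul H x) (\<lambda>b c. t (act V b (lmul V a v)) (act W c w))"
      by (simp add: lmul_atens act_atens)
    also have "\<dots> = tsum VW (comul H x) (\<lambda>b c. tsum VW (comul H b) (\<lambda>d e. t (lmul V (act A d a) (act V e v)) (act W c w)))"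
    proof (rule hsum_cong)
      fix b c assume [simp]: "b \<in> carrier H" "c \<in> carrier H"
      show "t (act V b (lmul V a v)) (act W c w) = tsum VW (comul H b) (\<lambda>d e. t (lmul V (act A d a) (act V e v)) (act W c w))"
        unfolding H_module_bimodule.act_lmul[OF V \<open>b \<in> carrier H\<close> \<open>a \<in> carrier A\<close> \<open>v \<in> carrier V\<close>]
        by (rule hsum_push[OF _ _ _ _ atens_linear_left[OF K_linear_id]]; (intro lin)?; simp)
    qed ((intro lin at_lin)?; simp)+
    also have "\<dots> = tsum VW (comul H x) (\<lambda>d y. tsum VW (comul H y) (\<lambda>e c. t (lmul V (act A d a) (act V e v)) (act W c w)))"
      by (rule coassoc_sum; (intro lin at_lin)?; simp)
    also have "\<dots> = tsum VW (comul H x) (\<lambda>x1 x2. lmul VW (act A x1 a) (act VW x2 (t v w)))"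
    proof (rule hsum_cong)
      fix d y assume [simp]: "d \<in> carrier H" "y \<in> carrier H"
      have "lmul VW (act A d a) (act VW y (t v w)) = tsum VW (comul H y) (\<lambda>e c. lmul VW (act A d a) (t (act V e v) (act W c w)))"
        unfolding act_atens[OF \<open>y \<in> carrier H\<close> \<open>v \<in> carrier V\<close> \<open>w \<in> carrier W\<close>]
        by (rule hsum_push[OF _ _ _ _ atensor_op_linear(3)]; (intro lin at_lin)?; simp)
      also have "\<dots> = tsum VW (comul H y) (\<lambda>e c. t (lmul V (act A d a) (act V e v)) (act W c w))"
        by (rule hsum_cong; (intro lin at_lin)?; simp add: lmul_atens)
      finally show "tsum VW (comul H y) (\<lambda>e c. t (lmul V (act A d a) (act V e v)) (act W c w)) = lmul VW (act A d a) (act VW y (t v w))" ..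
    qed ((intro lin op_linear at_lin)?; simp add: op_closed)+
    finally show "act VW x (lmul VW a (t v w)) = tsum VW (comul H x) (\<lambda>x1 x2. lmul VW (act A x1 a) (act VW x2 (t v w)))" .
  qed (intro lin op_linear; simp add: op_closed)+
  show "act VW x (rmul VW s a) = tsum VW (comul H x) (\<lambda>x1 x2. rmul VW (act VW x1 s) (act A x2 a))"
  proof (rule atensor_eqI[OF _ _ _ s, where X = VW and g = "\<lambda>s. act VW x (rmul VW s a)"])
    fix v w assume [simp]: "v \<in> carrier V" "w \<in> carrier W"
    have "act VW x (rmul VW (t v w) a) = tsum VW (comul H x) (\<lambda>b c. t (act V b v) (act W c (rmul W w a)))"
      by (simp add: rmul_atens act_atens)
    also have "\<dots> = tsum VW (comul H x) (\<lambda>b c. tsum VW (comul H c) (\<lambda>d e. t (act V b v) (rmul W (act W d w) (act A e a))))"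
    proof (rule hsum_cong)
      fix b c assume [simp]: "b \<in> carrier H" "c \<in> carrier H"
      show "t (act V b v) (act W c (rmul W w a)) = tsum VW (comul H c) (\<lambda>d e. t (act V b v) (rmul W (act W d w) (act A e a)))"
        unfolding H_module_bimodule.act_rmul[OF W \<open>c \<in> carrier H\<close> \<open>a \<in> carrier A\<close> \<open>w \<in> carrier W\<close>]
        by (rule hsum_push[OF _ _ _ _ atens_linear_right[OF _ K_linear_id]]; (intro lin)?; simp)
    qed ((intro lin at_lin)?; simp)+
    also have "\<dots> = tsum VW (comul H x) (\<lambda>y e. tsum VW (comul H y) (\<lambda>b d. t (act V b v) (rmul W (act W d w) (act A e a))))"
      by (rule coassoc_sum'; (intro lin at_lin)?; simp)
    also have "\<dots> = tsum VW (comul H x) (\<lambda>x1 x2. rmul VW (act VW x1 (t v w)) (act A x2 a))"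
    proof (rule hsum_cong)
      fix y e assume [simp]: "y \<in> carrier H" "e \<in> carrier H"
      have "rmul VW (act VW y (t v w)) (act A e a) = tsum VW (comul H y) (\<lambda>b d. rmul VW (t (act V b v) (act W d w)) (act A e a))"
        unfolding act_atens[OF \<open>y \<in> carrier H\<close> \<open>v \<in> carrier V\<close> \<open>w \<in> carrier W\<close>]
        by (rule hsum_push[OF _ _ _ _ atensor_op_linear(5)]; (intro lin at_lin)?; simp)
      also have "\<dots> = tsum VW (comul H y) (\<lambda>b d. t (act V b v) (rmul W (act W d w) (act A e a)))"
        by (rule hsum_cong; (intro lin at_lin)?; simp add: rmul_atens)
      finally show "tsum VW (comul H y) (\<lambda>b d. t (act V b v) (rmul W (act W d w) (act A e a))) = rmul VW (act VW y (t v w)) (act A e a)" ..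
    qed ((intro lin op_linear at_lin)?; simp add: op_closed)+
    finally show "act VW x (rmul VW (t v w) a) = tsum VW (comul H x) (\<lambda>x1 x2. rmul VW (act VW x1 (t v w)) (act A x2 a))" .
  qed (intro lin op_linear; simp add: op_closed)+
qed

end

lemmas [simp] = atensor_bimodule
lemmas [lin] = atens_linear_left atens_linear_right

text \<open>The two consequences of (graded) quasi-commutativity that are used: moving a scalar across a module
  element with \<open>R\<close> instead of its inverse, and the version with the roles of the legs exchanged,
  which is available for forms.\<close>

definition left_quasi_comm :: "('k, 'h, 'a, 'v, 'n) hbimod_scheme \<Rightarrow> bool" where
  "left_quasi_comm V \<longleftrightarrow> H_module_bimodule K H A V
     \<and> (\<forall>a\<in>carrier A. \<forall>v\<in>carrier V. lmul V a v = tsum V R (\<lambda>r s. rmul V (act V s v) (act A r a)))"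

definition right_quasi_comm :: "('k, 'h, 'a, 'v, 'n) hbimod_scheme \<Rightarrow> bool" where
  "right_quasi_comm V \<longleftrightarrow> H_module_bimodule K H A V
     \<and> (\<forall>a\<in>carrier A. \<forall>v\<in>carrier V. rmul V v a = tsum V R (\<lambda>r s. lmul V (act A s a) (act V r v)))"

lemma left_quasi_commD:
  assumes "left_quasi_comm V"
  shows "H_module_bimodule K H A V"
    and "a \<in> carrier A \<Longrightarrow> v \<in> carrier V \<Longrightarrow> tsum V R (\<lambda>r s. rmul V (act V s v) (act A r a)) = lmul V a v"
  using assms by (auto simp: left_quasi_comm_def)

lemma right_quasi_commD:
  assumes "right_quasi_comm V"
  shows "H_module_bimodule K H A V"
    and "a \<in> carrier A \<Longrightarrow> v \<in> carrier V \<Longrightarrow> tsum V R (\<lambda>r s. lmul V (act A s a) (act V r v)) = rmul V v a"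
  using assms by (auto simp: right_quasi_comm_def)

text \<open>Expanding the right multiplication by the quasi-commutativity axiom puts
  \<open>Rbar\<close> in front of R, and the product is 1.\<close>

lemma quasi_commutative_left:
  assumes "quasi_commutative_bimodule K H R A V"
  shows "left_quasi_comm V"
proof -
  interpret V: quasi_commutative_bimodule K H R A V by fact
  have V [simp]: "H_module_bimodule K H A V" by (rule V.H_module_bimodule_axioms)
  have "tsum V R (\<lambda>r s. rmul V (act V s v) (act A r a)) = lmul V a v"
    if [simp]: "a \<in> carrier A" "v \<in> carrier V" for a v
  proof -
    have "tsum V R (\<lambda>r s. rmul V (act V s v) (act A r a))
      = tsum V R (\<lambda>r s. tsum V Rb (\<lambda>r' s'. lmul V (act A (r' \<otimes>\<^bsub>H\<^esub> r) a) (act V (s' \<otimes>\<^bsub>H\<^esub> s) v)))"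
    proof (rule hsum_cong)
      fix r s assume [simp]: "r \<in> carrier H" "s \<in> carrier H"
      have "rmul V (act V s v) (act A r a) = tsum V Rb (\<lambda>r' s'. lmul V (act A r' (act A r a)) (act V s' (act V s v)))"
        by (rule V.quasi_comm) simp_all
      also have "\<dots> = tsum V Rb (\<lambda>r' s'. lmul V (act A (r' \<otimes>\<^bsub>H\<^esub> r) a) (act V (s' \<otimes>\<^bsub>H\<^esub> s) v))"
        by (rule hsum_cong; (intro lin)?; simp add: act_mult'[OF bimod_H_module] act_mult'[OF A_H_module])
      finally show "rmul V (act V s v) (act A r a) = \<dots>" .
    qed ((intro lin)?; simp)+
    also have "\<dots> = tsum V Rb (\<lambda>r' s'. tsum V R (\<lambda>r s. lmul V (act A (r' \<otimes>\<^bsub>H\<^esub> r) a) (act V (s' \<otimes>\<^bsub>H\<^esub> s) v)))"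
      by (rule hsum_swap; (intro lin)?; simp)
    also have "\<dots> = lmul V (act A \<one>\<^bsub>H\<^esub> a) (act V \<one>\<^bsub>H\<^esub> v)"
      by (rule Rbar_R_sum; (intro lin)?; simp)
    finally show ?thesis by simp
  qed
  then show ?thesis by (simp add: left_quasi_comm_def)
qed

text \<open>By (id \<otimes> \<Delta>) R = R_13 R_12 one copy of R moves a past W and the other past
  V, with the balance relation in between. It is applied to W tensored with one-forms and two-forms,
  the targets of a connection and of its curvature.\<close>

lemma atensor_left_quasi_comm:
  assumes V: "left_quasi_comm V" and W: "left_quasi_comm W"
  shows "left_quasi_comm (atensor H A V W)"
proof -
  note [simp] = left_quasi_commD(1)[OF V] left_quasi_commD(1)[OF W]
  let ?VW = "atensor H A V W" and ?t = "atens A V W"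
  have "tsum ?VW R (\<lambda>r s. rmul ?VW (act ?VW s x) (act A r a)) = lmul ?VW a x"
    if [simp]: "a \<in> carrier A" and x: "x \<in> carrier ?VW" for a x
  proof (rule atensor_eqI[OF _ _ _ _ _ x, where X = ?VW and g = "\<lambda>x. tsum ?VW R (\<lambda>r s. rmul ?VW (act ?VW s x) (act A r a))"])
    fix v w assume [simp]: "v \<in> carrier V" "w \<in> carrier W"
    have "tsum ?VW R (\<lambda>r s. rmul ?VW (act ?VW s (?t v w)) (act A r a))
      = tsum ?VW R (\<lambda>r s. tsum ?VW (comul H s) (\<lambda>c d. ?t (act V c v) (rmul W (act W d w) (act A r a))))"
    proof (rule hsum_cong)
      fix r s assume [simp]: "r \<in> carrier H" "s \<in> carrier H"
      have "rmul ?VW (act ?VW s (?t v w)) (act A r a)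
        = tsum ?VW (comul H s) (\<lambda>c d. rmul ?VW (?t (act V c v) (act W d w)) (act A r a))"
        by (subst act_atens, simp, simp, simp, simp, simp)
          (rule hsum_push[OF _ _ _ _ rmul_linear_left[OF _ K_linear_id]]; (intro lin)?; simp)
      also have "\<dots> = tsum ?VW (comul H s) (\<lambda>c d. ?t (act V c v) (rmul W (act W d w) (act A r a)))"
        by (rule hsum_cong; (intro lin)?; simp add: rmul_atens)
      finally show "rmul ?VW (act ?VW s (?t v w)) (act A r a) = \<dots>" .
    qed ((intro lin)?; simp)+
    also have "\<dots> = tsum ?VW R (\<lambda>r s. tsum ?VW R (\<lambda>r' s'. ?t (act V s' v) (rmul W (act W s w) (act A (r \<otimes>\<^bsub>H\<^esub> r') a))))"
      by (rule comul_R_sum(2); (intro lin)?; simp)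
    also have "\<dots> = tsum ?VW R (\<lambda>r' s'. tsum ?VW R (\<lambda>r s. ?t (act V s' v) (rmul W (act W s w) (act A (r \<otimes>\<^bsub>H\<^esub> r') a))))"
      by (rule hsum_swap; (intro lin)?; simp)
    also have "\<dots> = tsum ?VW R (\<lambda>r' s'. ?t (rmul V (act V s' v) (act A r' a)) w)"
    proof (rule hsum_cong)
      fix r' s' assume [simp]: "r' \<in> carrier H" "s' \<in> carrier H"
      have "tsum ?VW R (\<lambda>r s. ?t (act V s' v) (rmul W (act W s w) (act A (r \<otimes>\<^bsub>H\<^esub> r') a)))
        = tsum ?VW R (\<lambda>r s. ?t (act V s' v) (rmul W (act W s w) (act A r (act A r' a))))"
        by (rule hsum_cong; (intro lin)?; simp add: act_mult'[OF A_H_module])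
      also have "\<dots> = ?t (act V s' v) (tsum W R (\<lambda>r s. rmul W (act W s w) (act A r (act A r' a))))"
        by (rule hsum_push[OF _ _ _ _ atens_linear_right[OF _ _ _ K_linear_id], symmetric]; (intro lin)?; simp)
      also have "\<dots> = ?t (rmul V (act V s' v) (act A r' a)) w"
        by (simp add: left_quasi_commD(2)[OF W] atens_balanced)
      finally show "tsum ?VW R (\<lambda>r s. ?t (act V s' v) (rmul W (act W s w) (act A (r \<otimes>\<^bsub>H\<^esub> r') a))) = \<dots>" .
    qed ((intro lin)?; simp)+
    also have "\<dots> = ?t (tsum V R (\<lambda>r' s'. rmul V (act V s' v) (act A r' a))) w"
      by (rule hsum_push[OF _ _ _ _ atens_linear_left[OF _ _ K_linear_id], symmetric]; (intro lin)?; simp)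
    also have "\<dots> = lmul ?VW a (?t v w)"
      by (simp add: left_quasi_commD(2)[OF V] lmul_atens)
    finally show "tsum ?VW R (\<lambda>r s. rmul ?VW (act ?VW s (?t v w)) (act A r a)) = lmul ?VW a (?t v w)" .
  qed ((intro lin)?; simp)+
  then show ?thesis by (simp add: left_quasi_comm_def)
qed

section \<open>Rebracketing\<close>

context
  fixes V :: "('k, 'h, 'a, 'v, 'm1) hbimod_scheme" and W :: "('k, 'h, 'a, 'w, 'm2) hbimod_scheme"
    and Z :: "('k, 'h, 'a, 'z, 'm3) hbimod_scheme"
  assumes V [simp]: "H_module_bimodule K H A V" and W [simp]: "H_module_bimodule K H A W"
    and Z [simp]: "H_module_bimodule K H A Z"
begin

private abbreviation "E12 \<equiv> atensor H A V W"
private abbreviation "E23 \<equiv> atensor H A W Z"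
private abbreviation "E12_3 \<equiv> atensor H A E12 Z"
private abbreviation "E1_23 \<equiv> atensor H A V E23"

text \<open>A rebracketing is a nested sum, so it takes two balance proofs: for the inner summand
  with the outer factor fixed, and for the outer summand, one argument of which is itself a
  tensor.\<close>

lemma assoc_left_inner: "v \<in> carrier V \<Longrightarrow> balanced_map K A W Z E12_3 (\<lambda>w z. atens A E12 Z (atens A V W v w) z)"
  by (rule balanced_mapI; (intro lin)?; simp add: rmul_atens[symmetric] atens_balanced)

lemma assoc_left_outer: "balanced_map K A V E23 E12_3 (\<lambda>v s. tsum E12_3 s (\<lambda>w z. atens A E12 Z (atens A V W v w) z))"
proof (rule balanced_mapI)
  show "bilinear_map K V E23 E12_3 (\<lambda>v s. tsum E12_3 s (\<lambda>w z. atens A E12 Z (atens A V W v w) z))"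
    by (rule bilinear_mapI; (intro asum_linear[OF W Z] asum_param[OF W Z] assoc_left_inner lin)?; simp)
  fix v a s assume [simp]: "v \<in> carrier V" "a \<in> carrier A" and s: "s \<in> carrier E23"
  show "tsum E12_3 s (\<lambda>w z. atens A E12 Z (atens A V W (rmul V v a) w) z)
    = tsum E12_3 (lmul E23 a s) (\<lambda>w z. atens A E12 Z (atens A V W v w) z)"
    by (rule atensor_eqI[OF W Z _ _ _ s, where X = E12_3 and g = "\<lambda>s. tsum E12_3 s (\<lambda>w z. atens A E12 Z (atens A V W (rmul V v a) w) z)"];
      (intro asum_linear[OF W Z] assoc_left_inner lin)?; simp add: asum_atens[OF _ _ _ assoc_left_inner] lmul_atens atens_balanced)
qed

lemma assoc_left_linear [lin]: "f \<in> K_linear K Y E1_23 \<Longrightarrow> (\<lambda>y. assoc_left H A V W Z (f y)) \<in> K_linear K Y E12_3"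
  unfolding assoc_left_def Let_def by (rule asum_linear[OF _ _ _ assoc_left_outer]) simp_all

lemma assoc_left_atens': "v \<in> carrier V \<Longrightarrow> s \<in> carrier E23 \<Longrightarrow>
    assoc_left H A V W Z (atens A V E23 v s) = tsum E12_3 s (\<lambda>w z. atens A E12 Z (atens A V W v w) z)"
  unfolding assoc_left_def Let_def by (rule asum_atens[OF _ _ _ assoc_left_outer]) simp_all

lemma assoc_left_atens: "v \<in> carrier V \<Longrightarrow> w \<in> carrier W \<Longrightarrow> z \<in> carrier Z \<Longrightarrow>
    assoc_left H A V W Z (atens A V E23 v (atens A W Z w z)) = atens A E12 Z (atens A V W v w) z"
  by (simp add: assoc_left_atens' asum_atens[OF _ _ _ assoc_left_inner])

lemma assoc_left_closed [simp]: "s \<in> carrier E1_23 \<Longrightarrow> assoc_left H A V W Z s \<in> carrier E12_3"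
  by (rule K_linear_closed[OF assoc_left_linear[OF K_linear_id]])

lemma assoc_left_rmul:
  assumes s: "s \<in> carrier E1_23" and a [simp]: "a \<in> carrier A"
  shows "assoc_left H A V W Z (rmul E1_23 s a) = rmul E12_3 (assoc_left H A V W Z s) a"
proof (rule atensor_eqI[OF _ _ _ _ _ s, where X = E12_3 and g = "\<lambda>s. assoc_left H A V W Z (rmul E1_23 s a)"])
  fix v s assume [simp]: "v \<in> carrier V" and s: "s \<in> carrier E23"
  show "assoc_left H A V W Z (rmul E1_23 (atens A V E23 v s) a) = rmul E12_3 (assoc_left H A V W Z (atens A V E23 v s)) a"
    by (rule atensor_eqI[OF _ _ _ _ _ s, where X = E12_3 and g = "\<lambda>s. assoc_left H A V W Z (rmul E1_23 (atens A V E23 v s) a)"];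
       (intro lin)?; simp add: rmul_atens assoc_left_atens)
qed ((intro lin)?; simp)+

lemma assoc_right_inner: "z \<in> carrier Z \<Longrightarrow> balanced_map K A V W E1_23 (\<lambda>v w. atens A V E23 v (atens A W Z w z))"
  by (rule balanced_mapI; (intro lin)?; simp add: lmul_atens[symmetric] atens_balanced)

lemma assoc_right_outer: "balanced_map K A E12 Z E1_23 (\<lambda>s z. tsum E1_23 s (\<lambda>v w. atens A V E23 v (atens A W Z w z)))"
proof (rule balanced_mapI)
  show "bilinear_map K E12 Z E1_23 (\<lambda>s z. tsum E1_23 s (\<lambda>v w. atens A V E23 v (atens A W Z w z)))"
    by (rule bilinear_mapI; (intro asum_linear[OF V W] asum_param[OF V W] assoc_right_inner lin)?; simp)
  fix s a z assume [simp]: "z \<in> carrier Z" "a \<in> carrier A" and s: "s \<in> carrier E12"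
  show "tsum E1_23 (rmul E12 s a) (\<lambda>v w. atens A V E23 v (atens A W Z w z))
    = tsum E1_23 s (\<lambda>v w. atens A V E23 v (atens A W Z w (lmul Z a z)))"
    by (rule atensor_eqI[OF V W _ _ _ s, where X = E1_23 and g = "\<lambda>s. tsum E1_23 (rmul E12 s a) (\<lambda>v w. atens A V E23 v (atens A W Z w z))"];
      (intro asum_linear[OF V W] assoc_right_inner lin)?; simp add: asum_atens[OF _ _ _ assoc_right_inner] rmul_atens atens_balanced)
qed

lemma assoc_right_linear [lin]: "f \<in> K_linear K Y E12_3 \<Longrightarrow> (\<lambda>y. assoc_right H A V W Z (f y)) \<in> K_linear K Y E1_23"
  unfolding assoc_right_def Let_def by (rule asum_linear[OF _ _ _ assoc_right_outer]) simp_all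

lemma assoc_right_atens: "v \<in> carrier V \<Longrightarrow> w \<in> carrier W \<Longrightarrow> z \<in> carrier Z \<Longrightarrow>
    assoc_right H A V W Z (atens A E12 Z (atens A V W v w) z) = atens A V E23 v (atens A W Z w z)"
  unfolding assoc_right_def Let_def
  by (simp add: asum_atens[OF _ _ _ assoc_right_outer] asum_atens[OF _ _ _ assoc_right_inner])

end

section \<open>The inverse braiding of the second and third factor\<close>

context
  fixes V :: "('k, 'h, 'a, 'v, 'm1) hbimod_scheme" and M :: "('k, 'h, 'a, 'z, 'm2) hbimod_scheme"
    and W :: "('k, 'h, 'a, 'w, 'm3) hbimod_scheme"
  assumes V [simp]: "H_module_bimodule K H A V" and Mb [simp]: "H_module_bimodule K H A M" and Wb [simp]: "H_module_bimodule K H A W"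
    and M: "right_quasi_comm M" and W: "left_quasi_comm W"
begin

private abbreviation "F12 \<equiv> atensor H A V M"
private abbreviation "F13 \<equiv> atensor H A V W"
private abbreviation "F132 \<equiv> atensor H A F13 M"
private abbreviation "pm v w m \<equiv> atens A F13 M (atens A V W v w) m"
private abbreviation "tw v m w \<equiv> tsum F132 R (\<lambda>r s. pm v (act W s w) (act M r m))"

text \<open>For a scalar b between V and M, the identity (\<Delta> \<otimes> id) R = R_13 R_23 gives
  b a copy of R of its own, and left quasi-commutativity of W uses this copy to carry b through W to
  V.\<close>

lemma tau_inner:
  assumes w [simp]: "w \<in> carrier W"
  shows "balanced_map K A V M F132 (\<lambda>v m. tw v m w)"
proof (rule balanced_mapI)
  fix v b m assume [simp]: "v \<in> carrier V" "b \<in> carrier A" "m \<in> carrier M"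
  have "tw v (lmul M b m) w = tsum F132 R (\<lambda>r s. tsum F132 (comul H r) (\<lambda>c d. pm v (act W s w) (lmul M (act A c b) (act M d m))))"
  proof (rule hsum_cong)
    fix r s assume [simp]: "r \<in> carrier H" "s \<in> carrier H"
    show "pm v (act W s w) (act M r (lmul M b m)) = tsum F132 (comul H r) (\<lambda>c d. pm v (act W s w) (lmul M (act A c b) (act M d m)))"
      unfolding H_module_bimodule.act_lmul[OF Mb \<open>r \<in> carrier H\<close> \<open>b \<in> carrier A\<close> \<open>m \<in> carrier M\<close>]
      by (rule hsum_push[OF _ _ _ _ atens_linear_right[OF _ _ _ K_linear_id]]; (intro lin)?; simp)
  qed ((intro lin)?; simp)+
  also have "\<dots> = tsum F132 R (\<lambda>r s. tsum F132 R (\<lambda>r' s'. pm v (act W (s \<otimes>\<^bsub>H\<^esub> s') w) (lmul M (act A r b) (act M r' m))))"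
    by (rule comul_R_sum(1); (intro lin)?; simp)
  also have "\<dots> = tsum F132 R (\<lambda>r' s'. tsum F132 R (\<lambda>r s. pm v (act W (s \<otimes>\<^bsub>H\<^esub> s') w) (lmul M (act A r b) (act M r' m))))"
    by (rule hsum_swap; (intro lin)?; simp)
  also have "\<dots> = tsum F132 R (\<lambda>r' s'. pm (rmul V v b) (act W s' w) (act M r' m))"
  proof (rule hsum_cong)
    fix r' s' assume [simp]: "r' \<in> carrier H" "s' \<in> carrier H"
    have "tsum F132 R (\<lambda>r s. pm v (act W (s \<otimes>\<^bsub>H\<^esub> s') w) (lmul M (act A r b) (act M r' m)))
      = tsum F132 R (\<lambda>r s. pm v (rmul W (act W s (act W s' w)) (act A r b)) (act M r' m))"
      by (rule hsum_cong; (intro lin)?; simp add: act_mult'[OF bimod_H_module] atens_balanced[symmetric] rmul_atens)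
    also have "\<dots> = pm v (tsum W R (\<lambda>r s. rmul W (act W s (act W s' w)) (act A r b))) (act M r' m)"
      by (rule hsum_push[where g = "\<lambda>w. pm v w (act M r' m)", symmetric]; (intro lin)?; simp)
    also have "\<dots> = pm (rmul V v b) (act W s' w) (act M r' m)"
      by (simp add: left_quasi_commD(2)[OF W] atens_balanced)
    finally show "tsum F132 R (\<lambda>r s. pm v (act W (s \<otimes>\<^bsub>H\<^esub> s') w) (lmul M (act A r b) (act M r' m))) = \<dots>" .
  qed ((intro lin)?; simp)+
  finally show "tw (rmul V v b) m w = tw v (lmul M b m) w" ..
qed (intro lin; simp)

text \<open>The first equation, which leads to right linearity, rests on right quasi-commutativity
  of M. The second, balance between M and W, rests on that and on left quasi-commutativity of
  W.\<close>

lemma tau_rmul: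
  assumes [simp]: "v \<in> carrier V" "m \<in> carrier M" "w \<in> carrier W" "a \<in> carrier A"
  shows "tw v m (rmul W w a) = tsum F132 R (\<lambda>r s. pm v (act W s w) (rmul M (act M r m) a))"
    and "tw v m (lmul W a w) = tw v (rmul M m a) w"
proof -
  have quasi: "tsum F132 R (\<lambda>r' s'. pm v w (lmul M (act A s' a) (act M r' m))) = pm v w (rmul M m a)"
    if [simp]: "w \<in> carrier W" "a \<in> carrier A" "m \<in> carrier M" for w a m
    by (subst right_quasi_commD(2)[OF M, symmetric], simp, simp,
        rule hsum_push[OF _ _ _ _ atens_linear_right[OF _ _ _ K_linear_id], symmetric]; (intro lin)?; simp)
  have "tw v m (rmul W w a) = tsum F132 R (\<lambda>r s. tsum F132 (comul H s) (\<lambda>c d. pm v (rmul W (act W c w) (act A d a)) (act M r m)))"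
  proof (rule hsum_cong)
    fix r s assume [simp]: "r \<in> carrier H" "s \<in> carrier H"
    show "pm v (act W s (rmul W w a)) (act M r m) = tsum F132 (comul H s) (\<lambda>c d. pm v (rmul W (act W c w) (act A d a)) (act M r m))"
      unfolding H_module_bimodule.act_rmul[OF Wb \<open>s \<in> carrier H\<close> \<open>a \<in> carrier A\<close> \<open>w \<in> carrier W\<close>]
      by (rule hsum_push[where g = "\<lambda>w. pm v w (act M r m)"]; (intro lin)?; simp)
  qed ((intro lin)?; simp)+
  also have "\<dots> = tsum F132 R (\<lambda>r s. tsum F132 R (\<lambda>r' s'. pm v (rmul W (act W s' w) (act A s a)) (act M (r \<otimes>\<^bsub>H\<^esub> r') m)))"
    by (rule comul_R_sum(2); (intro lin)?; simp)
  also have "\<dots> = tsum F132 R (\<lambda>r' s'. tsum F132 R (\<lambda>r s. pm v (rmul W (act W s' w) (act A s a)) (act M (r \<otimes>\<^bsub>H\<^esub> r') m)))"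
    by (rule hsum_swap; (intro lin)?; simp)
  also have "\<dots> = tsum F132 R (\<lambda>r' s'. tsum F132 R (\<lambda>r s. pm v (act W s' w) (lmul M (act A s a) (act M r (act M r' m)))))"
    by (rule hsum_cong; (intro lin)?; (rule hsum_cong; (intro lin)?)?; simp add: act_mult'[OF bimod_H_module] atens_balanced[symmetric] rmul_atens)
  also have "\<dots> = tsum F132 R (\<lambda>r' s'. pm v (act W s' w) (rmul M (act M r' m) a))"
    by (rule hsum_cong; (intro lin)?; (rule quasi)?; simp)
  finally show "tw v m (rmul W w a) = tsum F132 R (\<lambda>r s. pm v (act W s w) (rmul M (act M r m) a))" .

  have "tw v (rmul M m a) w = tsum F132 R (\<lambda>r s. tsum F132 (comul H r) (\<lambda>c d. pm v (act W s w) (rmul M (act M c m) (act A d a))))"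
  proof (rule hsum_cong)
    fix r s assume [simp]: "r \<in> carrier H" "s \<in> carrier H"
    show "pm v (act W s w) (act M r (rmul M m a)) = tsum F132 (comul H r) (\<lambda>c d. pm v (act W s w) (rmul M (act M c m) (act A d a)))"
      unfolding H_module_bimodule.act_rmul[OF Mb \<open>r \<in> carrier H\<close> \<open>a \<in> carrier A\<close> \<open>m \<in> carrier M\<close>]
      by (rule hsum_push[OF _ _ _ _ atens_linear_right[OF _ _ _ K_linear_id]]; (intro lin)?; simp)
  qed ((intro lin)?; simp)+
  also have "\<dots> = tsum F132 R (\<lambda>r s. tsum F132 R (\<lambda>r' s'. pm v (act W (s \<otimes>\<^bsub>H\<^esub> s') w) (rmul M (act M r m) (act A r' a))))"
    by (rule comul_R_sum(1); (intro lin)?; simp)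
  finally have lhs: "tw v (rmul M m a) w = \<dots>" .

  have "tw v m (lmul W a w) = tsum F132 R (\<lambda>r s. tsum F132 R (\<lambda>r' s'. tsum F132 (comul H s) (\<lambda>c d.
      pm v (rmul W (act W (s' \<otimes>\<^bsub>H\<^esub> d) w) (act A (r' \<otimes>\<^bsub>H\<^esub> c) a)) (act M r m))))"
  proof (rule hsum_cong)
    fix r s assume [simp]: "r \<in> carrier H" "s \<in> carrier H"
    have "pm v (act W s (lmul W a w)) (act M r m) = tsum F132 (comul H s) (\<lambda>c d. pm v (lmul W (act A c a) (act W d w)) (act M r m))"
      unfolding H_module_bimodule.act_lmul[OF Wb \<open>s \<in> carrier H\<close> \<open>a \<in> carrier A\<close> \<open>w \<in> carrier W\<close>]
      by (rule hsum_push[where g = "\<lambda>w. pm v w (act M r m)"]; (intro lin)?; simp)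
    also have "\<dots> = tsum F132 (comul H s) (\<lambda>c d. tsum F132 R (\<lambda>r' s'. pm v (rmul W (act W (s' \<otimes>\<^bsub>H\<^esub> d) w) (act A (r' \<otimes>\<^bsub>H\<^esub> c) a)) (act M r m)))"
    proof (rule hsum_cong)
      fix c d assume [simp]: "c \<in> carrier H" "d \<in> carrier H"
      have "pm v (lmul W (act A c a) (act W d w)) (act M r m)
        = pm v (tsum W R (\<lambda>r' s'. rmul W (act W s' (act W d w)) (act A r' (act A c a)))) (act M r m)"
        by (simp add: left_quasi_commD(2)[OF W])
      also have "\<dots> = tsum F132 R (\<lambda>r' s'. pm v (rmul W (act W s' (act W d w)) (act A r' (act A c a))) (act M r m))"
        by (rule hsum_push[where g = "\<lambda>w. pm v w (act M r m)"]; (intro lin)?; simp)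
      also have "\<dots> = tsum F132 R (\<lambda>r' s'. pm v (rmul W (act W (s' \<otimes>\<^bsub>H\<^esub> d) w) (act A (r' \<otimes>\<^bsub>H\<^esub> c) a)) (act M r m))"
        by (rule hsum_cong; (intro lin)?; simp add: act_mult'[OF bimod_H_module] act_mult'[OF A_H_module])
      finally show "pm v (lmul W (act A c a) (act W d w)) (act M r m) = \<dots>" .
    qed ((intro lin)?; simp)+
    also have "\<dots> = tsum F132 R (\<lambda>r' s'. tsum F132 (comul H s) (\<lambda>c d. pm v (rmul W (act W (s' \<otimes>\<^bsub>H\<^esub> d) w) (act A (r' \<otimes>\<^bsub>H\<^esub> c) a)) (act M r m)))"
      by (rule hsum_swap; (intro lin)?; simp)
    finally show "pm v (act W s (lmul W a w)) (act M r m) = \<dots>" .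
  qed ((intro lin)?; simp)+
  \<comment> \<open>R \<Delta>(s) = \<Delta>^op(s) R moves the coproduct legs of s in front of R,
    where (id \<otimes> \<Delta>) R = R_13 R_12 can replace them.\<close>
  also have "\<dots> = tsum F132 R (\<lambda>r s. tsum F132 (comul H s) (\<lambda>c d. tsum F132 R (\<lambda>r' s'.
      pm v (rmul W (act W (c \<otimes>\<^bsub>H\<^esub> s') w) (act A (d \<otimes>\<^bsub>H\<^esub> r') a)) (act M r m))))"
    by (rule hsum_cong; (intro lin)?;
      (rule R_comul_sum[where f = "\<lambda>x y. pm v (rmul W (act W y w) (act A x a)) (act M _ m)"]; (intro lin)?)?; simp)
  also have "\<dots> = tsum F132 R (\<lambda>r1 s1. tsum F132 R (\<lambda>r2 s2. tsum F132 R (\<lambda>r' s'.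
      pm v (rmul W (act W (s2 \<otimes>\<^bsub>H\<^esub> s') w) (act A (s1 \<otimes>\<^bsub>H\<^esub> r') a)) (act M (r1 \<otimes>\<^bsub>H\<^esub> r2) m))))"
    by (rule comul_R_sum(2); (intro lin)?; simp)
  also have "\<dots> = tsum F132 R (\<lambda>r2 s2. tsum F132 R (\<lambda>r1 s1. tsum F132 R (\<lambda>r' s'.
      pm v (rmul W (act W (s2 \<otimes>\<^bsub>H\<^esub> s') w) (act A (s1 \<otimes>\<^bsub>H\<^esub> r') a)) (act M (r1 \<otimes>\<^bsub>H\<^esub> r2) m))))"
    by (rule hsum_swap; (intro lin)?; simp)
  \<comment> \<open>With the sum over (r1, s1) innermost, its legs act on the scalar and on m as
    right quasi-commutativity of M requires.\<close>
  also have "\<dots> = tsum F132 R (\<lambda>r2 s2. tsum F132 R (\<lambda>r' s'. tsum F132 R (\<lambda>r1 s1.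
      pm v (rmul W (act W (s2 \<otimes>\<^bsub>H\<^esub> s') w) (act A (s1 \<otimes>\<^bsub>H\<^esub> r') a)) (act M (r1 \<otimes>\<^bsub>H\<^esub> r2) m))))"
    by (rule hsum_cong; (intro lin)?; (rule hsum_swap; (intro lin)?)?; simp)
  also have "\<dots> = tsum F132 R (\<lambda>r s. tsum F132 R (\<lambda>r' s'. pm v (act W (s \<otimes>\<^bsub>H\<^esub> s') w) (rmul M (act M r m) (act A r' a))))"
  proof (rule hsum_cong, simp, simp, intro lin, simp_all, rule hsum_cong)
    fix r2 s2 r' s' assume [simp]: "r2 \<in> carrier H" "s2 \<in> carrier H" "r' \<in> carrier H" "s' \<in> carrier H"
    have "tsum F132 R (\<lambda>r1 s1. pm v (rmul W (act W (s2 \<otimes>\<^bsub>H\<^esub> s') w) (act A (s1 \<otimes>\<^bsub>H\<^esub> r') a)) (act M (r1 \<otimes>\<^bsub>H\<^esub> r2) m))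
      = tsum F132 R (\<lambda>r1 s1. pm v (act W (s2 \<otimes>\<^bsub>H\<^esub> s') w) (lmul M (act A s1 (act A r' a)) (act M r1 (act M r2 m))))"
      by (rule hsum_cong; (intro lin)?; simp add: act_mult'[OF bimod_H_module] act_mult'[OF A_H_module] atens_balanced[symmetric] rmul_atens)
    also have "\<dots> = pm v (act W (s2 \<otimes>\<^bsub>H\<^esub> s') w) (rmul M (act M r2 m) (act A r' a))"
      by (rule quasi) simp_all
    finally show "tsum F132 R (\<lambda>r1 s1. pm v (rmul W (act W (s2 \<otimes>\<^bsub>H\<^esub> s') w) (act A (s1 \<otimes>\<^bsub>H\<^esub> r') a)) (act M (r1 \<otimes>\<^bsub>H\<^esub> r2) m)) = \<dots>" .
  qed ((intro lin)?; simp)+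
  finally show "tw v m (lmul W a w) = tw v (rmul M m a) w" unfolding lhs .
qed

lemma tau_outer: "balanced_map K A F12 W F132 (\<lambda>s w. tsum F132 s (\<lambda>v m. tw v m w))"
proof (rule balanced_mapI)
  show "bilinear_map K F12 W F132 (\<lambda>s w. tsum F132 s (\<lambda>v m. tw v m w))"
    by (rule bilinear_mapI; (intro asum_linear[OF V Mb] asum_param[OF V Mb] tau_inner lin)?; simp)
  fix s a w assume [simp]: "w \<in> carrier W" "a \<in> carrier A" and s: "s \<in> carrier F12"
  show "tsum F132 (rmul F12 s a) (\<lambda>v m. tw v m w) = tsum F132 s (\<lambda>v m. tw v m (lmul W a w))"
    by (rule atensor_eqI[OF _ _ _ _ _ s, where X = F132 and g = "\<lambda>s. tsum F132 (rmul F12 s a) (\<lambda>v m. tw v m w)"];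
      (intro asum_linear[OF V Mb] tau_inner lin)?; simp add: asum_atens[OF _ _ _ tau_inner] rmul_atens tau_rmul)
qed

lemma tau23_inv_linear [lin]: "f \<in> K_linear K Y (atensor H A F12 W) \<Longrightarrow> (\<lambda>y. tau23_inv H R A V M W (f y)) \<in> K_linear K Y F132"
  unfolding tau23_inv_def Let_def by (rule asum_linear[OF _ _ _ tau_outer]) simp_all

lemma tau23_inv_closed: "s \<in> carrier (atensor H A F12 W) \<Longrightarrow> tau23_inv H R A V M W s \<in> carrier F132"
  by (rule K_linear_closed[OF tau23_inv_linear[OF K_linear_id]])

lemma tau23_inv_atens: "v \<in> carrier V \<Longrightarrow> m \<in> carrier M \<Longrightarrow> w \<in> carrier W \<Longrightarrow>
    tau23_inv H R A V M W (atens A F12 W (atens A V M v m) w) = tw v m w"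
  unfolding tau23_inv_def Let_def
  by (simp add: asum_atens[OF _ _ _ tau_outer] asum_atens[OF _ _ _ tau_inner])

lemma tau23_inv_rmul:
  assumes s: "s \<in> carrier (atensor H A F12 W)" and a [simp]: "a \<in> carrier A"
  shows "tau23_inv H R A V M W (rmul (atensor H A F12 W) s a) = rmul F132 (tau23_inv H R A V M W s) a"
proof (rule atensor_eqI[OF _ _ _ _ _ s, where X = F132 and g = "\<lambda>s. tau23_inv H R A V M W (rmul (atensor H A F12 W) s a)"])
  fix s w assume [simp]: "w \<in> carrier W" and s: "s \<in> carrier F12"
  show "tau23_inv H R A V M W (rmul (atensor H A F12 W) (atens A F12 W s w) a) = rmul F132 (tau23_inv H R A V M W (atens A F12 W s w)) a"
  proof (rule atensor_eqI[OF _ _ _ _ _ s, where X = F132 and g = "\<lambda>s. tau23_inv H R A V M W (rmul (atensor H A F12 W) (atens A F12 W s w) a)"])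
    fix v m assume [simp]: "v \<in> carrier V" "m \<in> carrier M"
    have "rmul F132 (tw v m w) a = tsum F132 R (\<lambda>r s. rmul F132 (pm v (act W s w) (act M r m)) a)"
      by (rule hsum_push[OF _ _ _ _ rmul_linear_left[OF _ K_linear_id]]; (intro lin)?; simp)
    also have "\<dots> = tsum F132 R (\<lambda>r s. pm v (act W s w) (rmul M (act M r m) a))"
      by (rule hsum_cong; (intro lin)?; simp add: rmul_atens)
    finally show "tau23_inv H R A V M W (rmul (atensor H A F12 W) (atens A F12 W (atens A V M v m) w) a)
        = rmul F132 (tau23_inv H R A V M W (atens A F12 W (atens A V M v m) w)) a"
      by (simp add: rmul_atens tau23_inv_atens tau_rmul)
  qed ((intro lin)?; simp)+
qed ((intro lin)?; simp)+

end

end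

section \<open>Forms of degree one and two\<close>

locale calculus_setting = braided_setting K H R A + \<Omega>: quasi_commutative_calculus K H R A \<Omega>
  for K :: "('k, 'l) ring_scheme" and H :: "('k, 'h, 'm) hopf_scheme" and R :: "('h, 'h) tens"
    and A :: "('k, 'h, 'o, 'p) hmod_scheme" and \<Omega> :: "('k, 'h, 'o, 'n) dcalc_scheme"
begin

lemma \<Omega>_H_module [simp]: "H_module K H \<Omega>" by (rule \<Omega>.H_module_axioms)

lemma forms_simps: "carrier (forms \<Omega> n) = grade \<Omega> n" "add (forms \<Omega> n) = add \<Omega>" "\<zero>\<^bsub>forms \<Omega> n\<^esub> = \<zero>\<^bsub>\<Omega>\<^esub>"
  "smult (forms \<Omega> n) = smult \<Omega>" "act (forms \<Omega> n) = act \<Omega>" "lmul (forms \<Omega> n) = monoid.mult \<Omega>"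
  "rmul (forms \<Omega> n) = monoid.mult \<Omega>"
  by (simp_all add: forms_def)

lemma grade_closed: "x \<in> grade \<Omega> n \<Longrightarrow> x \<in> carrier \<Omega>"
  using \<Omega>.submoduleE(1)[OF \<Omega>.grade_submodule] by blast

lemma A_grade: "a \<in> carrier A \<longleftrightarrow> a \<in> grade \<Omega> 0"
  by (simp add: \<Omega>.grade_0(1))

lemma forms_module: "module K (forms \<Omega> n)"
proof -
  note sub = \<Omega>.submoduleE[OF \<Omega>.grade_submodule]
  note [simp] = forms_simps grade_closed
  have "abelian_group (forms \<Omega> n)"
  proof (rule abelian_groupI)
    show "\<zero>\<^bsub>forms \<Omega> n\<^esub> \<in> carrier (forms \<Omega> n)"
      using \<Omega>.grade_submodule[of n] by (simp add: submodule_def subgroup.one_closed[of _ "add_monoid \<Omega>", simplified])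
    show "\<exists>y\<in>carrier (forms \<Omega> n). y \<oplus>\<^bsub>forms \<Omega> n\<^esub> x = \<zero>\<^bsub>forms \<Omega> n\<^esub>" if "x \<in> carrier (forms \<Omega> n)" for x
      using that sub(3)[of x n] by (auto intro!: bexI[of _ "\<ominus>\<^bsub>\<Omega>\<^esub> x"] simp: \<Omega>.M.l_neg)
  qed (auto simp: sub(5) \<Omega>.M.a_assoc intro: \<Omega>.M.a_comm)
  then show ?thesis
    by (rule moduleI[OF module.axioms(1)[OF H_module]])
      (auto simp: sub(4) \<Omega>.smult_l_distr \<Omega>.smult_r_distr \<Omega>.smult_assoc1)
qed

lemma forms_inclusion: "(\<lambda>x. x) \<in> K_linear K (forms \<Omega> n) \<Omega>"
  by (rule K_linearI) (auto simp: forms_simps grade_closed)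

text \<open>The axioms of the calculus take sums in all of \<Omega>, while the bimodule of n-forms
  takes them in its own record. The inclusion is linear, so the two agree.\<close>

lemma forms_hsum:
  assumes "t \<in> carrier (ktensor K H H)" "bilinear_map K H H (forms \<Omega> n) f"
  shows "tsum (forms \<Omega> n) t f = tsum \<Omega> t f"
  by (rule hsum_push[OF _ _ assms forms_inclusion]) (simp_all add: forms_module)

lemma forms_uminus: "x \<in> grade \<Omega> n \<Longrightarrow> \<ominus>\<^bsub>forms \<Omega> n\<^esub> x = \<ominus>\<^bsub>\<Omega>\<^esub> x"
  by (rule K_linear_map_uminus[OF forms_inclusion]) (simp_all add: forms_module forms_simps)

lemma forms_mult_linear:
  "f \<in> K_linear K Z (forms \<Omega> m) \<Longrightarrow> y \<in> grade \<Omega> n \<Longrightarrow> (\<lambda>z. f z \<otimes>\<^bsub>\<Omega>\<^esub> y) \<in> K_linear K Z (forms \<Omega> (m + n))"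
  "x \<in> grade \<Omega> m \<Longrightarrow> g \<in> K_linear K Z (forms \<Omega> n) \<Longrightarrow> (\<lambda>z. x \<otimes>\<^bsub>\<Omega>\<^esub> g z) \<in> K_linear K Z (forms \<Omega> (m + n))"
proof -
  assume f: "f \<in> K_linear K Z (forms \<Omega> m)" and y: "y \<in> grade \<Omega> n"
  have "(\<lambda>x. x \<otimes>\<^bsub>\<Omega>\<^esub> y) \<in> K_linear K (forms \<Omega> m) (forms \<Omega> (m + n))"
    by (rule K_linearI)
      (use y in \<open>simp_all add: forms_simps \<Omega>.grade_mult grade_closed \<Omega>.B.l_distr \<Omega>.smult_mult_left\<close>)
  from K_linear_comp[OF this f] show "(\<lambda>z. f z \<otimes>\<^bsub>\<Omega>\<^esub> y) \<in> K_linear K Z (forms \<Omega> (m + n))" .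
next
  assume g: "g \<in> K_linear K Z (forms \<Omega> n)" and x: "x \<in> grade \<Omega> m"
  have "(\<lambda>y. x \<otimes>\<^bsub>\<Omega>\<^esub> y) \<in> K_linear K (forms \<Omega> n) (forms \<Omega> (m + n))"
    by (rule K_linearI)
      (use x in \<open>simp_all add: forms_simps \<Omega>.grade_mult grade_closed \<Omega>.B.r_distr \<Omega>.smult_mult_right\<close>)
  from K_linear_comp[OF this g] show "(\<lambda>z. x \<otimes>\<^bsub>\<Omega>\<^esub> g z) \<in> K_linear K Z (forms \<Omega> (m + n))" .
qed

text \<open>A and the bimodule of zero-forms are separate records with the same operations; this
  lets the degree 0 instances of the calculus rules speak about A.\<close>

lemma A_forms: "K_linear K Z A = K_linear K Z (forms \<Omega> 0)" "K_linear K A Z = K_linear K (forms \<Omega> 0) Z"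
  by (auto simp: K_linear_def forms_simps \<Omega>.grade_0 Pi_iff)

lemma forms_H_module: "H_module K H (forms \<Omega> n)"
  by (rule H_module.intro[OF forms_module H_module_axioms.intro])
    (auto simp: forms_simps grade_closed \<Omega>.act_grade \<Omega>.act_add_left \<Omega>.act_add_right \<Omega>.act_smult_left \<Omega>.act_smult_right \<Omega>.act_mult \<Omega>.act_one)

lemma grade_mult_A: "a \<in> carrier A \<Longrightarrow> x \<in> grade \<Omega> n \<Longrightarrow> a \<otimes>\<^bsub>\<Omega>\<^esub> x \<in> grade \<Omega> n"
  "a \<in> carrier A \<Longrightarrow> x \<in> grade \<Omega> n \<Longrightarrow> x \<otimes>\<^bsub>\<Omega>\<^esub> a \<in> grade \<Omega> n"
  using \<Omega>.grade_mult[of a 0 x n] \<Omega>.grade_mult[of x n a 0] by (simp_all add: A_grade)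

lemma act_forms_mult:
  assumes [simp]: "x \<in> carrier H" and u: "u \<in> grade \<Omega> m" and v: "v \<in> grade \<Omega> n"
  shows "act \<Omega> x (u \<otimes>\<^bsub>\<Omega>\<^esub> v) = tsum (forms \<Omega> (m + n)) (comul H x) (\<lambda>a b. act \<Omega> a u \<otimes>\<^bsub>\<Omega>\<^esub> act \<Omega> b v)"
proof -
  note al = act_linear_left[OF forms_H_module, unfolded forms_simps]
  have "bilinear_map K H H (forms \<Omega> (m + n)) (\<lambda>a b. act \<Omega> a u \<otimes>\<^bsub>\<Omega>\<^esub> act \<Omega> b v)"
    by (intro bilinear_mapI forms_mult_linear al K_linear_id u v \<Omega>.act_grade)
  from forms_hsum[OF _ this] show ?thesis
    by (simp add: \<Omega>.act_prod grade_closed[OF u] grade_closed[OF v])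
qed

lemma forms_bimodule: "H_module_bimodule K H A (forms \<Omega> n)"
proof (intro H_module_bimodule.intro forms_H_module K_bimodule.intro forms_module
    K_bimodule_axioms.intro H_module_bimodule_axioms.intro)
  fix x a v assume *: "x \<in> carrier H" "a \<in> carrier A" "v \<in> carrier (forms \<Omega> n)"
  then have g: "a \<in> grade \<Omega> 0" "v \<in> grade \<Omega> n" by (auto simp: forms_simps A_grade)
  note al = act_linear_left[OF forms_H_module, unfolded forms_simps]
  have b: "bilinear_map K H H (forms \<Omega> n) (\<lambda>y z. act \<Omega> y a \<otimes>\<^bsub>\<Omega>\<^esub> act \<Omega> z v)"
    using forms_mult_linear[where m = 0 and n = n, simplified]
    by (intro bilinear_mapI forms_mult_linear[where m = 0 and n = n, simplified] al K_linear_id g \<Omega>.act_grade)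
  have b': "bilinear_map K H H (forms \<Omega> n) (\<lambda>y z. act \<Omega> y v \<otimes>\<^bsub>\<Omega>\<^esub> act \<Omega> z a)"
    by (intro bilinear_mapI forms_mult_linear[where m = n and n = 0, simplified] al K_linear_id g \<Omega>.act_grade)
  show "act (forms \<Omega> n) x (lmul (forms \<Omega> n) a v) =
    tsum (forms \<Omega> n) (comul H x) (\<lambda>x1 x2. lmul (forms \<Omega> n) (act A x1 a) (act (forms \<Omega> n) x2 v))"
    using act_forms_mult[of x a 0 v n] g * unfolding forms_simps
    by (simp, intro hsum_cong[OF _ _ b, symmetric]) (simp_all add: forms_module \<Omega>.act_grade_0)
  show "act (forms \<Omega> n) x (rmul (forms \<Omega> n) v a) =
    tsum (forms \<Omega> n) (comul H x) (\<lambda>x1 x2. rmul (forms \<Omega> n) (act (forms \<Omega> n) x1 v) (act A x2 a))"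
    using act_forms_mult[of x v n a 0] g * unfolding forms_simps
    by (simp, intro hsum_cong[OF _ _ b', symmetric]) (simp_all add: forms_module \<Omega>.act_grade_0)
qed (auto simp: forms_simps grade_mult_A grade_closed \<Omega>.grade_0(2-5) A_grade \<Omega>.B.l_distr \<Omega>.B.r_distr
    \<Omega>.smult_mult_left \<Omega>.smult_mult_right \<Omega>.B.m_assoc)

text \<open>Graded quasi-commutativity of an n-form with a scalar: the product of the degrees is 0,
  so no sign appears.\<close>

lemma forms_left_quasi_comm: "left_quasi_comm (forms \<Omega> n)"
proof (rule quasi_commutative_left, intro quasi_commutative_bimodule.intro forms_bimodule quasi_commutative_bimodule_axioms.intro)
  fix a v assume a [simp]: "a \<in> carrier A" and v: "v \<in> carrier (forms \<Omega> n)"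
  interpret F: H_module_bimodule K H A "forms \<Omega> n" by (rule forms_bimodule)
  have b: "bilinear_map K H H (forms \<Omega> n) (\<lambda>r s. lmul (forms \<Omega> n) (act A r a) (act (forms \<Omega> n) s v))"
    by (intro lin; simp add: forms_bimodule forms_H_module v)
  have "tsum (forms \<Omega> n) Rb (\<lambda>r s. lmul (forms \<Omega> n) (act A r a) (act (forms \<Omega> n) s v))
    = tsum (forms \<Omega> n) Rb (\<lambda>r s. act \<Omega> r a \<otimes>\<^bsub>\<Omega>\<^esub> act \<Omega> s v)"
    by (rule hsum_cong[OF forms_module _ b, symmetric]) (simp_all add: forms_simps \<Omega>.act_grade_0)
  also have "\<dots> = tsum \<Omega> Rb (\<lambda>r s. act \<Omega> r a \<otimes>\<^bsub>\<Omega>\<^esub> act \<Omega> s v)"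
    using forms_mult_linear[where m = 0 and n = n, simplified] v
    by (intro forms_hsum bilinear_mapI forms_mult_linear[where m = 0 and n = n, simplified]
      act_linear_left[OF forms_H_module, unfolded forms_simps] K_linear_id \<Omega>.act_grade)
      (simp_all add: forms_simps A_grade[symmetric])
  also have "\<dots> = rmul (forms \<Omega> n) v a"
    using \<Omega>.graded_quasi_comm[of v n a 0] v by (simp add: forms_simps A_grade[symmetric] signed_def)
  finally show "rmul (forms \<Omega> n) v a = tsum (forms \<Omega> n) Rb (\<lambda>r s. lmul (forms \<Omega> n) (act A r a) (act (forms \<Omega> n) s v))" ..
qed

text \<open>Quasi-commutativity of two forms, solved for the product in the other order.\<close>

lemma forms_braided_comm:
  assumes u: "u \<in> grade \<Omega> m" and v: "v \<in> grade \<Omega> n"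
  shows "tsum (forms \<Omega> (m + n)) R (\<lambda>r s. act \<Omega> s v \<otimes>\<^bsub>\<Omega>\<^esub> act \<Omega> r u) = signed (m * n) (forms \<Omega> (m + n)) (u \<otimes>\<^bsub>\<Omega>\<^esub> v)"
proof -
  let ?F = "forms \<Omega> (m + n)"
  note [simp] = forms_module \<Omega>.act_grade u v
  interpret F: module K ?F by (rule forms_module)
  have al: "f \<in> K_linear K Z H \<Longrightarrow> w \<in> grade \<Omega> k \<Longrightarrow> (\<lambda>z. act \<Omega> (f z) w) \<in> K_linear K Z (forms \<Omega> k)" for f w k and Z :: "('k, 'z, 'zz) module_scheme"
    using act_linear_left[OF forms_H_module, of f Z w k] by (simp add: forms_simps)
  have ml: "f \<in> K_linear K Z (forms \<Omega> n) \<Longrightarrow> y \<in> grade \<Omega> m \<Longrightarrow> (\<lambda>z. f z \<otimes>\<^bsub>\<Omega>\<^esub> y) \<in> K_linear K Z ?F"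
    "x \<in> grade \<Omega> n \<Longrightarrow> g \<in> K_linear K Z (forms \<Omega> m) \<Longrightarrow> (\<lambda>z. x \<otimes>\<^bsub>\<Omega>\<^esub> g z) \<in> K_linear K Z ?F"
    "f' \<in> K_linear K Z (forms \<Omega> m) \<Longrightarrow> y' \<in> grade \<Omega> n \<Longrightarrow> (\<lambda>z. f' z \<otimes>\<^bsub>\<Omega>\<^esub> y') \<in> K_linear K Z ?F"
    "x' \<in> grade \<Omega> m \<Longrightarrow> g' \<in> K_linear K Z (forms \<Omega> n) \<Longrightarrow> (\<lambda>z. x' \<otimes>\<^bsub>\<Omega>\<^esub> g' z) \<in> K_linear K Z ?F"
    for f y x g f' y' x' g' and Z :: "('k, 'z, 'zz) module_scheme"
    using forms_mult_linear(1)[of f Z n y m] forms_mult_linear(2)[of x n g Z m]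
      forms_mult_linear(1)[of f' Z m y' n] forms_mult_linear(2)[of x' m g' Z n] by (auto simp: add.commute)
  have sl: "f \<in> K_linear K Z ?F \<Longrightarrow> (\<lambda>z. signed k ?F (f z)) \<in> K_linear K Z ?F" for f k and Z :: "('k, 'z, 'zz) module_scheme"
    using K_linear_uminus[OF forms_module] by (cases "even k") (simp_all add: signed_def)
  have ga: "x \<otimes>\<^bsub>\<Omega>\<^esub> y \<in> grade \<Omega> (m + n)" if "x \<in> grade \<Omega> m" "y \<in> grade \<Omega> n" for x y
    using \<Omega>.grade_mult[OF that] .
  note rules = lin al ml sl
  have sg: "signed k \<Omega> x = signed k ?F x" if "x \<in> grade \<Omega> (m + n)" for k x
    using forms_uminus[OF that] by (simp add: signed_def)
  \<comment> \<open>The axiom for the product in the other order, summed in the forms of degree m +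
    n and with the sign inside the sum, so that \<open>Rbar_R_sum\<close> can act on the
    result.\<close>
  have flip: "v' \<otimes>\<^bsub>\<Omega>\<^esub> u' = tsum ?F Rb (\<lambda>r s. signed (m * n) ?F (act \<Omega> r u' \<otimes>\<^bsub>\<Omega>\<^esub> act \<Omega> s v'))"
    if [simp]: "u' \<in> grade \<Omega> m" "v' \<in> grade \<Omega> n" for u' v'
  proof -
    have b: "bilinear_map K H H ?F (\<lambda>r s. act \<Omega> r u' \<otimes>\<^bsub>\<Omega>\<^esub> act \<Omega> s v')" by (intro rules; simp)
    have c: "tsum ?F Rb (\<lambda>r s. act \<Omega> r u' \<otimes>\<^bsub>\<Omega>\<^esub> act \<Omega> s v') \<in> carrier ?F" by (rule hsum_closed[OF _ _ b]) simp_all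
    have "v' \<otimes>\<^bsub>\<Omega>\<^esub> u' = signed (m * n) \<Omega> (tsum ?F Rb (\<lambda>r s. act \<Omega> r u' \<otimes>\<^bsub>\<Omega>\<^esub> act \<Omega> s v'))"
      using \<Omega>.graded_quasi_comm[of v' n u' m] by (simp add: forms_hsum[OF _ b] mult.commute)
    also have "\<dots> = signed (m * n) ?F (tsum ?F Rb (\<lambda>r s. act \<Omega> r u' \<otimes>\<^bsub>\<Omega>\<^esub> act \<Omega> s v'))"
      using c by (simp add: sg forms_simps)
    also have "\<dots> = tsum ?F Rb (\<lambda>r s. signed (m * n) ?F (act \<Omega> r u' \<otimes>\<^bsub>\<Omega>\<^esub> act \<Omega> s v'))"
      by (rule hsum_push[OF _ _ _ b sl[OF K_linear_id]]) simp_all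
    finally show ?thesis .
  qed
  have "tsum ?F R (\<lambda>r s. act \<Omega> s v \<otimes>\<^bsub>\<Omega>\<^esub> act \<Omega> r u)
    = tsum ?F R (\<lambda>r s. tsum ?F Rb (\<lambda>r' s'. signed (m * n) ?F (act \<Omega> (r' \<otimes>\<^bsub>H\<^esub> r) u \<otimes>\<^bsub>\<Omega>\<^esub> act \<Omega> (s' \<otimes>\<^bsub>H\<^esub> s) v)))"
    by (rule hsum_cong; (intro rules)?; (subst flip; (rule hsum_cong; (intro rules)?)?)?;
      simp add: grade_closed[OF u] grade_closed[OF v] \<Omega>.act_mult)
  also have "\<dots> = tsum ?F Rb (\<lambda>r' s'. tsum ?F R (\<lambda>r s. signed (m * n) ?F (act \<Omega> (r' \<otimes>\<^bsub>H\<^esub> r) u \<otimes>\<^bsub>\<Omega>\<^esub> act \<Omega> (s' \<otimes>\<^bsub>H\<^esub> s) v)))"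
    by (rule hsum_swap; (intro rules)?; simp)
  also have "\<dots> = signed (m * n) ?F (act \<Omega> \<one>\<^bsub>H\<^esub> u \<otimes>\<^bsub>\<Omega>\<^esub> act \<Omega> \<one>\<^bsub>H\<^esub> v)"
    by (rule Rbar_R_sum; (intro rules)?; simp)
  finally show ?thesis by (simp add: grade_closed[OF u] grade_closed[OF v])
qed

text \<open>The graded rule treats a form and a scalar alike, so exchanging them gives this second
  rule, with R in the other leg order.\<close>

lemma forms_right_quasi_comm: "right_quasi_comm (forms \<Omega> n)"
proof -
  have "tsum (forms \<Omega> n) R (\<lambda>r s. lmul (forms \<Omega> n) (act A s a) (act (forms \<Omega> n) r v)) = rmul (forms \<Omega> n) v a"
    if [simp]: "a \<in> carrier A" and v: "v \<in> carrier (forms \<Omega> n)" for a v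
  proof -
    have b: "bilinear_map K H H (forms \<Omega> n) (\<lambda>r s. lmul (forms \<Omega> n) (act A s a) (act (forms \<Omega> n) r v))"
      by (intro lin; simp add: forms_bimodule forms_H_module v)
    have "tsum (forms \<Omega> n) R (\<lambda>r s. lmul (forms \<Omega> n) (act A s a) (act (forms \<Omega> n) r v))
      = tsum (forms \<Omega> n) R (\<lambda>r s. act \<Omega> s a \<otimes>\<^bsub>\<Omega>\<^esub> act \<Omega> r v)"
      by (rule hsum_cong[OF forms_module _ b, symmetric]) (simp_all add: forms_simps \<Omega>.act_grade_0)
    then show ?thesis
      using forms_braided_comm[of v n a 0] v by (simp add: forms_simps A_grade[symmetric] signed_def)
  qed
  then show ?thesis by (simp add: right_quasi_comm_def forms_bimodule)
qed

text \<open>Opaque names keep the simplifier from rewriting the degree \<open>1\<close>.\<close>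

definition F1 :: "('k, 'h, 'o, 'o) hbimod" where "F1 = forms \<Omega> 1"
definition F2 :: "('k, 'h, 'o, 'o) hbimod" where "F2 = forms \<Omega> 2"

lemma F_bimodule [simp]: "H_module_bimodule K H A F1" "H_module_bimodule K H A F2"
  unfolding F1_def F2_def by (rule forms_bimodule)+

lemma F_quasi_comm: "left_quasi_comm F1" "left_quasi_comm F2" "right_quasi_comm F1" "right_quasi_comm F2"
  unfolding F1_def F2_def by (rule forms_left_quasi_comm forms_right_quasi_comm)+

lemma F_grade: "x \<in> carrier F1 \<longleftrightarrow> x \<in> grade \<Omega> 1" "x \<in> carrier F2 \<longleftrightarrow> x \<in> grade \<Omega> 2"
  by (simp_all add: F1_def F2_def forms_simps)

section \<open>Wedge product and differential in degrees one and two\<close>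

lemma wedge_linear [lin]:
  "f \<in> K_linear K Z F1 \<Longrightarrow> y \<in> carrier F1 \<Longrightarrow> (\<lambda>z. f z \<otimes>\<^bsub>\<Omega>\<^esub> y) \<in> K_linear K Z F2"
  "x \<in> carrier F1 \<Longrightarrow> g \<in> K_linear K Z F1 \<Longrightarrow> (\<lambda>z. x \<otimes>\<^bsub>\<Omega>\<^esub> g z) \<in> K_linear K Z F2"
  using forms_mult_linear(1)[of f Z 1 y 1] forms_mult_linear(2)[of x 1 g Z 1]
  by (simp_all add: F_grade) (simp_all add: F1_def F2_def numeral_2_eq_2)

lemma wedge_closed [simp]: "x \<in> carrier F1 \<Longrightarrow> y \<in> carrier F1 \<Longrightarrow> x \<otimes>\<^bsub>\<Omega>\<^esub> y \<in> carrier F2"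
  using \<Omega>.grade_mult[of x 1 y 1] by (simp add: F_grade numeral_2_eq_2)

lemma wedge_assoc:
  assumes "x \<in> carrier F1" "y \<in> carrier F1" "a \<in> carrier A"
  shows "rmul F1 x a \<otimes>\<^bsub>\<Omega>\<^esub> y = x \<otimes>\<^bsub>\<Omega>\<^esub> lmul F1 a y"
    "lmul F1 a x \<otimes>\<^bsub>\<Omega>\<^esub> y = lmul F2 a (x \<otimes>\<^bsub>\<Omega>\<^esub> y)"
    "x \<otimes>\<^bsub>\<Omega>\<^esub> rmul F1 y a = rmul F2 (x \<otimes>\<^bsub>\<Omega>\<^esub> y) a"
  using assms by (auto simp: F1_def F2_def forms_simps A_grade intro!: \<Omega>.B.m_assoc \<Omega>.B.m_assoc[symmetric] dest: grade_closed)

lemma act_wedge: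
  "x \<in> carrier H \<Longrightarrow> u \<in> carrier F1 \<Longrightarrow> v \<in> carrier F1 \<Longrightarrow>
    act F2 x (u \<otimes>\<^bsub>\<Omega>\<^esub> v) = tsum F2 (comul H x) (\<lambda>a b. act F1 a u \<otimes>\<^bsub>\<Omega>\<^esub> act F1 b v)"
  using act_forms_mult[of x u 1 v 1] by (simp add: F_grade) (simp add: F1_def F2_def forms_simps numeral_2_eq_2)

text \<open>The product of the degrees is odd. This is the source of the minus sign in the mixed
  term.\<close>

lemma wedge_braided_comm:
  "u \<in> carrier F1 \<Longrightarrow> v \<in> carrier F1 \<Longrightarrow>
    tsum F2 R (\<lambda>r s. act F1 s v \<otimes>\<^bsub>\<Omega>\<^esub> act F1 r u) = \<ominus>\<^bsub>F2\<^esub> (u \<otimes>\<^bsub>\<Omega>\<^esub> v)"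
  using forms_braided_comm[of u 1 v 1] by (simp add: F_grade) (simp add: F1_def F2_def forms_simps signed_def numeral_2_eq_2)

lemma diff_linear [lin]:
  "f \<in> K_linear K Z A \<Longrightarrow> (\<lambda>z. diff \<Omega> (f z)) \<in> K_linear K Z F1"
  "g \<in> K_linear K Z F1 \<Longrightarrow> (\<lambda>z. diff \<Omega> (g z)) \<in> K_linear K Z F2"
  using K_linear_comp[OF \<Omega>.diff_linear[of 0], of f Z] K_linear_comp[OF \<Omega>.diff_linear[of 1], of g Z]
  by (simp_all add: A_forms F1_def F2_def numeral_2_eq_2)

lemma diff_closed [simp]: "a \<in> carrier A \<Longrightarrow> diff \<Omega> a \<in> carrier F1" "x \<in> carrier F1 \<Longrightarrow> diff \<Omega> x \<in> carrier F2"
  using K_linear_closed[OF diff_linear(1)[OF K_linear_id]] K_linear_closed[OF diff_linear(2)[OF K_linear_id]] by auto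

lemma act_diff:
  "x \<in> carrier H \<Longrightarrow> a \<in> carrier A \<Longrightarrow> act F1 x (diff \<Omega> a) = diff \<Omega> (act A x a)"
  "x \<in> carrier H \<Longrightarrow> u \<in> carrier F1 \<Longrightarrow> act F2 x (diff \<Omega> u) = diff \<Omega> (act F1 x u)"
  using \<Omega>.act_diff[of x a 0] \<Omega>.act_diff[of x u 1]
  by (simp_all add: A_grade \<Omega>.act_grade_0 F_grade) (simp_all add: F1_def F2_def forms_simps)

lemma diff_diff_A: "a \<in> carrier A \<Longrightarrow> diff \<Omega> (diff \<Omega> a) = \<zero>\<^bsub>F2\<^esub>"
  using \<Omega>.diff_diff[of a 0] by (simp add: A_grade F2_def forms_simps)

lemma leibniz_A:
  "a \<in> carrier A \<Longrightarrow> u \<in> carrier F1 \<Longrightarrow> diff \<Omega> (lmul F1 a u) = (diff \<Omega> a \<otimes>\<^bsub>\<Omega>\<^esub> u) \<oplus>\<^bsub>F2\<^esub> lmul F2 a (diff \<Omega> u)"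
  using \<Omega>.leibniz[of a 0 u 1] by (simp add: A_grade F_grade) (simp add: F1_def F2_def forms_simps signed_def)

lemma leibniz_right:
  assumes a: "a \<in> carrier A" and u: "u \<in> carrier F1"
  shows "diff \<Omega> (rmul F1 u a) = rmul F2 (diff \<Omega> u) a \<oplus>\<^bsub>F2\<^esub> \<ominus>\<^bsub>F2\<^esub> (u \<otimes>\<^bsub>\<Omega>\<^esub> diff \<Omega> a)"
proof -
  have "u \<otimes>\<^bsub>\<Omega>\<^esub> diff \<Omega> a \<in> grade \<Omega> 2"
    using wedge_closed[OF u diff_closed(1)[OF a]] unfolding F_grade .
  then have "\<ominus>\<^bsub>F2\<^esub> (u \<otimes>\<^bsub>\<Omega>\<^esub> diff \<Omega> a) = \<ominus>\<^bsub>\<Omega>\<^esub> (u \<otimes>\<^bsub>\<Omega>\<^esub> diff \<Omega> a)"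
    unfolding F2_def by (rule forms_uminus)
  then show ?thesis using \<Omega>.leibniz[of u 1 a 0] a u
    by (simp add: A_grade F_grade) (simp add: F1_def F2_def forms_simps signed_def)
qed

end

section \<open>Maps that are right linear up to an equivariant term\<close>

context braided_setting
begin

lemma act_rmul_sum: "H_module_bimodule K H A V \<Longrightarrow> x \<in> carrier H \<Longrightarrow> v \<in> carrier V \<Longrightarrow> a \<in> carrier A \<Longrightarrow>
    act V x (rmul V v a) = tsum V (comul H x) (\<lambda>b c. rmul V (act V b v) (act A c a))"
  by (rule H_module_bimodule.act_rmul)

context
  fixes W :: "('k, 'h, 'a, 'w, 'm1) hbimod_scheme" and N :: "('k, 'h, 'a, 'z, 'm2) hbimod_scheme" and Q and \<delta>
  assumes W [simp]: "H_module_bimodule K H A W" and N [simp]: "H_module_bimodule K H A N"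
    and Q: "Q \<in> K_linear K W N" and \<delta>: "bilinear_map K W A N \<delta>"
    and \<delta>_act: "\<And>x w a. \<lbrakk>x \<in> carrier H; w \<in> carrier W; a \<in> carrier A\<rbrakk> \<Longrightarrow>
      act N x (\<delta> w a) = tsum N (comul H x) (\<lambda>b c. \<delta> (act W b w) (act A c a))"
    and Q_rmul: "\<And>w a. \<lbrakk>w \<in> carrier W; a \<in> carrier A\<rbrakk> \<Longrightarrow> Q (rmul W w a) = rmul N (Q w) a \<oplus>\<^bsub>N\<^esub> \<delta> w a"
begin

lemmas Q_rules = K_linear_comp[OF Q] bilinear_comp[OF \<delta>] badj_linear_left[OF bimod_H_module[OF W] bimod_H_module[OF N] Q]
    badj_linear_right[OF bimod_H_module[OF W] bimod_H_module[OF N] Q] K_linear_plus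

lemma Q_closed: "w \<in> carrier W \<Longrightarrow> Q w \<in> carrier N"
  "w \<in> carrier W \<Longrightarrow> a \<in> carrier A \<Longrightarrow> \<delta> w a \<in> carrier N"
  "x \<in> carrier H \<Longrightarrow> w \<in> carrier W \<Longrightarrow> badj H W N x Q w \<in> carrier N"
  "u \<in> carrier N \<Longrightarrow> v \<in> carrier N \<Longrightarrow> u \<oplus>\<^bsub>N\<^esub> v \<in> carrier N"
  "k \<in> carrier K \<Longrightarrow> u \<in> carrier N \<Longrightarrow> k \<odot>\<^bsub>N\<^esub> u \<in> carrier N"
proof -
  interpret N: H_module_bimodule K H A N by (rule N)
  show "w \<in> carrier W \<Longrightarrow> Q w \<in> carrier N"
    "w \<in> carrier W \<Longrightarrow> a \<in> carrier A \<Longrightarrow> \<delta> w a \<in> carrier N"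
    "x \<in> carrier H \<Longrightarrow> w \<in> carrier W \<Longrightarrow> badj H W N x Q w \<in> carrier N"
    "u \<in> carrier N \<Longrightarrow> v \<in> carrier N \<Longrightarrow> u \<oplus>\<^bsub>N\<^esub> v \<in> carrier N"
    "k \<in> carrier K \<Longrightarrow> u \<in> carrier N \<Longrightarrow> k \<odot>\<^bsub>N\<^esub> u \<in> carrier N"
    using K_linear_closed[OF Q] bilinear_mapD(3)[OF \<delta>] badj_closed[OF bimod_H_module[OF W] bimod_H_module[OF N] Q]
    by simp_all
qed

text \<open>Expand y \<rhd> Q(u b): the right linear part goes by \<open>badj_conv\<close> and
  coassociativity, and the equivariant part acquires a third leg through y = \<epsilon>(y_1) y_2,
  which is where the counit comes from. The antipode then cancels by
  \<open>antipode_comul_cancel\<close>.\<close>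

lemma badj_rmul:
  assumes x [simp]: "x \<in> carrier H" and w [simp]: "w \<in> carrier W" and a [simp]: "a \<in> carrier A"
  shows "badj H W N x Q (rmul W w a) = rmul N (badj H W N x Q w) a \<oplus>\<^bsub>N\<^esub> counit H x \<odot>\<^bsub>N\<^esub> \<delta> w a"
proof -
  note [simp] = Q_closed
  note rules = lin Q_rules
  let ?F = "\<lambda>d u b. rmul N (badj H W N d Q u) b \<oplus>\<^bsub>N\<^esub> counit H d \<odot>\<^bsub>N\<^esub> \<delta> u b"
  have y: "act N y (Q (rmul W u b)) = tsum N (comul H y) (\<lambda>d z. tsum N (comul H z) (\<lambda>e c. ?F d (act W e u) (act A c b)))"
    if [simp]: "y \<in> carrier H" "u \<in> carrier W" "b \<in> carrier A" for y u b
  proof -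
    let ?g1 = "\<lambda>d e c. rmul N (badj H W N d Q (act W e u)) (act A c b)"
    let ?g2 = "\<lambda>d e c. counit H d \<odot>\<^bsub>N\<^esub> \<delta> (act W e u) (act A c b)"
    have "act N y (rmul N (Q u) b) = tsum N (comul H y) (\<lambda>x c. rmul N (act N x (Q u)) (act A c b))"
      by (rule act_rmul_sum) simp_all
    also have "\<dots> = tsum N (comul H y) (\<lambda>x c. tsum N (comul H x) (\<lambda>d e. ?g1 d e c))"
    proof (rule hsum_cong)
      fix x c assume [simp]: "x \<in> carrier H" "c \<in> carrier H"
      show "rmul N (act N x (Q u)) (act A c b) = tsum N (comul H x) (\<lambda>d e. ?g1 d e c)"
        unfolding badj_conv[OF bimod_H_module[OF W] bimod_H_module[OF N] Q \<open>x \<in> carrier H\<close> \<open>u \<in> carrier W\<close>, symmetric]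
        by (rule hsum_push[OF _ _ _ _ rmul_linear_left[OF _ K_linear_id]]; (intro rules)?; simp)
    qed ((intro rules)?; simp)+
    also have "\<dots> = tsum N (comul H y) (\<lambda>d z. tsum N (comul H z) (\<lambda>e c. ?g1 d e c))"
      by (rule coassoc_sum; (intro rules)?; simp)
    finally have 1: "act N y (rmul N (Q u) b) = \<dots>" .
    have "act N y (\<delta> u b) = tsum N (comul H y) (\<lambda>d z. counit H d \<odot>\<^bsub>N\<^esub> tsum N (comul H z) (\<lambda>e c. \<delta> (act W e u) (act A c b)))"
      unfolding \<delta>_act[OF \<open>y \<in> carrier H\<close> \<open>u \<in> carrier W\<close> \<open>b \<in> carrier A\<close>]
      by (rule counit_left_sum[symmetric]; (intro rules)?; simp)
    also have "\<dots> = tsum N (comul H y) (\<lambda>d z. tsum N (comul H z) (\<lambda>e c. ?g2 d e c))"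
      by (rule hsum_cong; (intro rules)?; (rule hsum_push[OF _ _ _ _ counit_scaled_linear_right[OF _ _ K_linear_id]]; (intro rules)?)?; simp)
    finally have 2: "act N y (\<delta> u b) = \<dots>" .
    have split: "tsum N t (\<lambda>a b. f a b \<oplus>\<^bsub>N\<^esub> g a b) = tsum N t f \<oplus>\<^bsub>N\<^esub> tsum N t g"
      if "t \<in> carrier (ktensor K H H)" "bilinear_map K H H N f" "bilinear_map K H H N g" for t f g
      by (rule hsum_plus[OF _ that]) simp
    have "tsum N (comul H y) (\<lambda>d z. tsum N (comul H z) (\<lambda>e c. ?F d (act W e u) (act A c b)))
      = tsum N (comul H y) (\<lambda>d z. tsum N (comul H z) (\<lambda>e c. ?g1 d e c) \<oplus>\<^bsub>N\<^esub> tsum N (comul H z) (\<lambda>e c. ?g2 d e c))"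
      by (rule hsum_cong; (intro rules)?; (rule split; (intro rules)?)?; simp)
    also have "\<dots> = act N y (rmul N (Q u) b) \<oplus>\<^bsub>N\<^esub> act N y (\<delta> u b)"
      unfolding 1 2 by (rule split; (intro rules)?; simp)
    finally show ?thesis
      by (simp add: Q_rmul K_linear_add[OF act_linear_right[OF _ _ K_linear_id]])
  qed
  have "badj H W N x Q (rmul W w a) = tsum N (comul H x) (\<lambda>y s. tsum N (comul H (antipode H s)) (\<lambda>p q.
      act N y (Q (rmul W (act W p w) (act A q a)))))"
    unfolding badj_def
  proof (rule hsum_cong)
    fix y s assume [simp]: "y \<in> carrier H" "s \<in> carrier H"
    have s: "antipode H s \<in> carrier H" by simp
    show "act N y (Q (act W (antipode H s) (rmul W w a))) = tsum N (comul H (antipode H s)) (\<lambda>p q.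
      act N y (Q (rmul W (act W p w) (act A q a))))"
      unfolding act_rmul_sum[OF W s w a]
      by (rule hsum_push[OF _ _ _ _ act_linear_right[OF _ _ Q]]; (intro rules)?; simp)
  qed ((intro rules)?; simp)+
  also have "\<dots> = tsum N (comul H x) (\<lambda>y s. tsum N (comul H y) (\<lambda>d z. tsum N (comul H z) (\<lambda>e c.
      tsum N (comul H (antipode H s)) (\<lambda>p q. ?F d (act W (e \<otimes>\<^bsub>H\<^esub> p) w) (act A (c \<otimes>\<^bsub>H\<^esub> q) a)))))"
  proof (rule hsum_cong)
    fix y s assume [simp]: "y \<in> carrier H" "s \<in> carrier H"
    have "tsum N (comul H (antipode H s)) (\<lambda>p q. act N y (Q (rmul W (act W p w) (act A q a))))
      = tsum N (comul H (antipode H s)) (\<lambda>p q. tsum N (comul H y) (\<lambda>d z. tsum N (comul H z) (\<lambda>e c. ?F d (act W (e \<otimes>\<^bsub>H\<^esub> p) w) (act A (c \<otimes>\<^bsub>H\<^esub> q) a))))"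
    proof (rule hsum_cong)
      fix p q assume [simp]: "p \<in> carrier H" "q \<in> carrier H"
      have "act N y (Q (rmul W (act W p w) (act A q a)))
        = tsum N (comul H y) (\<lambda>d z. tsum N (comul H z) (\<lambda>e c. ?F d (act W e (act W p w)) (act A c (act A q a))))"
        by (rule y) simp_all
      also have "\<dots> = tsum N (comul H y) (\<lambda>d z. tsum N (comul H z) (\<lambda>e c. ?F d (act W (e \<otimes>\<^bsub>H\<^esub> p) w) (act A (c \<otimes>\<^bsub>H\<^esub> q) a)))"
        by (rule hsum_cong; (intro rules)?; (rule hsum_cong; (intro rules)?)?; simp add: act_mult'[OF bimod_H_module] act_mult'[OF A_H_module])
      finally show "act N y (Q (rmul W (act W p w) (act A q a))) = \<dots>" .
    qed ((intro rules)?; simp)+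
    also have "\<dots> = tsum N (comul H y) (\<lambda>d z. tsum N (comul H (antipode H s)) (\<lambda>p q. tsum N (comul H z) (\<lambda>e c. ?F d (act W (e \<otimes>\<^bsub>H\<^esub> p) w) (act A (c \<otimes>\<^bsub>H\<^esub> q) a))))"
      by (rule hsum_swap; (intro rules)?; simp)
    also have "\<dots> = tsum N (comul H y) (\<lambda>d z. tsum N (comul H z) (\<lambda>e c. tsum N (comul H (antipode H s)) (\<lambda>p q. ?F d (act W (e \<otimes>\<^bsub>H\<^esub> p) w) (act A (c \<otimes>\<^bsub>H\<^esub> q) a))))"
      by (rule hsum_cong; (intro rules)?; (rule hsum_swap; (intro rules)?)?; simp)
    finally show "tsum N (comul H (antipode H s)) (\<lambda>p q. act N y (Q (rmul W (act W p w) (act A q a)))) = \<dots>" .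
  qed ((intro rules)?; simp)+
  also have "\<dots> = ?F x (act W \<one>\<^bsub>H\<^esub> w) (act A \<one>\<^bsub>H\<^esub> a)"
    by (rule antipode_comul_cancel; (intro rules)?; simp)
  finally show ?thesis by simp
qed

text \<open>Left multiplication is traded through R for right multiplication, where \<open>Q\<close>
  obeys its rule. Carrying R back through \<open>Q\<close> by \<open>R_act_Rbar_badj_sum\<close>
  leaves the adjoint action. So \<open>Q\<close> is also braided left linear up to \<delta>.\<close>

lemma Rbar_lmul_badj_sum:
  assumes WL: "left_quasi_comm W" and NL: "left_quasi_comm N" and w [simp]: "w \<in> carrier W" and a [simp]: "a \<in> carrier A"
  shows "tsum N Rb (\<lambda>r s. lmul N (act A r a) (badj H W N s Q w)) \<oplus>\<^bsub>N\<^esub> tsum N R (\<lambda>r s. \<delta> (act W s w) (act A r a))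
    = Q (lmul W a w)"
proof -
  note [simp] = Q_closed
  note rules = lin Q_rules
  have "tsum N Rb (\<lambda>r s. lmul N (act A r a) (badj H W N s Q w))
    = tsum N Rb (\<lambda>r s. tsum N R (\<lambda>r' s'. rmul N (act N s' (badj H W N s Q w)) (act A (r' \<otimes>\<^bsub>H\<^esub> r) a)))"
    by (rule hsum_cong; (intro rules)?; (subst left_quasi_commD(2)[OF NL, symmetric])?; ((rule hsum_cong; (intro rules)?))?; simp add: act_mult'[OF A_H_module])
  also have "\<dots> = tsum N R (\<lambda>r s. rmul N (Q (act W s w)) (act A r a))"
    by (rule R_act_Rbar_badj_sum[OF _ _ Q, where f = "\<lambda>r y. rmul N y (act A r a)"]; (intro rules)?; simp)
  finally have 1: "tsum N Rb (\<lambda>r s. lmul N (act A r a) (badj H W N s Q w)) = \<dots>" .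
  have "Q (lmul W a w) = tsum N R (\<lambda>r s. Q (rmul W (act W s w) (act A r a)))"
    unfolding left_quasi_commD(2)[OF WL a w, symmetric]
    by (rule hsum_push[OF _ _ _ _ Q]; (intro rules)?; simp)
  also have "\<dots> = tsum N R (\<lambda>r s. rmul N (Q (act W s w)) (act A r a) \<oplus>\<^bsub>N\<^esub> \<delta> (act W s w) (act A r a))"
    by (rule hsum_cong; (intro rules)?; simp add: Q_rmul)
  also have "\<dots> = tsum N R (\<lambda>r s. rmul N (Q (act W s w)) (act A r a)) \<oplus>\<^bsub>N\<^esub> tsum N R (\<lambda>r s. \<delta> (act W s w) (act A r a))"
    by (rule hsum_plus; (intro rules)?; simp)
  finally show ?thesis unfolding 1 ..
qed

end

text \<open>The hypotheses of the preceding lemmas with \<delta> as an explicit argument: it is v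
  \<otimes> da for a connection and 0 for a curvature, and the adjoint action scales it by the
  counit.\<close>

definition quasi_right_linear ::
  "('k, 'h, 'a, 'w, 'm1) hbimod_scheme \<Rightarrow> ('k, 'h, 'a, 'z, 'm2) hbimod_scheme
    \<Rightarrow> ('w \<Rightarrow> 'z) \<Rightarrow> ('w \<Rightarrow> 'a \<Rightarrow> 'z) \<Rightarrow> bool" where
  "quasi_right_linear W N Q \<delta> \<longleftrightarrow> Q \<in> K_linear K W N \<and> bilinear_map K W A N \<delta>
     \<and> (\<forall>x\<in>carrier H. \<forall>w\<in>carrier W. \<forall>a\<in>carrier A.
          act N x (\<delta> w a) = tsum N (comul H x) (\<lambda>b c. \<delta> (act W b w) (act A c a)))
     \<and> (\<forall>w\<in>carrier W. \<forall>a\<in>carrier A. Q (rmul W w a) = rmul N (Q w) a \<oplus>\<^bsub>N\<^esub> \<delta> w a)"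

lemma quasi_right_linearD:
  assumes "quasi_right_linear W N Q \<delta>"
  shows "Q \<in> K_linear K W N" "bilinear_map K W A N \<delta>"
    "\<lbrakk>x \<in> carrier H; w \<in> carrier W; a \<in> carrier A\<rbrakk> \<Longrightarrow>
      act N x (\<delta> w a) = tsum N (comul H x) (\<lambda>b c. \<delta> (act W b w) (act A c a))"
    "\<lbrakk>w \<in> carrier W; a \<in> carrier A\<rbrakk> \<Longrightarrow> Q (rmul W w a) = rmul N (Q w) a \<oplus>\<^bsub>N\<^esub> \<delta> w a"
  using assms by (auto simp: quasi_right_linear_def)

text \<open>Brings curvatures under the lemmas about connections, as maps whose Leibniz term is
  0.\<close>

lemma right_linear_quasi:
  assumes N [simp]: "H_module_bimodule K H A N" and Q: "Q \<in> Hom_right K A W N"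
  shows "quasi_right_linear W N Q (\<lambda>_ _. \<zero>\<^bsub>N\<^esub>)"
proof -
  interpret N: H_module_bimodule K H A N by (rule N)
  have b: "bilinear_map K H H N (\<lambda>_ _. \<zero>\<^bsub>N\<^esub>)" by (intro bilinear_mapI K_linear_zero) simp_all
  have act: "act N x \<zero>\<^bsub>N\<^esub> = \<zero>\<^bsub>N\<^esub>" if "x \<in> carrier H" for x
    by (rule K_linear_map_zero[OF act_linear_right[OF _ that K_linear_id]]) simp_all
  have zl: "(\<lambda>t. tsum N t (\<lambda>_ _. \<zero>\<^bsub>N\<^esub>)) \<in> K_linear K (ktensor K H H) N"
    by (intro ksum_linear[OF H_module H_module _ b] K_linear_id) simp
  have z: "tsum N t (\<lambda>_ _. \<zero>\<^bsub>N\<^esub>) = \<zero>\<^bsub>N\<^esub>" if "t \<in> carrier (ktensor K H H)" for t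
    by (rule ktensor_eqI[OF H_module H_module zl K_linear_zero _ that]) (simp_all add: ksum_ktens[OF H_module H_module _ b])
  show ?thesis
    using Q by (auto simp: quasi_right_linear_def Hom_right_def act z K_linear_closed
      intro!: bilinear_mapI K_linear_zero)
qed

context
  fixes W :: "('k, 'h, 'a, 'w, 'm1) hbimod_scheme" and N :: "('k, 'h, 'a, 'z, 'm2) hbimod_scheme" and Q and \<delta>
  assumes W [simp]: "H_module_bimodule K H A W" and N [simp]: "H_module_bimodule K H A N"
    and Q: "quasi_right_linear W N Q \<delta>"
begin

lemmas QD = quasi_right_linearD[OF Q]
lemmas badj_lin = badj_linear_left[OF bimod_H_module[OF W] bimod_H_module[OF N] QD(1)]
    badj_linear_right[OF bimod_H_module[OF W] bimod_H_module[OF N] QD(1)]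
lemmas badj_cl = badj_closed[OF bimod_H_module[OF W] bimod_H_module[OF N] QD(1)]

text \<open>Lets the rules for \<open>Q\<close> be applied again to its translates
  \<open>badj H W N x Q\<close>, as happens when two copies of \<open>Rbar\<close> occur.\<close>

lemma quasi_right_linear_badj:
  assumes x [simp]: "x \<in> carrier H"
  shows "quasi_right_linear W N (badj H W N x Q) (\<lambda>w a. counit H x \<odot>\<^bsub>N\<^esub> \<delta> w a)"
proof -
  note [simp] = bilinear_mapD(3)[OF QD(2)]
  have "act N y (counit H x \<odot>\<^bsub>N\<^esub> \<delta> w a) = tsum N (comul H y) (\<lambda>b c. counit H x \<odot>\<^bsub>N\<^esub> \<delta> (act W b w) (act A c a))"
    if [simp]: "y \<in> carrier H" "w \<in> carrier W" "a \<in> carrier A" for y w a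
  proof -
    have "act N y (counit H x \<odot>\<^bsub>N\<^esub> \<delta> w a) = counit H x \<odot>\<^bsub>N\<^esub> tsum N (comul H y) (\<lambda>b c. \<delta> (act W b w) (act A c a))"
      by (simp add: K_linear_smult[OF act_linear_right[OF _ _ K_linear_id]] QD(3))
    also have "\<dots> = tsum N (comul H y) (\<lambda>b c. counit H x \<odot>\<^bsub>N\<^esub> \<delta> (act W b w) (act A c a))"
      by (rule hsum_push[OF _ _ _ _ counit_scaled_linear_right[OF _ _ K_linear_id]]; (intro lin bilinear_comp[OF QD(2)])?; simp)
    finally show ?thesis .
  qed
  then show ?thesis
    unfolding quasi_right_linear_def
    by (intro conjI ballI badj_linear[OF _ _ QD(1)] lin bilinear_comp[OF QD(2)]
      badj_rmul[OF W N QD(1) QD(2) QD(3) QD(4)]; simp)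
qed

end

section \<open>The braided tensor product of the identity with a map\<close>

text \<open>The value of id \<otimes>_R Q at v \<otimes> w, kept as a function of the pair (v, w)
  since for a connection it does not descend to V \<otimes>_A W.\<close>

definition id_tensor ::
  "('k, 'h, 'a, 'v, 'm0) hbimod_scheme \<Rightarrow> ('k, 'h, 'a, 'w, 'm1) hbimod_scheme \<Rightarrow> ('k, 'h, 'a, 'z, 'm2) hbimod_scheme
    \<Rightarrow> ('w \<Rightarrow> 'z) \<Rightarrow> 'v \<Rightarrow> 'w \<Rightarrow> ('v, 'z) tens" where
  "id_tensor V W N Q v w = tsum (atensor H A V N) Rb (\<lambda>r s. atens A V N (act V r v) (badj H W N s Q w))"

context
  fixes V :: "('k, 'h, 'a, 'v, 'm0) hbimod_scheme"
    and W :: "('k, 'h, 'a, 'w, 'm1) hbimod_scheme" and N :: "('k, 'h, 'a, 'z, 'm2) hbimod_scheme" and Q and \<delta>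
  assumes V [simp]: "H_module_bimodule K H A V" and W [simp]: "H_module_bimodule K H A W" and N [simp]: "H_module_bimodule K H A N"
    and Q: "quasi_right_linear W N Q \<delta>"
begin

lemmas QD' = quasi_right_linearD[OF Q]
lemmas id_rules = lin badj_lin[OF W N Q] bilinear_comp[OF QD'(2)]
lemmas id_closed = badj_cl[OF W N Q] bilinear_mapD(3)[OF QD'(2)] K_linear_closed[OF QD'(1)]

lemma id_tensor_bilinear: "bilinear_map K V W (atensor H A V N) (id_tensor V W N Q)"
  unfolding id_tensor_def[abs_def] by (intro id_rules; simp add: id_closed)

lemma id_tensor_closed: "v \<in> carrier V \<Longrightarrow> w \<in> carrier W \<Longrightarrow> id_tensor V W N Q v w \<in> carrier (atensor H A V N)"
  by (rule bilinear_mapD(3)[OF id_tensor_bilinear])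

text \<open>The adjoint action of s scales the Leibniz term by \<epsilon>(s), and
  \<open>(id \<otimes> \<epsilon>) Rbar = 1\<close> then removes the R-matrix from it.\<close>

lemma id_tensor_rmul:
  assumes [simp]: "v \<in> carrier V" "w \<in> carrier W" "a \<in> carrier A"
  shows "id_tensor V W N Q v (rmul W w a) = rmul (atensor H A V N) (id_tensor V W N Q v w) a \<oplus>\<^bsub>atensor H A V N\<^esub> atens A V N v (\<delta> w a)"
proof -
  let ?X = "atensor H A V N"
  note [simp] = id_closed
  interpret N: module K N by simp
  have "id_tensor V W N Q v (rmul W w a) = tsum ?X Rb (\<lambda>r s. rmul ?X (atens A V N (act V r v) (badj H W N s Q w)) a \<oplus>\<^bsub>?X\<^esub> counit H s \<odot>\<^bsub>?X\<^esub> atens A V N (act V r v) (\<delta> w a))"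
    unfolding id_tensor_def
  proof (rule hsum_cong)
    fix r s assume [simp]: "r \<in> carrier H" "s \<in> carrier H"
    have "badj H W N s Q (rmul W w a) = rmul N (badj H W N s Q w) a \<oplus>\<^bsub>N\<^esub> counit H s \<odot>\<^bsub>N\<^esub> \<delta> w a"
      by (rule quasi_right_linearD(4)[OF quasi_right_linear_badj[OF W N Q]]) simp_all
    then show "atens A V N (act V r v) (badj H W N s Q (rmul W w a))
      = rmul ?X (atens A V N (act V r v) (badj H W N s Q w)) a \<oplus>\<^bsub>?X\<^esub> counit H s \<odot>\<^bsub>?X\<^esub> atens A V N (act V r v) (\<delta> w a)"
      by (simp add: K_linear_add[OF atens_linear_right[OF V N _ K_linear_id]] K_linear_smult[OF atens_linear_right[OF V N _ K_linear_id]] rmul_atens)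
  qed ((intro id_rules K_linear_plus)?; simp)+
  also have "\<dots> = tsum ?X Rb (\<lambda>r s. rmul ?X (atens A V N (act V r v) (badj H W N s Q w)) a)
      \<oplus>\<^bsub>?X\<^esub> tsum ?X Rb (\<lambda>r s. counit H s \<odot>\<^bsub>?X\<^esub> atens A V N (act V r v) (\<delta> w a))"
    by (rule hsum_plus; (intro id_rules)?; simp)
  also have "tsum ?X Rb (\<lambda>r s. counit H s \<odot>\<^bsub>?X\<^esub> atens A V N (act V r v) (\<delta> w a)) = atens A V N (act V \<one>\<^bsub>H\<^esub> v) (\<delta> w a)"
    by (rule counit_Rbar_sum; (intro id_rules)?; simp)
  also have "tsum ?X Rb (\<lambda>r s. rmul ?X (atens A V N (act V r v) (badj H W N s Q w)) a) = rmul ?X (id_tensor V W N Q v w) a"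
    unfolding id_tensor_def
    by (rule hsum_push[OF _ _ _ _ rmul_linear_left[OF _ K_linear_id], symmetric]; (intro id_rules)?; simp)
  finally show ?thesis by simp
qed

text \<open>The second summand on the left is the defect of balance. For a right linear
  \<open>Q\<close> it vanishes; for a connection it is compensated by the other part of the sum
  connection.\<close>

lemma id_tensor_balanced:
  assumes WL: "left_quasi_comm W" and NL: "left_quasi_comm N"
    and [simp]: "v \<in> carrier V" "w \<in> carrier W" "a \<in> carrier A"
  shows "id_tensor V W N Q (rmul V v a) w \<oplus>\<^bsub>atensor H A V N\<^esub> tsum (atensor H A V N) R (\<lambda>r s. atens A V N v (\<delta> (act W s w) (act A r a)))
    = id_tensor V W N Q v (lmul W a w)"
proof -
  let ?X = "atensor H A V N"
  note [simp] = id_closed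
  interpret N: module K N by simp
  let ?D = "tsum N R (\<lambda>r s. \<delta> (act W s w) (act A r a))"
  let ?L = "\<lambda>s. tsum N Rb (\<lambda>r' s'. lmul N (act A r' a) (badj H W N (s' \<otimes>\<^bsub>H\<^esub> s) Q w))"
  have D [simp]: "?D \<in> carrier N" by (rule hsum_closed; (intro id_rules)?; simp)
  have L [simp]: "s \<in> carrier H \<Longrightarrow> ?L s \<in> carrier N" for s by (rule hsum_closed; (intro id_rules)?; simp)
  \<comment> \<open>\<open>Rbar_lmul_badj_sum\<close> for the map \<open>badj H W N s Q\<close>: the
    two adjoint actions multiply to that of the product s' s, and \<delta> is scaled by
    \<epsilon>(s).\<close>
  have key: "badj H W N s Q (lmul W a w) = ?L s \<oplus>\<^bsub>N\<^esub> counit H s \<odot>\<^bsub>N\<^esub> ?D" if [simp]: "s \<in> carrier H" for s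
  proof -
    note Qs = quasi_right_linear_badj[OF W N Q that]
    note Qs' = quasi_right_linearD[OF Qs]
    have "badj H W N s Q (lmul W a w) = tsum N Rb (\<lambda>r' s'. lmul N (act A r' a) (badj H W N s' (badj H W N s Q) w))
        \<oplus>\<^bsub>N\<^esub> tsum N R (\<lambda>r' s'. counit H s \<odot>\<^bsub>N\<^esub> \<delta> (act W s' w) (act A r' a))"
      by (rule Rbar_lmul_badj_sum[OF W N Qs'(1-4) WL NL, symmetric]) simp_all
    also have "tsum N Rb (\<lambda>r' s'. lmul N (act A r' a) (badj H W N s' (badj H W N s Q) w)) = ?L s"
      by (rule hsum_cong; (intro id_rules)?; simp add: badj_mult[OF _ _ QD'(1)])
    also have "tsum N R (\<lambda>r' s'. counit H s \<odot>\<^bsub>N\<^esub> \<delta> (act W s' w) (act A r' a)) = counit H s \<odot>\<^bsub>N\<^esub> ?D"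
      by (rule hsum_push[OF _ _ _ _ counit_scaled_linear_right[OF _ _ K_linear_id], symmetric]; (intro id_rules)?; simp)
    finally show ?thesis .
  qed
  have "id_tensor V W N Q v (lmul W a w) = tsum ?X Rb (\<lambda>r s. atens A V N (act V r v) (?L s) \<oplus>\<^bsub>?X\<^esub> counit H s \<odot>\<^bsub>?X\<^esub> atens A V N (act V r v) ?D)"
    unfolding id_tensor_def
  proof (rule hsum_cong)
    fix r s assume [simp]: "r \<in> carrier H" "s \<in> carrier H"
    show "atens A V N (act V r v) (badj H W N s Q (lmul W a w))
      = atens A V N (act V r v) (?L s) \<oplus>\<^bsub>?X\<^esub> counit H s \<odot>\<^bsub>?X\<^esub> atens A V N (act V r v) ?D"
      by (simp add: key K_linear_add[OF atens_linear_right[OF V N _ K_linear_id]] K_linear_smult[OF atens_linear_right[OF V N _ K_linear_id]])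
  qed ((intro id_rules K_linear_plus)?; simp)+
  also have "\<dots> = tsum ?X Rb (\<lambda>r s. atens A V N (act V r v) (?L s)) \<oplus>\<^bsub>?X\<^esub> tsum ?X Rb (\<lambda>r s. counit H s \<odot>\<^bsub>?X\<^esub> atens A V N (act V r v) ?D)"
    by (rule hsum_plus; (intro id_rules)?; simp)
  also have "tsum ?X Rb (\<lambda>r s. counit H s \<odot>\<^bsub>?X\<^esub> atens A V N (act V r v) ?D) = atens A V N (act V \<one>\<^bsub>H\<^esub> v) ?D"
    by (rule counit_Rbar_sum; (intro id_rules)?; simp)
  also have "atens A V N (act V \<one>\<^bsub>H\<^esub> v) ?D = tsum ?X R (\<lambda>r s. atens A V N v (\<delta> (act W s w) (act A r a)))"
    by (simp, rule hsum_push[OF _ _ _ _ atens_linear_right[OF _ _ _ K_linear_id]]; (intro id_rules)?; simp)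
  also have "tsum ?X Rb (\<lambda>r s. atens A V N (act V r v) (?L s))
    = tsum ?X Rb (\<lambda>r s. tsum ?X Rb (\<lambda>r' s'. atens A V N (rmul V (act V r v) (act A r' a)) (badj H W N (s' \<otimes>\<^bsub>H\<^esub> s) Q w)))"
  proof (rule hsum_cong)
    fix r s assume [simp]: "r \<in> carrier H" "s \<in> carrier H"
    have "atens A V N (act V r v) (?L s) = tsum ?X Rb (\<lambda>r' s'. atens A V N (act V r v) (lmul N (act A r' a) (badj H W N (s' \<otimes>\<^bsub>H\<^esub> s) Q w)))"
      by (rule hsum_push[OF _ _ _ _ atens_linear_right[OF _ _ _ K_linear_id]]; (intro id_rules)?; simp)
    also have "\<dots> = tsum ?X Rb (\<lambda>r' s'. atens A V N (rmul V (act V r v) (act A r' a)) (badj H W N (s' \<otimes>\<^bsub>H\<^esub> s) Q w))"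
      by (rule hsum_cong; (intro id_rules)?; simp add: atens_balanced)
    finally show "atens A V N (act V r v) (?L s) = \<dots>" .
  qed ((intro id_rules)?; simp)+
  \<comment> \<open>The two copies of \<open>Rbar\<close> amount to one copy whose left leg is
    replaced by its coproduct, and this coproduct is the action on the product v a.\<close>
  also have "\<dots> = tsum ?X Rb (\<lambda>r s. tsum ?X (comul H r) (\<lambda>b c. atens A V N (rmul V (act V b v) (act A c a)) (badj H W N s Q w)))"
    by (rule comul_Rbar_sum_left[symmetric]; (intro id_rules)?; simp)
  also have "\<dots> = id_tensor V W N Q (rmul V v a) w"
    unfolding id_tensor_def
  proof (rule hsum_cong)
    fix r s assume [simp]: "r \<in> carrier H" "s \<in> carrier H"
    show "tsum ?X (comul H r) (\<lambda>b c. atens A V N (rmul V (act V b v) (act A c a)) (badj H W N s Q w))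
      = atens A V N (act V r (rmul V v a)) (badj H W N s Q w)"
      unfolding act_rmul_sum[OF V \<open>r \<in> carrier H\<close> \<open>v \<in> carrier V\<close> \<open>a \<in> carrier A\<close>]
      by (rule hsum_push[OF _ _ _ _ atens_linear_left[OF _ _ K_linear_id], symmetric]; (intro id_rules)?; simp)
  qed ((intro id_rules)?; simp)+
  finally show ?thesis ..
qed

end

end

section \<open>Connections and their curvature\<close>

context calculus_setting
begin

definition rwedge :: "('k, 'h, 'o, 'u, 'q) hbimod_scheme \<Rightarrow> ('u, 'o) tens \<Rightarrow> 'o \<Rightarrow> ('u, 'o) tens" where
  "rwedge U t \<theta> = tsum (atensor H A U F2) t (\<lambda>u \<eta>. atens A U F2 u (\<eta> \<otimes>\<^bsub>\<Omega>\<^esub> \<theta>))"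

text \<open>The extension of a map that satisfies the Leibniz rule up to the scalar \<open>c\<close>. Acting by \<open>x \<in> H\<close> on
  a connection changes the scalar from \<open>1\<close> to the counit of \<open>x\<close>.\<close>

definition ext :: "('k, 'h, 'o, 'u, 'q) hbimod_scheme \<Rightarrow> 'k \<Rightarrow> ('u \<Rightarrow> ('u, 'o) tens) \<Rightarrow> ('u, 'o) tens \<Rightarrow> ('u, 'o) tens" where
  "ext U c D t = tsum (atensor H A U F2) t (\<lambda>u \<theta>. rwedge U (D u) \<theta> \<oplus>\<^bsub>atensor H A U F2\<^esub> c \<odot>\<^bsub>atensor H A U F2\<^esub> atens A U F2 u (diff \<Omega> \<theta>))"

abbreviation leibniz_map :: "('k, 'h, 'o, 'u, 'q) hbimod_scheme \<Rightarrow> 'k \<Rightarrow> ('u \<Rightarrow> ('u, 'o) tens) \<Rightarrow> bool" where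
  "leibniz_map U c D \<equiv> quasi_right_linear U (atensor H A U F1) D (\<lambda>u a. c \<odot>\<^bsub>atensor H A U F1\<^esub> atens A U F1 u (diff \<Omega> a))"

context
  fixes U :: "('k, 'h, 'o, 'u, 'q) hbimod_scheme"
  assumes U [simp]: "H_module_bimodule K H A U"
begin

private abbreviation "U1 \<equiv> atensor H A U F1"
private abbreviation "U2 \<equiv> atensor H A U F2"

lemma rwedge_balanced: "\<theta> \<in> carrier F1 \<Longrightarrow> balanced_map K A U F1 U2 (\<lambda>u \<eta>. atens A U F2 u (\<eta> \<otimes>\<^bsub>\<Omega>\<^esub> \<theta>))"
  by (rule balanced_mapI; (intro lin)?; simp add: wedge_assoc atens_balanced)

lemma rwedge_linear [lin]:
  "f \<in> K_linear K Z U1 \<Longrightarrow> \<theta> \<in> carrier F1 \<Longrightarrow> (\<lambda>z. rwedge U (f z) \<theta>) \<in> K_linear K Z U2"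
  "t \<in> carrier U1 \<Longrightarrow> g \<in> K_linear K Z F1 \<Longrightarrow> (\<lambda>z. rwedge U t (g z)) \<in> K_linear K Z U2"
proof -
  show "f \<in> K_linear K Z U1 \<Longrightarrow> \<theta> \<in> carrier F1 \<Longrightarrow> (\<lambda>z. rwedge U (f z) \<theta>) \<in> K_linear K Z U2"
    unfolding rwedge_def by (rule asum_linear[OF U F_bimodule(1) _ rwedge_balanced]) simp_all
  have "(\<lambda>\<theta>. rwedge U t \<theta>) \<in> K_linear K F1 U2" if "t \<in> carrier U1"
    unfolding rwedge_def
    by (rule asum_param[OF U F_bimodule(1) _ _ that rwedge_balanced]; (intro lin)?; simp)
  then show "t \<in> carrier U1 \<Longrightarrow> g \<in> K_linear K Z F1 \<Longrightarrow> (\<lambda>z. rwedge U t (g z)) \<in> K_linear K Z U2"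
    by (rule K_linear_comp)
qed

lemma rwedge_atens: "u \<in> carrier U \<Longrightarrow> \<eta> \<in> carrier F1 \<Longrightarrow> \<theta> \<in> carrier F1 \<Longrightarrow>
    rwedge U (atens A U F1 u \<eta>) \<theta> = atens A U F2 u (\<eta> \<otimes>\<^bsub>\<Omega>\<^esub> \<theta>)"
  unfolding rwedge_def by (rule asum_atens[OF U F_bimodule(1) _ rwedge_balanced]) simp_all

lemma rwedge_closed [simp]: "t \<in> carrier U1 \<Longrightarrow> \<theta> \<in> carrier F1 \<Longrightarrow> rwedge U t \<theta> \<in> carrier U2"
  by (rule K_linear_closed[OF rwedge_linear(1)[OF K_linear_id]])

lemma rwedge_rmul:
  assumes t: "t \<in> carrier U1" and [simp]: "\<theta> \<in> carrier F1" "a \<in> carrier A"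
  shows "rwedge U (rmul U1 t a) \<theta> = rwedge U t (lmul F1 a \<theta>)"
    and "rwedge U t (rmul F1 \<theta> a) = rmul U2 (rwedge U t \<theta>) a"
  by (rule atensor_eqI[OF U F_bimodule(1) _ _ _ t, where X = U2]; (intro lin)?; simp add: rmul_atens rwedge_atens wedge_assoc)+

text \<open>The action on u \<otimes> \<eta> \<and> \<theta> uses three legs of x; coassociativity
  regroups the first two into the action on u \<otimes> \<eta>.\<close>

lemma act_rwedge:
  assumes t: "t \<in> carrier U1" and [simp]: "\<theta> \<in> carrier F1" "x \<in> carrier H"
  shows "act U2 x (rwedge U t \<theta>) = tsum U2 (comul H x) (\<lambda>b c. rwedge U (act U1 b t) (act F1 c \<theta>))"
proof (rule atensor_eqI[OF U F_bimodule(1) _ _ _ t, where X = U2 and g = "\<lambda>t. act U2 x (rwedge U t \<theta>)"])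
  fix u \<eta> assume [simp]: "u \<in> carrier U" "\<eta> \<in> carrier F1"
  have "act U2 x (rwedge U (atens A U F1 u \<eta>) \<theta>) = tsum U2 (comul H x) (\<lambda>b c. atens A U F2 (act U b u) (act F2 c (\<eta> \<otimes>\<^bsub>\<Omega>\<^esub> \<theta>)))"
    by (simp add: rwedge_atens act_atens)
  also have "\<dots> = tsum U2 (comul H x) (\<lambda>b c. tsum U2 (comul H c) (\<lambda>d e. atens A U F2 (act U b u) (act F1 d \<eta> \<otimes>\<^bsub>\<Omega>\<^esub> act F1 e \<theta>)))"
    by (rule hsum_cong; (intro lin)?; (subst act_wedge)?; (rule hsum_push[OF _ _ _ _ atens_linear_right[OF _ _ _ K_linear_id]]; (intro lin)?)?; simp)
  also have "\<dots> = tsum U2 (comul H x) (\<lambda>b e. tsum U2 (comul H b) (\<lambda>b d. atens A U F2 (act U b u) (act F1 d \<eta> \<otimes>\<^bsub>\<Omega>\<^esub> act F1 e \<theta>)))"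
    by (rule coassoc_sum'; (intro lin)?; simp)
  also have "\<dots> = tsum U2 (comul H x) (\<lambda>b e. rwedge U (act U1 b (atens A U F1 u \<eta>)) (act F1 e \<theta>))"
  proof (rule hsum_cong)
    fix b e assume [simp]: "b \<in> carrier H" "e \<in> carrier H"
    have "rwedge U (act U1 b (atens A U F1 u \<eta>)) (act F1 e \<theta>)
      = tsum U2 (comul H b) (\<lambda>b d. rwedge U (atens A U F1 (act U b u) (act F1 d \<eta>)) (act F1 e \<theta>))"
      unfolding act_atens[OF U F_bimodule(1) \<open>b \<in> carrier H\<close> \<open>u \<in> carrier U\<close> \<open>\<eta> \<in> carrier F1\<close>]
      by (rule hsum_push[OF _ _ _ _ rwedge_linear(1)[OF K_linear_id]]; (intro lin)?; simp)
    also have "\<dots> = tsum U2 (comul H b) (\<lambda>b d. atens A U F2 (act U b u) (act F1 d \<eta> \<otimes>\<^bsub>\<Omega>\<^esub> act F1 e \<theta>))"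
      by (rule hsum_cong; (intro lin)?; simp add: rwedge_atens)
    finally show "tsum U2 (comul H b) (\<lambda>b d. atens A U F2 (act U b u) (act F1 d \<eta> \<otimes>\<^bsub>\<Omega>\<^esub> act F1 e \<theta>))
      = rwedge U (act U1 b (atens A U F1 u \<eta>)) (act F1 e \<theta>)" ..
  qed ((intro lin)?; simp)+
  finally show "act U2 x (rwedge U (atens A U F1 u \<eta>) \<theta>) = tsum U2 (comul H x) (\<lambda>b c. rwedge U (act U1 b (atens A U F1 u \<eta>)) (act F1 c \<theta>))" .
qed ((intro lin)?; simp)+

end

end

context braided_setting
begin

text \<open>Only the values of \<delta> on the carriers matter. This absorbs the scalar 1 when the
  translate of a connection has its Leibniz term \<epsilon>(x) (1 t) rewritten as \<epsilon>(x)
  t.\<close>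

lemma quasi_right_linear_cong:
  assumes Q: "quasi_right_linear W N Q \<delta>" and W [simp]: "H_module_bimodule K H A W" and N [simp]: "H_module_bimodule K H A N"
    and eq: "\<And>w a. w \<in> carrier W \<Longrightarrow> a \<in> carrier A \<Longrightarrow> \<delta>' w a = \<delta> w a"
  shows "quasi_right_linear W N Q \<delta>'"
proof -
  note QD = quasi_right_linearD[OF Q]
  have "bilinear_map K W A N \<delta>'"
  proof (rule bilinear_mapI)
    show "(\<lambda>v. \<delta>' v w) \<in> K_linear K W N" if "w \<in> carrier A" for w
      by (rule K_linear_cong[OF bilinear_mapD(1)[OF QD(2) that]]) (simp_all add: eq that)
    show "(\<lambda>w. \<delta>' v w) \<in> K_linear K A N" if "v \<in> carrier W" for v
      by (rule K_linear_cong[OF bilinear_mapD(2)[OF QD(2) that]]) (simp_all add: eq that)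
  qed
  moreover have "act N x (\<delta>' w a) = tsum N (comul H x) (\<lambda>b c. \<delta>' (act W b w) (act A c a))"
    if [simp]: "x \<in> carrier H" "w \<in> carrier W" "a \<in> carrier A" for x w a
    by (simp add: eq QD(3), rule hsum_cong[symmetric]; (intro lin bilinear_comp[OF QD(2)])?; simp add: eq)
  ultimately show ?thesis
    using QD(1) QD(4) by (simp add: quasi_right_linear_def eq)
qed

text \<open>For an equivariant \<open>Q\<close> the adjoint action is the counit, and
  \<open>(id \<otimes> \<epsilon>) Rbar = 1\<close>; so the braided tensor product of the identity
  with \<open>Q\<close> is the ordinary one.\<close>

lemma id_tensor_equivariant:
  assumes V [simp]: "H_module_bimodule K H A V" and W [simp]: "H_module K H W" and N [simp]: "H_module_bimodule K H A N"
    and Q: "Q \<in> K_linear K W N" and eq: "\<And>x w. x \<in> carrier H \<Longrightarrow> w \<in> carrier W \<Longrightarrow> Q (act W x w) = act N x (Q w)"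
    and [simp]: "v \<in> carrier V" "w \<in> carrier W"
  shows "tsum (atensor H A V N) Rb (\<lambda>r s. atens A V N (act V r v) (badj H W N s Q w)) = atens A V N v (Q w)"
proof -
  let ?X = "atensor H A V N"
  note [simp] = K_linear_closed[OF Q]
  interpret N: module K N by simp
  have "tsum ?X Rb (\<lambda>r s. atens A V N (act V r v) (badj H W N s Q w)) = tsum ?X Rb (\<lambda>r s. counit H s \<odot>\<^bsub>?X\<^esub> atens A V N (act V r v) (Q w))"
    by (rule hsum_cong; (intro lin)?; simp add: badj_equivariant[OF W bimod_H_module[OF N] Q eq]
      K_linear_smult[OF atens_linear_right[OF V N _ K_linear_id]])
  also have "\<dots> = atens A V N (act V \<one>\<^bsub>H\<^esub> v) (Q w)"
    by (rule counit_Rbar_sum; (intro lin)?; simp)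
  finally show ?thesis by simp
qed

end

context calculus_setting
begin

lemma leibniz_right':
  assumes a [simp]: "a \<in> carrier A" and u [simp]: "u \<in> carrier F1"
  shows "diff \<Omega> (rmul F1 u a) \<oplus>\<^bsub>F2\<^esub> (u \<otimes>\<^bsub>\<Omega>\<^esub> diff \<Omega> a) = rmul F2 (diff \<Omega> u) a"
proof -
  interpret F2: module K F2 by simp
  show ?thesis by (simp add: leibniz_right F2.M.a_assoc F2.M.l_neg)
qed

text \<open>The condition on \<delta> in \<open>quasi_right_linear\<close> holds for u \<otimes> da
  because d commutes with the action of H.\<close>

lemma leibniz_term_equivariant:
  assumes U [simp]: "H_module_bimodule K H A U" and c [simp]: "c \<in> carrier K"
  shows "bilinear_map K U A (atensor H A U F1) (\<lambda>u a. c \<odot>\<^bsub>atensor H A U F1\<^esub> atens A U F1 u (diff \<Omega> a))"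
    and "\<lbrakk>x \<in> carrier H; u \<in> carrier U; a \<in> carrier A\<rbrakk> \<Longrightarrow> act (atensor H A U F1) x (c \<odot>\<^bsub>atensor H A U F1\<^esub> atens A U F1 u (diff \<Omega> a))
      = tsum (atensor H A U F1) (comul H x) (\<lambda>y z. c \<odot>\<^bsub>atensor H A U F1\<^esub> atens A U F1 (act U y u) (diff \<Omega> (act A z a)))"
proof -
  let ?X = "atensor H A U F1"
  show "bilinear_map K U A ?X (\<lambda>u a. c \<odot>\<^bsub>?X\<^esub> atens A U F1 u (diff \<Omega> a))"
    by (intro bilinear_mapI K_linear_scaled lin; simp)
  assume [simp]: "x \<in> carrier H" "u \<in> carrier U" "a \<in> carrier A"
  have "act ?X x (c \<odot>\<^bsub>?X\<^esub> atens A U F1 u (diff \<Omega> a)) = c \<odot>\<^bsub>?X\<^esub> tsum ?X (comul H x) (\<lambda>y z. atens A U F1 (act U y u) (act F1 z (diff \<Omega> a)))"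
    by (simp add: K_linear_smult[OF act_linear_right[OF _ _ K_linear_id]] act_atens)
  also have "\<dots> = tsum ?X (comul H x) (\<lambda>y z. c \<odot>\<^bsub>?X\<^esub> atens A U F1 (act U y u) (act F1 z (diff \<Omega> a)))"
    by (rule hsum_push[OF _ _ _ _ K_linear_scaled[OF _ K_linear_id c]]; (intro lin)?; simp)
  also have "\<dots> = tsum ?X (comul H x) (\<lambda>y z. c \<odot>\<^bsub>?X\<^esub> atens A U F1 (act U y u) (diff \<Omega> (act A z a)))"
    by (rule hsum_cong; (intro K_linear_scaled lin)?; simp add: act_diff)
  finally show "act ?X x (c \<odot>\<^bsub>?X\<^esub> atens A U F1 u (diff \<Omega> a)) = \<dots>" .
qed

lemma leibniz_mapI:
  assumes "H_module_bimodule K H A U" "c \<in> carrier K" "D \<in> K_linear K U (atensor H A U F1)"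
    and "\<And>u a. u \<in> carrier U \<Longrightarrow> a \<in> carrier A \<Longrightarrow>
      D (rmul U u a) = rmul (atensor H A U F1) (D u) a \<oplus>\<^bsub>atensor H A U F1\<^esub> c \<odot>\<^bsub>atensor H A U F1\<^esub> atens A U F1 u (diff \<Omega> a)"
  shows "leibniz_map U c D"
  unfolding quasi_right_linear_def using leibniz_term_equivariant[OF assms(1,2)] assms(3,4) by simp

lemma connection_leibniz_map:
  assumes U [simp]: "H_module_bimodule K H A U" and D: "D \<in> connections K H A \<Omega> U"
  shows "leibniz_map U \<one>\<^bsub>K\<^esub> D"
proof (rule leibniz_mapI)
  show "D \<in> K_linear K U (atensor H A U F1)"
    using D unfolding connections_def Let_def F1_def by simp
  fix u a assume [simp]: "u \<in> carrier U" "a \<in> carrier A"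
  interpret X: module K "atensor H A U F1" by simp
  have "D (rmul U u a) = rmul (atensor H A U F1) (D u) a \<oplus>\<^bsub>atensor H A U F1\<^esub> atens A U F1 u (diff \<Omega> a)"
    using D unfolding connections_def Let_def F1_def by simp
  then show "D (rmul U u a) = rmul (atensor H A U F1) (D u) a \<oplus>\<^bsub>atensor H A U F1\<^esub> \<one>\<^bsub>K\<^esub> \<odot>\<^bsub>atensor H A U F1\<^esub> atens A U F1 u (diff \<Omega> a)"
    by simp
qed (use module.axioms(1)[OF H_module] in \<open>simp_all add: cring_def ring.ring_simprules\<close>)

lemma leibniz_map_badj:
  assumes U [simp]: "H_module_bimodule K H A U" and D: "leibniz_map U \<one>\<^bsub>K\<^esub> D" and x [simp]: "x \<in> carrier H"
  shows "leibniz_map U (counit H x) (badj H U (atensor H A U F1) x D)"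
proof -
  interpret X: module K "atensor H A U F1" by simp
  show ?thesis
    by (rule quasi_right_linear_cong[OF quasi_right_linear_badj[OF U _ D x]]) simp_all
qed

section \<open>Extension of a Leibniz map to one-forms, and its curvature\<close>

context
  fixes U :: "('k, 'h, 'o, 'u, 'q) hbimod_scheme" and c D
  assumes U [simp]: "H_module_bimodule K H A U" and c [simp]: "c \<in> carrier K" and D: "leibniz_map U c D"
begin

private abbreviation "X1 \<equiv> atensor H A U F1"
private abbreviation "X2 \<equiv> atensor H A U F2"

lemma D_linear: "f \<in> K_linear K Z U \<Longrightarrow> (\<lambda>z. D (f z)) \<in> K_linear K Z X1"
  by (rule K_linear_comp[OF quasi_right_linearD(1)[OF D]])

lemma D_closed: "u \<in> carrier U \<Longrightarrow> D u \<in> carrier X1"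
  by (rule K_linear_closed[OF quasi_right_linearD(1)[OF D]])

lemma D_rmul: "u \<in> carrier U \<Longrightarrow> a \<in> carrier A \<Longrightarrow>
    D (rmul U u a) = rmul X1 (D u) a \<oplus>\<^bsub>X1\<^esub> c \<odot>\<^bsub>X1\<^esub> atens A U F1 u (diff \<Omega> a)"
  by (rule quasi_right_linearD(4)[OF D])

text \<open>The Leibniz term of D(u a) \<and> \<theta> and the term da \<and> \<theta> of d(a
  \<theta>) give the same contribution, both with the factor c.\<close>

lemma ext_balanced: "balanced_map K A U F1 X2 (\<lambda>u \<theta>. rwedge U (D u) \<theta> \<oplus>\<^bsub>X2\<^esub> c \<odot>\<^bsub>X2\<^esub> atens A U F2 u (diff \<Omega> \<theta>))"
proof (rule balanced_mapI)
  show "bilinear_map K U F1 X2 (\<lambda>u \<theta>. rwedge U (D u) \<theta> \<oplus>\<^bsub>X2\<^esub> c \<odot>\<^bsub>X2\<^esub> atens A U F2 u (diff \<Omega> \<theta>))"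
    by (intro bilinear_mapI K_linear_plus K_linear_scaled D_linear lin; simp add: D_closed)
  fix u a \<theta> assume [simp]: "u \<in> carrier U" "a \<in> carrier A" "\<theta> \<in> carrier F1"
  interpret X1: module K X1 by simp
  interpret X2: module K X2 by simp
  have "rwedge U (D (rmul U u a)) \<theta> = rwedge U (D u) (lmul F1 a \<theta>) \<oplus>\<^bsub>X2\<^esub> c \<odot>\<^bsub>X2\<^esub> atens A U F2 u (diff \<Omega> a \<otimes>\<^bsub>\<Omega>\<^esub> \<theta>)"
    by (simp add: D_rmul D_closed K_linear_add[OF rwedge_linear(1)[OF U K_linear_id]] K_linear_smult[OF rwedge_linear(1)[OF U K_linear_id]]
      rwedge_rmul rwedge_atens)
  moreover have "c \<odot>\<^bsub>X2\<^esub> atens A U F2 u (diff \<Omega> (lmul F1 a \<theta>))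
    = c \<odot>\<^bsub>X2\<^esub> atens A U F2 u (diff \<Omega> a \<otimes>\<^bsub>\<Omega>\<^esub> \<theta>) \<oplus>\<^bsub>X2\<^esub> c \<odot>\<^bsub>X2\<^esub> atens A U F2 (rmul U u a) (diff \<Omega> \<theta>)"
    by (simp add: leibniz_A K_linear_add[OF atens_linear_right[OF U _ _ K_linear_id]] X2.smult_r_distr atens_balanced)
  ultimately show "rwedge U (D (rmul U u a)) \<theta> \<oplus>\<^bsub>X2\<^esub> c \<odot>\<^bsub>X2\<^esub> atens A U F2 (rmul U u a) (diff \<Omega> \<theta>)
    = rwedge U (D u) (lmul F1 a \<theta>) \<oplus>\<^bsub>X2\<^esub> c \<odot>\<^bsub>X2\<^esub> atens A U F2 u (diff \<Omega> (lmul F1 a \<theta>))"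
    by (simp add: D_closed X2.M.a_assoc)
qed

lemma ext_linear: "f \<in> K_linear K Z X1 \<Longrightarrow> (\<lambda>z. ext U c D (f z)) \<in> K_linear K Z X2"
  unfolding ext_def by (rule asum_linear[OF U F_bimodule(1) _ ext_balanced]) simp_all

lemma ext_atens: "u \<in> carrier U \<Longrightarrow> \<theta> \<in> carrier F1 \<Longrightarrow>
    ext U c D (atens A U F1 u \<theta>) = rwedge U (D u) \<theta> \<oplus>\<^bsub>X2\<^esub> c \<odot>\<^bsub>X2\<^esub> atens A U F2 u (diff \<Omega> \<theta>)"
  unfolding ext_def by (rule asum_atens[OF U F_bimodule(1) _ ext_balanced]) simp_all

lemma ext_closed: "t \<in> carrier X1 \<Longrightarrow> ext U c D t \<in> carrier X2"
  by (rule K_linear_closed[OF ext_linear[OF K_linear_id]])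

text \<open>The extra term stands on the left because d(\<theta> a) = (d\<theta>) a - \<theta>
  \<and> da by the sign of the Leibniz rule. In the curvature it is supplied by the extension of u
  \<otimes> da.\<close>

lemma ext_rmul:
  assumes t: "t \<in> carrier X1" and a [simp]: "a \<in> carrier A"
  shows "ext U c D (rmul X1 t a) \<oplus>\<^bsub>X2\<^esub> c \<odot>\<^bsub>X2\<^esub> rwedge U t (diff \<Omega> a) = rmul X2 (ext U c D t) a"
proof (rule atensor_eqI[OF U F_bimodule(1) _ _ _ t, where X = X2 and g = "\<lambda>t. ext U c D (rmul X1 t a) \<oplus>\<^bsub>X2\<^esub> c \<odot>\<^bsub>X2\<^esub> rwedge U t (diff \<Omega> a)"])
  interpret X2: module K X2 by simp
  interpret F2: module K F2 by simp
  fix u \<theta> assume [simp]: "u \<in> carrier U" "\<theta> \<in> carrier F1"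
  have "ext U c D (rmul X1 (atens A U F1 u \<theta>) a) \<oplus>\<^bsub>X2\<^esub> c \<odot>\<^bsub>X2\<^esub> rwedge U (atens A U F1 u \<theta>) (diff \<Omega> a)
    = rmul X2 (rwedge U (D u) \<theta>) a \<oplus>\<^bsub>X2\<^esub> c \<odot>\<^bsub>X2\<^esub> atens A U F2 u (diff \<Omega> (rmul F1 \<theta> a) \<oplus>\<^bsub>F2\<^esub> (\<theta> \<otimes>\<^bsub>\<Omega>\<^esub> diff \<Omega> a))"
    by (simp add: rmul_atens ext_atens rwedge_atens rwedge_rmul D_closed X2.M.a_assoc X2.smult_r_distr
      K_linear_add[OF atens_linear_right[OF U _ _ K_linear_id]])
  also have "\<dots> = rmul X2 (ext U c D (atens A U F1 u \<theta>)) a"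
    by (simp add: leibniz_right' ext_atens D_closed rmul_atens K_linear_add[OF rmul_linear_left[OF _ K_linear_id]] K_linear_smult[OF rmul_linear_left[OF _ K_linear_id]])
  finally show "ext U c D (rmul X1 (atens A U F1 u \<theta>) a) \<oplus>\<^bsub>X2\<^esub> c \<odot>\<^bsub>X2\<^esub> rwedge U (atens A U F1 u \<theta>) (diff \<Omega> a)
    = rmul X2 (ext U c D (atens A U F1 u \<theta>)) a" .
qed (intro K_linear_plus K_linear_scaled ext_linear lin; simp)+

end

lemma curvature_ext:
  assumes U [simp]: "H_module_bimodule K H A U" and D: "leibniz_map U \<one>\<^bsub>K\<^esub> D" and u [simp]: "u \<in> carrier U"
  shows "curvature H A \<Omega> U D u = ext U \<one>\<^bsub>K\<^esub> D (D u)"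
proof -
  interpret X2: module K "atensor H A U F2" by simp
  have "curvature H A \<Omega> U D u = tsum (atensor H A U F2) (D u) (\<lambda>v w. rwedge U (D v) w \<oplus>\<^bsub>atensor H A U F2\<^esub> atens A U F2 v (diff \<Omega> w))"
    by (simp add: curvature_def conn_ext_def Let_def rwedge_def F2_def numeral_2_eq_2)
  also have "\<dots> = ext U \<one>\<^bsub>K\<^esub> D (D u)"
    unfolding ext_def
    by (rule asum_cong[OF U F_bimodule(1) _ ext_balanced[OF U _ D]]) (simp_all add: D_closed[OF U _ D])
  finally show ?thesis .
qed

text \<open>The extension of \<nabla>(u a) = (\<nabla>u) a + u \<otimes> da is the left side of
  \<open>ext_rmul\<close> at t = \<nabla>u and c = 1: since d(da) = 0, its second part is
  (\<nabla>u) \<and> da.\<close>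

lemma curvature_right_linear:
  assumes U [simp]: "H_module_bimodule K H A U" and D: "leibniz_map U \<one>\<^bsub>K\<^esub> D"
  shows "curvature H A \<Omega> U D \<in> Hom_right K A U (atensor H A U F2)"
proof -
  let ?X1 = "atensor H A U F1" and ?X2 = "atensor H A U F2" and ?E = "ext U \<one>\<^bsub>K\<^esub> D"
  interpret X1: module K ?X1 by simp
  interpret X2: module K ?X2 by simp
  note [simp] = D_closed[OF U _ D] ext_closed[OF U _ D]
  have "curvature H A \<Omega> U D \<in> K_linear K U ?X2"
    by (rule K_linear_cong[OF ext_linear[OF U _ D quasi_right_linearD(1)[OF D]]]) (simp_all add: curvature_ext[OF U D])
  moreover have "curvature H A \<Omega> U D (rmul U u a) = rmul ?X2 (curvature H A \<Omega> U D u) a"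
    if [simp]: "u \<in> carrier U" "a \<in> carrier A" for u a
  proof -
    interpret F2: module K F2 by simp
    have "?E (D (rmul U u a)) = ?E (rmul ?X1 (D u) a) \<oplus>\<^bsub>?X2\<^esub> ?E (atens A U F1 u (diff \<Omega> a))"
      by (simp add: D_rmul[OF U _ D] K_linear_add[OF ext_linear[OF U _ D K_linear_id]])
    also have "?E (atens A U F1 u (diff \<Omega> a)) = rwedge U (D u) (diff \<Omega> a)"
      by (simp add: ext_atens[OF U _ D] diff_diff_A K_linear_map_zero[OF atens_linear_right[OF U F_bimodule(2) _ K_linear_id]])
    also have "?E (rmul ?X1 (D u) a) \<oplus>\<^bsub>?X2\<^esub> rwedge U (D u) (diff \<Omega> a) = rmul ?X2 (?E (D u)) a"
      using ext_rmul[OF U _ D, of "D u" a] by simp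
    finally show ?thesis by (simp add: curvature_ext[OF U D])
  qed
  ultimately show ?thesis by (simp add: Hom_right_def)
qed

text \<open>Checked by the convolution equation on u \<otimes> \<theta>. The wedge part follows from
  the equation for \<open>D\<close>. The differential is equivariant, so in its part the adjoint
  action is the counit; this is the scalar of the extension on the right.\<close>

lemma badj_ext:
  assumes U [simp]: "H_module_bimodule K H A U" and D: "leibniz_map U \<one>\<^bsub>K\<^esub> D"
    and x: "x \<in> carrier H" and t: "t \<in> carrier (atensor H A U F1)"
  shows "badj H (atensor H A U F1) (atensor H A U F2) x (ext U \<one>\<^bsub>K\<^esub> D) t
    = ext U (counit H x) (badj H U (atensor H A U F1) x D) t"
proof -
  let ?X1 = "atensor H A U F1" and ?X2 = "atensor H A U F2"
  let ?B = "\<lambda>x. badj H U ?X1 x D"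
  interpret X2: module K ?X2 by simp
  note Bl = leibniz_map_badj[OF U D]
  note Bx [simp] = ext_closed[OF U _ Bl] ext_closed[OF U _ D] D_closed[OF U _ D] D_closed[OF U _ Bl]
  note rules = lin D_linear[OF U _ D] ext_linear[OF U _ D] ext_linear[OF U _ Bl]
    badj_linear_left[OF bimod_H_module[OF U] bimod_H_module quasi_right_linearD(1)[OF D]]
    badj_linear_right[OF bimod_H_module[OF U] bimod_H_module quasi_right_linearD(1)[OF D]]
  \<comment> \<open>Here x enters both through the map and through the scalar, so linearity in x is
    checked on the summand of the extension.\<close>
  have ext_left: "(\<lambda>x. ext U (counit H x) (?B x) t) \<in> K_linear K H ?X2" if "t \<in> carrier ?X1" for t
    unfolding ext_def
  proof (rule asum_param[OF U F_bimodule(1) _ _ that ext_balanced[OF U _ Bl]])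
    fix u \<theta> assume [simp]: "u \<in> carrier U" "\<theta> \<in> carrier F1"
    show "(\<lambda>x. rwedge U (?B x u) \<theta> \<oplus>\<^bsub>?X2\<^esub> counit H x \<odot>\<^bsub>?X2\<^esub> atens A U F2 u (diff \<Omega> \<theta>)) \<in> K_linear K H ?X2"
      by (intro K_linear_plus rules; simp)
  qed simp_all
  have ext_right: "(\<lambda>t. ext U (counit H x) (?B x) (f t)) \<in> K_linear K Z ?X2" if "x \<in> carrier H" "f \<in> K_linear K Z ?X1" for x f and Z :: "('k, 'z, 'zz) module_scheme"
    using that by (intro ext_linear[OF U _ Bl]) simp_all
  have bil: "bilinear_map K H ?X1 ?X2 (\<lambda>x t. ext U (counit H x) (?B x) t)"
    by (intro bilinear_mapI ext_left ext_right K_linear_id)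
  note rules = rules bilinear_comp[OF bil]
  show ?thesis
  proof (rule badj_unique[OF _ _ ext_linear[OF U _ D K_linear_id] _ _ _ x t])
    fix x t assume x [simp]: "x \<in> carrier H" and t: "t \<in> carrier ?X1"
    show "tsum ?X2 (comul H x) (\<lambda>a b. ext U (counit H a) (?B a) (act ?X1 b t)) = act ?X2 x (ext U \<one>\<^bsub>K\<^esub> D t)"
    proof (rule atensor_eqI[OF U F_bimodule(1) _ _ _ t, where X = ?X2 and g = "\<lambda>t. tsum ?X2 (comul H x) (\<lambda>a b. ext U (counit H a) (?B a) (act ?X1 b t))"])
      fix u \<theta> assume [simp]: "u \<in> carrier U" "\<theta> \<in> carrier F1"
      let ?f = "\<lambda>a e g. rwedge U (?B a (act U e u)) (act F1 g \<theta>)"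
      let ?g = "\<lambda>a e g. counit H a \<odot>\<^bsub>?X2\<^esub> atens A U F2 (act U e u) (diff \<Omega> (act F1 g \<theta>))"
      have "tsum ?X2 (comul H x) (\<lambda>a b. ext U (counit H a) (?B a) (act ?X1 b (atens A U F1 u \<theta>)))
        = tsum ?X2 (comul H x) (\<lambda>a b. tsum ?X2 (comul H b) (\<lambda>e g. ?f a e g) \<oplus>\<^bsub>?X2\<^esub> tsum ?X2 (comul H b) (\<lambda>e g. ?g a e g))"
      proof (rule hsum_cong)
        fix a b assume ab [simp]: "a \<in> carrier H" "b \<in> carrier H"
        have "ext U (counit H a) (?B a) (act ?X1 b (atens A U F1 u \<theta>))
          = tsum ?X2 (comul H b) (\<lambda>e g. ext U (counit H a) (?B a) (atens A U F1 (act U e u) (act F1 g \<theta>)))"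
          unfolding act_atens[OF U F_bimodule(1) ab(2) \<open>u \<in> carrier U\<close> \<open>\<theta> \<in> carrier F1\<close>]
          by (rule hsum_push[OF _ _ _ _ ext_right[OF ab(1) K_linear_id]]; (intro rules)?; simp)
        also have "\<dots> = tsum ?X2 (comul H b) (\<lambda>e g. ?f a e g \<oplus>\<^bsub>?X2\<^esub> ?g a e g)"
          by (rule hsum_cong; (intro K_linear_plus rules)?; simp add: ext_atens[OF U _ Bl])
        also have "\<dots> = tsum ?X2 (comul H b) (\<lambda>e g. ?f a e g) \<oplus>\<^bsub>?X2\<^esub> tsum ?X2 (comul H b) (\<lambda>e g. ?g a e g)"
          by (rule hsum_plus; (intro rules)?; simp)
        finally show "ext U (counit H a) (?B a) (act ?X1 b (atens A U F1 u \<theta>)) = \<dots>" .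
      qed ((intro K_linear_plus rules)?; simp)+
      also have "\<dots> = tsum ?X2 (comul H x) (\<lambda>a b. tsum ?X2 (comul H b) (\<lambda>e g. ?f a e g)) \<oplus>\<^bsub>?X2\<^esub> tsum ?X2 (comul H x) (\<lambda>a b. tsum ?X2 (comul H b) (\<lambda>e g. ?g a e g))"
        by (rule hsum_plus; (intro rules)?; simp)
      also have "tsum ?X2 (comul H x) (\<lambda>a b. tsum ?X2 (comul H b) (\<lambda>e g. ?f a e g)) = act ?X2 x (rwedge U (D u) \<theta>)"
      proof -
        have "tsum ?X2 (comul H x) (\<lambda>a b. tsum ?X2 (comul H b) (\<lambda>e g. ?f a e g)) = tsum ?X2 (comul H x) (\<lambda>y g. tsum ?X2 (comul H y) (\<lambda>a e. ?f a e g))"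
          by (rule coassoc_sum'; (intro rules)?; simp)
        also have "\<dots> = tsum ?X2 (comul H x) (\<lambda>y g. rwedge U (act ?X1 y (D u)) (act F1 g \<theta>))"
        proof (rule hsum_cong)
          fix y g assume [simp]: "y \<in> carrier H" "g \<in> carrier H"
          have "tsum ?X2 (comul H y) (\<lambda>a e. ?f a e g) = rwedge U (tsum ?X1 (comul H y) (\<lambda>a e. ?B a (act U e u))) (act F1 g \<theta>)"
            by (rule hsum_push[OF _ _ _ _ rwedge_linear(1)[OF U K_linear_id], symmetric]; (intro rules)?; simp)
          then show "tsum ?X2 (comul H y) (\<lambda>a e. ?f a e g) = rwedge U (act ?X1 y (D u)) (act F1 g \<theta>)"
            by (simp add: badj_conv[OF _ _ quasi_right_linearD(1)[OF D]])
        qed ((intro rules)?; simp)+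
        also have "\<dots> = act ?X2 x (rwedge U (D u) \<theta>)" by (simp add: act_rwedge)
        finally show ?thesis .
      qed
      also have "tsum ?X2 (comul H x) (\<lambda>a b. tsum ?X2 (comul H b) (\<lambda>e g. ?g a e g)) = act ?X2 x (atens A U F2 u (diff \<Omega> \<theta>))"
      proof -
        let ?h = "\<lambda>b. tsum ?X2 (comul H b) (\<lambda>e g. atens A U F2 (act U e u) (diff \<Omega> (act F1 g \<theta>)))"
        have [simp]: "?h b \<in> carrier ?X2" if "b \<in> carrier H" for b
          using that by (intro hsum_closed lin; simp)
        have "tsum ?X2 (comul H x) (\<lambda>a b. tsum ?X2 (comul H b) (\<lambda>e g. ?g a e g)) = tsum ?X2 (comul H x) (\<lambda>a b. counit H a \<odot>\<^bsub>?X2\<^esub> ?h b)"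
        proof (rule hsum_cong)
          fix a b assume ab [simp]: "a \<in> carrier H" "b \<in> carrier H"
          show "tsum ?X2 (comul H b) (\<lambda>e g. ?g a e g) = counit H a \<odot>\<^bsub>?X2\<^esub> ?h b"
            by (rule hsum_push[OF _ _ _ _ counit_scaled_linear_right[OF _ ab(1) K_linear_id], symmetric]; (intro rules)?; simp)
        qed ((intro rules)?; simp)+
        also have "\<dots> = ?h x"
          by (rule counit_left_sum; (intro rules)?; simp)
        also have "\<dots> = act ?X2 x (atens A U F2 u (diff \<Omega> \<theta>))"
          by (simp add: act_atens, rule hsum_cong; (intro rules)?; simp add: act_diff)
        finally show ?thesis .
      qed
      finally show "tsum ?X2 (comul H x) (\<lambda>a b. ext U (counit H a) (?B a) (act ?X1 b (atens A U F1 u \<theta>))) = act ?X2 x (ext U \<one>\<^bsub>K\<^esub> D (atens A U F1 u \<theta>))"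
        by (simp add: ext_atens[OF U _ D] K_linear_add[OF act_linear_right[OF _ _ K_linear_id]])
    qed ((intro rules)?; simp)+
  qed (simp_all add: ext_left ext_right[OF _ K_linear_id])
qed

section \<open>The sum of two connections\<close>

abbreviation "FF \<equiv> atensor H A F1 F1"

lemma wedge_balanced: "balanced_map K A F1 F1 F2 (monoid.mult \<Omega>)"
  by (rule balanced_mapI) (intro bilinear_mapI lin, simp_all add: wedge_assoc)

lemma wedge_map_eq: "t \<in> carrier FF \<Longrightarrow> wedge_map \<Omega> t = tsum F2 t (monoid.mult \<Omega>)"
  unfolding wedge_map_def F2_def
  by (rule asum_push[OF F_bimodule(1,1) _ _ _ wedge_balanced[unfolded F2_def] forms_inclusion, symmetric]) (simp_all add: forms_module)

lemma wedge_map_linear: "wedge_map \<Omega> \<in> K_linear K FF F2"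
  by (rule K_linear_cong[OF asum_linear[OF F_bimodule(1,1) _ wedge_balanced K_linear_id]]) (simp_all add: wedge_map_eq)

lemma wedge_map_atens: "u \<in> carrier F1 \<Longrightarrow> v \<in> carrier F1 \<Longrightarrow> wedge_map \<Omega> (atens A F1 F1 u v) = u \<otimes>\<^bsub>\<Omega>\<^esub> v"
  by (simp add: wedge_map_eq asum_atens[OF F_bimodule(1,1) _ wedge_balanced])

lemma wedge_map_closed: "t \<in> carrier FF \<Longrightarrow> wedge_map \<Omega> t \<in> carrier F2"
  by (rule K_linear_closed[OF wedge_map_linear])

lemmas wedge_lin = lin K_linear_comp[OF wedge_map_linear]

lemma wedge_map_act:
  assumes x [simp]: "x \<in> carrier H" and t: "t \<in> carrier FF"
  shows "wedge_map \<Omega> (act FF x t) = act F2 x (wedge_map \<Omega> t)"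
proof (rule atensor_eqI[OF F_bimodule(1,1) _ _ _ t, where X = F2 and g = "\<lambda>t. wedge_map \<Omega> (act FF x t)"])
  fix u v assume [simp]: "u \<in> carrier F1" "v \<in> carrier F1"
  have "wedge_map \<Omega> (act FF x (atens A F1 F1 u v)) = tsum F2 (comul H x) (\<lambda>a b. wedge_map \<Omega> (atens A F1 F1 (act F1 a u) (act F1 b v)))"
    by (simp add: act_atens, rule hsum_push[OF _ _ _ _ wedge_map_linear]; (intro lin)?; simp)
  also have "\<dots> = act F2 x (wedge_map \<Omega> (atens A F1 F1 u v))"
    by (simp add: wedge_map_atens act_wedge, rule hsum_cong; (intro lin)?; simp add: wedge_map_atens)
  finally show "wedge_map \<Omega> (act FF x (atens A F1 F1 u v)) = act F2 x (wedge_map \<Omega> (atens A F1 F1 u v))" .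
qed (intro wedge_lin; simp)+

lemma wedge_map_lmul:
  assumes a [simp]: "a \<in> carrier A" and t: "t \<in> carrier FF"
  shows "wedge_map \<Omega> (lmul FF a t) = lmul F2 a (wedge_map \<Omega> t)"
  by (rule atensor_eqI[OF F_bimodule(1,1) _ _ _ t, where X = F2 and g = "\<lambda>t. wedge_map \<Omega> (lmul FF a t)"];
    (intro wedge_lin)?; simp add: lmul_atens wedge_map_atens wedge_assoc)

context
  fixes U :: "('k, 'h, 'o, 'u, 'q) hbimod_scheme"
  assumes U [simp]: "H_module_bimodule K H A U"
begin

lemma id_wedge_balanced: "balanced_map K A U FF (atensor H A U F2) (\<lambda>x f. atens A U F2 x (wedge_map \<Omega> f))"
  by (rule balanced_mapI; (intro wedge_lin)?; simp add: wedge_map_closed wedge_map_lmul atens_balanced)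

text \<open>The wedge product is equivariant, so \<open>id_tensor_equivariant\<close> removes the
  R-matrix from the braided tensor product.\<close>

lemma rtensor_id_wedge:
  assumes t: "t \<in> carrier (atensor H A U FF)"
  shows "rtensor_A K H R A U U FF F2 id (wedge_map \<Omega>) t = tsum (atensor H A U F2) t (\<lambda>x f. atens A U F2 x (wedge_map \<Omega> f))"
  unfolding rtensor_A_def
  by (rule asum_cong[OF U _ _ id_wedge_balanced _ t])
    (simp_all add: id_tensor_equivariant[OF U _ F_bimodule(2) wedge_map_linear] wedge_map_act)

lemma rtensor_id_wedge_linear:
  "f \<in> K_linear K Z (atensor H A U FF) \<Longrightarrow> (\<lambda>z. rtensor_A K H R A U U FF F2 id (wedge_map \<Omega>) (f z)) \<in> K_linear K Z (atensor H A U F2)"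
  by (rule K_linear_comp[of "rtensor_A K H R A U U FF F2 id (wedge_map \<Omega>)"],
    rule K_linear_cong[OF asum_linear[OF U _ _ id_wedge_balanced K_linear_id]]) (simp_all add: rtensor_id_wedge)

lemma rtensor_id_wedge_atens: "x \<in> carrier U \<Longrightarrow> u \<in> carrier F1 \<Longrightarrow> v \<in> carrier F1 \<Longrightarrow>
    rtensor_A K H R A U U FF F2 id (wedge_map \<Omega>) (atens A U FF x (atens A F1 F1 u v)) = atens A U F2 x (u \<otimes>\<^bsub>\<Omega>\<^esub> v)"
  by (simp add: rtensor_id_wedge asum_atens[OF U _ _ id_wedge_balanced] wedge_map_atens)

end

text \<open>The map \<mu>(x, w \<otimes> \<theta>) = \<tau>^{-1}(x \<otimes> w) \<and> \<theta>. It
  gathers everything that the mixed term applies to an element x \<otimes> y of (V \<otimes>_A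
  \<Omega>) \<otimes> (W \<otimes>_A \<Omega>) into one bilinear map; see
  \<open>mix_chain\<close>.\<close>

definition mix :: "('k, 'h, 'o, 'v, 'q1) hbimod_scheme \<Rightarrow> ('k, 'h, 'o, 'w, 'q2) hbimod_scheme
    \<Rightarrow> ('v, 'o) tens \<Rightarrow> ('w, 'o) tens \<Rightarrow> (('v, 'w) tens, 'o) tens" where
  "mix V W x y = tsum (atensor H A (atensor H A V W) F2) y
    (\<lambda>w \<theta>. rwedge (atensor H A V W) (tau23_inv H R A V F1 W (atens A (atensor H A V F1) W x w)) \<theta>)"

context
  fixes V :: "('k, 'h, 'o, 'v, 'q1) hbimod_scheme" and W :: "('k, 'h, 'o, 'w, 'q2) hbimod_scheme" and DV DW
  assumes V [simp]: "H_module_bimodule K H A V" and W [simp]: "H_module_bimodule K H A W"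
    and WL [simp]: "left_quasi_comm W"
    and DV: "leibniz_map V \<one>\<^bsub>K\<^esub> DV" and DW: "leibniz_map W \<one>\<^bsub>K\<^esub> DW"
begin

private abbreviation "V1 \<equiv> atensor H A V F1"
private abbreviation "V2 \<equiv> atensor H A V F2"
private abbreviation "W1 \<equiv> atensor H A W F1"
private abbreviation "W2 \<equiv> atensor H A W F2"
private abbreviation "Z0 \<equiv> atensor H A V W"
private abbreviation "Z1 \<equiv> atensor H A Z0 F1"
private abbreviation "Z2 \<equiv> atensor H A Z0 F2"
private abbreviation "\<tau>1 \<equiv> tau23_inv H R A V F1 W"
private abbreviation "\<tau>2 \<equiv> tau23_inv H R A V F2 W"
private abbreviation "\<alpha>1 \<equiv> assoc_left H A V W F1"
private abbreviation "\<alpha>2 \<equiv> assoc_left H A V W F2"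
private abbreviation "DVW \<equiv> sum_connection K H R A \<Omega> V W DV DW"
private abbreviation "EV \<equiv> ext V \<one>\<^bsub>K\<^esub> DV"
private abbreviation "EW \<equiv> ext W \<one>\<^bsub>K\<^esub> DW"
private abbreviation "EVW \<equiv> ext Z0 \<one>\<^bsub>K\<^esub> DVW"
private abbreviation "BV \<equiv> \<lambda>s. badj H V V1 s DV"
private abbreviation "BW \<equiv> \<lambda>s. badj H W W1 s DW"
private abbreviation "KX \<equiv> ktensor K V1 W1"
private abbreviation "\<mu> \<equiv> mix V W"

section \<open>Well-definedness of the sum connection\<close>

definition sum_conn_pure :: "'v \<Rightarrow> 'w \<Rightarrow> (('v, 'w) tens, 'o) tens" where
  "sum_conn_pure v w = \<tau>1 (atens A V1 W (DV v) w) \<oplus>\<^bsub>Z1\<^esub> \<alpha>1 (id_tensor V W W1 DW v w)"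

private lemma W1_bimodule: "H_module_bimodule K H A W1" by simp

lemma sum_conn_closed:
  "\<lbrakk>v \<in> carrier V; w \<in> carrier W\<rbrakk> \<Longrightarrow> id_tensor V W W1 DW v w \<in> carrier (atensor H A V W1)"
  "v \<in> carrier V \<Longrightarrow> DV v \<in> carrier V1"
  "w \<in> carrier W \<Longrightarrow> DW w \<in> carrier W1"
  using id_tensor_closed[OF V W W1_bimodule DW] D_closed[OF V _ DV] D_closed[OF W _ DW] by simp_all

private lemma tau_simps:
  "s \<in> carrier (atensor H A V1 W) \<Longrightarrow> \<tau>1 s \<in> carrier Z1"
  "\<lbrakk>x \<in> carrier V1; w \<in> carrier W; a \<in> carrier A\<rbrakk> \<Longrightarrow> \<tau>1 (atens A V1 W x (rmul W w a)) = rmul Z1 (\<tau>1 (atens A V1 W x w)) a"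
  "\<lbrakk>v \<in> carrier V; m \<in> carrier F1; w \<in> carrier W\<rbrakk> \<Longrightarrow> \<tau>1 (atens A V1 W (atens A V F1 v m) w)
    = tsum Z1 R (\<lambda>r s. atens A Z0 F1 (atens A V W v (act W s w)) (act F1 r m))"
  using tau23_inv_closed[of V F1 W] tau23_inv_atens[of V F1 W]
    tau23_inv_rmul[of V F1 W "atens A V1 W x w" a] by (simp_all add: F_quasi_comm rmul_atens)

lemma sum_conn_linear:
  "f \<in> K_linear K Z (atensor H A V1 W) \<Longrightarrow> (\<lambda>z. \<tau>1 (f z)) \<in> K_linear K Z Z1"
  "g \<in> K_linear K Z V \<Longrightarrow> w \<in> carrier W \<Longrightarrow> (\<lambda>z. id_tensor V W W1 DW (g z) w) \<in> K_linear K Z (atensor H A V W1)"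
  "v \<in> carrier V \<Longrightarrow> h \<in> K_linear K Z W \<Longrightarrow> (\<lambda>z. id_tensor V W W1 DW v (h z)) \<in> K_linear K Z (atensor H A V W1)"
  using tau23_inv_linear[of V F1 W] bilinear_comp[OF id_tensor_bilinear[OF V W W1_bimodule DW]]
  by (simp_all add: F_quasi_comm)

text \<open>Moving a from w to v adds \<open>?e\<close> to the first summand (fact \<open>1\<close>)
  and removes it from the second (fact \<open>3\<close>). The two corrections agree because d
  commutes with the action of H.\<close>

lemma sum_conn_balanced: "balanced_map K A V W Z1 sum_conn_pure"
proof (rule balanced_mapI)
  note [simp] = sum_conn_closed tau_simps(1,2)
  interpret X: module K Z1 by simp
  interpret W1: module K W1 by simp
  interpret V1: module K V1 by simp
  interpret VW1: module K "atensor H A V W1" by simp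
  show "bilinear_map K V W Z1 sum_conn_pure"
    unfolding sum_conn_pure_def[abs_def]
    by (intro K_linear_plus lin sum_conn_linear D_linear[OF V _ DV]; simp)
  fix v a w assume [simp]: "v \<in> carrier V" "a \<in> carrier A" "w \<in> carrier W"
  let ?e = "tsum Z1 R (\<lambda>r s. atens A Z0 F1 (atens A V W v (act W s w)) (diff \<Omega> (act A r a)))"
  let ?t = "\<tau>1 (atens A V1 W (DV v) (lmul W a w))"
  let ?i = "id_tensor V W W1 DW"
  have e [simp]: "?e \<in> carrier Z1" by (intro hsum_closed lin; simp)
  have "\<tau>1 (atens A V1 W (DV (rmul V v a)) w) = ?t \<oplus>\<^bsub>Z1\<^esub> \<tau>1 (atens A V1 W (atens A V F1 v (diff \<Omega> a)) w)"
    by (simp add: D_rmul[OF V _ DV] K_linear_add[OF atens_linear_left[OF _ W K_linear_id]] atens_balanced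
        K_linear_add[OF sum_conn_linear(1)[OF K_linear_id]])
  also have "\<tau>1 (atens A V1 W (atens A V F1 v (diff \<Omega> a)) w) = ?e"
    unfolding tau_simps(3)[OF \<open>v \<in> carrier V\<close> diff_closed(1)[OF \<open>a \<in> carrier A\<close>] \<open>w \<in> carrier W\<close>]
    by (rule hsum_cong; (intro lin)?; simp add: act_diff)
  finally have 1: "\<tau>1 (atens A V1 W (DV (rmul V v a)) w) = ?t \<oplus>\<^bsub>Z1\<^esub> ?e" .
  \<comment> \<open>The defect from \<open>id_tensor_balanced\<close> for the Leibniz term of
    \<nabla>_W; rebracketing turns it into \<open>?e\<close>.\<close>
  let ?u = "tsum (atensor H A V W1) R (\<lambda>r s. atens A V W1 v (\<one>\<^bsub>K\<^esub> \<odot>\<^bsub>W1\<^esub> atens A W F1 (act W s w) (diff \<Omega> (act A r a))))"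
  have u [simp]: "?u \<in> carrier (atensor H A V W1)" by (intro hsum_closed K_linear_scaled lin; simp)
  have "\<alpha>1 ?u = tsum Z1 R (\<lambda>r s. \<alpha>1 (atens A V W1 v (\<one>\<^bsub>K\<^esub> \<odot>\<^bsub>W1\<^esub> atens A W F1 (act W s w) (diff \<Omega> (act A r a)))))"
    by (rule hsum_push[OF _ _ _ _ assoc_left_linear[OF V W F_bimodule(1) K_linear_id]]; (intro K_linear_scaled lin)?; simp)
  also have "\<dots> = ?e"
    by (rule hsum_cong; (intro lin)?; simp add: assoc_left_atens)
  finally have 2: "\<alpha>1 ?u = ?e" .
  have "\<alpha>1 (?i v (lmul W a w)) = \<alpha>1 (?i (rmul V v a) w \<oplus>\<^bsub>atensor H A V W1\<^esub> ?u)"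
    by (simp add: id_tensor_balanced[OF V W W1_bimodule DW WL atensor_left_quasi_comm[OF WL F_quasi_comm(1)]])
  also have "\<dots> = \<alpha>1 (?i (rmul V v a) w) \<oplus>\<^bsub>Z1\<^esub> ?e"
    by (simp add: K_linear_add[OF assoc_left_linear[OF V W F_bimodule(1) K_linear_id]] 2)
  finally have 3: "\<alpha>1 (?i v (lmul W a w)) = \<alpha>1 (?i (rmul V v a) w) \<oplus>\<^bsub>Z1\<^esub> ?e" .
  show "sum_conn_pure (rmul V v a) w = sum_conn_pure v (lmul W a w)"
    unfolding sum_conn_pure_def 1 3 by (simp add: X.M.a_ac)
qed

lemma sum_connection_eq: "DVW t = tsum Z1 t sum_conn_pure"
  by (simp add: sum_connection_def Let_def sum_conn_pure_def[abs_def] id_tensor_def F1_def)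

lemma sum_connection_linear: "f \<in> K_linear K Z Z0 \<Longrightarrow> (\<lambda>z. DVW (f z)) \<in> K_linear K Z Z1"
  unfolding sum_connection_eq by (rule asum_linear[OF V W _ sum_conn_balanced]) simp_all

lemma sum_connection_atens: "v \<in> carrier V \<Longrightarrow> w \<in> carrier W \<Longrightarrow>
    DVW (atens A V W v w)
      = \<tau>1 (atens A V1 W (DV v) w) \<oplus>\<^bsub>Z1\<^esub> \<alpha>1 (id_tensor V W W1 DW v w)"
  unfolding sum_connection_eq sum_conn_pure_def[symmetric] by (rule asum_atens[OF V W _ sum_conn_balanced]) simp_all

text \<open>The first summand is right linear in w, so the Leibniz term comes from the second
  alone.\<close>

lemma sum_connection_leibniz: "leibniz_map Z0 \<one>\<^bsub>K\<^esub> DVW"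
proof (rule leibniz_mapI)
  note [simp] = sum_conn_closed tau_simps(1,2)
  interpret X: module K Z1 by simp
  interpret W1: module K W1 by simp
  let ?S = "DVW"
  show "?S \<in> K_linear K Z0 Z1" by (rule sum_connection_linear[OF K_linear_id])
  fix t a assume t: "t \<in> carrier Z0" and a [simp]: "a \<in> carrier A"
  show "?S (rmul Z0 t a) = rmul Z1 (?S t) a \<oplus>\<^bsub>Z1\<^esub> \<one>\<^bsub>K\<^esub> \<odot>\<^bsub>Z1\<^esub> atens A Z0 F1 t (diff \<Omega> a)"
  proof (rule atensor_eqI[OF V W _ _ _ t, where X = Z1 and g = "\<lambda>t. ?S (rmul Z0 t a)"])
    fix v w assume [simp]: "v \<in> carrier V" "w \<in> carrier W"
    have "\<alpha>1 (id_tensor V W W1 DW v (rmul W w a))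
      = rmul Z1 (\<alpha>1 (id_tensor V W W1 DW v w)) a \<oplus>\<^bsub>Z1\<^esub> atens A Z0 F1 (atens A V W v w) (diff \<Omega> a)"
      by (simp add: id_tensor_rmul[OF V W W1_bimodule DW] assoc_left_rmul assoc_left_atens
        K_linear_add[OF assoc_left_linear[OF V W F_bimodule(1) K_linear_id]])
    then show "?S (rmul Z0 (atens A V W v w) a) = rmul Z1 (?S (atens A V W v w)) a
        \<oplus>\<^bsub>Z1\<^esub> \<one>\<^bsub>K\<^esub> \<odot>\<^bsub>Z1\<^esub> atens A Z0 F1 (atens A V W v w) (diff \<Omega> a)"
      by (simp add: rmul_atens sum_connection_atens K_linear_add[OF rmul_linear_left[OF _ K_linear_id]] X.M.a_assoc)
  qed (intro K_linear_plus K_linear_scaled sum_connection_linear lin; simp)+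
qed simp_all

subsection \<open>The curvature of the sum\<close>

private lemma tensor_bimodules: "H_module_bimodule K H A Z0" "H_module_bimodule K H A W1" "H_module_bimodule K H A W2" "H_module_bimodule K H A V1"
    "H_module_bimodule K H A V2"
  by simp_all

private lemma tau_lin:
  "f \<in> K_linear K Z (atensor H A V1 W) \<Longrightarrow> (\<lambda>z. \<tau>1 (f z)) \<in> K_linear K Z Z1"
  "g \<in> K_linear K Z (atensor H A V2 W) \<Longrightarrow> (\<lambda>z. \<tau>2 (g z)) \<in> K_linear K Z Z2"
  using tau23_inv_linear[of V F1 W] tau23_inv_linear[of V F2 W] by (simp_all add: F_quasi_comm)

private lemma tau_cl:
  "s \<in> carrier (atensor H A V1 W) \<Longrightarrow> \<tau>1 s \<in> carrier Z1"
  "s' \<in> carrier (atensor H A V2 W) \<Longrightarrow> \<tau>2 s' \<in> carrier Z2"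
  using tau23_inv_closed[of V F1 W] tau23_inv_closed[of V F2 W] by (simp_all add: F_quasi_comm)

private lemma tau2_atens: "\<lbrakk>v \<in> carrier V; m \<in> carrier F2; w \<in> carrier W\<rbrakk> \<Longrightarrow> \<tau>2 (atens A V2 W (atens A V F2 v m) w)
    = tsum Z2 R (\<lambda>r s. atens A Z0 F2 (atens A V W v (act W s w)) (act F2 r m))"
  using tau23_inv_atens[of V F2 W] by (simp add: F_quasi_comm)

private lemmas lin_rules = lin tau_lin D_linear[OF V _ DV] D_linear[OF W _ DW] ext_linear[OF V _ DV] ext_linear[OF W _ DW]
  ext_linear[OF tensor_bimodules(1) _ sum_connection_leibniz] sum_connection_linear
  badj_linear_left[OF bimod_H_module[OF W] bimod_H_module[OF tensor_bimodules(2)] quasi_right_linearD(1)[OF DW]]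
  badj_linear_right[OF bimod_H_module[OF W] bimod_H_module[OF tensor_bimodules(2)] quasi_right_linearD(1)[OF DW]]
  badj_linear_left[OF bimod_H_module[OF tensor_bimodules(2)] bimod_H_module[OF tensor_bimodules(3)] ext_linear[OF W _ DW K_linear_id]]
  badj_linear_right[OF bimod_H_module[OF tensor_bimodules(2)] bimod_H_module[OF tensor_bimodules(3)] ext_linear[OF W _ DW K_linear_id]]

private lemmas closed_rules = tau_cl D_closed[OF V _ DV] D_closed[OF W _ DW] ext_closed[OF V _ DV] ext_closed[OF W _ DW]
  ext_closed[OF tensor_bimodules(1) _ sum_connection_leibniz] K_linear_closed[OF sum_connection_linear[OF K_linear_id]]
  badj_closed[OF bimod_H_module[OF W] bimod_H_module[OF tensor_bimodules(2)] quasi_right_linearD(1)[OF DW]]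
  badj_closed[OF bimod_H_module[OF tensor_bimodules(2)] bimod_H_module[OF tensor_bimodules(3)] ext_linear[OF W _ DW K_linear_id]]

text \<open>A scalar on w leaves the braided tensor on the right, by right linearity of \<tau>, and
  there it meets the form \<theta>.\<close>

lemma mix_balanced: "x \<in> carrier V1 \<Longrightarrow> balanced_map K A W F1 Z2 (\<lambda>w \<theta>. rwedge Z0 (\<tau>1 (atens A V1 W x w)) \<theta>)"
  by (rule balanced_mapI; (intro lin_rules)?; simp add: closed_rules tau_simps(2) rwedge_rmul)

lemma mix_bilinear: "bilinear_map K V1 W1 Z2 \<mu>"
proof (rule bilinear_mapI)
  fix y assume y: "y \<in> carrier W1"
  show "(\<lambda>x. \<mu> x y) \<in> K_linear K V1 Z2"
    unfolding mix_def
  proof (rule asum_param[OF W F_bimodule(1) _ _ y mix_balanced])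
    fix w \<theta> assume [simp]: "w \<in> carrier W" "\<theta> \<in> carrier F1"
    show "(\<lambda>x. rwedge Z0 (\<tau>1 (atens A V1 W x w)) \<theta>) \<in> K_linear K V1 Z2" by (intro lin_rules; simp)
  qed simp_all
next
  fix x assume x: "x \<in> carrier V1"
  show "(\<lambda>y. \<mu> x y) \<in> K_linear K W1 Z2"
    unfolding mix_def by (rule asum_linear[OF W F_bimodule(1) _ mix_balanced[OF x] K_linear_id]) simp
qed

private lemmas mix_rules = lin_rules bilinear_comp[OF mix_bilinear]
private lemmas mix_closed = closed_rules bilinear_mapD(3)[OF mix_bilinear]

lemma mix_atens: "x \<in> carrier V1 \<Longrightarrow> w \<in> carrier W \<Longrightarrow> \<theta> \<in> carrier F1 \<Longrightarrow>
    \<mu> x (atens A W F1 w \<theta>) = rwedge Z0 (\<tau>1 (atens A V1 W x w)) \<theta>"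
  unfolding mix_def by (rule asum_atens[OF W F_bimodule(1) _ mix_balanced]) simp_all

text \<open>Braiding w past \<theta> and then past the one-form of z is braiding it past their wedge
  product, by (\<Delta> \<otimes> id) R = R_13 R_23 and the action on a product of forms.\<close>

lemma rwedge_tau:
  assumes z: "z \<in> carrier V1" and [simp]: "\<theta> \<in> carrier F1" "w \<in> carrier W"
  shows "tsum Z2 R (\<lambda>r s. rwedge Z0 (\<tau>1 (atens A V1 W z (act W s w))) (act F1 r \<theta>)) = \<tau>2 (atens A V2 W (rwedge V z \<theta>) w)"
proof (rule atensor_eqI[OF V F_bimodule(1) _ _ _ z, where X = Z2 and g = "\<lambda>z. tsum Z2 R (\<lambda>r s. rwedge Z0 (\<tau>1 (atens A V1 W z (act W s w))) (act F1 r \<theta>))"])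
  note [simp] = closed_rules
  fix v \<eta> assume [simp]: "v \<in> carrier V" "\<eta> \<in> carrier F1"
  let ?p = "\<lambda>w \<omega>. atens A Z0 F2 (atens A V W v w) \<omega>"
  have "tsum Z2 R (\<lambda>r s. rwedge Z0 (\<tau>1 (atens A V1 W (atens A V F1 v \<eta>) (act W s w))) (act F1 r \<theta>))
    = tsum Z2 R (\<lambda>r s. tsum Z2 R (\<lambda>r' s'. ?p (act W (s' \<otimes>\<^bsub>H\<^esub> s) w) (act F1 r' \<eta> \<otimes>\<^bsub>\<Omega>\<^esub> act F1 r \<theta>)))"
  proof (rule hsum_cong)
    fix r s assume [simp]: "r \<in> carrier H" "s \<in> carrier H"
    have "rwedge Z0 (\<tau>1 (atens A V1 W (atens A V F1 v \<eta>) (act W s w))) (act F1 r \<theta>)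
      = rwedge Z0 (tsum Z1 R (\<lambda>r' s'. atens A Z0 F1 (atens A V W v (act W s' (act W s w))) (act F1 r' \<eta>))) (act F1 r \<theta>)"
      by (simp add: tau_simps(3))
    also have "\<dots> = tsum Z2 R (\<lambda>r' s'. rwedge Z0 (atens A Z0 F1 (atens A V W v (act W s' (act W s w))) (act F1 r' \<eta>)) (act F1 r \<theta>))"
      by (rule hsum_push[OF _ _ _ _ rwedge_linear(1)[OF tensor_bimodules(1) K_linear_id]]; (intro lin_rules)?; simp)
    also have "\<dots> = tsum Z2 R (\<lambda>r' s'. ?p (act W (s' \<otimes>\<^bsub>H\<^esub> s) w) (act F1 r' \<eta> \<otimes>\<^bsub>\<Omega>\<^esub> act F1 r \<theta>))"
      by (rule hsum_cong; (intro lin_rules)?; simp add: rwedge_atens act_mult'[OF bimod_H_module])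
    finally show "rwedge Z0 (\<tau>1 (atens A V1 W (atens A V F1 v \<eta>) (act W s w))) (act F1 r \<theta>) = \<dots>" .
  qed ((intro lin_rules)?; simp)+
  also have "\<dots> = tsum Z2 R (\<lambda>r' s'. tsum Z2 R (\<lambda>r s. ?p (act W (s' \<otimes>\<^bsub>H\<^esub> s) w) (act F1 r' \<eta> \<otimes>\<^bsub>\<Omega>\<^esub> act F1 r \<theta>)))"
    by (rule hsum_swap; (intro lin_rules)?; simp)
  also have "\<dots> = tsum Z2 R (\<lambda>r s. tsum Z2 (comul H r) (\<lambda>a b. ?p (act W s w) (act F1 a \<eta> \<otimes>\<^bsub>\<Omega>\<^esub> act F1 b \<theta>)))"
    by (rule comul_R_sum(1)[symmetric]; (intro lin_rules)?; simp)
  also have "\<dots> = tsum Z2 R (\<lambda>r s. ?p (act W s w) (act F2 r (\<eta> \<otimes>\<^bsub>\<Omega>\<^esub> \<theta>)))"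
  proof (rule hsum_cong)
    fix r s assume [simp]: "r \<in> carrier H" "s \<in> carrier H"
    show "tsum Z2 (comul H r) (\<lambda>a b. ?p (act W s w) (act F1 a \<eta> \<otimes>\<^bsub>\<Omega>\<^esub> act F1 b \<theta>)) = ?p (act W s w) (act F2 r (\<eta> \<otimes>\<^bsub>\<Omega>\<^esub> \<theta>))"
      by (subst act_wedge, simp, simp, simp, rule hsum_push[OF _ _ _ _ atens_linear_right[OF _ _ _ K_linear_id], symmetric]; (intro lin_rules)?; simp)
  qed ((intro lin_rules)?; simp)+
  also have "\<dots> = \<tau>2 (atens A V2 W (rwedge V (atens A V F1 v \<eta>) \<theta>) w)"
    by (simp add: rwedge_atens tau2_atens)
  finally show "tsum Z2 R (\<lambda>r s. rwedge Z0 (\<tau>1 (atens A V1 W (atens A V F1 v \<eta>) (act W s w))) (act F1 r \<theta>)) = \<dots>" .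
qed ((intro lin_rules)?; simp add: closed_rules)+

lemma rwedge_assoc:
  assumes [simp]: "v \<in> carrier V" "\<theta> \<in> carrier F1" and y: "y \<in> carrier W1"
  shows "rwedge Z0 (\<alpha>1 (atens A V W1 v y)) \<theta> = \<alpha>2 (atens A V W2 v (rwedge W y \<theta>))"
  by (rule atensor_eqI[OF W F_bimodule(1) _ _ _ y, where X = Z2 and g = "\<lambda>y. rwedge Z0 (\<alpha>1 (atens A V W1 v y)) \<theta>"];
    (intro lin_rules)?; simp add: assoc_left_atens rwedge_atens)

text \<open>On the right \<eta> is braided past all of y = w \<otimes> \<theta>, and (id \<otimes>
  \<Delta>) R = R_13 R_12 splits this in two. The braiding past \<theta> restores the order \<eta>
  \<and> \<theta> up to a sign by \<open>wedge_braided_comm\<close>; the braiding past w is the one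
  in \<mu>.\<close>

lemma mix_flip:
  assumes [simp]: "v \<in> carrier V" "\<eta> \<in> carrier F1" and y: "y \<in> carrier W1"
  shows "\<mu> (atens A V F1 v \<eta>) y = tsum Z2 R (\<lambda>r s. \<ominus>\<^bsub>Z2\<^esub> rwedge Z0 (\<alpha>1 (atens A V W1 v (act W1 s y))) (act F1 r \<eta>))"
proof -
  note [simp] = mix_closed
  note rules = K_linear_uminus mix_rules
  interpret Z2: module K Z2 by simp
  interpret F2: module K F2 by simp
  show ?thesis
  proof (rule atensor_eqI[OF W F_bimodule(1) _ _ _ y, where X = Z2 and g = "\<mu> (atens A V F1 v \<eta>)"])
    fix w \<theta> assume [simp]: "w \<in> carrier W" "\<theta> \<in> carrier F1"
    let ?p = "\<lambda>w \<omega>. atens A Z0 F2 (atens A V W v w) \<omega>"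
    have minus: "?p w' (\<ominus>\<^bsub>F2\<^esub> \<omega>) = \<ominus>\<^bsub>Z2\<^esub> ?p w' \<omega>" if "w' \<in> carrier W" "\<omega> \<in> carrier F2" for w' \<omega>
      using that by (intro K_linear_map_uminus[OF atens_linear_right[OF _ _ _ K_linear_id]]) simp_all
    have "tsum Z2 R (\<lambda>r s. \<ominus>\<^bsub>Z2\<^esub> rwedge Z0 (\<alpha>1 (atens A V W1 v (act W1 s (atens A W F1 w \<theta>)))) (act F1 r \<eta>))
      = tsum Z2 R (\<lambda>r s. tsum Z2 (comul H s) (\<lambda>a b. \<ominus>\<^bsub>Z2\<^esub> ?p (act W a w) (act F1 b \<theta> \<otimes>\<^bsub>\<Omega>\<^esub> act F1 r \<eta>)))"
    proof (rule hsum_cong)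
      fix r s assume rs [simp]: "r \<in> carrier H" "s \<in> carrier H"
      let ?g = "\<lambda>y. \<ominus>\<^bsub>Z2\<^esub> rwedge Z0 (\<alpha>1 (atens A V W1 v y)) (act F1 r \<eta>)"
      have g: "?g \<in> K_linear K W1 Z2" by (intro rules; simp)
      have "?g (act W1 s (atens A W F1 w \<theta>)) = tsum Z2 (comul H s) (\<lambda>a b. ?g (atens A W F1 (act W a w) (act F1 b \<theta>)))"
        unfolding act_atens[OF W F_bimodule(1) rs(2) \<open>w \<in> carrier W\<close> \<open>\<theta> \<in> carrier F1\<close>]
        by (rule hsum_push[OF _ _ _ _ g]; (intro rules)?; simp)
      also have "\<dots> = tsum Z2 (comul H s) (\<lambda>a b. \<ominus>\<^bsub>Z2\<^esub> ?p (act W a w) (act F1 b \<theta> \<otimes>\<^bsub>\<Omega>\<^esub> act F1 r \<eta>))"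
        by (rule hsum_cong; (intro rules)?; simp add: assoc_left_atens rwedge_atens)
      finally show "?g (act W1 s (atens A W F1 w \<theta>)) = \<dots>" .
    qed ((intro rules)?; simp)+
    also have "\<dots> = tsum Z2 R (\<lambda>r s. tsum Z2 R (\<lambda>r' s'. \<ominus>\<^bsub>Z2\<^esub> ?p (act W s' w) (act F1 s \<theta> \<otimes>\<^bsub>\<Omega>\<^esub> act F1 (r \<otimes>\<^bsub>H\<^esub> r') \<eta>)))"
      by (rule comul_R_sum(2); (intro rules)?; simp)
    also have "\<dots> = tsum Z2 R (\<lambda>r' s'. tsum Z2 R (\<lambda>r s. \<ominus>\<^bsub>Z2\<^esub> ?p (act W s' w) (act F1 s \<theta> \<otimes>\<^bsub>\<Omega>\<^esub> act F1 (r \<otimes>\<^bsub>H\<^esub> r') \<eta>)))"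
      by (rule hsum_swap; (intro rules)?; simp)
    also have "\<dots> = tsum Z2 R (\<lambda>r' s'. ?p (act W s' w) (act F1 r' \<eta> \<otimes>\<^bsub>\<Omega>\<^esub> \<theta>))"
    proof (rule hsum_cong)
      fix r' s' assume [simp]: "r' \<in> carrier H" "s' \<in> carrier H"
      let ?g = "\<lambda>\<omega>. \<ominus>\<^bsub>Z2\<^esub> ?p (act W s' w) \<omega>"
      have g: "?g \<in> K_linear K F2 Z2" by (intro rules; simp)
      have "tsum Z2 R (\<lambda>r s. ?g (act F1 s \<theta> \<otimes>\<^bsub>\<Omega>\<^esub> act F1 (r \<otimes>\<^bsub>H\<^esub> r') \<eta>))
        = tsum Z2 R (\<lambda>r s. ?g (act F1 s \<theta> \<otimes>\<^bsub>\<Omega>\<^esub> act F1 r (act F1 r' \<eta>)))"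
        by (rule hsum_cong; (intro rules)?; simp add: act_mult'[OF bimod_H_module])
      also have "\<dots> = ?g (tsum F2 R (\<lambda>r s. act F1 s \<theta> \<otimes>\<^bsub>\<Omega>\<^esub> act F1 r (act F1 r' \<eta>)))"
        by (rule hsum_push[OF _ _ _ _ g, symmetric]; (intro rules)?; simp)
      also have "\<dots> = ?p (act W s' w) (act F1 r' \<eta> \<otimes>\<^bsub>\<Omega>\<^esub> \<theta>)"
        by (simp add: wedge_braided_comm minus)
      finally show "tsum Z2 R (\<lambda>r s. ?g (act F1 s \<theta> \<otimes>\<^bsub>\<Omega>\<^esub> act F1 (r \<otimes>\<^bsub>H\<^esub> r') \<eta>)) = \<dots>" .
    qed ((intro rules)?; simp)+
    also have "\<dots> = tsum Z2 R (\<lambda>r' s'. rwedge Z0 (atens A Z0 F1 (atens A V W v (act W s' w)) (act F1 r' \<eta>)) \<theta>)"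
      by (rule hsum_cong; (intro rules)?; simp add: rwedge_atens)
    also have "\<dots> = rwedge Z0 (tsum Z1 R (\<lambda>r' s'. atens A Z0 F1 (atens A V W v (act W s' w)) (act F1 r' \<eta>))) \<theta>"
      by (rule hsum_push[OF _ _ _ _ rwedge_linear(1)[OF tensor_bimodules(1) K_linear_id], symmetric]; (intro rules)?; simp)
    also have "\<dots> = \<mu> (atens A V F1 v \<eta>) (atens A W F1 w \<theta>)"
      by (simp add: mix_atens tau_simps(3))
    finally show "\<mu> (atens A V F1 v \<eta>) (atens A W F1 w \<theta>)
      = tsum Z2 R (\<lambda>r s. \<ominus>\<^bsub>Z2\<^esub> rwedge Z0 (\<alpha>1 (atens A V W1 v (act W1 s (atens A W F1 w \<theta>)))) (act F1 r \<eta>))" ..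
  qed ((intro rules)?; simp)+
qed

text \<open>Identifies the terms in which \<nabla>_W acts after w has been braided past \<theta>.
  Splitting the action on v \<otimes> \<theta> gives one copy of \<open>Rbar\<close> to v and one to
  \<theta>. The latter is consumed by \<open>mix_flip\<close> and
  \<open>R_act_Rbar_badj_sum\<close>, the former makes up id \<otimes>_R \<nabla>_W.\<close>

lemma mix_badj_sum:
  assumes [simp]: "v \<in> carrier V" "\<theta> \<in> carrier F1" "w \<in> carrier W"
  shows "tsum Z2 Rb (\<lambda>r s. \<mu> (act V1 r (atens A V F1 v \<theta>)) (BW s w))
    = \<ominus>\<^bsub>Z2\<^esub> tsum Z2 R (\<lambda>r s. rwedge Z0 (\<alpha>1 (id_tensor V W W1 DW v (act W s w))) (act F1 r \<theta>))"
proof -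
  note [simp] = mix_closed sum_conn_closed
  note rules = K_linear_uminus mix_rules sum_conn_linear(2,3)
  interpret Z2: module K Z2 by simp
  note DWl = quasi_right_linearD(1)[OF DW]
  have "tsum Z2 Rb (\<lambda>r s. \<mu> (act V1 r (atens A V F1 v \<theta>)) (BW s w))
    = tsum Z2 Rb (\<lambda>r s. tsum Z2 (comul H r) (\<lambda>a b. \<mu> (atens A V F1 (act V a v) (act F1 b \<theta>)) (BW s w)))"
  proof (rule hsum_cong)
    fix r s assume rs [simp]: "r \<in> carrier H" "s \<in> carrier H"
    have "BW s w \<in> carrier W1" by simp
    from bilinear_comp(1)[OF mix_bilinear K_linear_id this]
    show "\<mu> (act V1 r (atens A V F1 v \<theta>)) (BW s w) = tsum Z2 (comul H r) (\<lambda>a b. \<mu> (atens A V F1 (act V a v) (act F1 b \<theta>)) (BW s w))"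
      unfolding act_atens[OF V F_bimodule(1) rs(1) \<open>v \<in> carrier V\<close> \<open>\<theta> \<in> carrier F1\<close>]
      by (rule hsum_push[rotated 4]; (intro rules)?; simp)
  qed ((intro rules)?; simp)+
  also have "\<dots> = tsum Z2 Rb (\<lambda>r s. tsum Z2 Rb (\<lambda>r' s'. \<mu> (atens A V F1 (act V r v) (act F1 r' \<theta>)) (BW (s' \<otimes>\<^bsub>H\<^esub> s) w)))"
    by (rule comul_Rbar_sum_left; (intro rules)?; simp)
  also have "\<dots> = tsum Z2 Rb (\<lambda>r s. tsum Z2 R (\<lambda>r' s'. \<ominus>\<^bsub>Z2\<^esub> rwedge Z0 (\<alpha>1 (atens A V W1 (act V r v) (BW s (act W s' w)))) (act F1 r' \<theta>)))"
  proof (rule hsum_cong)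
    fix r s assume rs [simp]: "r \<in> carrier H" "s \<in> carrier H"
    let ?f = "\<lambda>u y. \<ominus>\<^bsub>Z2\<^esub> rwedge Z0 (\<alpha>1 (atens A V W1 (act V r v) y)) (act F1 u \<theta>)"
    have BWs: "BW s \<in> K_linear K W W1" by (rule badj_linear[OF _ _ DWl]) simp_all
    have bb [simp]: "badj H W W1 s' (BW s) w \<in> carrier W1" if "s' \<in> carrier H" for s'
      by (rule badj_closed[OF _ _ BWs]) (simp_all add: that)
    note rules = rules badj_linear_left[OF _ _ BWs] badj_linear_right[OF _ _ BWs]
    have "tsum Z2 Rb (\<lambda>r' s'. \<mu> (atens A V F1 (act V r v) (act F1 r' \<theta>)) (BW (s' \<otimes>\<^bsub>H\<^esub> s) w))
      = tsum Z2 Rb (\<lambda>r' s'. tsum Z2 R (\<lambda>r'' s''. ?f (r'' \<otimes>\<^bsub>H\<^esub> r') (act W1 s'' (badj H W W1 s' (BW s) w))))"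
    proof (rule hsum_cong)
      fix r' s' assume [simp]: "r' \<in> carrier H" "s' \<in> carrier H"
      have "\<mu> (atens A V F1 (act V r v) (act F1 r' \<theta>)) (BW (s' \<otimes>\<^bsub>H\<^esub> s) w)
        = \<mu> (atens A V F1 (act V r v) (act F1 r' \<theta>)) (badj H W W1 s' (BW s) w)"
        by (simp add: badj_mult[OF _ _ DWl])
      also have "\<dots> = tsum Z2 R (\<lambda>r'' s''. \<ominus>\<^bsub>Z2\<^esub> rwedge Z0 (\<alpha>1 (atens A V W1 (act V r v) (act W1 s'' (badj H W W1 s' (BW s) w)))) (act F1 r'' (act F1 r' \<theta>)))"
        by (rule mix_flip) simp_all
      also have "\<dots> = tsum Z2 R (\<lambda>r'' s''. ?f (r'' \<otimes>\<^bsub>H\<^esub> r') (act W1 s'' (badj H W W1 s' (BW s) w)))"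
        by (rule hsum_cong; (intro rules)?; simp add: act_mult'[OF bimod_H_module])
      finally show "\<mu> (atens A V F1 (act V r v) (act F1 r' \<theta>)) (BW (s' \<otimes>\<^bsub>H\<^esub> s) w) = \<dots>" .
    qed ((intro rules)?; simp)+
    \<comment> \<open>The copy of \<open>Rbar\<close> on \<theta> cancels against the R produced by
      \<open>mix_flip\<close>; what remains is a copy of R that acts on w before \<nabla>_W
      does.\<close>
    also have "\<dots> = tsum Z2 R (\<lambda>r' s'. ?f r' (BW s (act W s' w)))"
      by (rule R_act_Rbar_badj_sum[OF _ _ BWs]; (intro rules)?; simp)
    finally show "tsum Z2 Rb (\<lambda>r' s'. \<mu> (atens A V F1 (act V r v) (act F1 r' \<theta>)) (BW (s' \<otimes>\<^bsub>H\<^esub> s) w)) = \<dots>" .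
  qed ((intro rules)?; simp)+
  also have "\<dots> = tsum Z2 R (\<lambda>r' s'. tsum Z2 Rb (\<lambda>r s. \<ominus>\<^bsub>Z2\<^esub> rwedge Z0 (\<alpha>1 (atens A V W1 (act V r v) (BW s (act W s' w)))) (act F1 r' \<theta>)))"
    by (rule hsum_swap; (intro rules)?; simp)
  also have "\<dots> = tsum Z2 R (\<lambda>r' s'. \<ominus>\<^bsub>Z2\<^esub> rwedge Z0 (\<alpha>1 (id_tensor V W W1 DW v (act W s' w))) (act F1 r' \<theta>))"
  proof (rule hsum_cong)
    fix r' s' assume [simp]: "r' \<in> carrier H" "s' \<in> carrier H"
    let ?g = "\<lambda>x. \<ominus>\<^bsub>Z2\<^esub> rwedge Z0 (\<alpha>1 x) (act F1 r' \<theta>)"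
    have g: "?g \<in> K_linear K (atensor H A V W1) Z2" by (intro rules; simp)
    show "tsum Z2 Rb (\<lambda>r s. ?g (atens A V W1 (act V r v) (BW s (act W s' w)))) = ?g (id_tensor V W W1 DW v (act W s' w))"
      unfolding id_tensor_def by (rule hsum_push[OF _ _ _ _ g, symmetric]; (intro rules)?; simp)
  qed ((intro rules)?; simp)+
  also have "\<dots> = \<ominus>\<^bsub>Z2\<^esub> tsum Z2 R (\<lambda>r' s'. rwedge Z0 (\<alpha>1 (id_tensor V W W1 DW v (act W s' w))) (act F1 r' \<theta>))"
    by (rule hsum_push[OF _ _ _ _ K_linear_uminus[OF _ K_linear_id], symmetric]; (intro rules)?; simp)
  finally show ?thesis .
qed

text \<open>On v \<otimes> \<theta> the extension has three parts: \<nabla>_V on v, \<nabla>_W on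
  the braided w, and d\<theta>. The first and the third make up the extension of \<nabla>_V, the
  second is \<open>mix_badj_sum\<close>.\<close>

lemma ext_tau:
  assumes x: "x \<in> carrier V1" and w [simp]: "w \<in> carrier W"
  shows "EVW (\<tau>1 (atens A V1 W x w)) = \<tau>2 (atens A V2 W (EV x) w) \<oplus>\<^bsub>Z2\<^esub> \<ominus>\<^bsub>Z2\<^esub> tsum Z2 Rb (\<lambda>r s. \<mu> (act V1 r x) (BW s w))"
proof -
  note [simp] = mix_closed sum_conn_closed
  note rules = K_linear_uminus K_linear_plus mix_rules sum_conn_linear(2,3)
  interpret Z2: module K Z2 by simp
  interpret V2: module K V2 by simp
  show ?thesis
  proof (rule atensor_eqI[OF V F_bimodule(1) _ _ _ x, where X = Z2 and g = "\<lambda>x. EVW (\<tau>1 (atens A V1 W x w))"])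
    fix v \<theta> assume [simp]: "v \<in> carrier V" "\<theta> \<in> carrier F1"
    let ?a = "\<lambda>r s. rwedge Z0 (\<tau>1 (atens A V1 W (DV v) (act W s w))) (act F1 r \<theta>)"
    let ?b = "\<lambda>r s. rwedge Z0 (\<alpha>1 (id_tensor V W W1 DW v (act W s w))) (act F1 r \<theta>)"
    let ?c = "\<lambda>r s. atens A Z0 F2 (atens A V W v (act W s w)) (diff \<Omega> (act F1 r \<theta>))"
    have bil: "bilinear_map K H H Z2 ?a" "bilinear_map K H H Z2 ?b" "bilinear_map K H H Z2 ?c"
      "bilinear_map K H H Z2 (\<lambda>r s. ?a r s \<oplus>\<^bsub>Z2\<^esub> ?b r s)"
      by (intro rules; simp)+
    have cls [simp]: "tsum Z2 R ?a \<in> carrier Z2" "tsum Z2 R ?b \<in> carrier Z2" "tsum Z2 R ?c \<in> carrier Z2"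
      by (rule hsum_closed[OF _ R_closed bil(1)] hsum_closed[OF _ R_closed bil(2)] hsum_closed[OF _ R_closed bil(3)], simp)+
    have "EVW (\<tau>1 (atens A V1 W (atens A V F1 v \<theta>) w)) = tsum Z2 R (\<lambda>r s. EVW (atens A Z0 F1 (atens A V W v (act W s w)) (act F1 r \<theta>)))"
      by (simp add: tau_simps(3), rule hsum_push[OF _ _ _ _ ext_linear[OF tensor_bimodules(1) _ sum_connection_leibniz K_linear_id]]; (intro rules)?; simp)
    also have "\<dots> = tsum Z2 R (\<lambda>r s. (?a r s \<oplus>\<^bsub>Z2\<^esub> ?b r s) \<oplus>\<^bsub>Z2\<^esub> ?c r s)"
      by (rule hsum_cong; (intro rules)?; simp add: ext_atens[OF tensor_bimodules(1) _ sum_connection_leibniz] sum_connection_atens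
        K_linear_add[OF rwedge_linear(1)[OF tensor_bimodules(1) K_linear_id]])
    also have "\<dots> = tsum Z2 R (\<lambda>r s. ?a r s \<oplus>\<^bsub>Z2\<^esub> ?b r s) \<oplus>\<^bsub>Z2\<^esub> tsum Z2 R ?c"
      by (rule hsum_plus[OF _ R_closed bil(4,3)]) simp
    also have "tsum Z2 R (\<lambda>r s. ?a r s \<oplus>\<^bsub>Z2\<^esub> ?b r s) = tsum Z2 R ?a \<oplus>\<^bsub>Z2\<^esub> tsum Z2 R ?b"
      by (rule hsum_plus[OF _ R_closed bil(1,2)]) simp
    also have "(tsum Z2 R ?a \<oplus>\<^bsub>Z2\<^esub> tsum Z2 R ?b) \<oplus>\<^bsub>Z2\<^esub> tsum Z2 R ?c = (tsum Z2 R ?a \<oplus>\<^bsub>Z2\<^esub> tsum Z2 R ?c) \<oplus>\<^bsub>Z2\<^esub> \<ominus>\<^bsub>Z2\<^esub> tsum Z2 Rb (\<lambda>r s. \<mu> (act V1 r (atens A V F1 v \<theta>)) (BW s w))"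
      by (simp add: mix_badj_sum Z2.M.a_ac)
    also have "tsum Z2 R ?a = \<tau>2 (atens A V2 W (rwedge V (DV v) \<theta>) w)"
      by (rule rwedge_tau) simp_all
    also have "tsum Z2 R ?c = \<tau>2 (atens A V2 W (atens A V F2 v (diff \<Omega> \<theta>)) w)"
      by (simp add: tau2_atens, rule hsum_cong; (intro rules)?; simp add: act_diff)
    also have "\<tau>2 (atens A V2 W (rwedge V (DV v) \<theta>) w) \<oplus>\<^bsub>Z2\<^esub> \<tau>2 (atens A V2 W (atens A V F2 v (diff \<Omega> \<theta>)) w)
      = \<tau>2 (atens A V2 W (EV (atens A V F1 v \<theta>)) w)"
      by (simp add: ext_atens[OF V _ DV] K_linear_add[OF atens_linear_left[OF _ W K_linear_id]] K_linear_add[OF tau_lin(2)[OF K_linear_id]])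
    finally show "EVW (\<tau>1 (atens A V1 W (atens A V F1 v \<theta>) w)) = \<tau>2 (atens A V2 W (EV (atens A V F1 v \<theta>)) w)
      \<oplus>\<^bsub>Z2\<^esub> \<ominus>\<^bsub>Z2\<^esub> tsum Z2 Rb (\<lambda>r s. \<mu> (act V1 r (atens A V F1 v \<theta>)) (BW s w))" .
  qed ((intro rules)?; simp)+
qed

text \<open>The part with \<nabla>_V is \<mu>. In the rest, \<open>badj_ext\<close> scales the
  differential by \<epsilon>(s); summed over \<open>Rbar\<close> the scaling and the action on v
  disappear, which leaves the single term with d\<theta> that the extension on the left has.\<close>

lemma ext_assoc:
  assumes v [simp]: "v \<in> carrier V" and y: "y \<in> carrier W1"
  shows "EVW (\<alpha>1 (atens A V W1 v y)) = \<mu> (DV v) y \<oplus>\<^bsub>Z2\<^esub>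
    \<alpha>2 (tsum (atensor H A V W2) Rb (\<lambda>r s. atens A V W2 (act V r v) (badj H W1 W2 s EW y)))"
proof -
  note [simp] = mix_closed sum_conn_closed
  note rules = K_linear_uminus K_linear_plus mix_rules sum_conn_linear(2,3)
  let ?X = "atensor H A V W2"
  interpret Z2: module K Z2 by simp
  interpret W2: module K W2 by simp
  interpret X: module K ?X by simp
  show ?thesis
  proof (rule atensor_eqI[OF W F_bimodule(1) _ _ _ y, where X = Z2 and g = "\<lambda>y. EVW (\<alpha>1 (atens A V W1 v y))"])
    fix w \<theta> assume [simp]: "w \<in> carrier W" "\<theta> \<in> carrier F1"
    have "tsum ?X Rb (\<lambda>r s. atens A V W2 (act V r v) (badj H W1 W2 s EW (atens A W F1 w \<theta>)))
      = tsum ?X Rb (\<lambda>r s. atens A V W2 (act V r v) (rwedge W (BW s w) \<theta>) \<oplus>\<^bsub>?X\<^esub> counit H s \<odot>\<^bsub>?X\<^esub> atens A V W2 (act V r v) (atens A W F2 w (diff \<Omega> \<theta>)))"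
      by (rule hsum_cong; (intro rules)?; simp add: badj_ext[OF W DW] ext_atens[OF W _ leibniz_map_badj[OF W DW]]
        K_linear_add[OF atens_linear_right[OF V _ _ K_linear_id]] K_linear_smult[OF atens_linear_right[OF V _ _ K_linear_id]])
    also have "\<dots> = tsum ?X Rb (\<lambda>r s. atens A V W2 (act V r v) (rwedge W (BW s w) \<theta>))
      \<oplus>\<^bsub>?X\<^esub> tsum ?X Rb (\<lambda>r s. counit H s \<odot>\<^bsub>?X\<^esub> atens A V W2 (act V r v) (atens A W F2 w (diff \<Omega> \<theta>)))"
      by (rule hsum_plus; (intro rules)?; simp)
    also have "tsum ?X Rb (\<lambda>r s. counit H s \<odot>\<^bsub>?X\<^esub> atens A V W2 (act V r v) (atens A W F2 w (diff \<Omega> \<theta>)))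
      = atens A V W2 (act V \<one>\<^bsub>H\<^esub> v) (atens A W F2 w (diff \<Omega> \<theta>))"
      by (rule counit_Rbar_sum; (intro rules)?; simp)
    finally have eq: "tsum ?X Rb (\<lambda>r s. atens A V W2 (act V r v) (badj H W1 W2 s EW (atens A W F1 w \<theta>)))
      = tsum ?X Rb (\<lambda>r s. atens A V W2 (act V r v) (rwedge W (BW s w) \<theta>)) \<oplus>\<^bsub>?X\<^esub> atens A V W2 v (atens A W F2 w (diff \<Omega> \<theta>))"
      by simp
    have c [simp]: "tsum ?X Rb (\<lambda>r s. atens A V W2 (act V r v) (rwedge W (BW s w) \<theta>)) \<in> carrier ?X"
      by (intro hsum_closed rules; simp)
    have "rwedge Z0 (\<alpha>1 (id_tensor V W W1 DW v w)) \<theta> = tsum Z2 Rb (\<lambda>r s. rwedge Z0 (\<alpha>1 (atens A V W1 (act V r v) (BW s w))) \<theta>)"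
      unfolding id_tensor_def
      by (rule hsum_push[where g = "\<lambda>x. rwedge Z0 (\<alpha>1 x) \<theta>"]; (intro rules)?; simp)
    also have "\<dots> = tsum Z2 Rb (\<lambda>r s. \<alpha>2 (atens A V W2 (act V r v) (rwedge W (BW s w) \<theta>)))"
      by (rule hsum_cong; (intro rules)?; simp add: rwedge_assoc)
    also have "\<dots> = \<alpha>2 (tsum ?X Rb (\<lambda>r s. atens A V W2 (act V r v) (rwedge W (BW s w) \<theta>)))"
      by (rule hsum_push[OF _ _ _ _ assoc_left_linear[OF V W F_bimodule(2) K_linear_id], symmetric]; (intro rules)?; simp)
    finally have eq2: "rwedge Z0 (\<alpha>1 (id_tensor V W W1 DW v w)) \<theta> = \<dots>" .
    show "EVW (\<alpha>1 (atens A V W1 v (atens A W F1 w \<theta>))) = \<mu> (DV v) (atens A W F1 w \<theta>) \<oplus>\<^bsub>Z2\<^esub>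
      \<alpha>2 (tsum ?X Rb (\<lambda>r s. atens A V W2 (act V r v) (badj H W1 W2 s EW (atens A W F1 w \<theta>))))"
      unfolding eq
      by (simp add: assoc_left_atens ext_atens[OF tensor_bimodules(1) _ sum_connection_leibniz] sum_connection_atens mix_atens eq2
        K_linear_add[OF rwedge_linear(1)[OF tensor_bimodules(1) K_linear_id]] K_linear_add[OF assoc_left_linear[OF V W F_bimodule(2) K_linear_id]]
        Z2.M.a_assoc)
  qed ((intro rules)?; simp)+
qed

text \<open>\<open>ext_tau\<close> at x = \<nabla>_V v yields the first curvature and the subtracted
  part of the mixed term; \<open>ext_assoc\<close>, summed over \<open>Rbar\<close>, yields the
  second curvature and the other part.\<close>

lemma curvature_sum_atens:
  assumes v [simp]: "v \<in> carrier V" and w [simp]: "w \<in> carrier W"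
  shows "curvature H A \<Omega> Z0 DVW (atens A V W v w)
    = \<tau>2 (atens A V2 W (curvature H A \<Omega> V DV v) w) \<oplus>\<^bsub>Z2\<^esub> \<alpha>2 (id_tensor V W W2 (curvature H A \<Omega> W DW) v w)
      \<oplus>\<^bsub>Z2\<^esub> (tsum Z2 Rb (\<lambda>r s. \<mu> (DV (act V r v)) (BW s w)) \<oplus>\<^bsub>Z2\<^esub> \<ominus>\<^bsub>Z2\<^esub> tsum Z2 Rb (\<lambda>r s. \<mu> (act V1 r (DV v)) (BW s w)))"
proof -
  note [simp] = mix_closed sum_conn_closed
  note rules = K_linear_uminus K_linear_plus mix_rules sum_conn_linear(2,3)
  let ?X = "atensor H A V W2"
  interpret Z2: module K Z2 by simp
  note DWl = quasi_right_linearD(1)[OF DW] and EWl = ext_linear[OF W _ DW K_linear_id]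
  let ?M = "tsum Z2 Rb (\<lambda>r s. \<mu> (DV (act V r v)) (BW s w))"
  let ?N = "tsum Z2 Rb (\<lambda>r s. \<mu> (act V1 r (DV v)) (BW s w))"
  let ?E = "\<lambda>r s. tsum ?X Rb (\<lambda>r' s'. atens A V W2 (act V r' (act V r v)) (badj H W1 W2 s' EW (BW s w)))"
  have Ec [simp]: "?E r s \<in> carrier ?X" if "r \<in> carrier H" "s \<in> carrier H" for r s
    using that by (intro hsum_closed rules; simp)
  have [simp]: "?M \<in> carrier Z2" "?N \<in> carrier Z2" by (intro hsum_closed rules; simp)+
  have "EVW (\<alpha>1 (id_tensor V W W1 DW v w)) = tsum Z2 Rb (\<lambda>r s. EVW (\<alpha>1 (atens A V W1 (act V r v) (BW s w))))"
    unfolding id_tensor_def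
    by (rule hsum_push[where g = "\<lambda>x. EVW (\<alpha>1 x)"]; (intro rules)?; simp)
  also have "\<dots> = tsum Z2 Rb (\<lambda>r s. \<mu> (DV (act V r v)) (BW s w) \<oplus>\<^bsub>Z2\<^esub> \<alpha>2 (?E r s))"
    by (rule hsum_cong; (intro rules)?; simp add: ext_assoc)
  also have "\<dots> = ?M \<oplus>\<^bsub>Z2\<^esub> tsum Z2 Rb (\<lambda>r s. \<alpha>2 (?E r s))"
    by (rule hsum_plus; (intro rules)?; simp)
  also have "tsum Z2 Rb (\<lambda>r s. \<alpha>2 (?E r s)) = \<alpha>2 (tsum ?X Rb (\<lambda>r s. ?E r s))"
    by (rule hsum_push[OF _ _ _ _ assoc_left_linear[OF V W F_bimodule(2) K_linear_id], symmetric]; (intro rules)?; simp)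
  \<comment> \<open>Two copies of \<open>Rbar\<close> occur, one for \<nabla>_W and one for its
    extension. By \<open>(id \<otimes> \<Delta>) Rbar = Rbar_12 Rbar_13\<close> they form one copy
    with a coproduct on s, so \<open>badj_comp\<close> makes s act on the composite.\<close>
  also have "tsum ?X Rb (\<lambda>r s. ?E r s) = id_tensor V W W2 (curvature H A \<Omega> W DW) v w"
  proof -
    have "tsum ?X Rb (\<lambda>r s. ?E r s) = tsum ?X Rb (\<lambda>r' s'. tsum ?X Rb (\<lambda>r s. atens A V W2 (act V r' (act V r v)) (badj H W1 W2 s' EW (BW s w))))"
      by (rule hsum_swap; (intro rules)?; simp)
    also have "\<dots> = tsum ?X Rb (\<lambda>r' s'. tsum ?X Rb (\<lambda>r s. atens A V W2 (act V (r' \<otimes>\<^bsub>H\<^esub> r) v) (badj H W1 W2 s' EW (BW s w))))"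
      by (rule hsum_cong; (intro rules)?; (rule hsum_cong; (intro rules)?)?; simp add: act_mult'[OF bimod_H_module])
    also have "\<dots> = tsum ?X Rb (\<lambda>r s. tsum ?X (comul H s) (\<lambda>a b. atens A V W2 (act V r v) (badj H W1 W2 a EW (BW b w))))"
      by (rule comul_Rbar_sum_right[symmetric]; (intro rules)?; simp)
    also have "\<dots> = id_tensor V W W2 (curvature H A \<Omega> W DW) v w"
      unfolding id_tensor_def
    proof (rule hsum_cong)
      fix r s assume rs [simp]: "r \<in> carrier H" "s \<in> carrier H"
      have "badj H W W2 s (curvature H A \<Omega> W DW) w = badj H W W2 s (\<lambda>w. EW (DW w)) w"
        unfolding badj_def by (rule hsum_cong; (intro rules)?; simp add: curvature_ext[OF W DW])
      also have "\<dots> = tsum W2 (comul H s) (\<lambda>a b. badj H W1 W2 a EW (BW b w))"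
        by (rule badj_comp[OF _ _ _ DWl EWl]) simp_all
      finally have b: "badj H W W2 s (curvature H A \<Omega> W DW) w = \<dots>" .
      show "tsum ?X (comul H s) (\<lambda>a b. atens A V W2 (act V r v) (badj H W1 W2 a EW (BW b w)))
        = atens A V W2 (act V r v) (badj H W W2 s (curvature H A \<Omega> W DW) w)"
        unfolding b by (rule hsum_push[OF _ _ _ _ atens_linear_right[OF _ _ _ K_linear_id], symmetric]; (intro rules)?; simp)
    next
      have "curvature H A \<Omega> W DW \<in> K_linear K W W2" using curvature_right_linear[OF W DW] by (simp add: Hom_right_def)
      note cc = badj_linear_left[OF _ _ this] badj_linear_right[OF _ _ this] badj_closed[OF _ _ this]
      show "bilinear_map K H H ?X (\<lambda>r s. atens A V W2 (act V r v) (badj H W W2 s (curvature H A \<Omega> W DW) w))"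
        by (intro rules cc; simp add: cc)
    qed simp_all
    finally show ?thesis .
  qed
  finally have 2: "EVW (\<alpha>1 (id_tensor V W W1 DW v w)) = ?M \<oplus>\<^bsub>Z2\<^esub> \<alpha>2 (id_tensor V W W2 (curvature H A \<Omega> W DW) v w)" .
  have cW: "id_tensor V W W2 (curvature H A \<Omega> W DW) v w \<in> carrier ?X"
    by (rule id_tensor_closed[OF V W tensor_bimodules(3) right_linear_quasi[OF tensor_bimodules(3) curvature_right_linear[OF W DW]]]) simp_all
  have "curvature H A \<Omega> Z0 DVW (atens A V W v w) = EVW (\<tau>1 (atens A V1 W (DV v) w)) \<oplus>\<^bsub>Z2\<^esub> EVW (\<alpha>1 (id_tensor V W W1 DW v w))"
    by (simp add: curvature_ext[OF tensor_bimodules(1) sum_connection_leibniz] sum_connection_atens K_linear_add[OF ext_linear[OF tensor_bimodules(1) _ sum_connection_leibniz K_linear_id]])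
  then show ?thesis
    using cW by (simp add: 2 ext_tau curvature_ext[OF V DV] Z2.M.a_ac)
qed

subsection \<open>The mixed term\<close>

lemma tensor_id_balanced: "balanced_map K A (atensor H A V1 W) F1 (atensor H A Z1 F1) (\<lambda>v w. atens A Z1 F1 (\<tau>1 v) w)"
proof (rule balanced_mapI)
  show "bilinear_map K (atensor H A V1 W) F1 (atensor H A Z1 F1) (\<lambda>v w. atens A Z1 F1 (\<tau>1 v) w)"
    by (intro mix_rules; simp add: mix_closed)
  fix x a w assume "x \<in> carrier (atensor H A V1 W)" "a \<in> carrier A" "w \<in> carrier F1"
  then show "atens A Z1 F1 (\<tau>1 (rmul (atensor H A V1 W) x a)) w = atens A Z1 F1 (\<tau>1 x) (lmul F1 a w)"
    by (simp add: tau23_inv_rmul[OF V F_bimodule(1) W F_quasi_comm(3) WL] mix_closed atens_balanced)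
qed

lemma tensor_id_linear: "f \<in> K_linear K Y (atensor H A (atensor H A V1 W) F1) \<Longrightarrow>
    (\<lambda>y. tensor_id H A Z1 F1 \<tau>1 (f y)) \<in> K_linear K Y (atensor H A Z1 F1)"
  unfolding tensor_id_def by (rule asum_linear[OF _ _ _ tensor_id_balanced]) simp_all

lemma tensor_id_atens: "x \<in> carrier (atensor H A V1 W) \<Longrightarrow> w \<in> carrier F1 \<Longrightarrow>
    tensor_id H A Z1 F1 \<tau>1 (atens A (atensor H A V1 W) F1 x w) = atens A Z1 F1 (\<tau>1 x) w"
  unfolding tensor_id_def by (rule asum_atens[OF _ _ _ tensor_id_balanced]) simp_all

private lemma atens_bilinear: "bilinear_map K V1 W1 (atensor H A V1 W1) (atens A V1 W1)"
  by (intro bilinear_mapI lin; simp)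

text \<open>All maps of the chain are linear, so the chain is compared with \<mu> on elements x
  \<otimes> (w \<otimes> \<theta>).\<close>

lemma mix_chain:
  assumes t: "t \<in> carrier KX"
  shows "(rtensor_A K H R A Z0 Z0 FF F2 id (wedge_map \<Omega>) \<circ> assoc_right H A Z0 F1 F1 \<circ> tensor_id H A Z1 F1 \<tau>1
      \<circ> assoc_left H A V1 W F1 \<circ> proj_tensor H A V1 W1) t = tsum Z2 t \<mu>"
proof -
  have M: "module K V1" "module K W1" by simp_all
  let ?c = "\<lambda>x. rtensor_A K H R A Z0 Z0 FF F2 id (wedge_map \<Omega>) (assoc_right H A Z0 F1 F1 (tensor_id H A Z1 F1 \<tau>1 (assoc_left H A V1 W F1 x)))"
  have c: "(\<lambda>z. ?c (f z)) \<in> K_linear K Y Z2" if "f \<in> K_linear K Y (atensor H A V1 W1)" for f and Y :: "('k, 'y, 'yy) module_scheme"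
    by (intro rtensor_id_wedge_linear tensor_id_linear lin that; simp)
  have "?c (proj_tensor H A V1 W1 t) = tsum Z2 t \<mu>"
  proof (rule ktensor_eqI[OF M _ _ _ t, where X = Z2 and g = "\<lambda>t. ?c (proj_tensor H A V1 W1 t)"])
    show "(\<lambda>t. ?c (proj_tensor H A V1 W1 t)) \<in> K_linear K KX Z2"
      unfolding proj_tensor_def by (intro c ksum_linear[OF M _ atens_bilinear] K_linear_id) simp
    show "(\<lambda>t. tsum Z2 t \<mu>) \<in> K_linear K KX Z2"
      by (intro ksum_linear[OF M _ mix_bilinear] K_linear_id) simp
    fix x y assume x [simp]: "x \<in> carrier V1" and y: "y \<in> carrier W1"
    have "?c (atens A V1 W1 x y) = \<mu> x y"
    proof (rule atensor_eqI[OF W F_bimodule(1) _ _ _ y, where X = Z2 and g = "\<lambda>y. ?c (atens A V1 W1 x y)"])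
      fix w \<theta> assume [simp]: "w \<in> carrier W" "\<theta> \<in> carrier F1"
      have "?c (atens A V1 W1 x (atens A W F1 w \<theta>)) = rtensor_A K H R A Z0 Z0 FF F2 id (wedge_map \<Omega>)
          (assoc_right H A Z0 F1 F1 (atens A Z1 F1 (\<tau>1 (atens A V1 W x w)) \<theta>))"
        by (simp add: assoc_left_atens tensor_id_atens)
      \<comment> \<open>The braided tensor is a sum of pure ones, so this equation too is proved for
        a variable t and reduced to pure tensors.\<close>
      also have "\<dots> = rwedge Z0 (\<tau>1 (atens A V1 W x w)) \<theta>"
      proof (rule atensor_eqI[OF _ F_bimodule(1), where X = Z2 and t = "\<tau>1 (atens A V1 W x w)" and
            g = "\<lambda>t. rtensor_A K H R A Z0 Z0 FF F2 id (wedge_map \<Omega>) (assoc_right H A Z0 F1 F1 (atens A Z1 F1 t \<theta>))"])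
        show "(\<lambda>t. rtensor_A K H R A Z0 Z0 FF F2 id (wedge_map \<Omega>) (assoc_right H A Z0 F1 F1 (atens A Z1 F1 t \<theta>))) \<in> K_linear K Z1 Z2"
          by (intro rtensor_id_wedge_linear lin; simp)
        show "(\<lambda>t. rwedge Z0 t \<theta>) \<in> K_linear K Z1 Z2" by (intro lin; simp)
      qed (simp_all add: mix_closed assoc_right_atens rtensor_id_wedge_atens rwedge_atens)
      also have "\<dots> = \<mu> x (atens A W F1 w \<theta>)"
        by (simp add: mix_atens)
      finally show "?c (atens A V1 W1 x (atens A W F1 w \<theta>)) = \<mu> x (atens A W F1 w \<theta>)" .
    qed (intro c mix_rules; simp)+
    then show "?c (proj_tensor H A V1 W1 (ktens K V1 W1 x y)) = tsum Z2 (ktens K V1 W1 x y) \<mu>"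
      using y by (simp add: proj_tensor_def ksum_ktens[OF M _ atens_bilinear] ksum_ktens[OF M _ mix_bilinear])
  qed
  then show ?thesis by simp
qed

private lemma KX_module: "module K V1" "module K W1" "module K KX" "module K V" "module K W"
  by (simp_all add: ktensor_module)

private lemmas ktens_lin = ktens_linear_left[OF KX_module(1,2)] ktens_linear_right[OF KX_module(1,2)]

private lemmas BV_rules = badj_linear_left[OF bimod_H_module[OF V] bimod_H_module[OF tensor_bimodules(4)] quasi_right_linearD(1)[OF DV]]
  badj_linear_right[OF bimod_H_module[OF V] bimod_H_module[OF tensor_bimodules(4)] quasi_right_linearD(1)[OF DV]]
private lemmas BV_closed = badj_closed[OF bimod_H_module[OF V] bimod_H_module[OF tensor_bimodules(4)] quasi_right_linearD(1)[OF DV]]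

text \<open>\<open>px\<close> and \<open>qx\<close> are the two halves of the mixed difference at v
  \<otimes> w; they differ in whether \<open>Rbar\<close> acts before or after \<nabla>_V.\<close>

private abbreviation "px \<equiv> \<lambda>v w. tsum KX Rb (\<lambda>r s. ktens K V1 W1 (DV (act V r v)) (BW s w))"
private abbreviation "qx \<equiv> \<lambda>v w. tsum KX Rb (\<lambda>r s. ktens K V1 W1 (act V1 r (DV v)) (BW s w))"
private abbreviation "PX \<equiv> \<lambda>t. tsum KX t px"
private abbreviation "QX \<equiv> \<lambda>t. tsum KX t qx"

private lemma px_qx_bilinear: "bilinear_map K V W KX px" "bilinear_map K V W KX qx"
proof -
  note [simp] = mix_closed BV_closed KX_module ktens_closed[OF KX_module(1,2)]
  show "bilinear_map K V W KX px" "bilinear_map K V W KX qx"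
    by (intro mix_rules ktens_lin BV_rules; simp)+
qed

lemma mixed_diff_linear: "(\<lambda>t. PX t \<oplus>\<^bsub>KX\<^esub> \<ominus>\<^bsub>KX\<^esub> QX t) \<in> K_linear K (ktensor K V W) KX"
  by (intro K_linear_plus K_linear_uminus ksum_linear[OF KX_module(4,5,3) _ K_linear_id] px_qx_bilinear KX_module)

lemma mixed_diff_ktens: "\<lbrakk>v \<in> carrier V; w \<in> carrier W\<rbrakk> \<Longrightarrow>
    PX (ktens K V W v w) \<oplus>\<^bsub>KX\<^esub> \<ominus>\<^bsub>KX\<^esub> QX (ktens K V W v w) = px v w \<oplus>\<^bsub>KX\<^esub> \<ominus>\<^bsub>KX\<^esub> qx v w"
  by (simp add: ksum_ktens[OF KX_module(4,5,3) px_qx_bilinear(1)] ksum_ktens[OF KX_module(4,5,3) px_qx_bilinear(2)])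

text \<open>The subtracted half contains two copies of \<open>Rbar\<close>, one summed outside and
  one inside \<otimes>_R. By \<open>comul_Rbar_sum_left\<close> they form one copy with a coproduct
  on r, and \<open>badj_conv\<close> turns the action of r_1 on \<nabla>_V and of r_2 on v into r
  \<rhd> (\<nabla>_V v).\<close>

lemma mixed_diff_eq:
  assumes t: "t \<in> carrier (ktensor K V W)"
  shows "mixed_diff K H R A \<Omega> V W DV DW t = PX t \<oplus>\<^bsub>KX\<^esub> \<ominus>\<^bsub>KX\<^esub> QX t"
proof -
  note [simp] = mix_closed BV_closed KX_module ktens_closed[OF KX_module(1,2)]
  note rules = mix_rules ktens_lin BV_rules
  note DWl = quasi_right_linearD(1)[OF DW] and DVl = quasi_right_linearD(1)[OF DV]
  interpret KX: module K KX by simp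
  note bb = px_qx_bilinear(2)
  note suml = ksum_linear[OF KX_module(4,5,3) _ K_linear_id] and sume = ksum_ktens[OF KX_module(4,5,3)]
  \<comment> \<open>The inner braided tensor product at v \<otimes> w, with the two adjoint actions
    on \<nabla>_W merged by \<open>badj_mult\<close>.\<close>
  let ?G = "\<lambda>r s v w. tsum KX Rb (\<lambda>r' s'. ktens K V1 W1 (BV r (act V r' v)) (BW (s' \<otimes>\<^bsub>H\<^esub> s) w))"
  have bG: "bilinear_map K V W KX (\<lambda>v w. ?G r s v w)" if "r \<in> carrier H" "s \<in> carrier H" for r s
    using that by (intro rules; simp)
  have bGt: "bilinear_map K H H KX (\<lambda>r s. tsum KX t (\<lambda>v w. ?G r s v w))" if "t \<in> carrier (ktensor K V W)" for t
    using that by (intro bilinear_mapI ksum_param[OF KX_module(4,5,3)] bG rules; simp)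
  have G: "rtensor_K K H R V V1 W W1 (BV r) (BW s) t = tsum KX t (\<lambda>v w. ?G r s v w)" if rs [simp]: "r \<in> carrier H" "s \<in> carrier H" for r s
    unfolding rtensor_K_def
  proof (rule ksum_cong[OF KX_module(4,5,3) t bG[OF rs]])
    fix v w assume [simp]: "v \<in> carrier V" "w \<in> carrier W"
    show "tsum KX Rb (\<lambda>r' s'. ktens K V1 W1 (BV r (act V r' v)) (badj H W W1 s' (BW s) w)) = ?G r s v w"
      by (rule hsum_cong; (intro rules)?; simp add: badj_mult[OF _ _ DWl])
  qed
  have "tsum KX Rb (\<lambda>r s. rtensor_K K H R V V1 W W1 (BV r) (BW s) t) = tsum KX Rb (\<lambda>r s. tsum KX t (\<lambda>v w. ?G r s v w))"
    by (rule hsum_cong[OF _ _ bGt[OF t]]) (simp_all add: G)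
  also have "\<dots> = QX t"
  proof (rule ktensor_eqI[OF KX_module(4,5) _ _ _ t, where X = KX and g = "\<lambda>t. tsum KX Rb (\<lambda>r s. tsum KX t (\<lambda>v w. ?G r s v w))"])
    show "QX \<in> K_linear K (ktensor K V W) KX" by (intro suml bb)
    show "(\<lambda>t. tsum KX Rb (\<lambda>r s. tsum KX t (\<lambda>v w. ?G r s v w))) \<in> K_linear K (ktensor K V W) KX"
      by (rule hsum_param; (intro bGt suml bG)?; simp add: ktensor_module)
    fix v w assume vw [simp]: "v \<in> carrier V" "w \<in> carrier W"
    have "tsum KX Rb (\<lambda>r s. tsum KX (ktens K V W v w) (\<lambda>v w. ?G r s v w)) = tsum KX Rb (\<lambda>r s. ?G r s v w)"
      by (rule hsum_cong; (intro rules)?; simp add: sume[OF bG])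
    also have "\<dots> = tsum KX Rb (\<lambda>r s. tsum KX (comul H r) (\<lambda>a b. ktens K V1 W1 (BV a (act V b v)) (BW s w)))"
      by (rule comul_Rbar_sum_left[symmetric]; (intro rules)?; simp)
    also have "\<dots> = tsum KX Rb (\<lambda>r s. ktens K V1 W1 (act V1 r (DV v)) (BW s w))"
    proof (rule hsum_cong)
      fix r s assume rs [simp]: "r \<in> carrier H" "s \<in> carrier H"
      have s: "BW s w \<in> carrier W1" by simp
      show "tsum KX (comul H r) (\<lambda>a b. ktens K V1 W1 (BV a (act V b v)) (BW s w)) = ktens K V1 W1 (act V1 r (DV v)) (BW s w)"
        unfolding badj_conv[OF bimod_H_module[OF V] bimod_H_module[OF tensor_bimodules(4)] DVl rs(1) vw(1), symmetric]
        by (rule hsum_push[OF _ _ _ _ ktens_lin(1)[OF K_linear_id s], symmetric]; (intro rules)?; simp)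
    qed ((intro rules)?; simp)+
    finally show "tsum KX Rb (\<lambda>r s. tsum KX (ktens K V W v w) (\<lambda>v w. ?G r s v w)) = QX (ktens K V W v w)"
      by (simp add: sume[OF bb])
  qed
  finally show "mixed_diff K H R A \<Omega> V W DV DW t = PX t \<oplus>\<^bsub>KX\<^esub> \<ominus>\<^bsub>KX\<^esub> QX t"
    unfolding mixed_diff_def Let_def F1_def[symmetric] by (simp add: rtensor_K_def KX.minus_eq)
qed

lemma mixed_term_eq:
  assumes t: "t \<in> carrier (ktensor K V W)"
  shows "mixed_term K H R A \<Omega> V W DV DW t = tsum Z2 (mixed_diff K H R A \<Omega> V W DV DW t) \<mu>"
proof -
  have "mixed_diff K H R A \<Omega> V W DV DW t \<in> carrier KX"
    unfolding mixed_diff_eq[OF t] by (rule K_linear_closed[OF mixed_diff_linear t])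
  then show ?thesis
    using mix_chain unfolding mixed_term_def Let_def F1_def[symmetric] F2_def[symmetric] by simp
qed

lemma mixed_term_linear: "mixed_term K H R A \<Omega> V W DV DW \<in> K_linear K (ktensor K V W) Z2"
proof (rule K_linear_cong)
  let ?d = "\<lambda>t. PX t \<oplus>\<^bsub>KX\<^esub> \<ominus>\<^bsub>KX\<^esub> QX t"
  show "(\<lambda>t. tsum Z2 (?d t) \<mu>) \<in> K_linear K (ktensor K V W) Z2"
    by (rule ksum_linear[OF KX_module(1,2) _ mix_bilinear mixed_diff_linear]) simp
qed (simp_all add: ktensor_module mixed_term_eq mixed_diff_eq)

text \<open>Brings the mixed term into the shape of the last summand of
  \<open>curvature_sum_atens\<close>.\<close>

lemma mixed_term_ktens:
  assumes v [simp]: "v \<in> carrier V" and w [simp]: "w \<in> carrier W"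
  shows "mixed_term K H R A \<Omega> V W DV DW (ktens K V W v w)
    = tsum Z2 Rb (\<lambda>r s. \<mu> (DV (act V r v)) (BW s w)) \<oplus>\<^bsub>Z2\<^esub> \<ominus>\<^bsub>Z2\<^esub> tsum Z2 Rb (\<lambda>r s. \<mu> (act V1 r (DV v)) (BW s w))"
proof -
  note [simp] = mix_closed KX_module ktens_closed[OF KX_module(1,2)]
  note rules = mix_rules ktens_lin
  have kvw: "ktens K V W v w \<in> carrier (ktensor K V W)" by (simp add: ktens_closed)
  let ?s = "\<lambda>t. tsum Z2 t \<mu>"
  have s: "?s \<in> K_linear K KX Z2" by (intro ksum_linear[OF KX_module(1,2) _ mix_bilinear] K_linear_id) simp
  let ?p = "px v w"
  let ?q = "qx v w"
  interpret KX: module K KX by simp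
  have [simp]: "?p \<in> carrier KX" "?q \<in> carrier KX" by (intro hsum_closed rules; simp)+
  have se: "?s (ktens K V1 W1 x y) = \<mu> x y" if "x \<in> carrier V1" "y \<in> carrier W1" for x y
    using that by (intro ksum_ktens[OF KX_module(1,2) _ mix_bilinear]) simp_all
  have p: "?s ?p = tsum Z2 Rb (\<lambda>r s. \<mu> (DV (act V r v)) (BW s w))"
    by (subst hsum_push[OF _ _ _ _ s]; (intro rules)?; (rule hsum_cong; (intro rules)?)?; simp add: se)
  have q: "?s ?q = tsum Z2 Rb (\<lambda>r s. \<mu> (act V1 r (DV v)) (BW s w))"
    by (subst hsum_push[OF _ _ _ _ s]; (intro rules)?; (rule hsum_cong; (intro rules)?)?; simp add: se)
  show ?thesis
    unfolding mixed_term_eq[OF kvw] mixed_diff_eq[OF kvw] mixed_diff_ktens[OF v w]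
    by (simp add: K_linear_add[OF s] K_linear_map_uminus[OF s] p q)
qed

section \<open>The two curvature summands as right linear maps\<close>

private abbreviation "RV \<equiv> curvature H A \<Omega> V DV"
private abbreviation "RW \<equiv> curvature H A \<Omega> W DW"

private lemmas RW_quasi = right_linear_quasi[OF tensor_bimodules(3) curvature_right_linear[OF W DW]]

private lemma RV_facts: "RV \<in> K_linear K V V2" "v \<in> carrier V \<Longrightarrow> RV v \<in> carrier V2"
  "v \<in> carrier V \<Longrightarrow> a \<in> carrier A \<Longrightarrow> RV (rmul V v a) = rmul V2 (RV v) a"
  using curvature_right_linear[OF V DV] by (auto simp: Hom_right_def K_linear_closed)

lemma RV_id_balanced: "balanced_map K A V W (atensor H A V2 W) (\<lambda>v w. atens A V2 W (RV v) w)"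
  by (rule balanced_mapI; (intro lin K_linear_comp[OF RV_facts(1)])?; simp add: RV_facts atens_balanced)

text \<open>The identity of W is equivariant, so its adjoint action is the counit, and
  \<open>(id \<otimes> \<epsilon>) Rbar = 1\<close> removes the R-matrix.\<close>

lemma rtensor_RV_id:
  assumes t: "t \<in> carrier Z0"
  shows "rtensor_A K H R A V V2 W W RV id t = tsum (atensor H A V2 W) t (\<lambda>v w. atens A V2 W (RV v) w)"
  unfolding rtensor_A_def
proof (rule asum_cong[OF V W _ RV_id_balanced _ t])
  let ?X = "atensor H A V2 W"
  fix v w assume [simp]: "v \<in> carrier V" "w \<in> carrier W"
  have id: "badj H W W s id w = counit H s \<odot>\<^bsub>W\<^esub> w" if "s \<in> carrier H" for s
  proof -
    have i: "id \<in> K_linear K W W" using K_linear_id[of K W] by (simp add: id_def)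
    show ?thesis
      using badj_equivariant[OF _ _ i, of s w] that by simp
  qed
  interpret W: module K W by simp
  have "tsum ?X Rb (\<lambda>r s. atens A V2 W (RV (act V r v)) (badj H W W s id w)) = tsum ?X Rb (\<lambda>r s. counit H s \<odot>\<^bsub>?X\<^esub> atens A V2 W (RV (act V r v)) w)"
    by (rule hsum_cong; (intro lin K_linear_comp[OF RV_facts(1)])?; simp add: RV_facts id K_linear_smult[OF atens_linear_right[OF _ W _ K_linear_id]])
  also have "\<dots> = atens A V2 W (RV (act V \<one>\<^bsub>H\<^esub> v)) w"
    by (rule counit_Rbar_sum; (intro lin K_linear_comp[OF RV_facts(1)])?; simp add: RV_facts)
  finally show "tsum ?X Rb (\<lambda>r s. atens A V2 W (RV (act V r v)) (badj H W W s id w)) = atens A V2 W (RV v) w" by simp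
qed simp

text \<open>A curvature has Leibniz term 0, so the defect in \<open>id_tensor_balanced\<close> is a
  sum of zeros.\<close>

lemma id_RW_balanced: "balanced_map K A V W (atensor H A V W2) (id_tensor V W W2 RW)"
proof (rule balanced_mapI)
  show "bilinear_map K V W (atensor H A V W2) (id_tensor V W W2 RW)"
    by (rule id_tensor_bilinear[OF V W tensor_bimodules(3) RW_quasi])
  fix v a w assume [simp]: "v \<in> carrier V" "a \<in> carrier A" "w \<in> carrier W"
  let ?X = "atensor H A V W2"
  interpret X: module K ?X by simp
  interpret W2: module K W2 by simp
  have z: "atens A V W2 v \<zero>\<^bsub>W2\<^esub> = \<zero>\<^bsub>?X\<^esub>"
    by (rule K_linear_map_zero[OF atens_linear_right[OF V _ _ K_linear_id]]) simp_all
  have b: "bilinear_map K H H W2 (\<lambda>_ _. \<zero>\<^bsub>W2\<^esub>)" by (intro bilinear_mapI K_linear_zero) simp_all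
  have "tsum ?X R (\<lambda>r s. atens A V W2 v \<zero>\<^bsub>W2\<^esub>) = atens A V W2 v (tsum W2 R (\<lambda>r s. \<zero>\<^bsub>W2\<^esub>))"
    by (rule hsum_push[OF _ _ _ b atens_linear_right[OF V _ _ K_linear_id], symmetric]) simp_all
  \<comment> \<open>The zero map pushed through the sum gives 0, here written as \<epsilon>(1)
    0.\<close>
  also have "tsum W2 R (\<lambda>r s. \<zero>\<^bsub>W2\<^esub>) = counit H \<one>\<^bsub>H\<^esub> \<odot>\<^bsub>W2\<^esub> \<zero>\<^bsub>W2\<^esub>"
  proof -
    have "(\<lambda>x. \<zero>\<^bsub>W2\<^esub>) \<in> K_linear K W2 W2" by (rule K_linear_zero) simp
    from hsum_push[OF _ _ R_closed b this] show ?thesis by simp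
  qed
  finally have "tsum ?X R (\<lambda>r s. atens A V W2 v \<zero>\<^bsub>W2\<^esub>) = \<zero>\<^bsub>?X\<^esub>" by (simp add: z)
  moreover have "id_tensor V W W2 RW (rmul V v a) w \<oplus>\<^bsub>?X\<^esub> tsum ?X R (\<lambda>r s. atens A V W2 v \<zero>\<^bsub>W2\<^esub>) = id_tensor V W W2 RW v (lmul W a w)"
    by (rule id_tensor_balanced[OF V W tensor_bimodules(3) RW_quasi WL atensor_left_quasi_comm[OF WL F_quasi_comm(2)]]) simp_all
  ultimately show "id_tensor V W W2 RW (rmul V v a) w = id_tensor V W W2 RW v (lmul W a w)"
    by (simp add: id_tensor_closed[OF V W tensor_bimodules(3) RW_quasi])
qed

lemma rtensor_id_RW: "rtensor_A K H R A V V W W2 id RW t = tsum (atensor H A V W2) t (id_tensor V W W2 RW)"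
  by (simp add: rtensor_A_def id_tensor_def[abs_def])

private abbreviation "P1 \<equiv> \<lambda>t. \<tau>2 (rtensor_A K H R A V V2 W W RV id t)"
private abbreviation "P2 \<equiv> \<lambda>t. \<alpha>2 (rtensor_A K H R A V V W W2 id RW t)"

private lemma P1_facts: "P1 \<in> K_linear K Z0 Z2"
  "v \<in> carrier V \<Longrightarrow> w \<in> carrier W \<Longrightarrow> P1 (atens A V W v w) = \<tau>2 (atens A V2 W (RV v) w)"
  "t \<in> carrier Z0 \<Longrightarrow> a \<in> carrier A \<Longrightarrow> P1 (rmul Z0 t a) = rmul Z2 (P1 t) a"
proof -
  have l: "(\<lambda>t. tsum (atensor H A V2 W) (f t) (\<lambda>v w. atens A V2 W (RV v) w)) \<in> K_linear K Y (atensor H A V2 W)"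
    if "f \<in> K_linear K Y Z0" for f and Y :: "('k, 'y, 'yy) module_scheme"
    by (rule asum_linear[OF V W _ RV_id_balanced that]) simp
  show lin: "P1 \<in> K_linear K Z0 Z2"
    by (rule K_linear_cong[OF tau_lin(2)[OF l[OF K_linear_id]]]) (simp_all add: rtensor_RV_id)
  show atens: "v \<in> carrier V \<Longrightarrow> w \<in> carrier W \<Longrightarrow> P1 (atens A V W v w) = \<tau>2 (atens A V2 W (RV v) w)" for v w
    by (simp add: rtensor_RV_id asum_atens[OF V W _ RV_id_balanced])
  show "P1 (rmul Z0 t a) = rmul Z2 (P1 t) a" if t: "t \<in> carrier Z0" and [simp]: "a \<in> carrier A"
  proof (rule atensor_eqI[OF V W _ _ _ t, where X = Z2 and g = "\<lambda>t. P1 (rmul Z0 t a)"])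
    fix v w assume [simp]: "v \<in> carrier V" "w \<in> carrier W"
    have "\<tau>2 (rmul (atensor H A V2 W) (atens A V2 W (RV v) w) a) = rmul Z2 (\<tau>2 (atens A V2 W (RV v) w)) a"
      by (rule tau23_inv_rmul[OF V F_bimodule(2) W F_quasi_comm(4) WL]) (simp_all add: RV_facts)
    then show "P1 (rmul Z0 (atens A V W v w) a) = rmul Z2 (P1 (atens A V W v w)) a"
      by (simp add: rmul_atens atens RV_facts)
  next
    show "(\<lambda>t. P1 (rmul Z0 t a)) \<in> K_linear K Z0 Z2"
      by (rule K_linear_comp[OF lin rmul_linear_left[OF _ K_linear_id]]) simp_all
    show "(\<lambda>t. rmul Z2 (P1 t) a) \<in> K_linear K Z0 Z2"
      by (rule rmul_linear_left[OF _ lin]) simp_all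
  qed
qed

private lemma P2_facts: "P2 \<in> K_linear K Z0 Z2"
  "v \<in> carrier V \<Longrightarrow> w \<in> carrier W \<Longrightarrow> P2 (atens A V W v w) = \<alpha>2 (id_tensor V W W2 RW v w)"
  "t \<in> carrier Z0 \<Longrightarrow> a \<in> carrier A \<Longrightarrow> P2 (rmul Z0 t a) = rmul Z2 (P2 t) a"
proof -
  note idc = id_tensor_closed[OF V W tensor_bimodules(3) RW_quasi]
  show lin: "P2 \<in> K_linear K Z0 Z2"
    unfolding rtensor_id_RW
    by (rule assoc_left_linear[OF V W F_bimodule(2) asum_linear[OF V W _ id_RW_balanced K_linear_id]]) simp
  show atens: "v \<in> carrier V \<Longrightarrow> w \<in> carrier W \<Longrightarrow> P2 (atens A V W v w) = \<alpha>2 (id_tensor V W W2 RW v w)" for v w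
    by (simp add: rtensor_id_RW asum_atens[OF V W _ id_RW_balanced])
  show "P2 (rmul Z0 t a) = rmul Z2 (P2 t) a" if t: "t \<in> carrier Z0" and [simp]: "a \<in> carrier A"
  proof (rule atensor_eqI[OF V W _ _ _ t, where X = Z2 and g = "\<lambda>t. P2 (rmul Z0 t a)"])
    fix v w assume [simp]: "v \<in> carrier V" "w \<in> carrier W"
    interpret X: module K "atensor H A V W2" by simp
    have z: "atens A V W2 v \<zero>\<^bsub>W2\<^esub> = \<zero>\<^bsub>atensor H A V W2\<^esub>"
      by (rule K_linear_map_zero[OF atens_linear_right[OF V _ _ K_linear_id]]) simp_all
    have "id_tensor V W W2 RW v (rmul W w a) = rmul (atensor H A V W2) (id_tensor V W W2 RW v w) a"
      by (simp add: id_tensor_rmul[OF V W tensor_bimodules(3) RW_quasi] z idc)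
    then show "P2 (rmul Z0 (atens A V W v w) a) = rmul Z2 (P2 (atens A V W v w)) a"
      by (simp add: rmul_atens atens assoc_left_rmul idc)
  next
    show "(\<lambda>t. P2 (rmul Z0 t a)) \<in> K_linear K Z0 Z2"
      by (rule K_linear_comp[OF lin rmul_linear_left[OF _ K_linear_id]]) simp_all
    show "(\<lambda>t. rmul Z2 (P2 t) a) \<in> K_linear K Z0 Z2"
      by (rule rmul_linear_left[OF _ lin]) simp_all
  qed
qed

lemma curvature_sum:
  defines "RVW \<equiv> curvature H A \<Omega> Z0 DVW"
  shows "RVW \<in> Hom_right K A Z0 Z2"
    and "\<exists>C \<in> Hom_right K A Z0 Z2.
         (\<forall>t \<in> carrier (ktensor K V W). C (proj_tensor H A V W t) = mixed_term K H R A \<Omega> V W DV DW t)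
         \<and> (\<forall>t \<in> carrier Z0. RVW t = P1 t \<oplus>\<^bsub>Z2\<^esub> P2 t \<oplus>\<^bsub>Z2\<^esub> C t)"
proof -
  interpret Z2: module K Z2 by simp
  show Rh: "RVW \<in> Hom_right K A Z0 Z2"
    unfolding RVW_def by (rule curvature_right_linear[OF tensor_bimodules(1) sum_connection_leibniz])
  have Rl: "RVW \<in> K_linear K Z0 Z2" and Rr: "\<And>t a. t \<in> carrier Z0 \<Longrightarrow> a \<in> carrier A \<Longrightarrow> RVW (rmul Z0 t a) = rmul Z2 (RVW t) a"
    using Rh by (auto simp: Hom_right_def)
  \<comment> \<open>Defined as a difference, \<open>C\<close> is right linear because all three
    terms are. That it is induced by the mixed term is then a comparison on pure tensors, where
    \<open>curvature_sum_atens\<close> applies.\<close>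
  define C where "C = (\<lambda>t. RVW t \<oplus>\<^bsub>Z2\<^esub> \<ominus>\<^bsub>Z2\<^esub> (P1 t \<oplus>\<^bsub>Z2\<^esub> P2 t))"
  have Cl: "C \<in> K_linear K Z0 Z2"
    unfolding C_def by (intro K_linear_plus K_linear_uminus Rl P1_facts(1) P2_facts(1)) simp_all
  have c [simp]: "RVW t \<in> carrier Z2" "P1 t \<in> carrier Z2" "P2 t \<in> carrier Z2" if "t \<in> carrier Z0" for t
    using that K_linear_closed[OF Rl] K_linear_closed[OF P1_facts(1)] K_linear_closed[OF P2_facts(1)] by auto
  have "C (rmul Z0 t a) = rmul Z2 (C t) a" if [simp]: "t \<in> carrier Z0" "a \<in> carrier A" for t a
  proof -
    have r: "(\<lambda>x. rmul Z2 x a) \<in> K_linear K Z2 Z2" by (rule rmul_linear_left[OF _ K_linear_id]) simp_all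
    show ?thesis
      unfolding C_def by (simp add: Rr P1_facts(3) P2_facts(3) K_linear_add[OF r] K_linear_map_uminus[OF r])
  qed
  then have Ch: "C \<in> Hom_right K A Z0 Z2" using Cl by (simp add: Hom_right_def)
  have cancel: "x \<oplus>\<^bsub>Z2\<^esub> \<ominus>\<^bsub>Z2\<^esub> y = z" if "x = y \<oplus>\<^bsub>Z2\<^esub> z" "y \<in> carrier Z2" "z \<in> carrier Z2" for x y z
    using that(2,3) unfolding that(1) by (simp add: Z2.a_comm[of y z] Z2.a_assoc Z2.r_neg)
  have eq: "RVW t = P1 t \<oplus>\<^bsub>Z2\<^esub> P2 t \<oplus>\<^bsub>Z2\<^esub> C t" if [simp]: "t \<in> carrier Z0" for t
    unfolding C_def by (simp add: Z2.a_comm[of "RVW t"] Z2.a_assoc[symmetric] Z2.r_neg)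
  have M: "module K V" "module K W" by simp_all
  have ab: "bilinear_map K V W Z0 (atens A V W)" by (intro bilinear_mapI lin; simp)
  have "C (proj_tensor H A V W t) = mixed_term K H R A \<Omega> V W DV DW t" if t: "t \<in> carrier (ktensor K V W)" for t
  proof (rule ktensor_eqI[OF M _ mixed_term_linear _ t, where g = "\<lambda>t. C (proj_tensor H A V W t)"])
    show "(\<lambda>t. C (proj_tensor H A V W t)) \<in> K_linear K (ktensor K V W) Z2"
      unfolding proj_tensor_def by (intro K_linear_comp[OF Cl] ksum_linear[OF M _ ab] K_linear_id) simp
    fix v w assume [simp]: "v \<in> carrier V" "w \<in> carrier W"
    have m: "mixed_term K H R A \<Omega> V W DV DW (ktens K V W v w) \<in> carrier Z2"
      by (rule K_linear_closed[OF mixed_term_linear]) (simp add: ktens_closed)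
    have "C (atens A V W v w) = mixed_term K H R A \<Omega> V W DV DW (ktens K V W v w)"
      unfolding C_def
    proof (rule cancel)
      show "RVW (atens A V W v w) = P1 (atens A V W v w) \<oplus>\<^bsub>Z2\<^esub> P2 (atens A V W v w) \<oplus>\<^bsub>Z2\<^esub> mixed_term K H R A \<Omega> V W DV DW (ktens K V W v w)"
        by (simp add: RVW_def curvature_sum_atens mixed_term_ktens P1_facts(2) P2_facts(2))
    qed (simp_all add: m)
    then show "C (proj_tensor H A V W (ktens K V W v w)) = mixed_term K H R A \<Omega> V W DV DW (ktens K V W v w)"
      by (simp add: proj_tensor_def ksum_ktens[OF M _ ab])
  qed
  then show "\<exists>C \<in> Hom_right K A Z0 Z2.
         (\<forall>t \<in> carrier (ktensor K V W). C (proj_tensor H A V W t) = mixed_term K H R A \<Omega> V W DV DW t)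
         \<and> (\<forall>t \<in> carrier Z0. RVW t = P1 t \<oplus>\<^bsub>Z2\<^esub> P2 t \<oplus>\<^bsub>Z2\<^esub> C t)"
    using Ch eq by blast
qed

end

end

theorem mainTheorem11:
  fixes K :: "('k, 'l) ring_scheme"
    and H :: "('k, 'h, 'n) hopf_scheme"
    and R :: "('h, 'h) tens"
    and A :: "('k, 'h, 'o, 'p) hmod_scheme"
    and \<Omega> :: "('k, 'h, 'o, 'm) dcalc_scheme"
    and V :: "('k, 'h, 'o, 'v, 'q) hbimod_scheme"
    and W :: "('k, 'h, 'o, 'w, 'r) hbimod_scheme"
    and DV :: "'v \<Rightarrow> ('v, 'o) tens"
    and DW :: "'w \<Rightarrow> ('w, 'o) tens"
  defines "VW \<equiv> atensor H A V W"
    and "F2 \<equiv> forms \<Omega> 2"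
    and "RV \<equiv> curvature H A \<Omega> V DV"
    and "RW \<equiv> curvature H A \<Omega> W DW"
    and "RVW \<equiv> curvature H A \<Omega> (atensor H A V W) (sum_connection K H R A \<Omega> V W DV DW)"
  assumes "quasitriangular_hopf_algebra K H R"
    and "H_module_algebra K H A"
    and "quasi_commutative_bimodule K H R A V"
    and "quasi_commutative_bimodule K H R A W"
    and "quasi_commutative_calculus K H R A \<Omega>"
    and "DV \<in> connections K H A \<Omega> V"
    and "DW \<in> connections K H A \<Omega> W"
  shows "RV \<in> Hom_right K A V (atensor H A V F2)
    \<and> RW \<in> Hom_right K A W (atensor H A W F2)
    \<and> RVW \<in> Hom_right K A VW (atensor H A VW F2)
    \<and> (\<exists>C \<in> Hom_right K A VW (atensor H A VW F2).
         (\<forall>t \<in> carrier (ktensor K V W).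
            C (proj_tensor H A V W t) = mixed_term K H R A \<Omega> V W DV DW t)
         \<and> (\<forall>t \<in> carrier VW. RVW t =
              tau23_inv H R A V F2 W
                (rtensor_A K H R A V (atensor H A V F2) W W RV id t)
              \<oplus>\<^bsub>atensor H A VW F2\<^esub> assoc_left H A V W F2
                (rtensor_A K H R A V V W (atensor H A W F2) id RW t)
              \<oplus>\<^bsub>atensor H A VW F2\<^esub> C t))"
proof -
  interpret C: calculus_setting K H R A \<Omega>
    using assms(6,7,10) by (intro calculus_setting.intro braided_setting.intro)
  have bimod: "H_module_bimodule K H A V" "H_module_bimodule K H A W"
    using assms(8,9) by (simp_all add: quasi_commutative_bimodule_def)
  note W = C.quasi_commutative_left[OF assms(9)]
  note D = C.connection_leibniz_map[OF bimod(1) assms(11)] C.connection_leibniz_map[OF bimod(2) assms(12)]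
  \<comment> \<open>Folds the two-forms of the statement into the opaque constant in terms of which
    the results were proved.\<close>
  note F2 = F2_def C.F2_def[symmetric]
  show ?thesis
    unfolding VW_def RV_def RW_def RVW_def F2
    using C.curvature_right_linear[OF bimod(1) D(1)] C.curvature_right_linear[OF bimod(2) D(2)]
      C.curvature_sum[OF bimod W D] by blast
qed

end
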